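(* Let $V_h$ be finite element spaces satisfying the assumptions (H1), (H2), (H3) and (H4) listed in the context. Let $f\in L^2(\Omega)$ and $0<\epsilon\le 1$, let $u\in H^2_0(\Omega)$ be the solution of $$\epsilon^2 a(u,v)+b(u,v)=(f,v)\qquad \forall v\in H^2_0(\Omega),$$ with $u\in H^3(\Omega)$, and let $u_h\in V_h$ be the solution of $$\epsilon^2 a_h(u_h,v_h)+b_h(u_h,v_h)=(f,v_h)\qquad \forall v_h\in V_h .$$ Then there is a constant $C$, independent of $h$, $\epsilon$, $f$ and $u$, such that $$\|u-u_h\|_{\epsilon,h}\le C\,h\left(|u|_2+\epsilon|u|_3+\|f\|_0\right).$$ Moreover, when $V_h\subset H^1_0(\Omega)$, $$\|u-u_h\|_{\epsilon,h}\le C\,h(h+\epsilon)|u|_3 .$$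
   Context: $\Omega\subset\mathbb{R}^2$ is a bounded polygonal domain. $\|\cdot\|_m$ and $|\cdot|_m$ are the norm and semi-norm of $H^m(\Omega)$, $\|\cdot\|_{m,T}$ and $|\cdot|_{m,T}$ those of $H^m(T)$, and $(\cdot,\cdot)$ is the $L^2(\Omega)$ inner product. $P_k$ denotes polynomials of degree $\le k$. $\mathcal{T}_h$ ranges over a shape regular family of triangulations of $\Omega$ (into triangles or rectangles), $h$ being the maximum diameter of the elements of $\mathcal{T}_h$. With $D^2u:D^2v=\sum_{i,j=1}^2 \partial_{ij}u\,\partial_{ij}v$, set $$a(u,v)=\int_\Omega D^2u:D^2v,\quad b(u,v)=\int_\Omega\nabla u\cdot\nabla v,\quad a_h(u,v)=\sum_{T\in\mathcal{T}_h}\int_T D^2u:D^2v,\quad b_h(u,v)=\sum_{T\in\mathcal{T}_h}\int_T\nabla u\cdot\nabla v,$$ and $\|v\|_{\epsilon,h}=\sqrt{\epsilon^2a_h(v,v)+b_h(v,v)}$. $V_h\not\subset H^2_0(\Omega)$ is a finite-dimensional (piecewise smooth) finite element space on $\mathcal{T}_h$ with associated interpolation operator $I_h$, built on all meshes of the family from one fixed type of element. The assumptions are: (H1) for every $T\in\mathcal{T}_h$, $P_2(T)\subset V_h|_T$ and $I_h|_T v=v$ for all $v\in P_2(T)$. (H2) Every $v_h\in V_h$ is continuous at the vertices of elements and is zero at the vertices on $\partial\Omega$. (H3) For every $v_h\in V_h$, $\int_e\frac{\partial v_h}{\partial n}\,ds$ is continuous across each interior element edge $e$ and is zero on each edge $e\subset\partial\Omega$.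 (H4) If $V_h\not\subset H^1_0(\Omega)$, then $\int_T\nabla(v_h-\Pi v_h)=0$ for all $v_h\in V_h$ and all $T\in\mathcal{T}_h$. Here, $\Pi:V_h\to H^1_0(\Omega)$ is an interpolation operator which preserves linear polynomials locally, i.e. $\Pi|_Tv=v$ for $v\in P_1(T)$, $T\in\mathcal{T}_h$; it can be taken as the interpolation at the vertices by continuous piecewise linear functions (if the elements are triangles) or continuous piecewise bilinear functions (if they are rectangles). When $V_h\subset H^1_0(\Omega)$ one takes $\Pi$ to be the identity. Standing convention: the elements are such that standard interpolation theory applies with constants independent of the mesh, namely $$\Big(\sum_{T\in\mathcal{T}_h}\|v-I_hv\|_{j,T}^2\Big)^{1/2}\le C h^{k-j}|v|_k\quad\forall v\in H^2_0(\Omega)\cap H^k(\Omega),\ j=0,1,2,\ k=2,3,$$ and $|v_h-\Pi v_h|_{j,T}\le C h^{m-j}|v_h|_{m,T}$ for all $v_h\in V_h$, $T\in\mathcal{T}_h$, $j\in\{0,1\}$, $m\in\{1,2\}$, $j\le m$. *)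

theory Defs
  imports "HOL-Analysis.Analysis"
begin

type_synonym pt = "real^2"
type_synonym fn = "real^2 \<Rightarrow> real"
type_synonym mesh = "(real^2) set set"

section \<open>Smooth functions, test functions, polynomials\<close>

definition pd :: "2 \<Rightarrow> fn \<Rightarrow> fn" where
  "pd i f = (\<lambda>x. frechet_derivative f (at x) (axis i 1))"

primrec Ck :: "nat \<Rightarrow> fn \<Rightarrow> bool" where
  "Ck 0 f \<longleftrightarrow> continuous_on UNIV f"
| "Ck (Suc k) f \<longleftrightarrow> (\<forall>x. f differentiable (at x)) \<and> (\<forall>i. Ck k (pd i f))"

definition smooth :: "fn \<Rightarrow> bool" where
  "smooth f \<longleftrightarrow> (\<forall>k. Ck k f)"

text \<open>A multi-index is a map \<open>\<alpha> :: 2 \<Rightarrow> nat\<close>. Note that \<open>2 = 0\<close> in the index type \<open>2\<close>, whose two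
  elements are \<open>1\<close> and \<open>2\<close>.\<close>

definition mdeg :: "(2 \<Rightarrow> nat) \<Rightarrow> nat" where
  "mdeg \<alpha> = (\<Sum>i\<in>UNIV. \<alpha> i)"

definition mpd :: "(2 \<Rightarrow> nat) \<Rightarrow> fn \<Rightarrow> fn" where
  "mpd \<alpha> f = (pd 1 ^^ \<alpha> 1) ((pd 2 ^^ \<alpha> 2) f)"

definition idx1 :: "2 \<Rightarrow> 2 \<Rightarrow> nat" where
  "idx1 i = (\<lambda>k. of_bool (k = i))"

definition idx2 :: "2 \<Rightarrow> 2 \<Rightarrow> 2 \<Rightarrow> nat" where
  "idx2 i j = (\<lambda>k. of_bool (k = i) + of_bool (k = j))"

definition test_functions :: "pt set \<Rightarrow> fn set" where
  "test_functions S = {\<phi>. smooth \<phi> \<and> (\<exists>K. compact K \<and> K \<subseteq> S \<and> (\<forall>x. x \<notin> K \<longrightarrow> \<phi> x = 0))}"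

definition polys :: "nat \<Rightarrow> fn set" where
  "polys k = {p. \<exists>c. \<forall>x. p x = (\<Sum>\<alpha> | mdeg \<alpha> \<le> k. c \<alpha> * (\<Prod>i\<in>UNIV. (x $ i) ^ \<alpha> i))}"

section \<open>Sobolev spaces on an open set\<close>

definition L2 :: "pt set \<Rightarrow> fn set" where
  "L2 S = {f. set_borel_measurable lebesgue S f \<and> set_integrable lebesgue S (\<lambda>x. (f x)\<^sup>2)}"

definition L2_inner :: "pt set \<Rightarrow> fn \<Rightarrow> fn \<Rightarrow> real" where
  "L2_inner S f g = (LINT x:S|lebesgue. f x * g x)"

definition L2_norm :: "pt set \<Rightarrow> fn \<Rightarrow> real" where
  "L2_norm S f = sqrt (L2_inner S f f)"

definition is_weak_deriv :: "pt set \<Rightarrow> (2 \<Rightarrow> nat) \<Rightarrow> fn \<Rightarrow> fn \<Rightarrow> bool" where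
  "is_weak_deriv S \<alpha> u g \<longleftrightarrow>
     (\<forall>\<phi>\<in>test_functions S. L2_inner S u (mpd \<alpha> \<phi>) = (-1) ^ mdeg \<alpha> * L2_inner S g \<phi>)"

definition H :: "nat \<Rightarrow> pt set \<Rightarrow> fn set" where
  "H m S = {u \<in> L2 S. \<forall>\<alpha>. mdeg \<alpha> \<le> m \<longrightarrow> (\<exists>g\<in>L2 S. is_weak_deriv S \<alpha> u g)}"

text \<open>The weak derivative is determined up to a null set only; every use below is under an integral
  over \<open>S\<close>.\<close>

definition wd :: "pt set \<Rightarrow> (2 \<Rightarrow> nat) \<Rightarrow> fn \<Rightarrow> fn" where
  "wd S \<alpha> u = (SOME g. g \<in> L2 S \<and> is_weak_deriv S \<alpha> u g)"

definition H_norm :: "nat \<Rightarrow> pt set \<Rightarrow> fn \<Rightarrow> real" where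
  "H_norm m S u = sqrt (\<Sum>\<alpha> | mdeg \<alpha> \<le> m. (L2_norm S (wd S \<alpha> u))\<^sup>2)"

definition H_semi :: "nat \<Rightarrow> pt set \<Rightarrow> fn \<Rightarrow> real" where
  "H_semi m S u = sqrt (\<Sum>\<alpha> | mdeg \<alpha> = m. (L2_norm S (wd S \<alpha> u))\<^sup>2)"

definition H0 :: "nat \<Rightarrow> pt set \<Rightarrow> fn set" where
  "H0 m S = {u \<in> H m S. \<forall>e>0. \<exists>\<phi>\<in>test_functions S. H_norm m S (\<lambda>x. u x - \<phi> x) < e}"

definition a_form :: "pt set \<Rightarrow> fn \<Rightarrow> fn \<Rightarrow> real" where
  "a_form S u v = (LINT x:S|lebesgue.
     (\<Sum>i\<in>UNIV. \<Sum>j\<in>UNIV. wd S (idx2 i j) u x * wd S (idx2 i j) v x))"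

definition b_form :: "pt set \<Rightarrow> fn \<Rightarrow> fn \<Rightarrow> real" where
  "b_form S u v = (LINT x:S|lebesgue. (\<Sum>i\<in>UNIV. wd S (idx1 i) u x * wd S (idx1 i) v x))"

section \<open>Polygonal domains and meshes\<close>

text \<open>The condition \<open>interior (closure \<Omega>) = \<Omega>\<close> excludes slits; holes are allowed.\<close>

definition polygonal_domain :: "pt set \<Rightarrow> bool" where
  "polygonal_domain \<Omega> \<longleftrightarrow>
     open \<Omega> \<and> connected \<Omega> \<and> bounded \<Omega> \<and> \<Omega> \<noteq> {} \<and> interior (closure \<Omega>) = \<Omega> \<and>
     (\<exists>E. finite E \<and> frontier \<Omega> = (\<Union>(a, b)\<in>E. closed_segment a b))"

definition triangle :: "pt set \<Rightarrow> bool" where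
  "triangle T \<longleftrightarrow> (\<exists>a b c. \<not> collinear {a, b, c} \<and> T = convex hull {a, b, c})"

definition rectangle :: "pt set \<Rightarrow> bool" where
  "rectangle T \<longleftrightarrow> (\<exists>a p q. p \<noteq> 0 \<and> q \<noteq> 0 \<and> p \<bullet> q = 0 \<and>
     T = convex hull {a, a + p, a + q, a + p + q})"

text \<open>Elements are closed sets; any two of them meet in a common (possibly empty) face.\<close>

definition conforming_mesh :: "pt set \<Rightarrow> mesh \<Rightarrow> bool" where
  "conforming_mesh \<Omega> \<T> \<longleftrightarrow>
     finite \<T> \<and> ((\<forall>T\<in>\<T>. triangle T) \<or> (\<forall>T\<in>\<T>. rectangle T)) \<and> \<Union>\<T> = closure \<Omega> \<and>
     (\<forall>T\<in>\<T>. \<forall>T'\<in>\<T>. (T \<inter> T') face_of T \<and> (T \<inter> T') face_of T')"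

definition shape_regular :: "mesh set \<Rightarrow> bool" where
  "shape_regular \<MM> \<longleftrightarrow>
     (\<exists>\<sigma>>0. \<forall>\<T>\<in>\<MM>. \<forall>T\<in>\<T>. \<exists>x r. 0 < r \<and> cball x r \<subseteq> T \<and> diameter T \<le> \<sigma> * r)"

definition mesh_size :: "mesh \<Rightarrow> real" where
  "mesh_size \<T> = Max (diameter ` \<T>)"

definition a_h :: "mesh \<Rightarrow> fn \<Rightarrow> fn \<Rightarrow> real" where
  "a_h \<T> u v = (\<Sum>T\<in>\<T>. a_form (interior T) u v)"

definition b_h :: "mesh \<Rightarrow> fn \<Rightarrow> fn \<Rightarrow> real" where
  "b_h \<T> u v = (\<Sum>T\<in>\<T>. b_form (interior T) u v)"

definition energy_norm :: "real \<Rightarrow> mesh \<Rightarrow> fn \<Rightarrow> real" where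
  "energy_norm \<epsilon> \<T> v = sqrt (\<epsilon>\<^sup>2 * a_h \<T> v v + b_h \<T> v v)"

section \<open>Finite element spaces\<close>

text \<open>A discrete function is a function on the plane of which only the values in the interiors of the
  elements matter; on the boundary of an element \<open>T\<close> it is evaluated by its limit from inside \<open>T\<close>.\<close>

definition trace_from :: "pt set \<Rightarrow> fn \<Rightarrow> fn" where
  "trace_from T v x = Lim (at x within interior T) v"

definition normal_deriv_from :: "pt set \<Rightarrow> pt \<Rightarrow> fn \<Rightarrow> fn" where
  "normal_deriv_from T n v = trace_from T (\<lambda>y. frechet_derivative v (at y) n)"

definition edge_integral :: "pt \<Rightarrow> pt \<Rightarrow> fn \<Rightarrow> real" where
  "edge_integral a b g = dist a b * integral {0..1} (\<lambda>t. g (linepath a b t))"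

definition unit_normal :: "pt \<Rightarrow> pt \<Rightarrow> pt \<Rightarrow> bool" where
  "unit_normal a b n \<longleftrightarrow> norm n = 1 \<and> n \<bullet> (b - a) = 0"

definition finite_dim_space :: "fn set \<Rightarrow> bool" where
  "finite_dim_space W \<longleftrightarrow>
     (\<exists>(n::nat) b. W = {w. \<exists>c. \<forall>x. w x = (\<Sum>i<n. c i * b i x)})"

text \<open>An element type assigns to each cell \<open>T\<close> its space \<open>P T\<close> of shape functions and its local
  interpolation operator \<open>J T\<close>, which only sees the restriction to \<open>T\<close>. Both depend on \<open>T\<close> alone, not
  on the mesh containing \<open>T\<close>.\<close>

definition finite_element :: "fn set \<Rightarrow> (fn \<Rightarrow> fn) \<Rightarrow> pt set \<Rightarrow> bool" where
  "finite_element PT JT T \<longleftrightarrow>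
     finite_dim_space PT \<and> (\<forall>p\<in>PT. smooth p) \<and> (\<forall>v. JT v \<in> PT) \<and>
     (\<forall>v w. (\<forall>x\<in>T. v x = w x) \<longrightarrow> JT v = JT w)"

text \<open>The space \<open>V\<close> incorporates homogeneous boundary conditions, so that \<open>V\<close> restricted to \<open>T\<close> is
  all of \<open>P T\<close> only if \<open>T\<close> does not touch the boundary. The global interpolation operator \<open>I\<close> is
  given by \<open>J T\<close> on each element.\<close>

definition fe_space ::
  "pt set \<Rightarrow> (pt set \<Rightarrow> fn set) \<Rightarrow> (pt set \<Rightarrow> fn \<Rightarrow> fn) \<Rightarrow> mesh \<Rightarrow> fn set \<Rightarrow> (fn \<Rightarrow> fn) \<Rightarrow> bool" where
  "fe_space \<Omega> P J \<T> V I \<longleftrightarrow>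
     (\<forall>T\<in>\<T>. finite_element (P T) (J T) T) \<and>
     finite_dim_space V \<and>
     (\<forall>v\<in>V. \<forall>T\<in>\<T>. \<exists>p\<in>P T. \<forall>x\<in>interior T. v x = p x) \<and>
     (\<forall>T\<in>\<T>. T \<inter> frontier \<Omega> = {} \<longrightarrow> (\<forall>p\<in>P T. \<exists>v\<in>V. \<forall>x\<in>interior T. v x = p x)) \<and>
     (\<forall>v\<in>H0 2 \<Omega>. I v \<in> V \<and> (\<forall>T\<in>\<T>. \<forall>x\<in>interior T. I v x = J T v x))"

text \<open>The inclusion of the quadratics is required of the shape functions: on an element with a
  boundary vertex it cannot hold for \<open>V\<close>, whose members vanish at that vertex.\<close>

definition reproduces_P2 :: "(pt set \<Rightarrow> fn set) \<Rightarrow> (pt set \<Rightarrow> fn \<Rightarrow> fn) \<Rightarrow> mesh \<Rightarrow> bool" where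
  "reproduces_P2 P J \<T> \<longleftrightarrow>
     (\<forall>T\<in>\<T>. \<forall>q\<in>polys 2. (\<exists>p\<in>P T. \<forall>x\<in>T. p x = q x) \<and> (\<forall>x\<in>T. J T q x = q x))"

definition continuous_at_vertices :: "pt set \<Rightarrow> mesh \<Rightarrow> fn \<Rightarrow> bool" where
  "continuous_at_vertices \<Omega> \<T> v \<longleftrightarrow>
     (\<forall>T\<in>\<T>. \<forall>x. x extreme_point_of T \<longrightarrow>
        (\<forall>T'\<in>\<T>. x extreme_point_of T' \<longrightarrow> trace_from T v x = trace_from T' v x) \<and>
        (x \<in> frontier \<Omega> \<longrightarrow> trace_from T v x = 0))"

definition continuous_normal_means :: "pt set \<Rightarrow> mesh \<Rightarrow> fn \<Rightarrow> bool" where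
  "continuous_normal_means \<Omega> \<T> v \<longleftrightarrow>
     (\<forall>T\<in>\<T>. \<forall>a b n. closed_segment a b edge_of T \<and> unit_normal a b n \<longrightarrow>
        (\<forall>T'\<in>\<T>. closed_segment a b edge_of T' \<longrightarrow>
           edge_integral a b (normal_deriv_from T n v) =
           edge_integral a b (normal_deriv_from T' n v)) \<and>
        (closed_segment a b \<subseteq> frontier \<Omega> \<longrightarrow> edge_integral a b (normal_deriv_from T n v) = 0))"

definition conforming_operator :: "pt set \<Rightarrow> mesh \<Rightarrow> fn set \<Rightarrow> (fn \<Rightarrow> fn) \<Rightarrow> bool" where
  "conforming_operator \<Omega> \<T> V Pi_h \<longleftrightarrow>
     (\<forall>v\<in>V. Pi_h v \<in> H0 1 \<Omega>) \<and>
     (\<forall>v\<in>V. \<forall>T\<in>\<T>. \<forall>q\<in>polys 1. (\<forall>x\<in>interior T. v x = q x) \<longrightarrow> (\<forall>x\<in>interior T. Pi_h v x = q x)) \<and>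
     (V \<subseteq> H0 1 \<Omega> \<longrightarrow> (\<forall>v\<in>V. Pi_h v = v))"

definition preserves_mean_gradients :: "mesh \<Rightarrow> fn set \<Rightarrow> (fn \<Rightarrow> fn) \<Rightarrow> bool" where
  "preserves_mean_gradients \<T> V Pi_h \<longleftrightarrow>
     (\<forall>v\<in>V. \<forall>T\<in>\<T>. \<forall>i.
        (LINT x:interior T|lebesgue. wd (interior T) (idx1 i) (\<lambda>y. v y - Pi_h v y) x) = 0)"

definition interpolation_bound :: "pt set \<Rightarrow> mesh \<Rightarrow> (fn \<Rightarrow> fn) \<Rightarrow> real \<Rightarrow> bool" where
  "interpolation_bound \<Omega> \<T> I C \<longleftrightarrow>
     (\<forall>k\<in>{2,3}. \<forall>j\<in>{0,1,2}. \<forall>v\<in>H0 2 \<Omega> \<inter> H k \<Omega>.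
        sqrt (\<Sum>T\<in>\<T>. (H_norm j (interior T) (\<lambda>x. v x - I v x))\<^sup>2)
          \<le> C * mesh_size \<T> ^ (k - j) * H_semi k \<Omega> v)"

definition conforming_bound :: "mesh \<Rightarrow> fn set \<Rightarrow> (fn \<Rightarrow> fn) \<Rightarrow> real \<Rightarrow> bool" where
  "conforming_bound \<T> V Pi_h C \<longleftrightarrow>
     (\<forall>v\<in>V. \<forall>T\<in>\<T>. \<forall>j\<in>{0,1}. \<forall>m\<in>{1,2}. j \<le> m \<longrightarrow>
        H_semi j (interior T) (\<lambda>x. v x - Pi_h v x)
          \<le> C * mesh_size \<T> ^ (m - j) * H_semi m (interior T) v)"

end

theory Submission
  imports Defs
begin

text \<open>By a Strang argument the error is at most twice the interpolation error plus the consistency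
  error, so it remains to bound the latter. The weak equation extends to test functions \<open>z\<close> in \<open>H0 1\<close>;
  taking \<open>z\<close> to be the conforming companion of the discrete function \<open>w\<close>, the residual splits into terms
  in \<open>w - z\<close>, handled by (H4) and the Poincare inequality, and the sum over the elements of the boundary
  integrals of \<open>\<partial>\<^sub>i\<^sub>j u n\<^sub>j \<partial>\<^sub>i w\<close>. By (H2) and (H3) the edge means of the gradient of \<open>w\<close> are single valued and
  vanish on the boundary, hence only products of fluctuations remain, which are of order \<open>h\<close>.

  No trace theorem is used. Triangles and rectangles carry, for each edge, an explicit vector field of
  constant divergence and with normal component supported on that edge; it turns the edge mean of a
  function into a volume integral, which makes sense for Sobolev functions.\<close>

section \<open>Smooth functions\<close>

text \<open>The obstacle is the boundary. Weak derivatives of \<open>u\<close> can be approximated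
  by smooth functions only on compact subsets of \<Omega>, and the domain need not be Lipschitz,
  since it may touch itself at a vertex. Statements about an element are therefore proved on
  contracted copies of it and carried over by dominated convergence. Discrete functions need no such
  care: on each element they agree with a function that is smooth on the whole plane.

  The vector fields attached to the edges are the lowest-order Raviart-Thomas functions. That
  interpolation by their fluxes reproduces constant fields replaces the divergence theorem on an
  element.

  The weak equation extends from \<open>H0 2\<close> to \<open>H0 1\<close> because three
  derivatives of \<open>u\<close> permit one integration by parts. The resulting terms carry
  \<open>\<epsilon>\<^sup>2\<close>; one \<epsilon> is absorbed by the energy norm and the other
  stays with the third derivatives of \<open>u\<close>. In the conforming case the companion of
  \<open>w\<close> is \<open>w\<close> itself, so the terms in \<open>w - z\<close> vanish, and with
  them the contributions of \<open>f\<close> and of the second derivatives of \<open>u\<close> to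
  the consistency error.\<close>

definition grad :: "fn \<Rightarrow> pt \<Rightarrow> pt" where
  "grad f x = (\<chi> i. pd i f x)"

lemma pd_eqI: "(f has_derivative f') (at x) \<Longrightarrow> pd i f x = f' (axis i 1)"
  unfolding pd_def by (metis frechet_derivative_at)

lemma differentiable_has_derivative_grad:
  assumes "f differentiable (at x)"
  shows "(f has_derivative (\<lambda>h. grad f x \<bullet> h)) (at x)"
proof -
  have d: "(f has_derivative frechet_derivative f (at x)) (at x)"
    using assms frechet_derivative_works by blast
  then have lin: "linear (frechet_derivative f (at x))"
    by (rule has_derivative_linear)
  have "frechet_derivative f (at x) h = grad f x \<bullet> h" for h
  proof -
    have "frechet_derivative f (at x) h = frechet_derivative f (at x) (\<Sum>i\<in>UNIV. (h $ i) *\<^sub>R axis i 1)"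
      by (metis (no_types) basis_expansion scalar_mult_eq_scaleR sum.cong)
    also have "\<dots> = (\<Sum>i\<in>UNIV. (h $ i) * pd i f x)"
      unfolding linear_sum[OF lin] linear_scale[OF lin] pd_def by simp
    finally show ?thesis by (simp add: grad_def inner_vec_def mult.commute)
  qed
  then have "frechet_derivative f (at x) = (\<lambda>h. grad f x \<bullet> h)" by blast
  then show ?thesis using d by metis
qed

lemma pd_eqI_inner: "(f has_derivative (\<lambda>h. v \<bullet> h)) (at x) \<Longrightarrow> pd i f x = v $ i"
  using pd_eqI[of f "\<lambda>h. v \<bullet> h" x i] by (simp add: inner_axis)

lemma Ck_Suc_imp: "Ck (Suc k) f \<Longrightarrow> Ck k f"
proof (induction k arbitrary: f)
  case 0
  then show ?case
    by (simp add: continuous_at_imp_continuous_on differentiable_imp_continuous_within)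
next
  case (Suc k)
  then show ?case by (metis Ck.simps(2))
qed

lemma smooth_imp:
  assumes "smooth f"
  shows smooth_pd: "smooth (pd i f)" and smooth_differentiable: "f differentiable (at x)"
    and smooth_continuous: "continuous_on S f"
    and smooth_has_derivative: "(f has_derivative (\<lambda>h. grad f x \<bullet> h)) (at x)"
proof -
  have k: "Ck k f" for k using assms by (simp add: smooth_def)
  show "smooth (pd i f)" unfolding smooth_def using k Ck.simps(2) by blast
  show d: "f differentiable (at x)" using k[of 1] by simp
  show "continuous_on S f" using k[of 0] continuous_on_subset by auto
  show "(f has_derivative (\<lambda>h. grad f x \<bullet> h)) (at x)"
    using differentiable_has_derivative_grad[OF d] .
qed

text \<open>\<open>smooth\<close> is the greatest property of everywhere differentiable functions
  that is stable under \<open>pd\<close>. This form suits convolutions, where a derivative is again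
  a convolution with another kernel.\<close>

lemma smooth_coinduct:
  assumes "P f"
    and "\<And>f x. P f \<Longrightarrow> f differentiable (at x)"
    and "\<And>f i. P f \<Longrightarrow> P (pd i f)"
  shows "smooth f"
proof -
  have "P f \<Longrightarrow> Ck k f" for k f
  proof (induction k arbitrary: f)
    case 0
    then show ?case using assms(2)
      by (simp add: continuous_at_imp_continuous_on differentiable_imp_continuous_within)
  next
    case (Suc k)
    then show ?case using assms(2,3) by simp
  qed
  then show ?thesis using assms(1) by (simp add: smooth_def)
qed

lemma pd_add: "f differentiable (at x) \<Longrightarrow> g differentiable (at x) \<Longrightarrow>
    pd i (\<lambda>x. f x + g x) x = pd i f x + pd i g x"
  by (subst pd_eqI[OF has_derivative_add[OF differentiable_has_derivative_grad differentiable_has_derivative_grad]])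
    (auto simp: grad_def inner_axis)

lemma pd_cmult: "f differentiable (at x) \<Longrightarrow> pd i (\<lambda>x. c * f x) x = c * pd i f x"
  by (subst pd_eqI[OF has_derivative_mult_right[OF differentiable_has_derivative_grad]])
    (auto simp: grad_def inner_axis)

lemma pd_mult: "f differentiable (at x) \<Longrightarrow> g differentiable (at x) \<Longrightarrow>
    pd i (\<lambda>x. f x * g x) x = f x * pd i g x + pd i f x * g x"
  by (subst pd_eqI[OF has_derivative_mult[OF differentiable_has_derivative_grad differentiable_has_derivative_grad]])
    (auto simp: grad_def inner_axis)

lemma pd_const [simp]: "pd i (\<lambda>x. c) = (\<lambda>x. 0)"
  by (rule ext, subst pd_eqI[OF has_derivative_const]) auto

lemma pd_affine:
  assumes "f differentiable (at (c + r *\<^sub>R x))"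
  shows "pd i (\<lambda>x. f (c + r *\<^sub>R x)) x = r * pd i f (c + r *\<^sub>R x)"
    "(\<lambda>x. f (c + r *\<^sub>R x)) differentiable (at x)"
proof -
  have a: "((\<lambda>x. c + r *\<^sub>R x) has_derivative (\<lambda>h. r *\<^sub>R h)) (at x)"
    by (auto intro!: derivative_eq_intros)
  have "((\<lambda>x. f (c + r *\<^sub>R x)) has_derivative (\<lambda>h. grad f (c + r *\<^sub>R x) \<bullet> (r *\<^sub>R h))) (at x)"
    using has_derivative_compose[OF a differentiable_has_derivative_grad[OF assms]] .
  note b = this
  show "pd i (\<lambda>x. f (c + r *\<^sub>R x)) x = r * pd i f (c + r *\<^sub>R x)"
    by (subst pd_eqI[OF b]) (simp add: grad_def inner_axis)
  show "(\<lambda>x. f (c + r *\<^sub>R x)) differentiable (at x)"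
    using b by (auto simp: differentiable_def)
qed

lemma Ck_const [simp]: "Ck k (\<lambda>x. c)"
  by (induction k arbitrary: c) auto

lemma smooth_const [simp]: "smooth (\<lambda>x. c)"
  by (simp add: smooth_def)

lemma Ck_add: "Ck k f \<Longrightarrow> Ck k g \<Longrightarrow> Ck k (\<lambda>x. f x + g x)"
proof (induction k arbitrary: f g)
  case 0 then show ?case by (simp add: continuous_on_add)
next
  case (Suc k)
  then have "pd i (\<lambda>x. f x + g x) = (\<lambda>x. pd i f x + pd i g x)" for i
    by (auto simp: pd_add)
  then show ?case using Suc by (auto simp: differentiable_add)
qed

lemma Ck_mult: "Ck k f \<Longrightarrow> Ck k g \<Longrightarrow> Ck k (\<lambda>x. f x * g x)"
proof (induction k arbitrary: f g)
  case 0 then show ?case by (simp add: continuous_on_mult)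
next
  case (Suc k)
  then have "pd i (\<lambda>x. f x * g x) = (\<lambda>x. f x * pd i g x + pd i f x * g x)" for i
    by (auto simp: pd_mult)
  moreover have "Ck k f" "Ck k g" using Suc.prems Ck_Suc_imp by blast+
  ultimately show ?case using Suc by (auto simp: differentiable_mult intro!: Ck_add)
qed

lemma smooth_add: "smooth f \<Longrightarrow> smooth g \<Longrightarrow> smooth (\<lambda>x. f x + g x)"
  and smooth_mult: "smooth f \<Longrightarrow> smooth g \<Longrightarrow> smooth (\<lambda>x. f x * g x)"
  by (auto simp: smooth_def Ck_add Ck_mult)

lemma smooth_cmult: "smooth f \<Longrightarrow> smooth (\<lambda>x. c * f x)"
  using smooth_mult[OF smooth_const] .

lemma smooth_diff: "smooth f \<Longrightarrow> smooth g \<Longrightarrow> smooth (\<lambda>x. f x - g x)"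
  using smooth_add[OF _ smooth_cmult, of f g "-1"] by simp

lemma Ck_affine: "Ck k f \<Longrightarrow> Ck k (\<lambda>x. f (c + r *\<^sub>R x))"
proof (induction k arbitrary: f)
  case 0
  then have "continuous_on UNIV f" by simp
  then show ?case
    by (auto intro!: continuous_on_compose2[of UNIV f] continuous_intros)
next
  case (Suc k)
  then have "pd i (\<lambda>x. f (c + r *\<^sub>R x)) = (\<lambda>x. r * pd i f (c + r *\<^sub>R x))" for i
    by (auto simp: pd_affine(1))
  then show ?case using Suc by (auto simp: pd_affine(2) intro!: Ck_mult)
qed

lemma smooth_affine: "smooth f \<Longrightarrow> smooth (\<lambda>x. f (c + r *\<^sub>R x))"
  by (simp add: smooth_def Ck_affine)

lemma pd_smooth:
  assumes "smooth f" "smooth g"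
  shows pd_smooth_mult: "pd i (\<lambda>x. f x * g x) = (\<lambda>x. f x * pd i g x + pd i f x * g x)"
    and pd_smooth_diff: "pd i (\<lambda>x. f x - g x) = (\<lambda>x. pd i f x - pd i g x)"
proof -
  show "pd i (\<lambda>x. f x * g x) = (\<lambda>x. f x * pd i g x + pd i f x * g x)"
    using assms by (auto simp: pd_mult smooth_differentiable)
  show "pd i (\<lambda>x. f x - g x) = (\<lambda>x. pd i f x - pd i g x)"
    using pd_add[of f _ "\<lambda>x. - 1 * g x"] pd_cmult[of g _ i "-1"] assms
    by (auto simp: smooth_differentiable fun_eq_iff)
qed

lemma smooth_pd_pow: "smooth f \<Longrightarrow> smooth ((pd i ^^ n) f)"
  by (induction n) (auto simp: smooth_pd)

lemma smooth_mpd: "smooth f \<Longrightarrow> smooth (mpd \<alpha> f)"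
  by (simp add: mpd_def smooth_pd_pow)

section \<open>Test functions and their derivatives\<close>

lemma pd_zero_outside:
  assumes "closed K" "\<And>x. x \<notin> K \<Longrightarrow> f x = 0" "x \<notin> K"
  shows "pd i f x = 0"
proof -
  have "(f has_derivative (\<lambda>h. 0)) (at x)"
    by (rule has_derivative_transform_within_open[of "\<lambda>x. 0" _ _ _ "- K"])
      (use assms in \<open>auto simp: open_Compl\<close>)
  then show ?thesis by (subst pd_eqI) auto
qed

lemma test_functionsD:
  assumes "\<phi> \<in> test_functions S"
  shows "smooth \<phi>" and "\<exists>K. compact K \<and> K \<subseteq> S \<and> (\<forall>x. x \<notin> K \<longrightarrow> \<phi> x = 0)"
  using assms by (auto simp: test_functions_def)

lemma test_functions_pd: "\<phi> \<in> test_functions S \<Longrightarrow> pd i \<phi> \<in> test_functions S"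
  unfolding test_functions_def using pd_zero_outside compact_imp_closed smooth_pd by blast

lemma test_functions_mpd: "\<phi> \<in> test_functions S \<Longrightarrow> mpd \<alpha> \<phi> \<in> test_functions S"
proof -
  have "\<phi> \<in> test_functions S \<Longrightarrow> (pd i ^^ n) \<phi> \<in> test_functions S" for \<phi> i n
    by (induction n) (auto simp: test_functions_pd)
  then show "\<phi> \<in> test_functions S \<Longrightarrow> mpd \<alpha> \<phi> \<in> test_functions S" by (simp add: mpd_def)
qed

lemma test_functions_mono: "S \<subseteq> S' \<Longrightarrow> test_functions S \<subseteq> test_functions S'"
  unfolding test_functions_def by blast

subsection \<open>Symmetry of second derivatives\<close>

lemma smooth_shift: "smooth f \<Longrightarrow> smooth (\<lambda>x. f (x + c))" "smooth f \<Longrightarrow> pd i (\<lambda>x. f (x + c)) x = pd i f (x + c)"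
  using smooth_affine[of f c 1] pd_affine(1)[of f c 1 x i] smooth_differentiable[of f]
  by (simp_all add: add.commute[of _ c])

lemma smooth_mvt_axis:
  assumes "smooth f" "t > 0"
  shows "\<exists>s. 0 < s \<and> s < t \<and> f (x + axis i t) - f x = t * pd i f (x + axis i s)"
proof -
  have ax: "axis i r = r *\<^sub>R (axis i 1 :: pt)" for r :: real
    by (simp add: vec_eq_iff axis_def)
  have d: "((\<lambda>r. f (x + axis i r)) has_field_derivative pd i f (x + axis i r)) (at r)" for r
  proof -
    have "((\<lambda>r. x + r *\<^sub>R axis i 1) has_derivative (\<lambda>h. h *\<^sub>R axis i (1::real))) (at r)"
      by (auto intro!: derivative_eq_intros)
    from has_derivative_compose[OF this smooth_has_derivative[OF assms(1)]]
    have "((\<lambda>r. f (x + axis i r)) has_derivative (\<lambda>h. grad f (x + axis i r) \<bullet> (h *\<^sub>R axis i 1))) (at r)"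
      by (simp add: ax[symmetric])
    moreover have "(\<lambda>h. grad f (x + axis i r) \<bullet> (h *\<^sub>R axis i 1)) = (*) (pd i f (x + axis i r))"
      by (auto simp: grad_def inner_axis)
    ultimately show ?thesis by (simp add: has_field_derivative_def)
  qed
  have 0: "axis i (0::real) = (0::pt)" by (simp add: vec_eq_iff axis_def)
  obtain s where "0 < s" "s < t" "f (x + axis i t) - f (x + axis i 0) = (t - 0) * pd i f (x + axis i s)"
    using MVT2[OF assms(2), of "\<lambda>r. f (x + axis i r)" "\<lambda>r. pd i f (x + axis i r)"] d by blast
  then show ?thesis using 0 by auto
qed

text \<open>The second difference of \<open>f\<close> over a square of side \<open>t\<close> equals
  \<open>t * t\<close> times a mixed derivative at a point near \<open>x\<close>, by two
  applications of the mean value theorem. The order of the two applications decides which mixed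
  derivative appears, and continuity of both at \<open>x\<close> identifies them.\<close>

lemma pd_commute:
  assumes "smooth f"
  shows "pd i (pd j f) = pd j (pd i f)"
proof
  fix x
  have ax: "axis i r = r *\<^sub>R (axis i 1 :: pt)" for r :: real and i
    by (simp add: vec_eq_iff axis_def)
  \<comment> \<open>\<open>i\<close> and \<open>j\<close> are bound afresh here, so that the claim
    can be used in both orders.\<close>
  have fact: "\<exists>y. norm (y - x) \<le> 2 * t \<and> 
       (f (x + axis i t + axis j t) - f (x + axis i t)) - (f (x + axis j t) - f x) = t * t * pd j (pd i f) y"
    if t: "t > 0" for t i j
  proof -
    let ?g = "\<lambda>y. f (y + axis j t) - f y"
    have g: "smooth ?g" by (intro smooth_diff smooth_shift assms)
    obtain s where s: "0 < s" "s < t" "?g (x + axis i t) - ?g x = t * pd i ?g (x + axis i s)"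
      using smooth_mvt_axis[OF g t] by blast
    have "pd i ?g (x + axis i s) = pd i f (x + axis i s + axis j t) - pd i f (x + axis i s)"
      by (subst pd_smooth_diff) (auto simp: smooth_shift assms)
    moreover obtain r where r: "0 < r" "r < t"
      "pd i f (x + axis i s + axis j t) - pd i f (x + axis i s) = t * pd j (pd i f) (x + axis i s + axis j r)"
      using smooth_mvt_axis[OF smooth_pd[OF assms] t] by blast
    moreover have "norm (x + axis i s + axis j r - x) \<le> 2 * t"
      using norm_triangle_ineq[of "axis i s :: pt" "axis j r"] s r ax[of i s] ax[of j r] by simp
    ultimately show ?thesis using s by (metis mult.assoc)
  qed
  show "pd i (pd j f) x = pd j (pd i f) x"
  proof (rule ccontr)
    assume neq: "pd i (pd j f) x \<noteq> pd j (pd i f) x"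
    define e where "e = \<bar>pd i (pd j f) x - pd j (pd i f) x\<bar> / 2"
    have e: "e > 0" using neq by (simp add: e_def)
    have c: "isCont (pd i (pd j f)) x" "isCont (pd j (pd i f)) x"
      using smooth_continuous[OF smooth_pd[OF smooth_pd[OF assms]], of UNIV]
      by (auto simp: continuous_on_eq_continuous_at)
    obtain d1 where d1: "d1 > 0" "\<And>y. norm (y - x) < d1 \<Longrightarrow> \<bar>pd i (pd j f) y - pd i (pd j f) x\<bar> < e"
      using c(1) e unfolding continuous_at_eps_delta dist_norm real_norm_def by meson
    obtain d2 where d2: "d2 > 0" "\<And>y. norm (y - x) < d2 \<Longrightarrow> \<bar>pd j (pd i f) y - pd j (pd i f) x\<bar> < e"
      using c(2) e unfolding continuous_at_eps_delta dist_norm real_norm_def by meson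
    define t where "t = min d1 d2 / 3"
    have t: "t > 0" "2 * t < d1" "2 * t < d2" using d1 d2 by (auto simp: t_def)
    obtain y where y: "norm (y - x) \<le> 2 * t"
       "(f (x + axis i t + axis j t) - f (x + axis i t)) - (f (x + axis j t) - f x) = t * t * pd j (pd i f) y"
      using fact[OF t(1)] by blast
    obtain z where z: "norm (z - x) \<le> 2 * t"
       "(f (x + axis j t + axis i t) - f (x + axis j t)) - (f (x + axis i t) - f x) = t * t * pd i (pd j f) z"
      using fact[OF t(1)] by blast
    have "t * t * pd j (pd i f) y = t * t * pd i (pd j f) z"
      using y(2) z(2) by (simp add: algebra_simps)
    then have "pd j (pd i f) y = pd i (pd j f) z" using t by simp
    moreover have "\<bar>pd i (pd j f) z - pd i (pd j f) x\<bar> < e" "\<bar>pd j (pd i f) y - pd j (pd i f) x\<bar> < e"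
      using d1(2)[of z] d2(2)[of y] y z t by auto
    ultimately show False using abs_triangle_ineq4[of "pd i (pd j f) z - pd j (pd i f) x" "pd i (pd j f) z - pd i (pd j f) x"] unfolding e_def by simp
  qed
qed

lemma pd_pow_commute: "smooth f \<Longrightarrow> pd i ((pd j ^^ n) f) = (pd j ^^ n) (pd i f)"
proof (induction n)
  case (Suc n)
  have "pd i ((pd j ^^ Suc n) f) = pd j (pd i ((pd j ^^ n) f))"
    using pd_commute[OF smooth_pd_pow[OF Suc.prems]] by simp
  also have "\<dots> = pd j ((pd j ^^ n) (pd i f))" using Suc by simp
  finally show ?case by simp
qed auto

text \<open>\<open>mpd\<close> differentiates in direction 2 first and in direction 1 afterwards, so
  an inner derivative in direction 1 has to be moved past those in direction 2.\<close>

lemma mpd_pd: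
  assumes "smooth f"
  shows "mpd \<alpha> (pd k f) = mpd (\<lambda>j. \<alpha> j + idx1 k j) f"
proof -
  have k: "k = 1 \<or> k = 2" using exhaust_2 by auto
  have n: "(1::2) \<noteq> 2" by simp
  show ?thesis
  proof (cases "k = 1")
    case True
    have "(pd 2 ^^ \<alpha> 2) (pd 1 f) = pd 1 ((pd 2 ^^ \<alpha> 2) f)" using pd_pow_commute[OF assms] by simp
    then show ?thesis using True n by (simp add: mpd_def idx1_def funpow_swap1 add.commute)
  next
    case False
    then have "k = 2" using k by auto
    then show ?thesis using n by (simp add: mpd_def idx1_def funpow_swap1 add.commute)
  qed
qed

lemma mpd_zero: "mpd (\<lambda>_. 0) f = f"
  by (simp add: mpd_def)

lemma mpd_idx1: "smooth f \<Longrightarrow> mpd (idx1 i) f = pd i f"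
  using mpd_pd[of f "\<lambda>_. 0" i] by (simp add: mpd_zero)

lemma mpd_idx2: "smooth f \<Longrightarrow> mpd (idx2 i j) f = pd i (pd j f)"
proof -
  assume f: "smooth f"
  have "idx2 i j = (\<lambda>k. idx1 i k + idx1 j k)" by (simp add: idx1_def idx2_def fun_eq_iff)
  then show ?thesis using mpd_pd[OF f, of "idx1 i" j] mpd_idx1[OF smooth_pd[OF f]] by simp
qed

section \<open>The spaces L2\<close>

text \<open>\<open>wd\<close> picks a representative by choice, so identities between weak
  derivatives hold only in this sense. The transfer rules below allow a representative to be
  exchanged under an integral.\<close>

definition aeq :: "pt set \<Rightarrow> fn \<Rightarrow> fn \<Rightarrow> bool" where
  "aeq S f g \<longleftrightarrow> (AE x in lebesgue. x \<in> S \<longrightarrow> f x = g x)"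

lemma aeq_refl [simp]: "aeq S f f"
  by (simp add: aeq_def)

lemma aeq_sym: "aeq S f g \<Longrightarrow> aeq S g f"
  unfolding aeq_def by (elim AE_mp) auto

lemma aeq_pointwise: "(\<And>x. x \<in> S \<Longrightarrow> f x = g x) \<Longrightarrow> aeq S f g"
  by (simp add: aeq_def)

lemma aeq_subset: "aeq S f g \<Longrightarrow> S' \<subseteq> S \<Longrightarrow> aeq S' f g"
  unfolding aeq_def by (elim AE_mp) auto

lemma aeq_comp2: "aeq S f g \<Longrightarrow> aeq S f' g' \<Longrightarrow> aeq S (\<lambda>x. h (f x) (f' x)) (\<lambda>x. h (g x) (g' x))"
  unfolding aeq_def by (elim AE_mp) auto

lemma aeq_comp: "aeq S f g \<Longrightarrow> aeq S (\<lambda>x. h (f x)) (\<lambda>x. h (g x))"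
  unfolding aeq_def by (elim AE_mp) auto

lemma lebesgue_measurable_AE_cong:
  fixes f g :: fn
  assumes "f \<in> borel_measurable lebesgue" "AE x in lebesgue. f x = g x"
  shows "g \<in> borel_measurable lebesgue"
proof -
  have "f measurable_on UNIV"
    using assms(1) by (simp add: lebesgue_measurable_imp_measurable_on)
  moreover obtain N where N: "N \<in> null_sets lebesgue" "\<And>x. x \<notin> N \<Longrightarrow> f x = g x"
    using AE_E3[OF assms(2)] by auto
  moreover have "negligible N" using N by (simp add: negligible_iff_null_sets)
  ultimately have "g measurable_on UNIV"
    using measurable_on_spike[of f UNIV N g] by auto
  then show ?thesis
    by (simp add: measurable_on_imp_borel_measurable_lebesgue_UNIV)
qed

lemma aeq_integral:
  assumes "aeq S f g"
  shows aeq_set_measurable: "set_borel_measurable lebesgue S f \<longleftrightarrow> set_borel_measurable lebesgue S g"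
    and aeq_set_integrable: "set_integrable lebesgue S f \<longleftrightarrow> set_integrable lebesgue S g"
    and aeq_set_integral: "(LINT x:S|lebesgue. f x) = (LINT x:S|lebesgue. g x)"
proof -
  have ae: "AE x in lebesgue. indicat_real S x *\<^sub>R f x = indicat_real S x *\<^sub>R g x"
    using assms unfolding aeq_def by (elim AE_mp) (auto simp: indicator_def)
  then have ae': "AE x in lebesgue. indicat_real S x *\<^sub>R g x = indicat_real S x *\<^sub>R f x"
    by (elim AE_mp) auto
  show m: "set_borel_measurable lebesgue S f \<longleftrightarrow> set_borel_measurable lebesgue S g"
    unfolding set_borel_measurable_def
    using lebesgue_measurable_AE_cong[OF _ ae] lebesgue_measurable_AE_cong[OF _ ae'] by blast
  show i: "set_integrable lebesgue S f \<longleftrightarrow> set_integrable lebesgue S g"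
  proof (cases "set_borel_measurable lebesgue S f")
    case True
    then show ?thesis using m ae unfolding set_integrable_def set_borel_measurable_def
      by (intro integrable_cong_AE) auto
  next
    case False
    then show ?thesis using m unfolding set_integrable_def set_borel_measurable_def
      using borel_measurable_integrable by blast
  qed
  show "(LINT x:S|lebesgue. f x) = (LINT x:S|lebesgue. g x)"
  proof (cases "set_borel_measurable lebesgue S f")
    case True
    then show ?thesis using m ae unfolding set_lebesgue_integral_def set_borel_measurable_def
      by (intro integral_cong_AE) auto
  next
    case False
    then have "\<not> set_integrable lebesgue S f" "\<not> set_integrable lebesgue S g"
      using m unfolding set_integrable_def set_borel_measurable_def
      using borel_measurable_integrable by blast+
    \<comment> \<open>Both integrals have the default value 0.\<close>
    then show ?thesis unfolding set_lebesgue_integral_def set_integrable_def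
      by (simp add: not_integrable_integral_eq)
  qed
qed

lemma aeq_L2: "aeq S f g \<Longrightarrow> f \<in> L2 S \<longleftrightarrow> g \<in> L2 S"
  unfolding L2_def mem_Collect_eq
  using aeq_set_measurable[of S f g] aeq_set_integrable[OF aeq_comp[of S f g "\<lambda>a. a\<^sup>2"]]
  by argo

lemma aeq_L2_inner: "aeq S f g \<Longrightarrow> aeq S f' g' \<Longrightarrow> L2_inner S f f' = L2_inner S g g'"
  unfolding L2_inner_def using aeq_set_integral[OF aeq_comp2[of S f g f' g' "(*)"]] by simp

lemma aeq_L2_norm: "aeq S f g \<Longrightarrow> L2_norm S f = L2_norm S g"
  unfolding L2_norm_def using aeq_L2_inner[of S f g f g] by simp

section \<open>Inner product and norm of L2\<close>

lemma L2_mult_integrable: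
  assumes "f \<in> L2 S" "g \<in> L2 S"
  shows "set_integrable lebesgue S (\<lambda>x. f x * g x)"
proof -
  have m: "(\<lambda>x. indicat_real S x * f x) \<in> borel_measurable lebesgue"
      "(\<lambda>x. indicat_real S x * g x) \<in> borel_measurable lebesgue"
    and i: "integrable lebesgue (\<lambda>x. indicat_real S x * (f x)\<^sup>2)" "integrable lebesgue (\<lambda>x. indicat_real S x * (g x)\<^sup>2)"
    using assms by (auto simp: L2_def set_borel_measurable_def set_integrable_def)
  have eq: "indicat_real S x * (f x * g x) = (indicat_real S x * f x) * (indicat_real S x * g x)" for x
    by (simp add: indicator_def)
  have "integrable lebesgue (\<lambda>x. indicat_real S x * (f x * g x))"
  proof (rule Bochner_Integration.integrable_bound[OF Bochner_Integration.integrable_add[OF i]])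
    show "(\<lambda>x. indicat_real S x * (f x * g x)) \<in> borel_measurable lebesgue"
      unfolding eq using m by measurable
    have "\<bar>a * b\<bar> \<le> a\<^sup>2 + b\<^sup>2" for a b :: real
    proof -
      have "2 * (\<bar>a\<bar> * \<bar>b\<bar>) \<le> a\<^sup>2 + b\<^sup>2" "0 \<le> \<bar>a\<bar> * \<bar>b\<bar>"
        using sum_squares_bound[of "\<bar>a\<bar>" "\<bar>b\<bar>"] by auto
      then show ?thesis unfolding abs_mult by linarith
    qed
    then show "AE x in lebesgue. norm (indicat_real S x * (f x * g x)) \<le> norm (indicat_real S x * (f x)\<^sup>2 + indicat_real S x * (g x)\<^sup>2)"
      by (auto simp: indicator_def)
  qed
  then show ?thesis by (simp add: set_integrable_def)
qed

lemma L2_add: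
  assumes "f \<in> L2 S" "g \<in> L2 S"
  shows "(\<lambda>x. f x + g x) \<in> L2 S"
proof -
  have "set_integrable lebesgue S (\<lambda>x. (f x)\<^sup>2 + 2 * (f x * g x) + (g x)\<^sup>2)"
    using assms L2_mult_integrable[OF assms] by (auto simp: L2_def)
  then have "set_integrable lebesgue S (\<lambda>x. (f x + g x)\<^sup>2)"
    by (simp add: power2_sum algebra_simps)
  moreover have "set_borel_measurable lebesgue S (\<lambda>x. f x + g x)"
    using assms borel_measurable_add[of "\<lambda>x. indicat_real S x * f x" lebesgue "\<lambda>x. indicat_real S x * g x"]
    by (simp add: L2_def set_borel_measurable_def distrib_left)
  ultimately show ?thesis by (simp add: L2_def)
qed

lemma L2_cmult:
  assumes "f \<in> L2 S" shows "(\<lambda>x. c * f x) \<in> L2 S"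
proof -
  have "set_borel_measurable lebesgue S (\<lambda>x. c * f x)"
    using assms borel_measurable_times[of "\<lambda>_. c" lebesgue "\<lambda>x. indicat_real S x * f x"]
    by (simp add: L2_def set_borel_measurable_def mult.left_commute)
  then show ?thesis using assms by (auto simp: L2_def power_mult_distrib)
qed

lemma L2_diff: "f \<in> L2 S \<Longrightarrow> g \<in> L2 S \<Longrightarrow> (\<lambda>x. f x - g x) \<in> L2 S"
  using L2_add[OF _ L2_cmult, of f S g "-1"] by simp

lemma L2_zero [simp]: "(\<lambda>x. 0) \<in> L2 S"
  by (simp add: L2_def set_borel_measurable_def set_integrable_def)

lemma L2_sum: "finite A \<Longrightarrow> (\<And>i. i \<in> A \<Longrightarrow> f i \<in> L2 S) \<Longrightarrow> (\<lambda>x. \<Sum>i\<in>A. f i x) \<in> L2 S"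
  by (induction A rule: finite_induct) (auto intro: L2_add)

lemma L2_subset:
  assumes "f \<in> L2 S" "S' \<subseteq> S" "S' \<in> sets lebesgue"
  shows "f \<in> L2 S'"
proof -
  have "indicat_real S' x * f x = indicat_real S' x * (indicat_real S x * f x)" for x
    using assms(2) by (auto simp: indicator_def)
  moreover have "(\<lambda>x. indicat_real S' x * (indicat_real S x * f x)) \<in> borel_measurable lebesgue"
    using assms borel_measurable_times[of "indicat_real S'" lebesgue "\<lambda>x. indicat_real S x * f x"]
    by (simp add: L2_def set_borel_measurable_def)
  ultimately have "set_borel_measurable lebesgue S' f"
    unfolding set_borel_measurable_def real_scaleR_def by presburger
  then show ?thesis using assms by (auto simp: L2_def intro: set_integrable_subset)
qed

lemma L2_bounded_mult:
  assumes "f \<in> L2 S" "h \<in> borel_measurable lebesgue" "\<And>x. x \<in> S \<Longrightarrow> \<bar>h x\<bar> \<le> B"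
  shows "(\<lambda>x. h x * f x) \<in> L2 S"
proof -
  have m: "(\<lambda>x. indicat_real S x * f x) \<in> borel_measurable lebesgue"
    and i: "integrable lebesgue (\<lambda>x. indicat_real S x * (f x)\<^sup>2)"
    using assms by (auto simp: L2_def set_borel_measurable_def set_integrable_def)
  have m': "(\<lambda>x. h x * (indicat_real S x * f x)) \<in> borel_measurable lebesgue"
    using m assms(2) by measurable
  have sq: "indicat_real S x * (h x * f x)\<^sup>2 = (h x * (indicat_real S x * f x))\<^sup>2" for x
    by (simp add: indicator_def)
  have "integrable lebesgue (\<lambda>x. indicat_real S x * (h x * f x)\<^sup>2)"
  proof (rule Bochner_Integration.integrable_bound[OF integrable_mult_right[OF i, of "B\<^sup>2"]])
    show "(\<lambda>x. indicat_real S x * (h x * f x)\<^sup>2) \<in> borel_measurable lebesgue"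
      unfolding sq using m' by measurable
    have "(h x)\<^sup>2 \<le> B\<^sup>2" if "x \<in> S" for x
      using assms(3)[OF that] by (simp add: abs_le_square_iff[symmetric])
    then show "AE x in lebesgue. norm (indicat_real S x * (h x * f x)\<^sup>2) \<le> norm (B\<^sup>2 * (indicat_real S x * (f x)\<^sup>2))"
      by (auto simp: indicator_def power_mult_distrib mult_right_mono)
  qed
  then show ?thesis using m'
    by (simp add: L2_def set_borel_measurable_def set_integrable_def mult.left_commute)
qed

lemma L2_const: "S \<in> lmeasurable \<Longrightarrow> (\<lambda>x. c) \<in> L2 S"
  by (auto simp: L2_def set_borel_measurable_def set_integrable_def fmeasurable_def intro!: integrable_mult_left)

lemma L2_bounded_measurable:
  assumes "S \<in> lmeasurable" "h \<in> borel_measurable lebesgue" "\<And>x. x \<in> S \<Longrightarrow> \<bar>h x\<bar> \<le> B"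
  shows "h \<in> L2 S"
  using L2_bounded_mult[OF L2_const[OF assms(1), of 1] assms(2,3)] by simp

lemma L2_continuous:
  assumes "bounded S" "S \<in> sets lebesgue" "continuous_on UNIV h"
  shows "h \<in> L2 S"
proof -
  have "compact (closure S)" using assms by simp
  then have "bounded (h ` closure S)"
    using assms(3) by (meson compact_continuous_image compact_imp_bounded continuous_on_subset subset_UNIV)
  then obtain B where "\<And>x. x \<in> closure S \<Longrightarrow> \<bar>h x\<bar> \<le> B"
    by (auto simp: bounded_iff)
  moreover have "h \<in> borel_measurable lebesgue"
    using borel_measurable_continuous_onI[OF assms(3)] by (simp add: measurable_completion)
  ultimately show ?thesis
    using assms closure_subset by (intro L2_bounded_measurable) (auto simp: bounded_set_imp_lmeasurable)
qed

lemma L2_inner_commute: "L2_inner S f g = L2_inner S g f"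
  by (simp add: L2_inner_def mult.commute)

lemma L2_inner_add: "f \<in> L2 S \<Longrightarrow> g \<in> L2 S \<Longrightarrow> h \<in> L2 S \<Longrightarrow> L2_inner S (\<lambda>x. f x + g x) h = L2_inner S f h + L2_inner S g h"
  unfolding L2_inner_def distrib_right by (intro set_integral_add L2_mult_integrable)

lemma L2_inner_diff: "f \<in> L2 S \<Longrightarrow> g \<in> L2 S \<Longrightarrow> h \<in> L2 S \<Longrightarrow> L2_inner S (\<lambda>x. f x - g x) h = L2_inner S f h - L2_inner S g h"
  unfolding L2_inner_def left_diff_distrib by (intro set_integral_diff L2_mult_integrable)

lemma L2_inner_cmult: "L2_inner S (\<lambda>x. c * f x) h = c * L2_inner S f h"
  unfolding L2_inner_def mult.assoc by simp

lemma L2_inner_right: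
  shows L2_inner_add_right: "f \<in> L2 S \<Longrightarrow> g \<in> L2 S \<Longrightarrow> h \<in> L2 S \<Longrightarrow> L2_inner S h (\<lambda>x. f x + g x) = L2_inner S h f + L2_inner S h g"
    and L2_inner_diff_right: "f \<in> L2 S \<Longrightarrow> g \<in> L2 S \<Longrightarrow> h \<in> L2 S \<Longrightarrow> L2_inner S h (\<lambda>x. f x - g x) = L2_inner S h f - L2_inner S h g"
    and L2_inner_cmult_right: "L2_inner S h (\<lambda>x. c * f x) = c * L2_inner S h f"
  using L2_inner_add[of f S g h] L2_inner_diff[of f S g h] L2_inner_cmult[of S c f h]
  unfolding L2_inner_commute[of S h] by auto

lemma L2_inner_nonneg: "0 \<le> L2_inner S f f"
  unfolding L2_inner_def set_lebesgue_integral_def by (rule integral_nonneg_AE) (auto simp: indicator_def)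

lemma L2_norm_nonneg [simp]: "0 \<le> L2_norm S f"
  by (simp add: L2_norm_def L2_inner_nonneg)

lemma L2_norm_sq: "(L2_norm S f)\<^sup>2 = L2_inner S f f"
  by (simp add: L2_norm_def L2_inner_nonneg)

lemma L2_norm_cmult: "L2_norm S (\<lambda>x. c * f x) = \<bar>c\<bar> * L2_norm S f"
  by (simp add: L2_norm_def L2_inner_cmult L2_inner_cmult_right real_sqrt_mult)

text \<open>The algebra behind the Cauchy-Schwarz inequality, kept free of integrals because it
  serves the inner product of L2 and the energy form alike.\<close>

lemma quadratic_nonneg_discriminant:
  fixes a b c :: real
  assumes "\<And>t. 0 \<le> a + 2 * t * b + t\<^sup>2 * c" "0 \<le> a" "0 \<le> c"
  shows "\<bar>b\<bar> \<le> sqrt a * sqrt c"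
proof -
  have "b\<^sup>2 \<le> a * c"
  proof (cases "c = 0")
    case True
    have "b = 0"
    proof (rule ccontr)
      assume "b \<noteq> 0"
      \<comment> \<open>With \<open>c = 0\<close> the polynomial is affine in \<open>t\<close>; this
        is the point where it takes the value -1.\<close>
      then have "a + 2 * (- (a + 1) / (2 * b)) * b = -1" by (simp add: field_simps)
      then show False using assms(1)[of "- (a + 1) / (2 * b)"] True by simp
    qed
    then show ?thesis using True by simp
  next
    case False
    \<comment> \<open>Evaluation at the minimiser \<open>- b / c\<close>.\<close>
    then have "a + 2 * (- b / c) * b + (- b / c)\<^sup>2 * c = a - b\<^sup>2 / c"
      by (simp add: field_simps power2_eq_square)
    then have "b\<^sup>2 / c \<le> a" using assms(1)[of "- b / c"] by simp
    then show ?thesis using False assms by (simp add: field_simps)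
  qed
  then show ?thesis by (metis real_sqrt_abs real_sqrt_le_mono real_sqrt_mult)
qed

lemma L2_Cauchy_Schwarz:
  assumes "f \<in> L2 S" "g \<in> L2 S"
  shows "\<bar>L2_inner S f g\<bar> \<le> L2_norm S f * L2_norm S g"
proof -
  have "0 \<le> L2_inner S f f + 2 * t * L2_inner S f g + t\<^sup>2 * L2_inner S g g" for t
  proof -
    have tg: "(\<lambda>x. t * g x) \<in> L2 S" "(\<lambda>x. f x + t * g x) \<in> L2 S" using assms by (auto intro: L2_add L2_cmult)
    have "L2_inner S (\<lambda>x. f x + t * g x) (\<lambda>x. f x + t * g x) =
       L2_inner S f f + 2 * t * L2_inner S f g + t\<^sup>2 * L2_inner S g g"
      using assms tg
      by (simp add: L2_inner_add L2_inner_add_right L2_inner_commute[of S g f]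
          L2_inner_cmult L2_inner_cmult_right algebra_simps power2_eq_square)
    then show ?thesis by (metis L2_inner_nonneg)
  qed
  then show ?thesis unfolding L2_norm_def
    by (intro quadratic_nonneg_discriminant L2_inner_nonneg)
qed

lemma L2_norm_triangle:
  assumes "f \<in> L2 S" "g \<in> L2 S"
  shows "L2_norm S (\<lambda>x. f x + g x) \<le> L2_norm S f + L2_norm S g"
proof (rule power2_le_imp_le)
  have fg: "(\<lambda>x. f x + g x) \<in> L2 S" using assms by (rule L2_add)
  have "(L2_norm S (\<lambda>x. f x + g x))\<^sup>2 = L2_inner S f f + 2 * L2_inner S f g + L2_inner S g g"
    unfolding L2_norm_sq using assms fg
    by (simp add: L2_inner_add L2_inner_add_right L2_inner_commute[of S g f])
  also have "\<dots> \<le> (L2_norm S f + L2_norm S g)\<^sup>2"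
    using L2_Cauchy_Schwarz[OF assms] by (simp add: power2_sum L2_norm_sq)
  finally show "(L2_norm S (\<lambda>x. f x + g x))\<^sup>2 \<le> (L2_norm S f + L2_norm S g)\<^sup>2" .
qed auto

lemma L2_norm_mono_set:
  assumes "f \<in> L2 S" "S' \<subseteq> S" "S' \<in> sets lebesgue"
  shows "L2_norm S' f \<le> L2_norm S f"
proof -
  have "L2_inner S' f f \<le> L2_inner S f f"
    unfolding L2_inner_def
    using L2_mult_integrable[OF assms(1,1)] L2_mult_integrable[OF L2_subset[OF assms] L2_subset[OF assms]] assms
    unfolding set_lebesgue_integral_def set_integrable_def
    by (intro integral_mono) (auto simp: indicator_def)
  then show ?thesis by (simp add: L2_norm_def)
qed

lemma L2_norm_bounded_mult:
  assumes "f \<in> L2 S" "h \<in> borel_measurable lebesgue" "\<And>x. x \<in> S \<Longrightarrow> \<bar>h x\<bar> \<le> B" "0 \<le> B"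
  shows "L2_norm S (\<lambda>x. h x * f x) \<le> B * L2_norm S f"
proof -
  have hf: "(\<lambda>x. h x * f x) \<in> L2 S" by (rule L2_bounded_mult[OF assms(1-3)])
  have "L2_inner S (\<lambda>x. h x * f x) (\<lambda>x. h x * f x) \<le> L2_inner S (\<lambda>x. B * f x) (\<lambda>x. B * f x)"
    unfolding L2_inner_def set_lebesgue_integral_def
  proof (rule integral_mono)
    show "integrable lebesgue (\<lambda>x. indicat_real S x *\<^sub>R (h x * f x * (h x * f x)))"
      "integrable lebesgue (\<lambda>x. indicat_real S x *\<^sub>R (B * f x * (B * f x)))"
      using L2_mult_integrable[OF hf hf] L2_mult_integrable[OF L2_cmult L2_cmult, OF assms(1,1), of B B] by (auto simp: set_integrable_def)
    fix x
    have "(h x * f x)\<^sup>2 \<le> (B * f x)\<^sup>2" if "x \<in> S"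
      using assms(3)[OF that] assms(4) by (simp add: abs_le_square_iff[symmetric] abs_mult mult_right_mono)
    then show "indicat_real S x *\<^sub>R (h x * f x * (h x * f x)) \<le> indicat_real S x *\<^sub>R (B * f x * (B * f x))"
      by (auto simp: indicator_def power2_eq_square)
  qed
  then have "L2_norm S (\<lambda>x. h x * f x) \<le> L2_norm S (\<lambda>x. B * f x)"
    by (simp add: L2_norm_def)
  then show ?thesis using assms(4) by (simp add: L2_norm_cmult)
qed

section \<open>Mollification\<close>

text \<open>The powers of \<open>1 / t\<close> make the family closed under differentiation up to
  linear combinations, so smoothness can be proved by an induction that treats all \<open>n\<close>
  at once. The case \<open>n = 0\<close> is the one used as a bump.\<close>

definition bump_fun :: "nat \<Rightarrow> real \<Rightarrow> real" where
  "bump_fun n t = (if t > 0 then (1 / t) ^ n * exp (- (1 / t)) else 0)"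

lemma bump_fun_tendsto_0: "((\<lambda>t. (1 / t) ^ n * exp (- (1 / t))) \<longlongrightarrow> 0) (at_right (0::real))"
proof -
  have "((\<lambda>x::real. x ^ n / exp x) \<longlongrightarrow> 0) at_top" by (rule tendsto_power_div_exp_0)
  from filterlim_compose[OF this filterlim_inverse_at_top_right]
  show ?thesis by (simp add: exp_minus divide_inverse)
qed

lemma bump_fun_has_derivative:
  "(bump_fun n has_field_derivative bump_fun (n + 2) t - real n * bump_fun (n + 1) t) (at t)"
proof -
  consider "t > 0" | "t < 0" | "t = 0" by linarith
  then show ?thesis
  proof cases
    case 1
    have "((\<lambda>t. (1 / t) ^ n * exp (- (1 / t))) has_field_derivative bump_fun (n + 2) t - real n * bump_fun (n + 1) t) (at t)"
      using 1 apply (auto intro!: derivative_eq_intros simp: bump_fun_def)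
      apply (cases n) apply (auto simp: field_simps power2_eq_square)
      done
    then show ?thesis
      by (rule has_field_derivative_transform_within_open[where S="{0<..}"]) (use 1 in \<open>auto simp: bump_fun_def\<close>)
  next
    case 2
    have "((\<lambda>t. 0) has_field_derivative bump_fun (n + 2) t - real n * bump_fun (n + 1) t) (at t)"
      using 2 by (simp add: bump_fun_def)
    then show ?thesis
      by (rule has_field_derivative_transform_within_open[where S="{..<0}"]) (use 2 in \<open>auto simp: bump_fun_def\<close>)
  next
    case 3
    \<comment> \<open>For positive \<open>h\<close> the difference quotient at 0 is the same
      expression with \<open>Suc n\<close> in place of \<open>n\<close>.\<close>
    have r: "((\<lambda>h. (bump_fun n (0 + h) - bump_fun n 0) / h) \<longlongrightarrow> 0) (at_right 0)"
      by (rule Lim_transform_eventually[OF bump_fun_tendsto_0[of "Suc n"]])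
        (auto simp: bump_fun_def eventually_at_filter)
    have l: "((\<lambda>h. (bump_fun n (0 + h) - bump_fun n 0) / h) \<longlongrightarrow> 0) (at_left 0)"
      by (rule Lim_transform_eventually[OF tendsto_const])
        (auto simp: bump_fun_def eventually_at_filter)
    have "((\<lambda>h. (bump_fun n (0 + h) - bump_fun n 0) / h) \<longlongrightarrow> 0) (at 0)"
      using filterlim_split_at[OF l r] .
    then have "(bump_fun n has_field_derivative 0) (at 0)"
      by (simp add: DERIV_def)
    then show ?thesis using 3 by (simp add: bump_fun_def)
  qed
qed

lemma Ck_bump: "Ck k (\<lambda>x. bump_fun n (x \<bullet> d + c))"
proof -
  have D: "((\<lambda>x. bump_fun n (x \<bullet> d + c)) has_derivative
      (\<lambda>h. (bump_fun (n + 2) (x \<bullet> d + c) - real n * bump_fun (n + 1) (x \<bullet> d + c)) * (h \<bullet> d))) (at x)" for n x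
  proof -
    have "((\<lambda>x. x \<bullet> d + c) has_derivative (\<lambda>h. h \<bullet> d)) (at x)"
      by (auto intro!: derivative_eq_intros)
    from has_derivative_compose[OF this bump_fun_has_derivative[unfolded has_field_derivative_def]]
    show ?thesis .
  qed
  show ?thesis
  proof (induction k arbitrary: n)
    case 0
    show ?case using has_derivative_continuous[OF D] by (simp add: continuous_at_imp_continuous_on)
  next
    case (Suc k)
    have "pd i (\<lambda>x. bump_fun n (x \<bullet> d + c)) =
       (\<lambda>x. d $ i * (bump_fun (n + 2) (x \<bullet> d + c) + (- real n) * bump_fun (n + 1) (x \<bullet> d + c)))" for i
      by (rule ext, subst pd_eqI[OF D]) (simp add: inner_axis' algebra_simps)
    moreover have "Ck k (\<lambda>x. d $ i * (bump_fun (n + 2) (x \<bullet> d + c) + (- real n) * bump_fun (n + 1) (x \<bullet> d + c)))" for i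
      using Suc by (intro Ck_mult Ck_add Ck_const)
    moreover have "(\<lambda>x. bump_fun n (x \<bullet> d + c)) differentiable at x" for x
      using D differentiable_def by blast
    ultimately show ?case by (simp only: Ck.simps) simp
  qed
qed

lemma smooth_bump: "smooth (\<lambda>x. bump_fun n (x \<bullet> d + c))"
  by (simp add: smooth_def Ck_bump)

text \<open>No family obtained by scaling is fixed. Any kernel of this kind will do, because the
  estimates below depend on the radius \<delta> only.\<close>

definition mollifier :: "real \<Rightarrow> fn \<Rightarrow> bool" where
  "mollifier \<delta> k \<longleftrightarrow> smooth k \<and> (\<forall>x. 0 \<le> k x) \<and> (\<forall>x. \<delta> \<le> norm x \<longrightarrow> k x = 0) \<and>
     integrable lborel k \<and> (LINT x|lborel. k x) = 1"

lemma smooth_borel_measurable: "smooth f \<Longrightarrow> f \<in> borel_measurable borel"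
  by (rule borel_measurable_continuous_onI) (rule smooth_continuous)

lemma smooth_compact_bounded:
  assumes "smooth k" "\<And>x. \<delta> \<le> norm x \<Longrightarrow> k x = 0"
  obtains B where "\<And>x. \<bar>k x\<bar> \<le> B" "0 \<le> B"
proof -
  have "bounded (k ` cball 0 \<delta>)"
    using smooth_continuous[OF assms(1)] by (intro compact_imp_bounded compact_continuous_image) auto
  then obtain B where B: "\<And>x. x \<in> cball 0 \<delta> \<Longrightarrow> \<bar>k x\<bar> \<le> B" unfolding bounded_iff by force
  have "\<bar>k x\<bar> \<le> max B 0" for x
    using B[of x] assms(2)[of x] by (cases "norm x \<le> \<delta>") (auto simp: max_def split: if_splits)
  then show thesis using that[of "max B 0"] by auto
qed

lemma smooth_compact_integrable:
  assumes "smooth k" "\<And>x. \<delta> \<le> norm x \<Longrightarrow> k x = 0"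
  shows "integrable lborel k"
proof -
  have "integrable lborel (\<lambda>x. indicator (cball 0 \<delta>) x *\<^sub>R k x)"
    by (rule borel_integrable_compact) (auto intro: smooth_continuous[OF assms(1)])
  moreover have "(\<lambda>x. indicator (cball 0 \<delta>) x *\<^sub>R k x) = k"
    using assms(2) by (auto simp: fun_eq_iff indicator_def)
  ultimately show ?thesis by simp
qed

text \<open>A product of four one-dimensional bumps is positive exactly on an open square of side
  \<delta>, which lies in the ball of radius \<delta> because the norm is at most the sum of the
  absolute values of the coordinates. Its integral is positive, since a function that is positive on
  a nonempty open set does not vanish almost everywhere.\<close>

lemma mollifier_exists:
  assumes "0 < \<delta>"
  shows "\<exists>k. mollifier \<delta> k"
proof -
  define b :: fn where "b x = (bump_fun 0 (x \<bullet> axis 1 1 + \<delta> / 2) * bump_fun 0 (x \<bullet> (- axis 1 1) + \<delta> / 2)) *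
     (bump_fun 0 (x \<bullet> axis 2 1 + \<delta> / 2) * bump_fun 0 (x \<bullet> (- axis 2 1) + \<delta> / 2))" for x
  have sm: "smooth b" unfolding b_def by (intro smooth_mult smooth_bump)
  have nn: "0 \<le> b x" for x by (simp add: b_def bump_fun_def)
  have pos: "0 < b x \<longleftrightarrow> \<bar>x $ 1\<bar> < \<delta> / 2 \<and> \<bar>x $ 2\<bar> < \<delta> / 2" for x
    by (auto simp: b_def bump_fun_def inner_axis zero_less_mult_iff abs_less_iff split: if_splits)
  have z: "b x = 0" if "\<delta> \<le> norm x" for x
  proof (rule ccontr)
    assume "b x \<noteq> 0"
    then have "0 < b x" using nn[of x] by simp
    moreover have "norm x \<le> \<bar>x $ 1\<bar> + \<bar>x $ 2\<bar>" using norm_le_l1_cart[of x] by (simp add: sum_2)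
    ultimately show False using pos[of x] that by auto
  qed
  have int: "integrable lborel b" using smooth_compact_integrable[OF sm z] by auto
  have "(LINT x|lborel. b x) \<noteq> 0"
  proof
    assume "(LINT x|lborel. b x) = 0"
    then have "AE x in lborel. b x = 0"
      using int nn by (subst (asm) integral_nonneg_eq_0_iff_AE) auto
    then have "{x. b x \<noteq> 0} \<in> null_sets lborel"
      using smooth_borel_measurable[OF sm] by (subst AE_iff_null_sets) (auto simp: pred_def)
    moreover have "open {x. b x \<noteq> 0}"
      using open_Collect_neq[of b "\<lambda>_. 0"] smooth_continuous[OF sm] by auto
    moreover have "(0::pt) \<in> {x. b x \<noteq> 0}" using pos[of 0] assms by auto
    ultimately show False
      by (metis null_sets_completionI open_not_negligible empty_iff negligible_iff_null_sets)
  qed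
  moreover have "0 \<le> (LINT x|lborel. b x)" using nn by (rule Bochner_Integration.integral_nonneg)
  ultimately have I: "0 < (LINT x|lborel. b x)" by simp
  have "mollifier \<delta> (\<lambda>x. inverse (LINT x|lborel. b x) * b x)"
    unfolding mollifier_def using sm nn z int I by (auto intro: smooth_cmult)
  then show ?thesis by blast
qed

lemma nn_integral_shift:
  fixes f :: "pt \<Rightarrow> ennreal"
  assumes [measurable]: "f \<in> borel_measurable borel"
  shows nn_integral_lborel_translate: "(\<integral>\<^sup>+x. f (x + c) \<partial>lborel) = (\<integral>\<^sup>+x. f x \<partial>lborel)"
    and nn_integral_lborel_reflect: "(\<integral>\<^sup>+x. f (c - x) \<partial>lborel) = (\<integral>\<^sup>+x. f x \<partial>lborel)"
proof -
  have "(\<integral>\<^sup>+x. f x \<partial>distr lborel borel ((+) c)) = (\<integral>\<^sup>+x. f (c + x) \<partial>lborel)"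
    by (rule nn_integral_distr) auto
  then show "(\<integral>\<^sup>+x. f (x + c) \<partial>lborel) = (\<integral>\<^sup>+x. f x \<partial>lborel)"
    by (simp add: lborel_distr_plus add.commute)
  have "(\<integral>\<^sup>+x. f x \<partial>lborel) = (\<integral>\<^sup>+x. f x \<partial>density (distr lborel borel (\<lambda>x. c + (-1) *\<^sub>R x)) (\<lambda>_. 1))"
    using lborel_affine[of "-1" c] by simp
  also have "\<dots> = (\<integral>\<^sup>+x. f (c - x) \<partial>lborel)"
    by (simp add: density_1 nn_integral_distr)
  finally show "(\<integral>\<^sup>+x. f (c - x) \<partial>lborel) = (\<integral>\<^sup>+x. f x \<partial>lborel)" ..
qed

section \<open>Convolution with a smooth kernel and its convergence in L2\<close>

definition conv :: "fn \<Rightarrow> fn \<Rightarrow> fn" where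
  "conv k f x = (LINT y|lborel. k (x - y) * f y)"

lemma conv_integrable:
  assumes "integrable lborel f" "smooth k" "\<And>x. \<delta> \<le> norm x \<Longrightarrow> k x = 0"
  shows "integrable lborel (\<lambda>y. k (x - y) * f y)"
proof -
  obtain B where B: "\<And>x. \<bar>k x\<bar> \<le> B" using smooth_compact_bounded[OF assms(2,3)] by metis
  have [measurable]: "k \<in> borel_measurable borel" using assms(2) by (rule smooth_borel_measurable)
  have [measurable]: "f \<in> borel_measurable borel" using assms(1) by auto
  show ?thesis
    by (rule Bochner_Integration.integrable_bound[OF integrable_mult_right[OF integrable_norm[OF assms(1)], of B]])
      (use order_trans[OF B abs_ge_self] in \<open>auto simp: abs_mult intro!: mult_right_mono\<close>)
qed

text \<open>Mean value theorem along the segment from \<open>z\<close> to \<open>z + h\<close>, with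
  uniform continuity of the gradient. The uniformity in \<open>z\<close> is what differentiation
  under the integral sign needs.\<close>

lemma smooth_uniform_derivative:
  assumes "smooth k" "\<And>x. \<delta> \<le> norm x \<Longrightarrow> k x = 0" "0 < e"
  shows "\<exists>d>0. \<forall>z h. norm h < d \<longrightarrow> \<bar>k (z + h) - k z - grad k z \<bullet> h\<bar> \<le> e * norm h"
proof -
  have g: "continuous_on UNIV (grad k)"
    unfolding grad_def using smooth_continuous[OF smooth_pd[OF assms(1)]]
    by (intro continuous_on_vec_lambda) auto
  \<comment> \<open>The margin 1 puts \<open>x\<close> strictly outside the closed ball of radius
    \<delta>.\<close>
  have gz: "grad k x = 0" if "\<delta> + 1 \<le> norm x" for x
  proof -
    have "pd i k x = 0" for i
      by (rule pd_zero_outside[of "cball 0 \<delta>"]) (use assms(2) that in auto)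
    then show ?thesis by (simp add: grad_def vec_eq_iff)
  qed
  \<comment> \<open>Increments are shorter than 1, so either both points lie in this ball or the
    gradient vanishes at both.\<close>
  have "uniformly_continuous_on (cball 0 (\<bar>\<delta>\<bar> + 3)) (grad k)"
    using g by (intro compact_uniformly_continuous) (auto intro: continuous_on_subset)
  then obtain d where d: "d > 0" "\<And>x y. x \<in> cball 0 (\<bar>\<delta>\<bar> + 3) \<Longrightarrow> y \<in> cball 0 (\<bar>\<delta>\<bar> + 3) \<Longrightarrow> dist y x < d \<Longrightarrow> dist (grad k y) (grad k x) < e"
    using assms(3) unfolding uniformly_continuous_on_def by meson
  have u: "norm (grad k (z + h) - grad k z) \<le> e" if h: "norm h < min d 1" for z h
  proof (cases "norm z \<le> \<bar>\<delta>\<bar> + 2")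
    case True
    then have "norm (z + h) \<le> \<bar>\<delta>\<bar> + 3" using h norm_triangle_ineq[of z h] by auto
    then have "z \<in> cball 0 (\<bar>\<delta>\<bar> + 3)" "z + h \<in> cball 0 (\<bar>\<delta>\<bar> + 3)"
      using True unfolding mem_cball_0 by linarith+
    then have "dist (grad k (z + h)) (grad k z) < e"
      using h by (intro d(2)) (simp_all only: dist_norm add_diff_cancel_left' min_less_iff_conj)
    then show ?thesis by (simp add: dist_norm)
  next
    case False
    then have "norm (z + h) \<ge> \<delta> + 1" using h norm_triangle_ineq2[of z "-h"] by auto
    then show ?thesis using gz[of z] gz[of "z + h"] False assms(3) by auto
  qed
  have "\<bar>k (z + h) - k z - grad k z \<bullet> h\<bar> \<le> e * norm h" if h: "norm h < min d 1" for z h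
  proof -
    have der: "((\<lambda>t. k (z + t *\<^sub>R h)) has_field_derivative grad k (z + t *\<^sub>R h) \<bullet> h) (at t)" for t
    proof -
      have "((\<lambda>t. z + t *\<^sub>R h) has_derivative (\<lambda>s. s *\<^sub>R h)) (at t)"
        by (auto intro!: derivative_eq_intros)
      from has_derivative_compose[OF this smooth_has_derivative[OF assms(1)]]
      show ?thesis by (simp add: has_field_derivative_def mult_commute_abs)
    qed
    obtain s where s: "0 < s" "s < 1" "k (z + 1 *\<^sub>R h) - k (z + 0 *\<^sub>R h) = (1 - 0) * (grad k (z + s *\<^sub>R h) \<bullet> h)"
      using MVT2[of 0 1 "\<lambda>t. k (z + t *\<^sub>R h)" "\<lambda>t. grad k (z + t *\<^sub>R h) \<bullet> h"] der by auto
    then have "k (z + h) - k z - grad k z \<bullet> h = (grad k (z + s *\<^sub>R h) - grad k z) \<bullet> h"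
      by (simp add: inner_diff_left)
    also have "\<bar>\<dots>\<bar> \<le> norm (grad k (z + s *\<^sub>R h) - grad k z) * norm h"
      by (rule Cauchy_Schwarz_ineq2)
    also have "\<dots> \<le> e * norm h"
    proof (rule mult_right_mono)
      have "norm (s *\<^sub>R h) < min d 1" using s h mult_le_cancel_right1[of s "norm h"]
        by (smt (verit, best) mult_less_cancel_right1 norm_ge_zero norm_scaleR zero_less_abs_iff)
      then show "norm (grad k (z + s *\<^sub>R h) - grad k z) \<le> e" by (rule u)
    qed auto
    finally show ?thesis .
  qed
  then show ?thesis using d(1) by (intro exI[of _ "min d 1"]) auto
qed

text \<open>The error of the linear approximation of the kernel is small uniformly in the
  integration variable; multiplied by \<open>f\<close> it integrates to a small multiple of
  \<open>norm (y - x)\<close>.\<close>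

lemma conv_has_derivative:
  assumes f: "integrable lborel f" and k: "smooth k" "\<And>x. \<delta> \<le> norm x \<Longrightarrow> k x = 0"
  shows "(conv k f has_derivative (\<lambda>h. (\<chi> i. conv (pd i k) f x) \<bullet> h)) (at x)"
proof -
  have pz: "pd i k x = 0" if "\<delta> + 1 \<le> norm x" for i x
    by (rule pd_zero_outside[of "cball 0 \<delta>"]) (use k(2) that in auto)
  note ik = conv_integrable[OF f k]
  have ip: "integrable lborel (\<lambda>y. pd i k (x - y) * f y)" for i x
    by (rule conv_integrable[OF f smooth_pd[OF k(1)] pz])
  have lin: "(\<chi> i. conv (pd i k) f x) \<bullet> h = (LINT y|lborel. (grad k (x - y) \<bullet> h) * f y)"
    and ig: "integrable lborel (\<lambda>y. (grad k (x - y) \<bullet> h) * f y)" for x h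
  proof -
    have e: "(grad k (x - y) \<bullet> h) * f y = (\<Sum>i\<in>UNIV. (pd i k (x - y) * f y) * h $ i)" for y
      by (simp add: grad_def inner_vec_def sum_distrib_left mult_ac)
    show "integrable lborel (\<lambda>y. (grad k (x - y) \<bullet> h) * f y)"
      unfolding e using ip by (intro Bochner_Integration.integrable_sum integrable_mult_left)
    show "(\<chi> i. conv (pd i k) f x) \<bullet> h = (LINT y|lborel. (grad k (x - y) \<bullet> h) * f y)"
      unfolding e using ip by (subst Bochner_Integration.integral_sum) (auto simp: inner_vec_def conv_def)
  qed
  define F where "F = (LINT y|lborel. \<bar>f y\<bar>)"
  have F: "0 \<le> F" by (simp add: F_def)
  show ?thesis
    unfolding has_derivative_at_alt
  proof (intro conjI allI impI)
    show "bounded_linear (\<lambda>h. (\<chi> i. conv (pd i k) f x) \<bullet> h)" by (rule bounded_linear_inner_right)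
    fix e :: real assume "0 < e"
    \<comment> \<open>\<open>F\<close> may be 0, hence the denominator \<open>F + 1\<close>.\<close>
    then have e: "0 < e / (F + 1)" using F by simp
    obtain d where d: "d > 0" "\<And>z h. norm h < d \<Longrightarrow> \<bar>k (z + h) - k z - grad k z \<bullet> h\<bar> \<le> e / (F + 1) * norm h"
      using smooth_uniform_derivative[OF k e] by blast
    have "norm (conv k f y - conv k f x - (\<chi> i. conv (pd i k) f x) \<bullet> (y - x)) \<le> e * norm (y - x)"
      if y: "norm (y - x) < d" for y
    proof -
      have "conv k f y - conv k f x - (\<chi> i. conv (pd i k) f x) \<bullet> (y - x)
        = (LINT w|lborel. k (y - w) * f w - k (x - w) * f w - (grad k (x - w) \<bullet> (y - x)) * f w)"
        unfolding lin unfolding conv_def using ik ig by (simp add: Bochner_Integration.integral_diff)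
      also have "\<dots> = (LINT w|lborel. (k ((x - w) + (y - x)) - k (x - w) - grad k (x - w) \<bullet> (y - x)) * f w)"
        by (simp add: algebra_simps)
      also have "norm \<dots> \<le> (LINT w|lborel. (e / (F + 1) * norm (y - x)) * \<bar>f w\<bar>)"
      proof (rule order_trans[OF integral_norm_bound integral_mono])
        have "integrable lborel (\<lambda>w. k (y - w) * f w - k (x - w) * f w - (grad k (x - w) \<bullet> (y - x)) * f w)"
          using ik ig by (intro Bochner_Integration.integrable_diff)
        then show "integrable lborel (\<lambda>w. norm ((k ((x - w) + (y - x)) - k (x - w) - grad k (x - w) \<bullet> (y - x)) * f w))"
          by (intro integrable_norm) (simp add: algebra_simps)
        show "integrable lborel (\<lambda>w. (e / (F + 1) * norm (y - x)) * \<bar>f w\<bar>)"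
          using f by auto
        show "norm ((k ((x - w) + (y - x)) - k (x - w) - grad k (x - w) \<bullet> (y - x)) * f w) \<le> e / (F + 1) * norm (y - x) * \<bar>f w\<bar>" for w
          unfolding norm_mult real_norm_def abs_mult by (intro mult_right_mono d(2) y) auto
      qed
      also have "\<dots> = e * norm (y - x) * (F / (F + 1))" by (simp add: F_def)
      also have "\<dots> \<le> e * norm (y - x) * 1"
        using F \<open>0 < e\<close> by (intro mult_left_mono) auto
      finally show ?thesis by simp
    qed
    then show "\<exists>d>0. \<forall>y. norm (y - x) < d \<longrightarrow> norm (conv k f y - conv k f x - (\<chi> i. conv (pd i k) f x) \<bullet> (y - x)) \<le> e * norm (y - x)"
      using d(1) by blast
  qed
qed

lemma pd_conv:
  assumes "integrable lborel f" "smooth k" "\<And>x. \<delta> \<le> norm x \<Longrightarrow> k x = 0"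
  shows "pd i (conv k f) = conv (pd i k) f"
  using pd_eqI_inner[OF conv_has_derivative[OF assms]] by auto

lemma smooth_conv:
  assumes "integrable lborel f" "smooth k" "\<And>x. \<delta> \<le> norm x \<Longrightarrow> k x = 0"
  shows "smooth (conv k f)"
proof (rule smooth_coinduct[where P="\<lambda>g. \<exists>k \<delta>. smooth k \<and> (\<forall>x. \<delta> \<le> norm x \<longrightarrow> k x = 0) \<and> g = conv k f"])
  show "\<exists>k' \<delta>. smooth k' \<and> (\<forall>x. \<delta> \<le> norm x \<longrightarrow> k' x = 0) \<and> conv k f = conv k' f" using assms by blast
next
  fix g x assume "\<exists>k \<delta>. smooth k \<and> (\<forall>x. \<delta> \<le> norm x \<longrightarrow> k x = 0) \<and> g = conv k f"
  then obtain k \<delta> where "smooth k" "\<And>x. \<delta> \<le> norm x \<Longrightarrow> k x = 0" "g = conv k f" by blast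
  then show "g differentiable at x" using conv_has_derivative[OF assms(1)] unfolding differentiable_def by blast
next
  fix g i assume "\<exists>k \<delta>. smooth k \<and> (\<forall>x. \<delta> \<le> norm x \<longrightarrow> k x = 0) \<and> g = conv k f"
  then obtain k \<delta> where k: "smooth k" "\<And>x. \<delta> \<le> norm x \<Longrightarrow> k x = 0" "g = conv k f" by blast
  have "pd i k x = 0" if "\<delta> + 1 \<le> norm x" for x
    by (rule pd_zero_outside[of "cball 0 \<delta>"]) (use k(2) that in auto)
  moreover have "pd i g = conv (pd i k) f" using pd_conv[OF assms(1) k(1,2)] k(3) by simp
  ultimately show "\<exists>k \<delta>. smooth k \<and> (\<forall>x. \<delta> \<le> norm x \<longrightarrow> k x = 0) \<and> pd i g = conv k f"
    using smooth_pd[OF k(1)] by blast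
qed

text \<open>Two approximations are combined: truncation of \<open>f\<close> at a height
  \<open>m\<close>, and then continuous functions converging almost everywhere to the truncation,
  which \<open>measurable_on\<close> provides. Each converges in L2 by dominated
  convergence.\<close>

lemma L2_continuous_dense:
  fixes f :: fn
  assumes f[measurable]: "f \<in> borel_measurable borel" and f2: "integrable lborel (\<lambda>x. (f x)\<^sup>2)"
    and supp: "\<And>x. R \<le> norm x \<Longrightarrow> f x = 0" and e: "0 < e"
  shows "\<exists>c. continuous_on UNIV c \<and> (\<forall>x. R + 1 \<le> norm x \<longrightarrow> c x = 0) \<and>
     integrable lborel (\<lambda>x. (f x - c x)\<^sup>2) \<and> (LINT x|lborel. (f x - c x)\<^sup>2) < e"
proof -
  define F where "F m x = (if \<bar>f x\<bar> \<le> real m then f x else 0)" for m x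
  have Fm[measurable]: "F m \<in> borel_measurable borel" for m unfolding F_def by measurable
  have "(\<lambda>m. LINT x|lborel. (f x - F m x)\<^sup>2) \<longlonglongrightarrow> (LINT x|(lborel::pt measure). 0::real)"
  proof (rule Bochner_Integration.integral_dominated_convergence[where w="\<lambda>x. (f x)\<^sup>2"])
    show "AE x in lborel. (\<lambda>m. (f x - F m x)\<^sup>2) \<longlonglongrightarrow> 0"
    proof (rule AE_I2)
      fix x
      obtain m0 where "\<bar>f x\<bar> \<le> real m0" using real_arch_simple by blast
      then have "\<forall>\<^sub>F m in sequentially. 0 = (f x - F m x)\<^sup>2"
        unfolding F_def by (intro eventually_sequentiallyI[of m0]) (auto intro: order_trans)
      then show "(\<lambda>m. (f x - F m x)\<^sup>2) \<longlonglongrightarrow> 0"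
        by (rule Lim_transform_eventually[OF tendsto_const])
    qed
  qed (use f2 in \<open>auto simp: F_def\<close>)
  then have "\<forall>\<^sub>F m in sequentially. (LINT x|lborel. (f x - F m x)\<^sup>2) < e / 4"
    using e by (intro order_tendstoD(2)) auto
  then obtain m where m: "(LINT x|lborel. (f x - F m x)\<^sup>2) < e / 4"
    by (auto simp: eventually_sequentially)
  have i1: "integrable lborel (\<lambda>x. (f x - F m x)\<^sup>2)"
    by (rule Bochner_Integration.integrable_bound[OF f2]) (auto simp: F_def)
  have "F m measurable_on UNIV"
    by (intro lebesgue_measurable_imp_measurable_on) (auto intro: measurable_completion)
  then obtain N g where N: "negligible N" and gc: "\<And>n. continuous_on UNIV (g n)"
    and gl: "\<And>x. x \<notin> N \<Longrightarrow> (\<lambda>n. g n x) \<longlonglongrightarrow> F m x"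
    unfolding measurable_on_def by auto
  \<comment> \<open>Clipping at height \<open>m\<close> and the cut-off supply a dominating function
    and the compact support. Neither changes the pointwise limit, which obeys the same
    bounds.\<close>
  define c where "c n x = max (- real m) (min (real m) (g n x)) * max 0 (min 1 (R + 1 - norm x))" for n x
  have cc: "continuous_on UNIV (c n)" for n
    unfolding c_def by (intro continuous_intros gc)
  have [measurable]: "c n \<in> borel_measurable borel" for n
    using borel_measurable_continuous_onI[OF cc] .
  have cb: "\<bar>c n x\<bar> \<le> real m" for n x
  proof -
    have "\<bar>c n x\<bar> \<le> real m * 1"
      unfolding c_def abs_mult by (intro mult_mono) auto
    then show ?thesis by simp
  qed
  have cz: "c n x = 0" if "R + 1 \<le> norm x" for n x using that by (simp add: c_def)
  have Fz: "F m x = 0" if "R \<le> norm x" for x using supp[OF that] by (simp add: F_def)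
  have Fb: "\<bar>F m x\<bar> \<le> real m" for x by (simp add: F_def)
  have cl: "(\<lambda>n. (F m x - c n x)\<^sup>2) \<longlonglongrightarrow> 0" if "x \<notin> N" for x
  proof -
    have "(\<lambda>n. c n x) \<longlonglongrightarrow> max (- real m) (min (real m) (F m x)) * max 0 (min 1 (R + 1 - norm x))"
      unfolding c_def by (intro tendsto_intros gl that)
    moreover have "max (- real m) (min (real m) (F m x)) = F m x" using Fb[of x] by auto
    moreover have "F m x * max 0 (min 1 (R + 1 - norm x)) = F m x"
      using Fz[of x] by (cases "R \<le> norm x") auto
    ultimately have "(\<lambda>n. c n x) \<longlonglongrightarrow> F m x" by simp
    then have "(\<lambda>n. (F m x - c n x)\<^sup>2) \<longlonglongrightarrow> (F m x - F m x)\<^sup>2" by (intro tendsto_intros)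
    then show ?thesis by simp
  qed
  let ?w = "\<lambda>x. (2 * real m)\<^sup>2 * indicat_real (cball 0 (\<bar>R\<bar> + 1)) x"
  have w: "integrable lborel ?w"
    using borel_integrable_compact[OF compact_cball continuous_on_const, of 0 "\<bar>R\<bar> + 1" "1::real"]
    by (intro integrable_mult_right) simp
  have bd: "\<bar>(F m x - c n x)\<^sup>2\<bar> \<le> ?w x" for n x
  proof (cases "norm x \<le> \<bar>R\<bar> + 1")
    case True
    have "\<bar>F m x - c n x\<bar> \<le> \<bar>2 * real m\<bar>" using Fb[of x] cb[of n x] by linarith
    then have "(F m x - c n x)\<^sup>2 \<le> (2 * real m)\<^sup>2" by (simp only: abs_le_square_iff)
    then show ?thesis using True by simp
  next
    case False
    then show ?thesis using cz[of x n] Fz[of x] by (auto simp: indicator_def)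
  qed
  have "(\<lambda>n. LINT x|lborel. (F m x - c n x)\<^sup>2) \<longlonglongrightarrow> (LINT x|(lborel::pt measure). 0::real)"
  proof (rule Bochner_Integration.integral_dominated_convergence[where w="?w"])
    have "N \<in> null_sets lebesgue" using N by (simp add: negligible_iff_null_sets)
    then have "AE x in lebesgue. x \<notin> N" by (rule AE_not_in)
    then have "AE x in lborel. x \<notin> N" by (simp add: AE_completion_iff)
    then show "AE x in lborel. (\<lambda>n. (F m x - c n x)\<^sup>2) \<longlonglongrightarrow> 0"
      by (elim AE_mp) (use cl in auto)
  qed (use w bd in auto)
  then have "\<forall>\<^sub>F n in sequentially. (LINT x|lborel. (F m x - c n x)\<^sup>2) < e / 4"
    using e by (intro order_tendstoD(2)) auto
  then obtain n where n: "(LINT x|lborel. (F m x - c n x)\<^sup>2) < e / 4"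
    by (auto simp: eventually_sequentially)
  have i2: "integrable lborel (\<lambda>x. (F m x - c n x)\<^sup>2)"
    by (rule Bochner_Integration.integrable_bound[OF w]) (use bd[of _ n] in auto)
  have i3: "integrable lborel (\<lambda>x. 2 * (f x - F m x)\<^sup>2 + 2 * (F m x - c n x)\<^sup>2)"
    using i1 i2 by auto
  have le: "(f x - c n x)\<^sup>2 \<le> 2 * (f x - F m x)\<^sup>2 + 2 * (F m x - c n x)\<^sup>2" for x
    using sum_squares_bound[of "f x - F m x" "F m x - c n x"]
      power2_sum[of "f x - F m x" "F m x - c n x"] by simp
  have i4: "integrable lborel (\<lambda>x. (f x - c n x)\<^sup>2)"
    by (rule Bochner_Integration.integrable_bound[OF i3]) (use le in auto)
  have "(LINT x|lborel. (f x - c n x)\<^sup>2) \<le> (LINT x|lborel. 2 * (f x - F m x)\<^sup>2 + 2 * (F m x - c n x)\<^sup>2)"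
    using i4 i3 le by (rule integral_mono)
  also have "\<dots> = 2 * (LINT x|lborel. (f x - F m x)\<^sup>2) + 2 * (LINT x|lborel. (F m x - c n x)\<^sup>2)"
    using i1 i2 by simp
  also have "\<dots> < e" using m n by simp
  finally show ?thesis using cc cz i4 by blast
qed

text \<open>Jensen's inequality for the probability density \<open>k (x - y)\<close> in the variable
  \<open>y\<close>.\<close>

lemma conv_sub_sq_le:
  fixes f :: fn
  assumes k: "mollifier \<delta> k" and f: "integrable lborel f" "integrable lborel (\<lambda>x. (f x)\<^sup>2)"
  shows "ennreal ((conv k f x - f x)\<^sup>2) \<le> (\<integral>\<^sup>+y. ennreal (k (x - y) * (f y - f x)\<^sup>2) \<partial>lborel)"
proof -
  have k': "smooth k" "\<And>x. \<delta> \<le> norm x \<Longrightarrow> k x = 0" "\<And>x. 0 \<le> k x"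
    using k by (auto simp: mollifier_def)
  have [measurable]: "k \<in> borel_measurable borel" using k'(1) by (rule smooth_borel_measurable)
  have [measurable]: "f \<in> borel_measurable borel" using f by auto
  have nk: "(\<integral>\<^sup>+y. ennreal (k (x - y)) \<partial>lborel) = 1"
  proof -
    have "(\<integral>\<^sup>+y. ennreal (k (x - y)) \<partial>lborel) = (\<integral>\<^sup>+y. ennreal (k y) \<partial>lborel)"
      using nn_integral_lborel_reflect[of "\<lambda>y. ennreal (k y)" x] by simp
    also have "\<dots> = 1" using k by (subst nn_integral_eq_integral) (auto simp: mollifier_def)
    finally show ?thesis .
  qed
  have ik: "integrable lborel (\<lambda>y. k (x - y))"
    using nk k'(3) by (intro integrableI_nonneg) auto
  have Ik: "(LINT y|lborel. k (x - y)) = 1"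
    using nk k'(3) by (subst integral_eq_nn_integral) auto
  note ikf = conv_integrable[OF f(1) k'(1,2)] and ikf2 = conv_integrable[OF f(2) k'(1,2)]
  define t where "t = conv k f x - f x"
  have ih2: "integrable lborel (\<lambda>y. k (x - y) * (f y - f x)\<^sup>2)"
  proof -
    have "integrable lborel (\<lambda>y. k (x - y) * (f y)\<^sup>2 - 2 * f x * (k (x - y) * f y) + (f x)\<^sup>2 * k (x - y))"
      by (intro Bochner_Integration.integrable_add Bochner_Integration.integrable_diff integrable_mult_right ikf ikf2 ik)
    then show ?thesis by (simp add: power2_diff algebra_simps)
  qed
  have ih: "integrable lborel (\<lambda>y. k (x - y) * (f y - f x))"
    and Ih: "(LINT y|lborel. k (x - y) * (f y - f x)) = t"
    unfolding right_diff_distrib t_def conv_def using ikf ik Ik by auto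
  \<comment> \<open>\<open>f x + t\<close> is the mean of \<open>f\<close> under this density, so
    this is a variance.\<close>
  have "0 \<le> (LINT y|lborel. k (x - y) * (f y - f x - t)\<^sup>2)"
    using k'(3) by (intro Bochner_Integration.integral_nonneg) auto
  also have "\<dots> = (LINT y|lborel. k (x - y) * (f y - f x)\<^sup>2 - 2 * t * (k (x - y) * (f y - f x)) + t\<^sup>2 * k (x - y))"
    by (rule Bochner_Integration.integral_cong[OF refl]) (simp add: power2_eq_square algebra_simps)
  also have "\<dots> = (LINT y|lborel. k (x - y) * (f y - f x)\<^sup>2) - 2 * t * t + t\<^sup>2"
    using ih2 ih ik Ih Ik by simp
  finally have "t\<^sup>2 \<le> (LINT y|lborel. k (x - y) * (f y - f x)\<^sup>2)" by (simp add: power2_eq_square)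
  then have "ennreal (t\<^sup>2) \<le> ennreal (LINT y|lborel. k (x - y) * (f y - f x)\<^sup>2)" by (rule ennreal_leI)
  also have "\<dots> = (\<integral>\<^sup>+y. ennreal (k (x - y) * (f y - f x)\<^sup>2) \<partial>lborel)"
    using ih2 k'(3) by (subst nn_integral_eq_integral) auto
  finally show ?thesis by (simp add: t_def)
qed

text \<open>The indicator keeps the bound integrable over the plane. For \<open>x\<close> outside
  the larger ball and \<open>y\<close> at distance less than 1 both values of \<open>c\<close> are
  0.\<close>

lemma compact_support_uniformly_continuous:
  fixes c :: fn
  assumes "continuous_on UNIV c" "\<And>x. R \<le> norm x \<Longrightarrow> c x = 0" "0 < w"
  obtains d where "0 < d" "\<And>x y. norm (x - y) < d \<Longrightarrow> (c y - c x)\<^sup>2 \<le> w * indicat_real (cball 0 (\<bar>R\<bar> + 1)) x"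
proof -
  have "uniformly_continuous_on (cball 0 (\<bar>R\<bar> + 2)) c"
    using assms(1) by (intro compact_uniformly_continuous) (auto intro: continuous_on_subset)
  then obtain d where d: "d > 0" "\<And>x y. x \<in> cball 0 (\<bar>R\<bar> + 2) \<Longrightarrow> y \<in> cball 0 (\<bar>R\<bar> + 2) \<Longrightarrow> dist y x < d \<Longrightarrow> dist (c y) (c x) < sqrt w"
    using assms(3) unfolding uniformly_continuous_on_def by (metis real_sqrt_gt_0_iff)
  have "(c y - c x)\<^sup>2 \<le> w * indicat_real (cball 0 (\<bar>R\<bar> + 1)) x" if "norm (x - y) < min d 1" for x y
  proof (cases "norm x \<le> \<bar>R\<bar> + 1")
    case True
    have "norm y \<le> norm x + norm (x - y)" using norm_triangle_ineq4[of x "x - y"] by simp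
    then have "dist (c y) (c x) < sqrt w"
      by (intro d(2)) (use True that in \<open>auto simp: mem_cball_0 dist_norm norm_minus_commute\<close>)
    then have "\<bar>c y - c x\<bar> \<le> \<bar>sqrt w\<bar>" using assms(3) by (simp add: dist_norm)
    then have "(c y - c x)\<^sup>2 \<le> (sqrt w)\<^sup>2" by (simp only: abs_le_square_iff)
    then show ?thesis using True assms(3) by simp
  next
    case False
    have "norm x \<le> norm y + norm (x - y)" using norm_triangle_ineq[of y "x - y"] by simp
    then have "R \<le> norm x" "R \<le> norm y" using False that by auto
    then show ?thesis using assms(2) by (simp add: False)
  qed
  then show thesis using that[of "min d 1"] d(1) by auto
qed

text \<open>The increment \<open>f y - f x\<close> is led through a continuous function
  \<open>c\<close> close to \<open>f\<close>, and squaring a sum of three terms costs a factor 3.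
  The term in \<open>f y - c y\<close> is handled by exchanging the integrals, because the kernel
  has integral 1 in either variable. The radius depends on \<open>f\<close> and not on the
  kernel.\<close>

lemma conv_approx:
  fixes f :: fn
  assumes f: "integrable lborel f" "integrable lborel (\<lambda>x. (f x)\<^sup>2)"
    and supp: "\<And>x. R \<le> norm x \<Longrightarrow> f x = 0" and e: "0 < e"
  shows "\<exists>d>0. \<forall>\<delta> k. \<delta> \<le> d \<and> mollifier \<delta> k \<longrightarrow> (\<integral>\<^sup>+x. ennreal ((conv k f x - f x)\<^sup>2) \<partial>lborel) \<le> ennreal e"
proof -
  have [measurable]: "f \<in> borel_measurable borel" using f by auto
  obtain c where c: "continuous_on UNIV c" "\<And>x. R + 1 \<le> norm x \<Longrightarrow> c x = 0"
     "integrable lborel (\<lambda>x. (f x - c x)\<^sup>2)" "(LINT x|lborel. (f x - c x)\<^sup>2) < e / 9"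
    using L2_continuous_dense[of f R "e / 9"] f supp e by auto
  have cm[measurable]: "c \<in> borel_measurable borel" using borel_measurable_continuous_onI[OF c(1)] .
  define B :: "pt set" where "B = cball 0 (\<bar>R + 1\<bar> + 1)"
  define v where "v = measure lborel B"
  have v: "0 \<le> v" by (simp add: v_def)
  have B[measurable]: "B \<in> sets borel" by (simp add: B_def)
  \<comment> \<open>Each of the three contributions is to be at most \<open>3 * (e / 9)\<close>. The
    denominator compensates the area \<open>v\<close> of the ball on which \<open>c\<close> may
    vary.\<close>
  define w where "w = e / (9 * (v + 1))"
  have w: "0 < w" "w * v \<le> e / 9" using v e by (auto simp: w_def field_simps)
  obtain d where d: "0 < d" "\<And>x y. norm (x - y) < d \<Longrightarrow> (c y - c x)\<^sup>2 \<le> w * indicat_real B x"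
    using compact_support_uniformly_continuous[OF c(1,2) w(1)] unfolding B_def by blast
  define p where "p y = 3 * (f y - c y)\<^sup>2" for y
  define q where "q x = 3 * (w * indicat_real B x) + 3 * (f x - c x)\<^sup>2" for x
  have [measurable]: "p \<in> borel_measurable borel" "q \<in> borel_measurable borel"
    unfolding p_def q_def by measurable
  have pq: "0 \<le> p x" "0 \<le> q x" for x using w by (auto simp: p_def q_def)
  have iB: "integrable lborel (indicat_real B)" 
    using borel_integrable_compact[OF compact_cball continuous_on_const, of 0 "\<bar>R + 1\<bar> + 1" "1::real"]
    by (simp add: B_def)
  have Ip: "integrable lborel p" "(LINT x|lborel. p x) \<le> 3 * (e / 9)"
    unfolding p_def using c(3,4) by auto
  have Iq: "integrable lborel q" "(LINT x|lborel. q x) \<le> 3 * (e / 9) + 3 * (e / 9)"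
    unfolding q_def using c(3,4) iB w(2) by (auto simp: v_def)
  have "(\<integral>\<^sup>+x. ennreal ((conv k f x - f x)\<^sup>2) \<partial>lborel) \<le> ennreal e" if \<delta>: "\<delta> \<le> d" and k: "mollifier \<delta> k" for \<delta> k
  proof -
    have k': "smooth k" "\<And>x. \<delta> \<le> norm x \<Longrightarrow> k x = 0" "\<And>x. 0 \<le> k x"
      using k by (auto simp: mollifier_def)
    have [measurable]: "k \<in> borel_measurable borel" using k'(1) by (rule smooth_borel_measurable)
    have nk: "(\<integral>\<^sup>+y. ennreal (k y) \<partial>lborel) = 1"
      using k by (subst nn_integral_eq_integral) (auto simp: mollifier_def)
    have nk1: "(\<integral>\<^sup>+y. ennreal (k (x - y)) \<partial>lborel) = 1" for x
      using nn_integral_lborel_reflect[of "\<lambda>y. ennreal (k y)" x] nk by simp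
    have nk2: "(\<integral>\<^sup>+x. ennreal (k (x - y)) \<partial>lborel) = 1" for y
      using nn_integral_lborel_translate[of "\<lambda>y. ennreal (k y)" "- y"] nk by simp
    have "ennreal ((conv k f x - f x)\<^sup>2) \<le> (\<integral>\<^sup>+y. ennreal (k (x - y)) * ennreal (p y) + ennreal (k (x - y)) * ennreal (q x) \<partial>lborel)" for x
    proof (rule order_trans[OF conv_sub_sq_le[OF k f] nn_integral_mono])
      fix y
      have "k (x - y) * (f y - f x)\<^sup>2 \<le> k (x - y) * (p y + q x)"
      proof (cases "norm (x - y) < \<delta>")
        case True
        have "(c y - c x)\<^sup>2 \<le> w * indicat_real B x" using True \<delta> by (intro d(2)) auto
        moreover have "(f y - f x)\<^sup>2 \<le> 3 * ((f y - c y)\<^sup>2 + (c y - c x)\<^sup>2 + (f x - c x)\<^sup>2)"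
        proof -
          have "0 \<le> ((f y - c y) - (c y - c x))\<^sup>2 + ((f y - c y) + (f x - c x))\<^sup>2 + ((c y - c x) + (f x - c x))\<^sup>2" by simp
          then show ?thesis by (simp add: power2_eq_square algebra_simps)
        qed
        ultimately have "(f y - f x)\<^sup>2 \<le> p y + q x" by (simp add: p_def q_def)
        then show ?thesis using k'(3) by (intro mult_left_mono) auto
      next
        case False
        then show ?thesis using k'(2)[of "x - y"] by simp
      qed
      then show "ennreal (k (x - y) * (f y - f x)\<^sup>2) \<le> ennreal (k (x - y)) * ennreal (p y) + ennreal (k (x - y)) * ennreal (q x)"
        using k'(3)[of "x - y"] pq by (simp add: ennreal_mult[symmetric] ennreal_plus[symmetric] distrib_left ennreal_leI del: ennreal_plus)
    qed
    then have "(\<integral>\<^sup>+x. ennreal ((conv k f x - f x)\<^sup>2) \<partial>lborel) \<le>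
       (\<integral>\<^sup>+x. (\<integral>\<^sup>+y. ennreal (k (x - y)) * ennreal (p y) + ennreal (k (x - y)) * ennreal (q x) \<partial>lborel) \<partial>lborel)"
      by (intro nn_integral_mono)
    also have "\<dots> = (\<integral>\<^sup>+x. (\<integral>\<^sup>+y. ennreal (k (x - y)) * ennreal (p y) \<partial>lborel) \<partial>lborel) + (\<integral>\<^sup>+x. ennreal (q x) \<partial>lborel)"
      by (simp add: nn_integral_add nn_integral_multc nk1)
    also have "(\<integral>\<^sup>+x. (\<integral>\<^sup>+y. ennreal (k (x - y)) * ennreal (p y) \<partial>lborel) \<partial>lborel)
       = (\<integral>\<^sup>+y. (\<integral>\<^sup>+x. ennreal (k (x - y)) * ennreal (p y) \<partial>lborel) \<partial>lborel)"
      by (rule lborel_pair.Fubini') measurable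
    also have "\<dots> = (\<integral>\<^sup>+y. ennreal (p y) \<partial>lborel)"
      by (simp add: nn_integral_multc nk2)
    also have "\<dots> + (\<integral>\<^sup>+x. ennreal (q x) \<partial>lborel) = ennreal (LINT x|lborel. p x) + ennreal (LINT x|lborel. q x)"
      using Ip(1) Iq(1) pq by (simp add: nn_integral_eq_integral)
    also have "\<dots> = ennreal ((LINT x|lborel. p x) + (LINT x|lborel. q x))"
      using pq by (intro ennreal_plus[symmetric] Bochner_Integration.integral_nonneg) auto
    also have "\<dots> \<le> ennreal e" using Ip(2) Iq(2) by (intro ennreal_leI) auto
    finally show ?thesis .
  qed
  then show ?thesis using d(1) by blast
qed

section \<open>Weak derivatives\<close>

text \<open>Convolutions are integrals over \<open>lborel\<close>, so \<open>f\<close> is replaced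
  by a Borel function that vanishes outside \<open>S\<close>. It is integrable because
  \<open>S\<close> has finite measure and the absolute value of a number is at most 1 plus its
  square.\<close>

lemma L2_borel_representative:
  assumes S: "open S" "bounded S" and f: "f \<in> L2 S"
  obtains f0 where "f0 \<in> borel_measurable borel" "aeq S f f0" "\<And>x. x \<notin> S \<Longrightarrow> f0 x = 0"
    "integrable lborel f0" "integrable lborel (\<lambda>x. (f0 x)\<^sup>2)"
proof -
  have [measurable]: "S \<in> sets borel" using S by auto
  have m: "(\<lambda>x. indicat_real S x * f x) \<in> borel_measurable lebesgue"
    and i: "integrable lebesgue (\<lambda>x. indicat_real S x * (f x)\<^sup>2)"
    using f by (auto simp: L2_def set_borel_measurable_def set_integrable_def)
  obtain g where g: "g \<in> borel_measurable lborel" "AE x in lborel. indicat_real S x * f x = g x"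
    using completion_ex_borel_measurable_real[OF m] by auto
  have [measurable]: "g \<in> borel_measurable borel" using g(1) by simp
  define f0 where "f0 x = indicat_real S x * g x" for x
  have f0[measurable]: "f0 \<in> borel_measurable borel" unfolding f0_def by measurable
  have ae: "AE x in lebesgue. indicat_real S x * f x = g x" using AE_completion[OF g(2)] .
  have aeq: "aeq S f f0" unfolding aeq_def using ae by (elim AE_mp) (auto simp: f0_def)
  have "set_integrable lebesgue S (\<lambda>x. (f x)\<^sup>2)" using f by (simp add: L2_def)
  then have "set_integrable lebesgue S (\<lambda>x. (f0 x)\<^sup>2)"
    using aeq_set_integrable[OF aeq_comp[OF aeq, of "\<lambda>a. a\<^sup>2"]] by simp
  moreover have "(\<lambda>x. indicat_real S x *\<^sub>R (f0 x)\<^sup>2) = (\<lambda>x. (f0 x)\<^sup>2)"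
    by (auto simp: f0_def indicator_def)
  ultimately have "integrable lebesgue (\<lambda>x. (f0 x)\<^sup>2)" by (simp add: set_integrable_def)
  then have i2: "integrable lborel (\<lambda>x. (f0 x)\<^sup>2)" by (subst (asm) integrable_completion) auto
  have "emeasure lborel S < \<infinity>" using emeasure_bounded_finite[OF S(2)] by simp
  then have "integrable lborel (\<lambda>x. indicat_real S x + (f0 x)\<^sup>2)" using i2 by (intro Bochner_Integration.integrable_add) auto
  moreover have "\<bar>f0 x\<bar> \<le> indicat_real S x + (f0 x)\<^sup>2" for x
  proof -
    have "\<bar>g x\<bar> \<le> 1 + (g x)\<^sup>2" using sum_squares_bound[of "\<bar>g x\<bar>" 1] by simp
    then show ?thesis by (auto simp: f0_def indicator_def)
  qed
  ultimately have i1: "integrable lborel f0"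
    by (auto intro: Bochner_Integration.integrable_bound)
  show thesis using that[OF f0 aeq _ i1 i2] by (auto simp: f0_def)
qed

lemma L2_inner_lborel:
  assumes [measurable]: "f \<in> borel_measurable borel" "h \<in> borel_measurable borel"
    and "\<And>x. x \<notin> S \<Longrightarrow> f x * h x = 0"
  shows "L2_inner S f h = (LINT x|lborel. f x * h x)"
proof -
  have "(\<lambda>x. indicat_real S x *\<^sub>R (f x * h x)) = (\<lambda>x. f x * h x)"
    using assms(3) by (fastforce simp: indicator_def)
  then have "L2_inner S f h = (LINT x|lebesgue. f x * h x)"
    by (simp add: L2_inner_def set_lebesgue_integral_def)
  also have "\<dots> = (LINT x|lborel. f x * h x)" by (rule integral_completion) measurable
  finally show ?thesis .
qed

lemma mdeg_eq: "mdeg \<alpha> = \<alpha> 1 + \<alpha> 2"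
  by (simp add: mdeg_def sum_2)

lemma mdeg_idx1 [simp]: "mdeg (idx1 i) = 1"
  using exhaust_2[of i] by (auto simp: mdeg_eq idx1_def)

lemma mdeg_idx2 [simp]: "mdeg (idx2 i j) = 2"
  using exhaust_2[of i] exhaust_2[of j] by (auto simp: mdeg_eq idx2_def)

lemma mdeg_add: "mdeg (\<lambda>k. \<alpha> k + \<beta> k) = mdeg \<alpha> + mdeg \<beta>"
  by (simp add: mdeg_eq)

lemma is_weak_deriv_cong:
  assumes "aeq S u u'" "aeq S g g'"
  shows "is_weak_deriv S \<alpha> u g \<longleftrightarrow> is_weak_deriv S \<alpha> u' g'"
  unfolding is_weak_deriv_def using aeq_L2_inner[OF assms(1) aeq_refl] aeq_L2_inner[OF assms(2) aeq_refl] by auto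

lemma test_functions_L2:
  assumes "\<phi> \<in> test_functions S'" "open S" "bounded S"
  shows "\<phi> \<in> L2 S"
  using test_functionsD(1)[OF assms(1)] assms by (intro L2_continuous smooth_continuous) auto

text \<open>At a point whose \<delta>-ball lies in \<open>S\<close> the convolution pairs
  \<open>g\<close> with the reflected and translated kernel, which is a test function of
  \<open>S\<close>. The reflection causes the minus sign in the last part; through it a weak
  derivative of \<open>g\<close> passes to the convolution.\<close>

lemma conv_local:
  assumes S: "open S" "bounded S" and g0: "g0 \<in> borel_measurable borel" "\<And>x. x \<notin> S \<Longrightarrow> g0 x = 0" "aeq S g g0"
    and k: "mollifier \<delta> k" and x: "cball x \<delta> \<subseteq> S"
  shows "(\<lambda>y. k (x - y)) \<in> test_functions S" "conv k g0 x = L2_inner S g (\<lambda>y. k (x - y))"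
    "conv (pd i k) g0 x = - L2_inner S g (pd i (\<lambda>y. k (x - y)))"
proof -
  have k': "smooth k" "\<And>x. \<delta> \<le> norm x \<Longrightarrow> k x = 0" using k by (auto simp: mollifier_def)
  have eq: "(\<lambda>y. k (x - y)) = (\<lambda>y. k (x + (-1) *\<^sub>R y))" by simp
  have sm: "smooth (\<lambda>y. k (x - y))" unfolding eq using k'(1) by (rule smooth_affine)
  have z: "k (x - y) = 0" if "y \<notin> cball x \<delta>" for y using that k'(2)[of "x - y"] by (simp add: dist_norm)
  show t: "(\<lambda>y. k (x - y)) \<in> test_functions S"
    unfolding test_functions_def using sm z x by (auto intro!: exI[of _ "cball x \<delta>"])
  have [measurable]: "g0 \<in> borel_measurable borel" "(\<lambda>y. k (x - y)) \<in> borel_measurable borel"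
    "pd i (\<lambda>y. k (x - y)) \<in> borel_measurable borel"
    using g0 sm smooth_pd by (auto intro: smooth_borel_measurable)
  have p: "pd i (\<lambda>y. k (x - y)) = (\<lambda>y. - pd i k (x - y))"
    unfolding eq using pd_affine(1)[OF smooth_differentiable[OF k'(1)], of i x "-1"] by auto
  have "L2_inner S g (\<lambda>y. k (x - y)) = L2_inner S g0 (\<lambda>y. k (x - y))"
    using aeq_L2_inner[OF g0(3) aeq_refl] .
  also have "\<dots> = (LINT y|lborel. g0 y * k (x - y))"
    using g0(2) by (intro L2_inner_lborel) auto
  finally show "conv k g0 x = L2_inner S g (\<lambda>y. k (x - y))"
    by (simp add: conv_def mult.commute)
  have "L2_inner S g (pd i (\<lambda>y. k (x - y))) = L2_inner S g0 (pd i (\<lambda>y. k (x - y)))"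
    using aeq_L2_inner[OF g0(3) aeq_refl] .
  also have "\<dots> = (LINT y|lborel. g0 y * pd i (\<lambda>y. k (x - y)) y)"
    using g0(2) by (intro L2_inner_lborel) auto
  also have "\<dots> = - conv (pd i k) g0 x"
    unfolding p by (simp add: conv_def mult.commute)
  finally show "conv (pd i k) g0 x = - L2_inner S g (pd i (\<lambda>y. k (x - y)))" by simp
qed

lemma compact_cball_margin:
  fixes K S :: "pt set"
  assumes "compact K" "open S" "K \<subseteq> S"
  obtains d where "0 < d" "\<And>x. x \<in> K \<Longrightarrow> cball x d \<subseteq> S"
proof -
  obtain e where e: "e > 0" "(\<Union>x\<in>K. ball x e) \<subseteq> S"
    using compact_subset_open_imp_ball_epsilon_subset[OF assms] by blast
  then have "cball x (e / 2) \<subseteq> S" if "x \<in> K" for x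
    using that e by (intro order_trans[OF _ e(2)]) (auto intro!: bexI[OF _ that])
  then show thesis using that[of "e / 2"] e by auto
qed

lemma nn_sq_L2_norm_le:
  assumes f: "f \<in> borel_measurable borel" "(\<integral>\<^sup>+x. ennreal ((f x)\<^sup>2) \<partial>lborel) \<le> ennreal (e\<^sup>2)" "0 \<le> e"
    and K: "K \<in> sets borel"
  shows "f \<in> L2 K" "L2_norm K f \<le> e"
proof -
  have [measurable]: "f \<in> borel_measurable borel" "K \<in> sets borel" using f K by auto
  have "(\<integral>\<^sup>+x. ennreal ((f x)\<^sup>2) \<partial>lborel) < \<infinity>"
    using f(2) by (rule order.strict_trans1) simp
  then have i: "integrable lborel (\<lambda>x. (f x)\<^sup>2)"
    by (intro integrableI_nonneg) auto
  then have I: "(LINT x|lborel. (f x)\<^sup>2) \<le> e\<^sup>2"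
    using f(2) by (subst (asm) nn_integral_eq_integral) auto
  have il: "integrable lebesgue (\<lambda>x. (f x)\<^sup>2)" "(LINT x|lebesgue. (f x)\<^sup>2) \<le> e\<^sup>2"
    using i I by (auto simp: integrable_completion integral_completion)
  have U: "f \<in> L2 UNIV"
    using il(1) f(1) by (simp add: L2_def set_borel_measurable_def set_integrable_def measurable_completion)
  show "f \<in> L2 K" by (rule L2_subset[OF U]) auto
  have "L2_norm K f \<le> L2_norm UNIV f" by (rule L2_norm_mono_set[OF U]) auto
  also have "\<dots> \<le> sqrt (e\<^sup>2)" unfolding L2_norm_def L2_inner_def set_lebesgue_integral_def
    using il(2) by (intro real_sqrt_le_mono) (simp add: power2_eq_square)
  finally show "L2_norm K f \<le> e" using f(3) by simp
qed

text \<open>A representative together with its convergence. The radius \<open>d\<close> comes before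
  the kernel and before the subset \<open>K\<close>, so several functions can be mollified with one
  kernel.\<close>

definition mollifiable :: "pt set \<Rightarrow> fn \<Rightarrow> fn \<Rightarrow> bool" where
  "mollifiable S g g0 \<longleftrightarrow> g0 \<in> borel_measurable borel \<and> (\<forall>x. x \<notin> S \<longrightarrow> g0 x = 0) \<and> aeq S g g0 \<and> integrable lborel g0 \<and>
    (\<forall>e>0. \<exists>d>0. \<forall>\<delta> k K. \<delta> \<le> d \<and> mollifier \<delta> k \<and> K \<in> sets borel \<and> K \<subseteq> S \<longrightarrow>
         L2_norm K (\<lambda>x. g x - conv k g0 x) \<le> e)"

lemma mollifiableD:
  assumes "mollifiable S g g0"
  shows "g0 \<in> borel_measurable borel" "x \<notin> S \<Longrightarrow> g0 x = 0" "aeq S g g0" "integrable lborel g0"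
    "0 < e \<Longrightarrow> K \<in> sets borel \<Longrightarrow> K \<subseteq> S \<Longrightarrow>
      \<exists>d>0. \<forall>\<delta> k. \<delta> \<le> d \<and> mollifier \<delta> k \<longrightarrow> L2_norm K (\<lambda>x. g x - conv k g0 x) \<le> e"
proof -
  note A = assms[unfolded mollifiable_def]
  show "g0 \<in> borel_measurable borel" "x \<notin> S \<Longrightarrow> g0 x = 0" "aeq S g g0" "integrable lborel g0"
    using A by simp_all
  assume e: "0 < e" and K: "K \<in> sets borel" "K \<subseteq> S"
  obtain d where d: "0 < d" "\<forall>\<delta> k K. \<delta> \<le> d \<and> mollifier \<delta> k \<and> K \<in> sets borel \<and> K \<subseteq> S \<longrightarrow>
         L2_norm K (\<lambda>x. g x - conv k g0 x) \<le> e"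
    using A e by meson
  show "\<exists>d>0. \<forall>\<delta> k. \<delta> \<le> d \<and> mollifier \<delta> k \<longrightarrow> L2_norm K (\<lambda>x. g x - conv k g0 x) \<le> e"
    using d K by (intro exI[of _ d]) simp
qed

lemma mollify_approx:
  assumes S: "open S" "bounded S" and g: "g \<in> L2 S"
  shows "\<exists>g0. mollifiable S g g0"
proof -
  obtain g0 where g0: "g0 \<in> borel_measurable borel" "aeq S g g0" "\<And>x. x \<notin> S \<Longrightarrow> g0 x = 0"
    "integrable lborel g0" "integrable lborel (\<lambda>x. (g0 x)\<^sup>2)"
    using L2_borel_representative[OF S g] by blast
  obtain R where R: "\<And>x. x \<in> S \<Longrightarrow> norm x < R"
    using S(2) by (metis bounded_pos_less)
  then have z: "g0 x = 0" if "R \<le> norm x" for x using g0(3)[of x] R[of x] that by fastforce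
  have "\<exists>d>0. \<forall>\<delta> k K. \<delta> \<le> d \<and> mollifier \<delta> k \<and> K \<in> sets borel \<and> K \<subseteq> S \<longrightarrow>
         L2_norm K (\<lambda>x. g x - conv k g0 x) \<le> e" if e: "0 < e" for e
  proof -
    obtain d where d: "d > 0" "\<And>\<delta> k. \<delta> \<le> d \<Longrightarrow> mollifier \<delta> k \<Longrightarrow> (\<integral>\<^sup>+x. ennreal ((conv k g0 x - g0 x)\<^sup>2) \<partial>lborel) \<le> ennreal (e\<^sup>2)"
      using conv_approx[OF g0(4,5), of R "e\<^sup>2"] z e by auto
    have "L2_norm K (\<lambda>x. g x - conv k g0 x) \<le> e" if "\<delta> \<le> d" "mollifier \<delta> k" "K \<in> sets borel" "K \<subseteq> S" for \<delta> k K
    proof -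
      have "smooth (conv k g0)"
        using that(2) by (intro smooth_conv[OF g0(4)]) (auto simp: mollifier_def)
      then have [measurable]: "conv k g0 \<in> borel_measurable borel" "g0 \<in> borel_measurable borel"
        using g0(1) by (auto intro: smooth_borel_measurable)
      have "L2_norm K (\<lambda>x. conv k g0 x - g0 x) \<le> e"
        by (rule nn_sq_L2_norm_le(2)[OF _ d(2)[OF that(1,2)]]) (use e that in auto)
      moreover have "L2_norm K (\<lambda>x. conv k g0 x - g0 x) = L2_norm K (\<lambda>x. (-1) * (g x - conv k g0 x))"
        using aeq_L2_norm[OF aeq_comp2[OF aeq_refl[of K "conv k g0"] aeq_subset[OF aeq_sym[OF g0(2)] that(4)], of "(-)"]] by simp
      ultimately show ?thesis unfolding L2_norm_cmult by simp
    qed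
    then show ?thesis using d(1) by blast
  qed
  then show ?thesis unfolding mollifiable_def using g0 by blast
qed

text \<open>Fundamental lemma of the calculus of variations. On a compact subset the mollifications
  of small radius are pairings of \<open>g\<close> with test functions, hence 0, yet they converge
  to \<open>g\<close>. Countably many compact subsets exhaust \<open>S\<close>.\<close>

lemma test_functions_separate:
  assumes S: "open S" "bounded S" and g: "g \<in> L2 S"
    and ortho: "\<And>\<phi>. \<phi> \<in> test_functions S \<Longrightarrow> L2_inner S g \<phi> = 0"
  shows "aeq S g (\<lambda>x. 0)"
proof -
  obtain g0 where m: "mollifiable S g g0" using mollify_approx[OF S g] by blast
  note g0 = mollifiableD(1-4)[OF m]
  have K0: "aeq K g (\<lambda>x. 0)" if K: "compact K" "K \<subseteq> S" for K
  proof -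
    have Kb: "K \<in> sets borel" using K by (simp add: borel_compact)
    obtain d0 where d0: "0 < d0" "\<And>x. x \<in> K \<Longrightarrow> cball x d0 \<subseteq> S"
      using compact_cball_margin[OF K(1) S(1) K(2)] by blast
    have "L2_norm K g \<le> e" if e: "0 < e" for e
    proof -
      obtain d where d: "d > 0" "\<And>\<delta> k. \<delta> \<le> d \<Longrightarrow> mollifier \<delta> k \<Longrightarrow> L2_norm K (\<lambda>x. g x - conv k g0 x) \<le> e"
        using mollifiableD(5)[OF m e Kb K(2)] by blast
      define \<delta> where "\<delta> = min d d0"
      have "0 < \<delta>" using d d0 by (simp add: \<delta>_def)
      then obtain k where k: "mollifier \<delta> k" using mollifier_exists by blast
      have "conv k g0 x = 0" if "x \<in> K" for x
      proof -
        have "cball x \<delta> \<subseteq> S" using d0(2)[OF that] by (auto simp: \<delta>_def)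
        then show ?thesis
          using conv_local(1,2)[OF S g0(1,2,3) k] ortho by metis
      qed
      then have "aeq K (\<lambda>x. g x - conv k g0 x) g" by (intro aeq_pointwise) simp
      then show ?thesis using aeq_L2_norm d(2)[of \<delta> k] k by (simp add: \<delta>_def)
    qed
    then have "L2_norm K g = 0" using field_le_epsilon[of "L2_norm K g" 0] L2_norm_nonneg[of K g] by simp
    then have I0: "(LINT x|lebesgue. indicat_real K x * (g x * g x)) = 0"
      by (simp add: L2_norm_def L2_inner_def set_lebesgue_integral_def)
    have gK: "g \<in> L2 K" using L2_subset[OF g K(2)] Kb by simp
    have "integrable lebesgue (\<lambda>x. indicat_real K x * (g x * g x))"
      using L2_mult_integrable[OF gK gK] by (simp add: set_integrable_def)
    then have "AE x in lebesgue. indicat_real K x * (g x * g x) = 0"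
      using I0 by (subst (asm) integral_nonneg_eq_0_iff_AE) auto
    then show ?thesis unfolding aeq_def by (elim AE_mp) auto
  qed
  obtain C where C: "\<And>n::nat. compact (C n)" "\<And>n. C n \<subseteq> S" "\<Union> (range C) = S"
    using open_Union_compact_subsets[OF S(1)] by metis
  have "AE x in lebesgue. \<forall>n. x \<in> C n \<longrightarrow> g x = 0"
    using K0[OF C(1,2)] by (subst AE_all_countable) (simp add: aeq_def)
  then show ?thesis unfolding aeq_def using C(3) by (elim AE_mp) auto
qed

lemma weak_deriv_unique:
  assumes S: "open S" "bounded S" and g: "g \<in> L2 S" "g' \<in> L2 S" "is_weak_deriv S \<alpha> u g" "is_weak_deriv S \<alpha> u g'"
  shows "aeq S g g'"
proof -
  have "aeq S (\<lambda>x. g x - g' x) (\<lambda>x. 0)"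
  proof (rule test_functions_separate[OF S L2_diff[OF g(1,2)]])
    fix \<phi> assume \<phi>: "\<phi> \<in> test_functions S"
    have "(-1) ^ mdeg \<alpha> * L2_inner S g \<phi> = (-1) ^ mdeg \<alpha> * L2_inner S g' \<phi>"
      using g(3,4) \<phi> unfolding is_weak_deriv_def by metis
    then show "L2_inner S (\<lambda>x. g x - g' x) \<phi> = 0"
      using L2_inner_diff[OF g(1,2) test_functions_L2[OF \<phi> S]] by simp
  qed
  then show ?thesis unfolding aeq_def by (elim AE_mp) auto
qed

text \<open>Away from the boundary mollification commutes with weak differentiation, so one kernel
  approximates \<open>g\<close> and both its derivatives. The price is that \<open>K\<close> has to
  be a compact subset of \<open>S\<close>.\<close>

lemma weak_gradient_approx:
  assumes S: "open S" "bounded S" and K: "compact K" "K \<subseteq> S" and g: "g \<in> L2 S" "\<And>i. G i \<in> L2 S"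
    and w: "\<And>i. is_weak_deriv S (idx1 i) g (G i)" and e: "0 < e"
  shows "\<exists>\<phi>. smooth \<phi> \<and> L2_norm K (\<lambda>x. g x - \<phi> x) \<le> e \<and> (\<forall>i. L2_norm K (\<lambda>x. G i x - pd i \<phi> x) \<le> e)"
proof -
  have Kb: "K \<in> sets borel" using K by (simp add: borel_compact)
  obtain d0 where d0: "0 < d0" "\<And>x. x \<in> K \<Longrightarrow> cball x d0 \<subseteq> S"
    using compact_cball_margin[OF K(1) S(1) K(2)] by blast
  obtain g0 where m: "mollifiable S g g0" using mollify_approx[OF S g(1)] by blast
  note g0 = mollifiableD(1-4)[OF m]
  obtain d1 where d1: "0 < d1" "\<And>\<delta> k. \<delta> \<le> d1 \<Longrightarrow> mollifier \<delta> k \<Longrightarrow> L2_norm K (\<lambda>x. g x - conv k g0 x) \<le> e"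
    using mollifiableD(5)[OF m e Kb K(2)] by blast
  obtain G0 where M: "\<And>i. mollifiable S (G i) (G0 i)" using mollify_approx[OF S g(2)] by metis
  note G0 = mollifiableD(1-4)[OF M]
  have "\<exists>d>0. \<forall>\<delta> k. \<delta> \<le> d \<and> mollifier \<delta> k \<longrightarrow> L2_norm K (\<lambda>x. G i x - conv k (G0 i) x) \<le> e" for i
    using mollifiableD(5)[OF M e Kb K(2)] by blast
  then obtain d2 where d2: "\<And>i. 0 < d2 i" "\<And>i \<delta> k. \<delta> \<le> d2 i \<Longrightarrow> mollifier \<delta> k \<Longrightarrow> L2_norm K (\<lambda>x. G i x - conv k (G0 i) x) \<le> e"
    by metis
  \<comment> \<open>Small enough for the kernel to stay inside \<open>S\<close> and for the
    approximation of \<open>g\<close> and of both derivatives.\<close>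
  define \<delta> where "\<delta> = min (min d0 d1) (min (d2 1) (d2 2))"
  have \<delta>: "0 < \<delta>" "\<delta> \<le> d0" "\<delta> \<le> d1" using d0 d1 d2 by (auto simp: \<delta>_def)
  have \<delta>2: "\<delta> \<le> d2 i" for i using exhaust_2[of i] by (auto simp: \<delta>_def)
  obtain k where k: "mollifier \<delta> k" using mollifier_exists[OF \<delta>(1)] by blast
  have k': "smooth k" "\<And>x. \<delta> \<le> norm x \<Longrightarrow> k x = 0" using k by (auto simp: mollifier_def)
  have "pd i (conv k g0) x = conv k (G0 i) x" if "x \<in> K" for i x
  proof -
    have c: "cball x \<delta> \<subseteq> S" using d0(2)[OF that] \<delta>(2) subset_cball by blast
    have "L2_inner S g (pd i (\<lambda>y. k (x - y))) = - L2_inner S (G i) (\<lambda>y. k (x - y))"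
      using w[of i] conv_local(1)[OF S g0(1,2,3) k c]
        mpd_idx1[OF test_functionsD(1)[OF conv_local(1)[OF S g0(1,2,3) k c]], of i]
      unfolding is_weak_deriv_def by fastforce
    then show ?thesis
      using pd_conv[OF g0(4) k'] conv_local(3)[OF S g0(1,2,3) k c, of i]
        conv_local(2)[OF S G0(1,2,3) k c, of i] by simp
  qed
  then have "aeq K (\<lambda>x. G i x - pd i (conv k g0) x) (\<lambda>x. G i x - conv k (G0 i) x)" for i
    by (intro aeq_pointwise) simp
  then have "L2_norm K (\<lambda>x. G i x - pd i (conv k g0) x) \<le> e" for i
    using aeq_L2_norm d2(2)[OF \<delta>2 k, of i] by metis
  moreover have "L2_norm K (\<lambda>x. g x - conv k g0 x) \<le> e" by (rule d1(2)[OF \<delta>(3) k])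
  moreover have "smooth (conv k g0)" by (rule smooth_conv[OF g0(4) k'])
  ultimately show ?thesis by blast
qed

section \<open>Integration by parts against test functions\<close>

lemma lborel_integral_translate:
  fixes f :: fn
  assumes [measurable]: "f \<in> borel_measurable borel"
  shows "(LINT x|lborel. f (x + c)) = (LINT x|lborel. f x)"
proof -
  have "(LINT x|distr lborel borel ((+) c). f x) = (LINT x|lborel. f (c + x))"
    by (rule integral_distr) auto
  then show ?thesis by (simp add: lborel_distr_plus add.commute)
qed

text \<open>Translation invariance makes the integral of \<open>f (z + h) - f z\<close> vanish, and
  this difference is \<open>t * pd i f z\<close> up to a uniformly small multiple of
  \<open>t\<close>, on a ball that contains all supports.\<close>

lemma integral_pd_compact_support:
  assumes f: "smooth f" "\<And>x. \<delta> \<le> norm x \<Longrightarrow> f x = 0"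
  shows "(LINT x|lborel. pd i f x) = 0"
proof -
  have pz: "pd i f x = 0" if "\<delta> + 1 \<le> norm x" for x
    by (rule pd_zero_outside[of "cball 0 \<delta>"]) (use f(2) that in auto)
  have [measurable]: "f \<in> borel_measurable borel" using f(1) by (rule smooth_borel_measurable)
  have if': "integrable lborel f" using smooth_compact_integrable[OF f] .
  have ip: "integrable lborel (pd i f)" using smooth_compact_integrable[OF smooth_pd[OF f(1)] pz] .
  \<comment> \<open>Room for the supports of \<open>f\<close>, of its derivative and of its
    translate, the translation being shorter than 1.\<close>
  define B :: "pt set" where "B = cball 0 (\<bar>\<delta>\<bar> + 2)"
  have iB: "integrable lborel (indicat_real B)"
    using borel_integrable_compact[OF compact_cball continuous_on_const, of 0 "\<bar>\<delta>\<bar> + 2" "1::real"]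
    by (simp add: B_def)
  define v where "v = measure lborel B"
  have v: "0 \<le> v" by (simp add: v_def)
  have "\<bar>LINT x|lborel. pd i f x\<bar> \<le> 0 + e" if "0 < e" for e
  proof -
    define e' where "e' = e / (v + 1)"
    have e': "0 < e'" "e' * v \<le> e" using that v by (auto simp: e'_def field_simps)
    obtain d where d: "d > 0" "\<And>z h. norm h < d \<Longrightarrow> \<bar>f (z + h) - f z - grad f z \<bullet> h\<bar> \<le> e' * norm h"
      using smooth_uniform_derivative[OF f e'(1)] by blast
    define t where "t = min d 1 / 2"
    have t: "0 < t" "t < d" "t \<le> 1" using d(1) by (auto simp: t_def)
    define h :: pt where "h = t *\<^sub>R axis i 1"
    have h: "norm h = t" using t by (simp add: h_def)
    have gh: "grad f z \<bullet> h = t * pd i f z" for z :: pt by (simp add: h_def grad_def inner_axis)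
    have tr: "integrable lborel (\<lambda>z. f (z + h))"
    proof (rule smooth_compact_integrable[of _ "\<bar>\<delta>\<bar> + 1"])
      show "smooth (\<lambda>z. f (z + h))" using f(1) by (rule smooth_shift)
      fix z :: pt assume "\<bar>\<delta>\<bar> + 1 \<le> norm z"
      then have "\<delta> \<le> norm (z + h)" using norm_diff_ineq[of z h] h t by linarith
      then show "f (z + h) = 0" by (rule f(2))
    qed
    have "(LINT z|lborel. f (z + h) - f z - t * pd i f z) = - t * (LINT x|lborel. pd i f x)"
      using tr if' ip by (simp add: lborel_integral_translate)
    then have "t * \<bar>LINT x|lborel. pd i f x\<bar> = \<bar>LINT z|lborel. f (z + h) - f z - t * pd i f z\<bar>"
      using t by (simp add: abs_mult)
    also have "\<dots> \<le> (LINT z|lborel. norm (f (z + h) - f z - t * pd i f z))"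
      using integral_norm_bound[of lborel "\<lambda>z. f (z + h) - f z - t * pd i f z"] by simp
    also have "\<dots> \<le> (LINT z|lborel. e' * t * indicat_real B z)"
    proof (rule integral_mono)
      show "integrable lborel (\<lambda>z. norm (f (z + h) - f z - t * pd i f z))"
        using tr if' ip by (intro integrable_norm Bochner_Integration.integrable_diff) auto
      show "integrable lborel (\<lambda>z. e' * t * indicat_real B z)" using iB by simp
      fix z :: pt
      show "norm (f (z + h) - f z - t * pd i f z) \<le> e' * t * indicat_real B z"
      proof (cases "z \<in> B")
        case True
        then show ?thesis using d(2)[of h z] t h gh by simp
      next
        case False
        then have "\<bar>\<delta>\<bar> + 2 < norm z" by (simp add: B_def)
        moreover have "norm z \<le> norm (z + h) + t" using norm_diff_ineq[of z h] h by linarith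
        ultimately show ?thesis using f(2)[of z] f(2)[of "z + h"] pz[of z] t False by auto
      qed
    qed
    also have "\<dots> = t * (e' * v)" by (simp add: v_def)
    finally have "\<bar>LINT x|lborel. pd i f x\<bar> \<le> e' * v" using t by simp
    then show ?thesis using e'(2) by simp
  qed
  then have "\<bar>LINT x|lborel. pd i f x\<bar> \<le> 0" by (rule field_le_epsilon)
  then show ?thesis by simp
qed

lemma test_functions_zero: "\<phi> \<in> test_functions S \<Longrightarrow> x \<notin> S \<Longrightarrow> \<phi> x = 0"
  using test_functionsD(2) by blast

lemma L2_inner_smooth_test:
  assumes "smooth p" "\<phi> \<in> test_functions S"
  shows "L2_inner S p \<phi> = (LINT x|lborel. p x * \<phi> x)"
  using assms test_functions_zero[OF assms(2)] test_functionsD(1)[OF assms(2)]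
  by (intro L2_inner_lborel) (auto intro: smooth_borel_measurable)

lemma integration_by_parts:
  assumes p: "smooth p" and \<phi>: "\<phi> \<in> test_functions S"
  shows "L2_inner S p (pd i \<phi>) = - L2_inner S (pd i p) \<phi>"
proof -
  obtain K where K: "compact K" "\<And>x. x \<notin> K \<Longrightarrow> \<phi> x = 0" using test_functionsD(2)[OF \<phi>] by blast
  obtain R where R: "\<And>x. x \<in> K \<Longrightarrow> norm x < R" using compact_imp_bounded[OF K(1)] by (metis bounded_pos_less)
  have \<phi>z: "\<phi> x = 0" if "R \<le> norm x" for x using K(2)[of x] R[of x] that by fastforce
  have sm: "smooth \<phi>" using test_functionsD(1)[OF \<phi>] .
  have pz: "pd i \<phi> x = 0" if "R + 1 \<le> norm x" for x
    by (rule pd_zero_outside[of "cball 0 R"]) (use \<phi>z that in auto)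
  have i1: "integrable lborel (\<lambda>x. p x * pd i \<phi> x)"
    by (rule smooth_compact_integrable[of _ "R + 1"]) (use p sm pz in \<open>auto intro: smooth_mult smooth_pd\<close>)
  have i2: "integrable lborel (\<lambda>x. pd i p x * \<phi> x)"
    by (rule smooth_compact_integrable[of _ R]) (use p sm \<phi>z in \<open>auto intro: smooth_mult smooth_pd\<close>)
  have "(LINT x|lborel. pd i (\<lambda>x. p x * \<phi> x) x) = 0"
    by (rule integral_pd_compact_support[of _ R]) (use p sm \<phi>z in \<open>auto intro: smooth_mult\<close>)
  then have "(LINT x|lborel. p x * pd i \<phi> x) + (LINT x|lborel. pd i p x * \<phi> x) = 0"
    unfolding pd_smooth_mult[OF p sm] using i1 i2 by simp
  then show ?thesis
    using L2_inner_smooth_test[OF p test_functions_pd[OF \<phi>]] L2_inner_smooth_test[OF smooth_pd[OF p] \<phi>] by simp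
qed

lemma integration_by_parts_pow:
  "smooth p \<Longrightarrow> \<phi> \<in> test_functions S \<Longrightarrow> L2_inner S p ((pd i ^^ n) \<phi>) = (-1) ^ n * L2_inner S ((pd i ^^ n) p) \<phi>"
proof (induction n arbitrary: \<phi>)
  case (Suc n)
  have "L2_inner S p ((pd i ^^ Suc n) \<phi>) = L2_inner S p ((pd i ^^ n) (pd i \<phi>))"
    by (simp add: funpow_swap1)
  also have "\<dots> = (-1) ^ n * L2_inner S ((pd i ^^ n) p) (pd i \<phi>)"
    using Suc.IH[OF Suc.prems(1) test_functions_pd[OF Suc.prems(2)]] .
  also have "\<dots> = (-1) ^ Suc n * L2_inner S ((pd i ^^ Suc n) p) \<phi>"
    using integration_by_parts[OF smooth_pd_pow[OF Suc.prems(1)] Suc.prems(2)] by simp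
  finally show ?case .
qed simp

lemma test_functions_pd_pow: "\<phi> \<in> test_functions S \<Longrightarrow> (pd i ^^ n) \<phi> \<in> test_functions S"
  by (induction n) (auto simp: test_functions_pd)

text \<open>Moving the derivatives over one at a time reverses their order; symmetry of the mixed
  derivatives restores the order in \<open>mpd\<close>.\<close>

lemma smooth_weak_deriv:
  assumes p: "smooth p"
  shows "is_weak_deriv S \<alpha> p (mpd \<alpha> p)"
  unfolding is_weak_deriv_def
proof
  fix \<phi> assume \<phi>: "\<phi> \<in> test_functions S"
  have "L2_inner S p (mpd \<alpha> \<phi>) = (-1) ^ \<alpha> 1 * ((-1) ^ \<alpha> 2 * L2_inner S ((pd 2 ^^ \<alpha> 2) ((pd 1 ^^ \<alpha> 1) p)) \<phi>)"
    unfolding mpd_def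
    using integration_by_parts_pow[OF p test_functions_pd_pow[OF \<phi>]]
      integration_by_parts_pow[OF smooth_pd_pow[OF p] \<phi>] by simp
  moreover have "(pd 2 ^^ n) ((pd 1 ^^ m) p) = (pd 1 ^^ m) ((pd 2 ^^ n) p)" for n m
    by (induction n) (simp_all add: pd_pow_commute smooth_pd_pow p)
  ultimately show "L2_inner S p (mpd \<alpha> \<phi>) = (-1) ^ mdeg \<alpha> * L2_inner S (mpd \<alpha> p) \<phi>"
    by (simp add: mpd_def mdeg_eq power_add)
qed

section \<open>Sobolev functions\<close>

lemma aeq_wd: "aeq S u v \<Longrightarrow> wd S \<alpha> u = wd S \<alpha> v"
  unfolding wd_def using is_weak_deriv_cong[OF _ aeq_refl] by metis

lemma aeq_H: "aeq S u v \<Longrightarrow> u \<in> H m S \<longleftrightarrow> v \<in> H m S"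
  unfolding H_def using is_weak_deriv_cong[OF _ aeq_refl] aeq_L2 by blast

lemma H_imp_L2: "u \<in> H m S \<Longrightarrow> u \<in> L2 S"
  by (simp add: H_def)

lemma H_mono: "u \<in> H m S \<Longrightarrow> n \<le> m \<Longrightarrow> u \<in> H n S"
  by (auto simp: H_def)

lemma wd_H:
  assumes "u \<in> H m S" "mdeg \<alpha> \<le> m"
  shows wd_L2: "wd S \<alpha> u \<in> L2 S" and wd_weak_deriv: "is_weak_deriv S \<alpha> u (wd S \<alpha> u)"
proof -
  have "\<exists>g. g \<in> L2 S \<and> is_weak_deriv S \<alpha> u g" using assms by (auto simp: H_def)
  then have "wd S \<alpha> u \<in> L2 S \<and> is_weak_deriv S \<alpha> u (wd S \<alpha> u)" unfolding wd_def by (rule someI_ex)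
  then show "wd S \<alpha> u \<in> L2 S" "is_weak_deriv S \<alpha> u (wd S \<alpha> u)" by auto
qed

lemma wd_eqI:
  assumes "open S" "bounded S" "g \<in> L2 S" "is_weak_deriv S \<alpha> u g"
  shows "aeq S (wd S \<alpha> u) g"
proof -
  have "wd S \<alpha> u \<in> L2 S \<and> is_weak_deriv S \<alpha> u (wd S \<alpha> u)"
    unfolding wd_def by (rule someI[of _ g]) (use assms in auto)
  then show ?thesis using weak_deriv_unique[OF assms(1,2)] assms(3,4) by blast
qed

lemma wd_zero:
  assumes "open S" "bounded S" "u \<in> L2 S"
  shows "aeq S (wd S (\<lambda>_. 0) u) u"
  by (rule wd_eqI[OF assms]) (simp add: is_weak_deriv_def mpd_zero mdeg_eq)

lemma is_weak_deriv_subset: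
  assumes w: "is_weak_deriv S \<alpha> u g" and S: "S' \<subseteq> S"
  shows "is_weak_deriv S' \<alpha> u g"
proof -
  have "L2_inner S f \<phi> = L2_inner S' f \<phi>" if "\<phi> \<in> test_functions S'" for f \<phi>
  proof -
    have "(\<lambda>x. indicat_real S x *\<^sub>R (f x * \<phi> x)) = (\<lambda>x. indicat_real S' x *\<^sub>R (f x * \<phi> x))"
      using test_functions_zero[OF that] S by (fastforce simp: indicator_def)
    then show ?thesis by (simp add: L2_inner_def set_lebesgue_integral_def)
  qed
  then show ?thesis
    using w test_functions_mono[OF S] test_functions_mpd unfolding is_weak_deriv_def
    by (metis subsetD)
qed

lemma H_subset:
  assumes u: "u \<in> H m S" and S: "open S'" "bounded S'" "S' \<subseteq> S"
  shows "u \<in> H m S'" "mdeg \<alpha> \<le> m \<Longrightarrow> aeq S' (wd S' \<alpha> u) (wd S \<alpha> u)"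
proof -
  have sub: "f \<in> L2 S'" if "f \<in> L2 S" for f using L2_subset[OF that S(3)] S(1) by simp
  show "u \<in> H m S'"
    unfolding H_def using u sub is_weak_deriv_subset[OF _ S(3)] by (auto simp: H_def) blast
  show "mdeg \<alpha> \<le> m \<Longrightarrow> aeq S' (wd S' \<alpha> u) (wd S \<alpha> u)"
    using wd_H[OF u] sub is_weak_deriv_subset[OF _ S(3)] by (intro wd_eqI[OF S(1,2)]) auto
qed

lemma H_lincomb:
  assumes S: "open S" "bounded S" and u: "u \<in> H m S" "v \<in> H m S"
  shows "(\<lambda>x. u x + c * v x) \<in> H m S"
    "mdeg \<alpha> \<le> m \<Longrightarrow> aeq S (wd S \<alpha> (\<lambda>x. u x + c * v x)) (\<lambda>x. wd S \<alpha> u x + c * wd S \<alpha> v x)"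
proof -
  have *: "is_weak_deriv S \<alpha> (\<lambda>x. u x + c * v x) (\<lambda>x. wd S \<alpha> u x + c * wd S \<alpha> v x)"
    "(\<lambda>x. wd S \<alpha> u x + c * wd S \<alpha> v x) \<in> L2 S" if "mdeg \<alpha> \<le> m" for \<alpha>
  proof -
    note w = wd_H[OF u(1) that] wd_H[OF u(2) that]
    show "(\<lambda>x. wd S \<alpha> u x + c * wd S \<alpha> v x) \<in> L2 S" using w by (intro L2_add L2_cmult)
    show "is_weak_deriv S \<alpha> (\<lambda>x. u x + c * v x) (\<lambda>x. wd S \<alpha> u x + c * wd S \<alpha> v x)"
      unfolding is_weak_deriv_def
    proof
      fix \<phi> assume \<phi>: "\<phi> \<in> test_functions S"
      have t: "\<phi> \<in> L2 S" "mpd \<alpha> \<phi> \<in> L2 S" using test_functions_L2[OF _ S] test_functions_mpd \<phi> by blast+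
      have "L2_inner S u (mpd \<alpha> \<phi>) = (-1) ^ mdeg \<alpha> * L2_inner S (wd S \<alpha> u) \<phi>"
        "L2_inner S v (mpd \<alpha> \<phi>) = (-1) ^ mdeg \<alpha> * L2_inner S (wd S \<alpha> v) \<phi>"
        using w \<phi> by (auto simp: is_weak_deriv_def)
      then show "L2_inner S (\<lambda>x. u x + c * v x) (mpd \<alpha> \<phi>) = (-1) ^ mdeg \<alpha> * L2_inner S (\<lambda>x. wd S \<alpha> u x + c * wd S \<alpha> v x) \<phi>"
        using t w H_imp_L2[OF u(1)] H_imp_L2[OF u(2)]
        by (simp add: L2_inner_add L2_cmult L2_inner_cmult algebra_simps)
    qed
  qed
  show "(\<lambda>x. u x + c * v x) \<in> H m S"
    unfolding H_def using * H_imp_L2[OF u(1)] H_imp_L2[OF u(2)] by (auto intro: L2_add L2_cmult)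
  show "mdeg \<alpha> \<le> m \<Longrightarrow> aeq S (wd S \<alpha> (\<lambda>x. u x + c * v x)) (\<lambda>x. wd S \<alpha> u x + c * wd S \<alpha> v x)"
    using * by (intro wd_eqI[OF S])
qed

lemma H_diff:
  assumes S: "open S" "bounded S" and u: "u \<in> H m S" "v \<in> H m S"
  shows "(\<lambda>x. u x - v x) \<in> H m S"
    "mdeg \<alpha> \<le> m \<Longrightarrow> aeq S (wd S \<alpha> (\<lambda>x. u x - v x)) (\<lambda>x. wd S \<alpha> u x - wd S \<alpha> v x)"
  using H_lincomb[OF S u, where c="-1"] by auto

lemma H_smooth:
  assumes S: "open S" "bounded S" and p: "smooth p"
  shows "p \<in> H m S" "aeq S (wd S \<alpha> p) (mpd \<alpha> p)"
proof -
  have l: "f \<in> L2 S" if "smooth f" for f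
    using S by (intro L2_continuous smooth_continuous that) auto
  show "p \<in> H m S" unfolding H_def using l[OF p] l[OF smooth_mpd[OF p]] smooth_weak_deriv[OF p] by blast
  show "aeq S (wd S \<alpha> p) (mpd \<alpha> p)"
    using l[OF smooth_mpd[OF p]] smooth_weak_deriv[OF p] by (rule wd_eqI[OF S])
qed

text \<open>Comes from testing with \<open>pd k \<phi>\<close>. Its use is to regard first and
  second weak derivatives of an H3 function as functions that have a weak gradient
  themselves.\<close>

lemma wd_weak_deriv_pd:
  assumes S: "open S" "bounded S" and u: "u \<in> H m S" and \<alpha>: "mdeg \<alpha> + 1 \<le> m"
  shows "is_weak_deriv S (idx1 k) (wd S \<alpha> u) (wd S (\<lambda>j. \<alpha> j + idx1 k j) u)"
  unfolding is_weak_deriv_def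
proof
  fix \<phi> assume \<phi>: "\<phi> \<in> test_functions S"
  have w: "is_weak_deriv S \<alpha> u (wd S \<alpha> u)" using wd_weak_deriv[OF u] \<alpha> by simp
  have w': "is_weak_deriv S (\<lambda>j. \<alpha> j + idx1 k j) u (wd S (\<lambda>j. \<alpha> j + idx1 k j) u)"
    using wd_weak_deriv[OF u] \<alpha> by (simp add: mdeg_add)
  have "(-1) ^ mdeg \<alpha> * L2_inner S (wd S \<alpha> u) (pd k \<phi>) = L2_inner S u (mpd \<alpha> (pd k \<phi>))"
    using w test_functions_pd[OF \<phi>] by (simp add: is_weak_deriv_def)
  also have "\<dots> = (-1) ^ mdeg \<alpha> * (- L2_inner S (wd S (\<lambda>j. \<alpha> j + idx1 k j) u) \<phi>)"
    using w' \<phi> by (simp add: is_weak_deriv_def mpd_pd[OF test_functionsD(1)[OF \<phi>]] mdeg_add)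
  finally have "L2_inner S (wd S \<alpha> u) (pd k \<phi>) = - L2_inner S (wd S (\<lambda>j. \<alpha> j + idx1 k j) u) \<phi>"
    using mult_left_cancel[of "(-1 :: real) ^ mdeg \<alpha>"] by (metis power_eq_0_iff neg_equal_0_iff_equal one_neq_zero)
  then show "L2_inner S (wd S \<alpha> u) (mpd (idx1 k) \<phi>) = (-1) ^ mdeg (idx1 k) * L2_inner S (wd S (\<lambda>j. \<alpha> j + idx1 k j) u) \<phi>"
    by (simp add: mpd_idx1[OF test_functionsD(1)[OF \<phi>]])
qed

subsection \<open>Norms and forms\<close>

lemma multi_index_eqI: "\<alpha> 1 = \<beta> 1 \<Longrightarrow> \<alpha> 2 = \<beta> 2 \<Longrightarrow> \<alpha> = (\<beta> :: 2 \<Rightarrow> nat)"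
  using exhaust_2 by (metis ext)

lemma finite_mdeg_le: "finite {\<alpha>. mdeg \<alpha> \<le> m}"
proof (rule finite_subset)
  show "{\<alpha>. mdeg \<alpha> \<le> m} \<subseteq> (\<lambda>(a, b) k. if k = 1 then a else b) ` ({..m} \<times> {..m})"
  proof
    fix \<alpha> assume "\<alpha> \<in> {\<alpha>. mdeg \<alpha> \<le> m}"
    then have "\<alpha> 1 \<le> m" "\<alpha> 2 \<le> m" by (auto simp: mdeg_eq)
    moreover have "\<alpha> = (\<lambda>(a, b) k. if k = 1 then a else b) (\<alpha> 1, \<alpha> 2)"
      by (rule multi_index_eqI) auto
    ultimately show "\<alpha> \<in> (\<lambda>(a, b) k. if k = 1 then a else b) ` ({..m} \<times> {..m})" by blast
  qed
qed auto

lemma finite_mdeg_eq: "finite {\<alpha>. mdeg \<alpha> = m}"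
  by (rule finite_subset[OF _ finite_mdeg_le[of m]]) auto

lemma mdeg_1_cases: "mdeg \<alpha> = 1 \<Longrightarrow> \<exists>i. \<alpha> = idx1 i"
proof -
  assume "mdeg \<alpha> = 1"
  then have "\<alpha> 1 = 1 \<and> \<alpha> 2 = 0 \<or> \<alpha> 1 = 0 \<and> \<alpha> 2 = 1" by (auto simp: mdeg_eq)
  then have "\<alpha> = idx1 1 \<or> \<alpha> = idx1 2" by (auto intro!: multi_index_eqI simp: idx1_def)
  then show ?thesis by blast
qed

lemma mdeg_2_cases: "mdeg \<alpha> = 2 \<Longrightarrow> \<exists>i j. \<alpha> = idx2 i j"
proof -
  assume "mdeg \<alpha> = 2"
  then have "\<alpha> 1 = 2 \<and> \<alpha> 2 = 0 \<or> \<alpha> 1 = 0 \<and> \<alpha> 2 = 2 \<or> \<alpha> 1 = 1 \<and> \<alpha> 2 = 1" unfolding mdeg_eq by arith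
  then have "\<alpha> = idx2 1 1 \<or> \<alpha> = idx2 2 2 \<or> \<alpha> = idx2 1 2"
    by (auto intro!: multi_index_eqI simp: idx2_def)
  then show ?thesis by blast
qed

lemma H_semi_nonneg [simp]: "0 \<le> H_semi m S u" and H_norm_nonneg [simp]: "0 \<le> H_norm m S u"
  by (simp_all add: H_semi_def H_norm_def sum_nonneg)

lemma wd_le_H_semi: "L2_norm S (wd S \<alpha> u) \<le> H_semi (mdeg \<alpha>) S u"
proof -
  have "(L2_norm S (wd S \<alpha> u))\<^sup>2 \<le> (\<Sum>\<beta> | mdeg \<beta> = mdeg \<alpha>. (L2_norm S (wd S \<beta> u))\<^sup>2)"
    using finite_mdeg_eq by (intro member_le_sum) auto
  then show ?thesis unfolding H_semi_def by (rule real_le_rsqrt)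
qed

lemma wd_le_H_norm: "mdeg \<alpha> \<le> m \<Longrightarrow> L2_norm S (wd S \<alpha> u) \<le> H_norm m S u"
proof -
  assume "mdeg \<alpha> \<le> m"
  then have "(L2_norm S (wd S \<alpha> u))\<^sup>2 \<le> (\<Sum>\<beta> | mdeg \<beta> \<le> m. (L2_norm S (wd S \<beta> u))\<^sup>2)"
    using finite_mdeg_le by (intro member_le_sum) auto
  then show ?thesis unfolding H_norm_def by (rule real_le_rsqrt)
qed

lemma b_form_eq:
  assumes "u \<in> H 1 S" "v \<in> H 1 S"
  shows "b_form S u v = (\<Sum>i\<in>UNIV. L2_inner S (wd S (idx1 i) u) (wd S (idx1 i) v))"
  unfolding b_form_def L2_inner_def sum_2
  using assms by (intro set_integral_add L2_mult_integrable wd_L2) auto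

lemma a_form_eq:
  assumes "u \<in> H 2 S" "v \<in> H 2 S"
  shows "a_form S u v = (\<Sum>i\<in>UNIV. \<Sum>j\<in>UNIV. L2_inner S (wd S (idx2 i j) u) (wd S (idx2 i j) v))"
proof -
  have i: "set_integrable lebesgue S (\<lambda>x. wd S (idx2 i j) u x * wd S (idx2 i j) v x)" for i j
    using assms by (intro L2_mult_integrable wd_L2) auto
  then show ?thesis unfolding a_form_def L2_inner_def sum_2
    by (simp add: set_integral_add)
qed

lemma b_form_sq: "u \<in> H 1 S \<Longrightarrow> b_form S u u = (\<Sum>i\<in>UNIV. (L2_norm S (wd S (idx1 i) u))\<^sup>2)"
  by (simp add: b_form_eq L2_norm_sq)

lemma a_form_sq: "u \<in> H 2 S \<Longrightarrow> a_form S u u = (\<Sum>i\<in>UNIV. \<Sum>j\<in>UNIV. (L2_norm S (wd S (idx2 i j) u))\<^sup>2)"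
  by (simp add: a_form_eq L2_norm_sq)

lemma b_form_nonneg: "u \<in> H 1 S \<Longrightarrow> 0 \<le> b_form S u u"
  by (simp add: b_form_sq sum_nonneg)

lemma a_form_nonneg: "u \<in> H 2 S \<Longrightarrow> 0 \<le> a_form S u u"
  by (simp add: a_form_sq sum_nonneg)

lemma H_semi_1_le: 
  assumes "u \<in> H 1 S"
  shows "(H_semi 1 S u)\<^sup>2 \<le> b_form S u u"
proof -
  have "(H_semi 1 S u)\<^sup>2 = (\<Sum>\<alpha> | mdeg \<alpha> = 1. (L2_norm S (wd S \<alpha> u))\<^sup>2)"
    by (simp add: H_semi_def sum_nonneg)
  also have "\<dots> \<le> (\<Sum>\<alpha>\<in>range idx1. (L2_norm S (wd S \<alpha> u))\<^sup>2)"
    using mdeg_1_cases by (intro sum_mono2) auto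
  also have "\<dots> \<le> (\<Sum>i\<in>UNIV. (L2_norm S (wd S (idx1 i) u))\<^sup>2)"
    using sum_image_le[of UNIV "\<lambda>\<alpha>. (L2_norm S (wd S \<alpha> u))\<^sup>2" idx1] by (simp add: o_def)
  finally show ?thesis using assms by (simp add: b_form_sq)
qed

text \<open>Only an inequality, because \<open>a_form\<close> counts the mixed derivative twice and
  \<open>H_semi\<close> counts it once.\<close>

lemma H_semi_2_le: 
  assumes "u \<in> H 2 S"
  shows "(H_semi 2 S u)\<^sup>2 \<le> a_form S u u"
proof -
  have "(H_semi 2 S u)\<^sup>2 = (\<Sum>\<alpha> | mdeg \<alpha> = 2. (L2_norm S (wd S \<alpha> u))\<^sup>2)"
    by (simp add: H_semi_def sum_nonneg)
  also have "\<dots> \<le> (\<Sum>\<alpha>\<in>range (\<lambda>(i, j). idx2 i j). (L2_norm S (wd S \<alpha> u))\<^sup>2)"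
    using mdeg_2_cases by (intro sum_mono2) auto
  also have "\<dots> \<le> (\<Sum>(i, j)\<in>UNIV. (L2_norm S (wd S (idx2 i j) u))\<^sup>2)"
    using sum_image_le[of UNIV "\<lambda>\<alpha>. (L2_norm S (wd S \<alpha> u))\<^sup>2" "\<lambda>(i, j). idx2 i j"]
    by (simp add: o_def case_prod_unfold)
  also have "\<dots> = (\<Sum>i\<in>UNIV. \<Sum>j\<in>UNIV. (L2_norm S (wd S (idx2 i j) u))\<^sup>2)"
    by (simp add: sum.cartesian_product)
  finally show ?thesis using assms by (simp add: a_form_sq)
qed

section \<open>The Poincare inequality on convex sets\<close>

lemma set_integral_lborel:
  assumes [measurable]: "f \<in> borel_measurable borel" "K \<in> sets borel"
  shows "(LINT x:K|lebesgue. f x) = (LINT x|lborel. indicat_real K x * f x)"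
  unfolding set_lebesgue_integral_def by (subst integral_completion) auto

text \<open>Fundamental theorem of calculus along the segment, followed by the Cauchy-Schwarz
  inequality in \<open>t\<close>. The right side is written with a nonnegative integral so that the
  order of integration can later be exchanged without integrability conditions.\<close>

lemma segment_square_le:
  assumes \<phi>: "smooth \<phi>"
  shows "ennreal ((\<phi> (y + h) - \<phi> y)\<^sup>2) \<le>
    ennreal ((norm h)\<^sup>2) * (\<integral>\<^sup>+t. indicator {0..1} t * ennreal ((norm (grad \<phi> (y + t *\<^sub>R h)))\<^sup>2) \<partial>lborel)"
proof -
  define F where "F t = grad \<phi> (y + t *\<^sub>R h) \<bullet> h" for t
  have gc: "continuous_on UNIV (grad \<phi>)"
    unfolding grad_def using smooth_continuous[OF smooth_pd[OF \<phi>]]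
    by (intro continuous_on_vec_lambda) auto
  have gc': "continuous_on UNIV (\<lambda>t. grad \<phi> (y + t *\<^sub>R h))"
    by (intro continuous_on_compose2[OF gc] continuous_intros) auto
  have Fc: "continuous_on UNIV F" unfolding F_def by (intro continuous_intros gc')
  have der: "((\<lambda>t. \<phi> (y + t *\<^sub>R h)) has_vector_derivative F t) (at t within {0..1})" for t
  proof -
    have "((\<lambda>t. y + t *\<^sub>R h) has_derivative (\<lambda>s. s *\<^sub>R h)) (at t within {0..1})"
      by (auto intro!: derivative_eq_intros)
    from has_derivative_compose[OF this smooth_has_derivative[OF \<phi>]]
    show ?thesis by (simp add: has_vector_derivative_def F_def)
  qed
  have I: "(F has_integral (\<phi> (y + h) - \<phi> y)) {0..1}"
    using fundamental_theorem_of_calculus[of 0 1 "\<lambda>t. \<phi> (y + t *\<^sub>R h)" F] der by simp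
  define a where "a = \<phi> (y + h) - \<phi> y"
  have ii: "f integrable_on {0..1}" if "continuous_on UNIV f" for f :: "real \<Rightarrow> real"
    using that by (intro integrable_continuous_interval) (auto intro: continuous_on_subset)
  \<comment> \<open>\<open>a\<close> is the mean of \<open>F\<close>, so this is a variance.\<close>
  have "0 \<le> integral {0..1} (\<lambda>t. (F t - a)\<^sup>2)"
    by (intro integral_nonneg ii continuous_intros Fc) auto
  also have "integral {0..1} (\<lambda>t. (F t - a)\<^sup>2) = integral {0..1} (\<lambda>t. (F t)\<^sup>2 + ((- 2 * a) * F t + a\<^sup>2))"
    by (rule integral_cong) (simp add: power2_diff algebra_simps)
  also have "\<dots> = integral {0..1} (\<lambda>t. (F t)\<^sup>2) - a\<^sup>2"
  proof -
    have "integral {0..1} (\<lambda>t. (F t)\<^sup>2 + ((- 2 * a) * F t + a\<^sup>2)) =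
      integral {0..1} (\<lambda>t. (F t)\<^sup>2) + (integral {0..1} (\<lambda>t. (- 2 * a) * F t) + integral {0..1} (\<lambda>t::real. a\<^sup>2))"
      by (subst integral_add; (intro ii continuous_intros Fc)?)
        (subst integral_add; (intro ii continuous_intros Fc)?; simp)
    also have "integral {0..1} (\<lambda>t. (- 2 * a) * F t) = (- 2 * a) * a"
      unfolding integral_mult_right using integral_unique[OF I] by (simp add: a_def)
    finally show ?thesis using integral_const_real[of 0 1 "a\<^sup>2"] by (simp add: power2_eq_square)
  qed
  finally have "a\<^sup>2 \<le> integral {0..1} (\<lambda>t. (F t)\<^sup>2)" by simp
  also have "\<dots> \<le> integral {0..1} (\<lambda>t. (norm h)\<^sup>2 * (norm (grad \<phi> (y + t *\<^sub>R h)))\<^sup>2)"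
  proof (intro integral_le ii continuous_intros Fc gc')
    fix t :: real
    have "\<bar>F t\<bar> \<le> \<bar>norm (grad \<phi> (y + t *\<^sub>R h)) * norm h\<bar>"
      using Cauchy_Schwarz_ineq2[of "grad \<phi> (y + t *\<^sub>R h)" h] by (simp add: F_def abs_mult)
    then have "(F t)\<^sup>2 \<le> (norm (grad \<phi> (y + t *\<^sub>R h)) * norm h)\<^sup>2" by (simp only: abs_le_square_iff)
    then show "(F t)\<^sup>2 \<le> (norm h)\<^sup>2 * (norm (grad \<phi> (y + t *\<^sub>R h)))\<^sup>2"
      by (simp add: power_mult_distrib mult.commute)
  qed
  also have "\<dots> = (norm h)\<^sup>2 * integral {0..1} (\<lambda>t. (norm (grad \<phi> (y + t *\<^sub>R h)))\<^sup>2)"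
    by simp
  finally have le: "a\<^sup>2 \<le> (norm h)\<^sup>2 * integral {0..1} (\<lambda>t. (norm (grad \<phi> (y + t *\<^sub>R h)))\<^sup>2)" .
  have "(\<integral>\<^sup>+t. indicator {0..1} t * ennreal ((norm (grad \<phi> (y + t *\<^sub>R h)))\<^sup>2) \<partial>lborel)
      = (\<integral>\<^sup>+t. ennreal (indicator {0..1} t *\<^sub>R (norm (grad \<phi> (y + t *\<^sub>R h)))\<^sup>2) \<partial>lborel)"
    by (intro nn_integral_cong) (auto simp: indicator_def)
  also have "\<dots> = ennreal (integral {0..1} (\<lambda>t. (norm (grad \<phi> (y + t *\<^sub>R h)))\<^sup>2))"
  proof -
    have c: "continuous_on {0..1} (\<lambda>t. (norm (grad \<phi> (y + t *\<^sub>R h)))\<^sup>2)"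
      by (intro continuous_intros continuous_on_subset[OF gc']) auto
    have i: "integrable lborel (\<lambda>t. indicator {0..1} t *\<^sub>R (norm (grad \<phi> (y + t *\<^sub>R h)))\<^sup>2)"
      using borel_integrable_compact[OF compact_Icc c] .
    then have "(LINT t|lborel. indicator {0..1} t *\<^sub>R (norm (grad \<phi> (y + t *\<^sub>R h)))\<^sup>2) = integral {0..1} (\<lambda>t. (norm (grad \<phi> (y + t *\<^sub>R h)))\<^sup>2)"
      using set_borel_integral_eq_integral(2)[of "{0..1}" "\<lambda>t. (norm (grad \<phi> (y + t *\<^sub>R h)))\<^sup>2"]
      by (simp add: set_integrable_def set_lebesgue_integral_def)
    then show ?thesis using i by (subst nn_integral_eq_integral) auto
  qed
  finally have eq: "(\<integral>\<^sup>+t. indicator {0..1} t * ennreal ((norm (grad \<phi> (y + t *\<^sub>R h)))\<^sup>2) \<partial>lborel)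
     = ennreal (integral {0..1} (\<lambda>t. (norm (grad \<phi> (y + t *\<^sub>R h)))\<^sup>2))" .
  show ?thesis
    unfolding eq using le by (subst ennreal_mult[symmetric]) (auto simp: a_def intro!: ennreal_leI integral_nonneg ii continuous_intros gc')
qed

lemma emeasure_cball_le:
  assumes "0 \<le> d"
  shows "emeasure lborel (cball (0::pt) d) \<le> ennreal (4 * d\<^sup>2)"
proof -
  have sub: "cball (0::pt) d \<subseteq> cbox (\<chi> i. - d) (\<chi> i. d)"
  proof
    fix x :: pt assume "x \<in> cball 0 d"
    then have "\<bar>x $ i\<bar> \<le> d" for i using component_le_norm_cart[of x i] by simp
    then show "x \<in> cbox (\<chi> i. - d) (\<chi> i. d)" by (simp add: mem_box_cart abs_le_iff minus_le_iff)
  qed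
  have "emeasure lborel (cball (0::pt) d) \<le> emeasure lborel (cbox (\<chi> i. - d) (\<chi> i. d) :: pt set)"
    using sub by (rule emeasure_mono) auto
  also have "\<dots> = ennreal (measure lborel (cbox (\<chi> i. - d) (\<chi> i. d) :: pt set))"
    by (rule emeasure_eq_ennreal_measure) (simp add: emeasure_lborel_cbox_eq)
  also have "measure lborel (cbox (\<chi> i. - d) (\<chi> i. d) :: pt set) = 4 * d\<^sup>2"
  proof -
    have "cbox (\<chi> i. - d) (\<chi> i. d) \<noteq> ({} :: pt set)" using sub assms by fastforce
    then show ?thesis
      by (subst content_cbox_cart) (auto simp: UNIV_2 power2_eq_square)
  qed
  finally show ?thesis .
qed

text \<open>The double integral of \<open>(\<phi> x - \<phi> y)\<^sup>2\<close> over
  \<open>K\<close> is evaluated in two ways. Expanding the square gives twice the difference of the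
  left side and the squared integral of \<phi>. On the other hand convexity keeps the segment from
  \<open>y\<close> to \<open>x\<close> in \<open>K\<close>, where \<open>segment_square_le\<close>
  applies. In the variable \<open>h = x - y\<close> the order of integration is exchanged, and for
  fixed \<open>h\<close> and \<open>t\<close> the integral over \<open>y\<close> is that of a
  translate. The bound is \<open>d\<^sup>2\<close> times the area \<open>4 * d\<^sup>2\<close>
  available to \<open>h\<close>, and halving gives \<open>2 * d ^ 4\<close>.\<close>

lemma poincare_smooth:
  assumes \<phi>: "smooth \<phi>" and K: "compact K" "convex K" and d: "\<And>x y. x \<in> K \<Longrightarrow> y \<in> K \<Longrightarrow> norm (x - y) \<le> d" "0 \<le> d"
  shows "measure lebesgue K * L2_inner K \<phi> \<phi> \<le> (L2_inner K \<phi> (\<lambda>x. 1))\<^sup>2 + 2 * d ^ 4 * (\<Sum>i\<in>UNIV. L2_inner K (pd i \<phi>) (pd i \<phi>))"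
proof -
  have Kb[measurable]: "K \<in> sets borel" using K by (simp add: borel_compact)
  have [measurable]: "\<phi> \<in> borel_measurable borel" using \<phi> by (rule smooth_borel_measurable)
  have gc: "continuous_on UNIV (grad \<phi>)"
    unfolding grad_def using smooth_continuous[OF smooth_pd[OF \<phi>]]
    by (intro continuous_on_vec_lambda) auto
  then have [measurable]: "grad \<phi> \<in> borel_measurable borel" by (rule borel_measurable_continuous_onI)
  have int: "integrable lborel (\<lambda>x. indicat_real K x * f x)" if "continuous_on UNIV f" for f :: fn
    using borel_integrable_compact[OF K(1) continuous_on_subset[OF that subset_UNIV]] by simp
  have \<phi>c: "continuous_on UNIV \<phi>" using smooth_continuous[OF \<phi>] .
  have [measurable]: "{0..1::real} \<in> sets borel" "cball (0::pt) d \<in> sets borel" by auto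
  define m where "m = (LINT x|lborel. indicat_real K x * 1)"
  define B where "B = (LINT x|lborel. indicat_real K x * \<phi> x)"
  define A where "A = (LINT x|lborel. indicat_real K x * (\<phi> x)\<^sup>2)"
  define Q where "Q = (LINT x|lborel. indicat_real K x * (norm (grad \<phi> x))\<^sup>2)"
  have i1: "integrable lborel (\<lambda>x. indicat_real K x * 1)" by (rule int) simp
  have i\<phi>: "integrable lborel (\<lambda>x. indicat_real K x * \<phi> x)" by (rule int) (rule \<phi>c)
  have i\<phi>2: "integrable lborel (\<lambda>x. indicat_real K x * (\<phi> x)\<^sup>2)" by (rule int) (intro continuous_intros \<phi>c)
  have iQ: "integrable lborel (\<lambda>x. indicat_real K x * (norm (grad \<phi> x))\<^sup>2)" by (rule int) (intro continuous_intros gc)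
  \<comment> \<open>Extended by 0 outside \<open>K\<close>, so that every translate of
    \<open>q\<close> has the same integral over the plane.\<close>
  define q where "q x = indicator K x * ennreal ((norm (grad \<phi> x))\<^sup>2)" for x
  have [measurable]: "q \<in> borel_measurable borel" unfolding q_def by measurable
  have q: "(\<integral>\<^sup>+x. q x \<partial>lborel) = ennreal Q"
  proof -
    have "q x = ennreal (indicat_real K x * (norm (grad \<phi> x))\<^sup>2)" for x by (auto simp: q_def indicator_def)
    then show ?thesis unfolding Q_def using iQ by (simp add: nn_integral_eq_integral)
  qed
  have Q0: "0 \<le> Q" unfolding Q_def by (rule Bochner_Integration.integral_nonneg) auto
  define L where "L = (\<integral>\<^sup>+y. (\<integral>\<^sup>+x. indicator K y * (indicator K x * ennreal ((\<phi> x - \<phi> y)\<^sup>2)) \<partial>lborel) \<partial>lborel)"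
  have "L = ennreal (m * A - 2 * B\<^sup>2 + m * A)"
  proof -
    have inner: "(\<integral>\<^sup>+x. indicator K x * ennreal ((\<phi> x - \<phi> y)\<^sup>2) \<partial>lborel) = ennreal (A - 2 * \<phi> y * B + m * (\<phi> y)\<^sup>2)"
      and inner0: "0 \<le> A - 2 * \<phi> y * B + m * (\<phi> y)\<^sup>2" for y
    proof -
      have e: "indicat_real K x * (\<phi> x - \<phi> y)\<^sup>2 = indicat_real K x * (\<phi> x)\<^sup>2 - 2 * \<phi> y * (indicat_real K x * \<phi> x) + (\<phi> y)\<^sup>2 * (indicat_real K x * 1)" for x
        by (simp add: power2_diff algebra_simps)
      have i: "integrable lborel (\<lambda>x. indicat_real K x * (\<phi> x - \<phi> y)\<^sup>2)"
        unfolding e using i1 i\<phi> i\<phi>2 by (intro Bochner_Integration.integrable_add Bochner_Integration.integrable_diff integrable_mult_right)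
      have v: "(LINT x|lborel. indicat_real K x * (\<phi> x - \<phi> y)\<^sup>2) = A - 2 * \<phi> y * B + m * (\<phi> y)\<^sup>2"
        unfolding e A_def B_def m_def using i1 i\<phi> i\<phi>2 by (simp del: mult_1_right)
      have "(\<integral>\<^sup>+x. indicator K x * ennreal ((\<phi> x - \<phi> y)\<^sup>2) \<partial>lborel) = (\<integral>\<^sup>+x. ennreal (indicat_real K x * (\<phi> x - \<phi> y)\<^sup>2) \<partial>lborel)"
        by (intro nn_integral_cong) (auto simp: indicator_def)
      then show "(\<integral>\<^sup>+x. indicator K x * ennreal ((\<phi> x - \<phi> y)\<^sup>2) \<partial>lborel) = ennreal (A - 2 * \<phi> y * B + m * (\<phi> y)\<^sup>2)"
        using i by (simp add: nn_integral_eq_integral v)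
      show "0 \<le> A - 2 * \<phi> y * B + m * (\<phi> y)\<^sup>2" unfolding v[symmetric]
        by (rule Bochner_Integration.integral_nonneg) auto
    qed
    have "L = (\<integral>\<^sup>+y. indicator K y * ennreal (A - 2 * \<phi> y * B + m * (\<phi> y)\<^sup>2) \<partial>lborel)"
      unfolding L_def by (simp add: nn_integral_cmult inner)
    also have "\<dots> = (\<integral>\<^sup>+y. ennreal (A * (indicat_real K y * 1) - 2 * B * (indicat_real K y * \<phi> y) + m * (indicat_real K y * (\<phi> y)\<^sup>2)) \<partial>lborel)"
      by (intro nn_integral_cong) (auto simp: indicator_def algebra_simps)
    also have "\<dots> = ennreal (LINT y|lborel. A * (indicat_real K y * 1) - 2 * B * (indicat_real K y * \<phi> y) + m * (indicat_real K y * (\<phi> y)\<^sup>2))"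
    proof (rule nn_integral_eq_integral)
      show "integrable lborel (\<lambda>y. A * (indicat_real K y * 1) - 2 * B * (indicat_real K y * \<phi> y) + m * (indicat_real K y * (\<phi> y)\<^sup>2))"
        using i1 i\<phi> i\<phi>2 by (intro Bochner_Integration.integrable_add Bochner_Integration.integrable_diff integrable_mult_right)
      show "AE y in lborel. 0 \<le> A * (indicat_real K y * 1) - 2 * B * (indicat_real K y * \<phi> y) + m * (indicat_real K y * (\<phi> y)\<^sup>2)"
        using inner0 by (auto simp: indicator_def algebra_simps)
    qed
    also have "(LINT y|lborel. A * (indicat_real K y * 1) - 2 * B * (indicat_real K y * \<phi> y) + m * (indicat_real K y * (\<phi> y)\<^sup>2)) = m * A - 2 * B\<^sup>2 + m * A"
      using i1 i\<phi> i\<phi>2 unfolding A_def B_def m_def by (simp add: power2_eq_square del: mult_1_right)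
    finally show ?thesis .
  qed
  moreover have "L \<le> ennreal (d\<^sup>2 * (4 * d\<^sup>2) * Q)"
  proof -
    have "L = (\<integral>\<^sup>+y. (\<integral>\<^sup>+h. indicator K y * (indicator K (y + h) * ennreal ((\<phi> (y + h) - \<phi> y)\<^sup>2)) \<partial>lborel) \<partial>lborel)"
      unfolding L_def
    proof (rule nn_integral_cong)
      fix y
      show "(\<integral>\<^sup>+x. indicator K y * (indicator K x * ennreal ((\<phi> x - \<phi> y)\<^sup>2)) \<partial>lborel)
        = (\<integral>\<^sup>+h. indicator K y * (indicator K (y + h) * ennreal ((\<phi> (y + h) - \<phi> y)\<^sup>2)) \<partial>lborel)"
        using nn_integral_lborel_translate[of "\<lambda>x. indicator K y * (indicator K x * ennreal ((\<phi> x - \<phi> y)\<^sup>2))" y]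
        by (simp add: add.commute)
    qed
    \<comment> \<open>The domain grows from the pairs with both points in \<open>K\<close> to all
      \<open>y\<close> and all \<open>h\<close> in a ball, so that the integral over
      \<open>y\<close> is no longer tied to \<open>h\<close>.\<close>
    also have "\<dots> \<le> (\<integral>\<^sup>+y. (\<integral>\<^sup>+h. (\<integral>\<^sup>+t. ennreal (d\<^sup>2) * (indicator (cball 0 d) h * indicator {0..1::real} t) * q (y + t *\<^sub>R h) \<partial>lborel) \<partial>lborel) \<partial>lborel)"
    proof (intro nn_integral_mono)
      fix y h :: pt
      show "indicator K y * (indicator K (y + h) * ennreal ((\<phi> (y + h) - \<phi> y)\<^sup>2)) \<le>
        (\<integral>\<^sup>+t. ennreal (d\<^sup>2) * (indicator (cball 0 d) h * indicator {0..1::real} t) * q (y + t *\<^sub>R h) \<partial>lborel)"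
      proof (cases "y \<in> K \<and> y + h \<in> K")
        case True
        then have h: "norm h \<le> d" using d(1)[of "y + h" y] by simp
        have seg: "y + t *\<^sub>R h \<in> K" if "t \<in> {0..1}" for t
        proof -
          have "(1 - t) *\<^sub>R y + t *\<^sub>R (y + h) \<in> K"
            using K(2) True that by (intro convexD_alt) auto
          then show ?thesis by (simp add: algebra_simps)
        qed
        have "ennreal ((\<phi> (y + h) - \<phi> y)\<^sup>2) \<le> ennreal ((norm h)\<^sup>2) * (\<integral>\<^sup>+t. indicator {0..1} t * ennreal ((norm (grad \<phi> (y + t *\<^sub>R h)))\<^sup>2) \<partial>lborel)"
          by (rule segment_square_le[OF \<phi>])
        also have "\<dots> \<le> ennreal (d\<^sup>2) * (\<integral>\<^sup>+t. indicator {0..1} t * ennreal ((norm (grad \<phi> (y + t *\<^sub>R h)))\<^sup>2) \<partial>lborel)"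
          using h by (intro mult_right_mono ennreal_leI power_mono) auto
        also have "\<dots> = (\<integral>\<^sup>+t. ennreal (d\<^sup>2) * (indicator {0..1} t * ennreal ((norm (grad \<phi> (y + t *\<^sub>R h)))\<^sup>2)) \<partial>lborel)"
          by (rule nn_integral_cmult[symmetric]) measurable
        also have "\<dots> = (\<integral>\<^sup>+t. ennreal (d\<^sup>2) * (indicator (cball 0 d) h * indicator {0..1::real} t) * q (y + t *\<^sub>R h) \<partial>lborel)"
          using seg h by (intro nn_integral_cong) (auto simp: q_def indicator_def)
        finally show ?thesis using True by simp
      qed auto
    qed
    also have "\<dots> = (\<integral>\<^sup>+h. (\<integral>\<^sup>+y. (\<integral>\<^sup>+t. ennreal (d\<^sup>2) * (indicator (cball 0 d) h * indicator {0..1::real} t) * q (y + t *\<^sub>R h) \<partial>lborel) \<partial>lborel) \<partial>lborel)"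
      by (rule lborel_pair.Fubini') measurable
    also have "\<dots> = (\<integral>\<^sup>+h. (\<integral>\<^sup>+t. (\<integral>\<^sup>+y. ennreal (d\<^sup>2) * (indicator (cball 0 d) h * indicator {0..1::real} t) * q (y + t *\<^sub>R h) \<partial>lborel) \<partial>lborel) \<partial>lborel)"
      by (intro nn_integral_cong lborel_pair.Fubini') measurable
    also have "\<dots> = (\<integral>\<^sup>+h. (\<integral>\<^sup>+t. ennreal (d\<^sup>2) * ennreal Q * indicator (cball (0::pt) d) h * indicator {0..1::real} t \<partial>lborel) \<partial>lborel)"
      by (intro nn_integral_cong) (simp add: nn_integral_cmult nn_integral_lborel_translate q mult_ac)
    also have "\<dots> = ennreal (d\<^sup>2) * ennreal Q * emeasure lborel (cball (0::pt) d)"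
      by (simp add: nn_integral_cmult)
    also have "\<dots> \<le> ennreal (d\<^sup>2) * ennreal Q * ennreal (4 * d\<^sup>2)"
      by (intro mult_left_mono emeasure_cball_le d(2)) auto
    also have "\<dots> = ennreal (d\<^sup>2 * (4 * d\<^sup>2) * Q)"
      using Q0 by (simp add: ennreal_mult[symmetric] mult_ac)
    finally show ?thesis .
  qed
  ultimately have "ennreal (m * A - 2 * B\<^sup>2 + m * A) \<le> ennreal (d\<^sup>2 * (4 * d\<^sup>2) * Q)" by simp
  then have "m * A - 2 * B\<^sup>2 + m * A \<le> d\<^sup>2 * (4 * d\<^sup>2) * Q"
    using Q0 by (subst (asm) ennreal_le_iff) auto
  moreover have "d\<^sup>2 * (4 * d\<^sup>2) * Q = 2 * (2 * d ^ 4 * Q)" by (simp add: eval_nat_numeral)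
  ultimately have main: "m * A \<le> B\<^sup>2 + 2 * d ^ 4 * Q" by linarith
  have "measure lebesgue K = m" by (simp add: m_def)
  moreover have "L2_inner K \<phi> \<phi> = A"
    unfolding L2_inner_def A_def by (subst set_integral_lborel) (auto simp: power2_eq_square)
  moreover have "L2_inner K \<phi> (\<lambda>x. 1) = B"
    unfolding L2_inner_def B_def by (subst set_integral_lborel) auto
  moreover have "(\<Sum>i\<in>UNIV. L2_inner K (pd i \<phi>) (pd i \<phi>)) = Q"
  proof -
    have [measurable]: "pd i \<phi> \<in> borel_measurable borel" for i using smooth_pd[OF \<phi>] by (rule smooth_borel_measurable)
    have "L2_inner K (pd i \<phi>) (pd i \<phi>) = (LINT x|lborel. indicat_real K x * (pd i \<phi> x)\<^sup>2)" for i
      unfolding L2_inner_def by (subst set_integral_lborel) (auto simp: power2_eq_square)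
    moreover have "integrable lborel (\<lambda>x. indicat_real K x * (pd i \<phi> x)\<^sup>2)" for i
      by (intro int continuous_intros smooth_continuous smooth_pd \<phi>)
    moreover have "(norm (grad \<phi> x))\<^sup>2 = (pd 1 \<phi> x)\<^sup>2 + (pd 2 \<phi> x)\<^sup>2" for x
      unfolding power2_norm_eq_inner by (simp add: inner_vec_def sum_2 grad_def power2_eq_square)
    ultimately show ?thesis unfolding Q_def sum_2 by (simp add: distrib_left)
  qed
  ultimately show ?thesis using main by (simp only:)
qed

section \<open>Limits of inner products and of integrals over exhausting sets\<close>

lemma L2_inner_tendsto:
  assumes g: "g \<in> L2 K" "h \<in> L2 K" "\<And>n. f n \<in> L2 K" and l: "(\<lambda>n. L2_norm K (\<lambda>x. g x - f n x)) \<longlonglongrightarrow> 0"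
  shows "(\<lambda>n. L2_inner K (f n) h) \<longlonglongrightarrow> L2_inner K g h"
proof -
  have "(\<lambda>n. L2_inner K (f n) h - L2_inner K g h) \<longlonglongrightarrow> 0"
  proof (rule Lim_null_comparison)
    show "\<forall>\<^sub>F n in sequentially. norm (L2_inner K (f n) h - L2_inner K g h) \<le> L2_norm K (\<lambda>x. g x - f n x) * L2_norm K h"
      using L2_Cauchy_Schwarz[OF L2_diff[OF g(1,3)] g(2)] L2_inner_diff[OF g(1) g(3) g(2)]
      by (simp add: abs_minus_commute)
    show "(\<lambda>n. L2_norm K (\<lambda>x. g x - f n x) * L2_norm K h) \<longlonglongrightarrow> 0"
      using tendsto_mult_right[OF l, of "L2_norm K h"] by simp
  qed
  then show ?thesis by (rule LIM_zero_cancel)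
qed

lemma L2_inner_self_tendsto:
  assumes g: "g \<in> L2 K" "\<And>n. f n \<in> L2 K" and l: "(\<lambda>n. L2_norm K (\<lambda>x. g x - f n x)) \<longlonglongrightarrow> 0"
  shows "(\<lambda>n. L2_inner K (f n) (f n)) \<longlonglongrightarrow> L2_inner K g g"
proof -
  have e: "L2_inner K (f n) (f n) = 2 * L2_inner K (f n) g - L2_inner K g g + (L2_norm K (\<lambda>x. g x - f n x))\<^sup>2" for n
    unfolding L2_norm_sq using g L2_diff[OF g(1) g(2)]
    by (simp add: L2_inner_diff L2_inner_diff_right L2_inner_commute[of K g "f n"])
  have "(\<lambda>n. 2 * L2_inner K (f n) g - L2_inner K g g + (L2_norm K (\<lambda>x. g x - f n x))\<^sup>2) \<longlonglongrightarrow>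
      2 * L2_inner K g g - L2_inner K g g + 0\<^sup>2"
    by (intro tendsto_intros l L2_inner_tendsto[OF g(1) g(1) g(2) l])
  then show ?thesis unfolding e by simp
qed

lemma weak_gradient_approx_seq:
  assumes S: "open S" "bounded S" and K: "compact K" "K \<subseteq> S" and g: "g \<in> L2 S" "\<And>i. G i \<in> L2 S"
    and w: "\<And>i. is_weak_deriv S (idx1 i) g (G i)"
  obtains \<phi> where "\<And>n. smooth (\<phi> n)" "(\<lambda>n. L2_norm K (\<lambda>x. g x - \<phi> n x)) \<longlonglongrightarrow> 0"
    "\<And>i. (\<lambda>n. L2_norm K (\<lambda>x. G i x - pd i (\<phi> n) x)) \<longlonglongrightarrow> 0"
proof -
  have "\<exists>\<phi>. smooth \<phi> \<and> L2_norm K (\<lambda>x. g x - \<phi> x) \<le> 1 / real (Suc n) \<and> (\<forall>i. L2_norm K (\<lambda>x. G i x - pd i \<phi> x) \<le> 1 / real (Suc n))" for n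
    by (rule weak_gradient_approx[OF S K g w]) simp
  then obtain \<phi> where p: "\<And>n. smooth (\<phi> n)" "\<And>n. L2_norm K (\<lambda>x. g x - \<phi> n x) \<le> 1 / real (Suc n)"
    "\<And>n i. L2_norm K (\<lambda>x. G i x - pd i (\<phi> n) x) \<le> 1 / real (Suc n)" by metis
  have "(\<lambda>n. 1 / real (Suc n)) \<longlonglongrightarrow> 0" using LIMSEQ_Suc[OF lim_1_over_n] by simp
  then have z: "f \<longlonglongrightarrow> 0" if "\<And>n. 0 \<le> f n" "\<And>n. f n \<le> 1 / real (Suc n)" for f :: "nat \<Rightarrow> real"
    by (rule real_tendsto_sandwich[OF _ _ tendsto_const, rotated 2]) (use that in auto)
  show thesis using that[OF p(1) z[OF _ p(2)] z[OF _ p(3)]] by simp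
qed

text \<open>Dominated convergence for sets \<open>A n\<close> that exhaust \<open>T\<close> up to
  its null frontier. The integrand may vary with \<open>n\<close>, as needed when a field is
  transported along with the set.\<close>

lemma shrink_integral_tendsto:
  fixes T :: "pt set" and f w :: fn and fs :: "nat \<Rightarrow> fn"
  assumes T: "negligible (frontier T)"
    and w: "set_integrable lebesgue T w" and f: "set_borel_measurable lebesgue T f"
    and fs: "\<And>n. set_borel_measurable lebesgue (A n) (fs n)" "\<And>n x. x \<in> A n \<Longrightarrow> \<bar>fs n x\<bar> \<le> w x"
      "\<And>x. x \<in> interior T \<Longrightarrow> (\<lambda>n. fs n x) \<longlonglongrightarrow> f x"
    and A: "\<And>n. A n \<subseteq> T"
    and ev: "\<And>x. x \<in> interior T \<Longrightarrow> \<forall>\<^sub>F n in sequentially. x \<in> A n"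
  shows "(\<lambda>n. LINT x:A n|lebesgue. fs n x) \<longlonglongrightarrow> (LINT x:T|lebesgue. f x)"
  unfolding set_lebesgue_integral_def
proof (rule Bochner_Integration.integral_dominated_convergence[where w="\<lambda>x. norm (indicat_real T x *\<^sub>R w x)"])
  have i: "integrable lebesgue (\<lambda>x. indicat_real T x *\<^sub>R w x)" using w by (simp add: set_integrable_def)
  show "integrable lebesgue (\<lambda>x. norm (indicat_real T x *\<^sub>R w x))" using i by (rule integrable_norm)
  show "(\<lambda>x. indicat_real T x *\<^sub>R f x) \<in> borel_measurable lebesgue"
    using f by (simp add: set_borel_measurable_def)
  show "(\<lambda>x. indicat_real (A n) x *\<^sub>R fs n x) \<in> borel_measurable lebesgue" for n
    using fs(1)[of n] by (simp add: set_borel_measurable_def)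
  have "frontier T \<in> null_sets lebesgue" using T by (simp add: negligible_iff_null_sets)
  then have "AE x in lebesgue. x \<notin> frontier T" by (rule AE_not_in)
  then show "AE x in lebesgue. (\<lambda>n. indicat_real (A n) x *\<^sub>R fs n x) \<longlonglongrightarrow> indicat_real T x *\<^sub>R f x"
  proof (rule AE_mp, intro AE_I2 impI)
    fix x assume "x \<notin> frontier T"
    then consider "x \<in> interior T" | "x \<notin> T" using interior_subset closure_subset by (auto simp: frontier_def)
    then show "(\<lambda>n. indicat_real (A n) x *\<^sub>R fs n x) \<longlonglongrightarrow> indicat_real T x *\<^sub>R f x"
    proof cases
      case 1
      then have "\<forall>\<^sub>F n in sequentially. fs n x = indicat_real (A n) x *\<^sub>R fs n x"
        using ev[OF 1] by (elim eventually_mono) auto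
      moreover have "indicat_real T x *\<^sub>R f x = f x" using subsetD[OF interior_subset 1] by simp
      ultimately show ?thesis using Lim_transform_eventually[OF fs(3)[OF 1]] by metis
    next
      case 2
      then have "x \<notin> A n" for n using A(1) by blast
      then show ?thesis using 2 by simp
    qed
  qed
  show "AE x in lebesgue. norm (indicat_real (A n) x *\<^sub>R fs n x) \<le> norm (indicat_real T x *\<^sub>R w x)" for n
  proof (rule AE_I2)
    fix x
    have "\<bar>fs n x\<bar> \<le> \<bar>w x\<bar> \<and> x \<in> T" if "x \<in> A n" using A[of n] fs(2)[OF that] that by auto
    then show "norm (indicat_real (A n) x *\<^sub>R fs n x) \<le> norm (indicat_real T x *\<^sub>R w x)"
      by (auto simp: indicator_def)
  qed
qed

text \<open>A homothety with centre \<open>c\<close>; the shift \<open>n + 2\<close> keeps its ratio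
  between 1/2 and 1, so it is invertible for every \<open>n\<close>.\<close>

definition shrink :: "pt \<Rightarrow> nat \<Rightarrow> pt \<Rightarrow> pt" where
  "shrink c n x = c + (1 - 1 / real (n + 2)) *\<^sub>R (x - c)"

lemma shrink_image_eventually:
  assumes "x \<in> interior T"
  shows "\<forall>\<^sub>F n in sequentially. x \<in> shrink c n ` T"
proof -
  have "(\<lambda>n. 1 / real (n + 2)) \<longlonglongrightarrow> 0"
    using LIMSEQ_ignore_initial_segment[OF lim_1_over_n, of 2] .
  then have r: "(\<lambda>n. 1 - 1 / real (n + 2)) \<longlonglongrightarrow> 1 - 0" by (rule tendsto_diff[OF tendsto_const])
  then have "(\<lambda>n. c + (1 / (1 - 1 / real (n + 2))) *\<^sub>R (x - c)) \<longlonglongrightarrow> c + (1 / (1 - 0)) *\<^sub>R (x - c)"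
    by (intro tendsto_intros r) auto
  then have "(\<lambda>n. c + (1 / (1 - 1 / real (n + 2))) *\<^sub>R (x - c)) \<longlonglongrightarrow> x" by simp
  then have "\<forall>\<^sub>F n in sequentially. c + (1 / (1 - 1 / real (n + 2))) *\<^sub>R (x - c) \<in> interior T"
    by (rule topological_tendstoD[OF _ open_interior assms])
  then show ?thesis
  proof (rule eventually_mono)
    fix n assume "c + (1 / (1 - 1 / real (n + 2))) *\<^sub>R (x - c) \<in> interior T"
    moreover have "1 - 1 / real (n + 2) \<noteq> 0" by (simp add: field_simps)
    ultimately show "x \<in> shrink c n ` T"
      using interior_subset by (intro image_eqI[of _ _ "c + (1 / (1 - 1 / real (n + 2))) *\<^sub>R (x - c)"]) (auto simp: shrink_def)
  qed
qed

text \<open>A contraction of \<open>T\<close> towards an interior point is a compact convex subset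
  of the open set on which \<open>g\<close> is given, so the smooth case and approximation apply
  there, with the same \<open>d\<close>. Then the ratio of the contraction tends to 1.\<close>

lemma poincare_convex:
  assumes T: "compact T" "convex T" "interior T \<noteq> {}" and d: "\<And>x y. x \<in> T \<Longrightarrow> y \<in> T \<Longrightarrow> norm (x - y) \<le> d" "0 \<le> d"
    and g: "g \<in> L2 (interior T)" "\<And>i. G i \<in> L2 (interior T)" "\<And>i. is_weak_deriv (interior T) (idx1 i) g (G i)"
  shows "measure lebesgue (interior T) * L2_inner (interior T) g g \<le>
    (L2_inner (interior T) g (\<lambda>x. 1))\<^sup>2 + 2 * d ^ 4 * (\<Sum>i\<in>UNIV. L2_inner (interior T) (G i) (G i))"
proof -
  obtain c where c: "c \<in> interior T" using T(3) by blast
  define K where "K n = shrink c n ` T" for n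
  have S: "open (interior T)" "bounded (interior T)"
    using T(1) by (auto intro: bounded_subset[OF compact_imp_bounded interior_subset])
  have Kc: "compact (K n)" for n
    unfolding K_def shrink_def by (intro compact_continuous_image continuous_intros T(1))
  have KT: "K n \<subseteq> interior T" for n
  proof
    fix y assume "y \<in> K n"
    then obtain x where x: "x \<in> T" "y = shrink c n x" by (auto simp: K_def)
    have "x - (1 / real (n + 2)) *\<^sub>R (x - c) \<in> interior T"
      by (rule mem_interior_convex_shrink[OF T(2) c x(1)]) auto
    moreover have "y = x - (1 / real (n + 2)) *\<^sub>R (x - c)" by (simp add: x(2) shrink_def algebra_simps)
    ultimately show "y \<in> interior T" by simp
  qed
  have Kx: "convex (K n)" for n
  proof -
    have "K n = (+) (c - (1 - 1 / real (n + 2)) *\<^sub>R c) ` ((*\<^sub>R) (1 - 1 / real (n + 2)) ` T)"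
      unfolding K_def shrink_def image_image by (rule image_cong) (auto simp: algebra_simps)
    then show ?thesis using T(2) by (simp add: convex_scaling convex_translation)
  qed
  have Kl: "K n \<in> sets lebesgue" for n using Kc by (simp add: borel_compact)
  have Kd: "norm (x - y) \<le> d" if "x \<in> K n" "y \<in> K n" for x y n
    using d(1) that KT[of n] interior_subset[of T] by blast
  have le: "measure lebesgue (K n) * L2_inner (K n) g g \<le>
    (L2_inner (K n) g (\<lambda>x. 1))\<^sup>2 + 2 * d ^ 4 * (\<Sum>i\<in>UNIV. L2_inner (K n) (G i) (G i))" for n
  proof -
    obtain \<phi> where p: "\<And>k. smooth (\<phi> k)" "(\<lambda>k. L2_norm (K n) (\<lambda>x. g x - \<phi> k x)) \<longlonglongrightarrow> 0"
      "\<And>i. (\<lambda>k. L2_norm (K n) (\<lambda>x. G i x - pd i (\<phi> k) x)) \<longlonglongrightarrow> 0"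
      using weak_gradient_approx_seq[OF S Kc KT g] by blast
    have sm: "f \<in> L2 (K n)" if "smooth f" for f
      using Kc Kl by (intro L2_continuous smooth_continuous that compact_imp_bounded)
    have gl: "g \<in> L2 (K n)" "G i \<in> L2 (K n)" for i using L2_subset[OF _ KT Kl] g by blast+
    have o: "(\<lambda>x. 1) \<in> L2 (K n)" by (rule sm) simp
    show ?thesis
    proof (rule LIMSEQ_le)
      show "(\<lambda>k. measure lebesgue (K n) * L2_inner (K n) (\<phi> k) (\<phi> k)) \<longlonglongrightarrow> measure lebesgue (K n) * L2_inner (K n) g g"
        by (intro tendsto_intros L2_inner_self_tendsto gl sm p)
      show "(\<lambda>k. (L2_inner (K n) (\<phi> k) (\<lambda>x. 1))\<^sup>2 + 2 * d ^ 4 * (\<Sum>i\<in>UNIV. L2_inner (K n) (pd i (\<phi> k)) (pd i (\<phi> k))))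
        \<longlonglongrightarrow> (L2_inner (K n) g (\<lambda>x. 1))\<^sup>2 + 2 * d ^ 4 * (\<Sum>i\<in>UNIV. L2_inner (K n) (G i) (G i))"
        by (intro tendsto_intros L2_inner_self_tendsto L2_inner_tendsto gl o sm smooth_pd p)
      show "\<exists>N. \<forall>k\<ge>N. measure lebesgue (K n) * L2_inner (K n) (\<phi> k) (\<phi> k) \<le>
        (L2_inner (K n) (\<phi> k) (\<lambda>x. 1))\<^sup>2 + 2 * d ^ 4 * (\<Sum>i\<in>UNIV. L2_inner (K n) (pd i (\<phi> k)) (pd i (\<phi> k)))"
      proof (intro exI allI impI)
        fix k
        show "measure lebesgue (K n) * L2_inner (K n) (\<phi> k) (\<phi> k) \<le>
        (L2_inner (K n) (\<phi> k) (\<lambda>x. 1))\<^sup>2 + 2 * d ^ 4 * (\<Sum>i\<in>UNIV. L2_inner (K n) (pd i (\<phi> k)) (pd i (\<phi> k)))"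
          by (rule poincare_smooth[OF p(1) Kc Kx _ d(2)]) (rule Kd)
      qed
    qed
  qed
  have lim: "(\<lambda>n. L2_inner (K n) f h) \<longlonglongrightarrow> L2_inner (interior T) f h" if "f \<in> L2 (interior T)" "h \<in> L2 (interior T)" for f h
    unfolding L2_inner_def
  proof (rule shrink_integral_tendsto[where w="\<lambda>x. \<bar>f x * h x\<bar>"])
    note i = L2_mult_integrable[OF that]
    show "negligible (frontier (interior T))" using T(2) by (intro negligible_convex_frontier convex_interior)
    show "set_integrable lebesgue (interior T) (\<lambda>x. \<bar>f x * h x\<bar>)" using set_integrable_abs[OF i] .
    show "set_borel_measurable lebesgue (interior T) (\<lambda>x. f x * h x)"
      using i by (auto simp: set_integrable_def set_borel_measurable_def)
    show "set_borel_measurable lebesgue (K n) (\<lambda>x. f x * h x)" for n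
      using set_integrable_subset[OF i Kl KT, of n] by (auto simp: set_integrable_def set_borel_measurable_def)
    show "\<forall>\<^sub>F n in sequentially. x \<in> K n" if "x \<in> interior (interior T)" for x
      unfolding K_def by (rule shrink_image_eventually) (use that in simp)
  qed (use KT in auto)
  have oI: "(\<lambda>x. 1) \<in> L2 (interior T)" by (rule L2_const) (use S in \<open>simp add: lmeasurable_open\<close>)
  have m1: "measure lebesgue A = L2_inner A (\<lambda>x. 1) (\<lambda>x. 1)" if "A \<in> lmeasurable" for A :: "pt set"
    unfolding L2_inner_def set_lebesgue_integral_def using that by (simp add: fmeasurable_def)
  have mK: "measure lebesgue (K n) = L2_inner (K n) (\<lambda>x. 1) (\<lambda>x. 1)" for n
    using Kc by (intro m1 lmeasurable_compact)
  have mT: "measure lebesgue (interior T) = L2_inner (interior T) (\<lambda>x. 1) (\<lambda>x. 1)"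
    using S by (intro m1 lmeasurable_open)
  show ?thesis
    unfolding mT
  proof (rule LIMSEQ_le)
    show "(\<lambda>n. L2_inner (K n) (\<lambda>x. 1) (\<lambda>x. 1) * L2_inner (K n) g g) \<longlonglongrightarrow> L2_inner (interior T) (\<lambda>x. 1) (\<lambda>x. 1) * L2_inner (interior T) g g"
      by (intro tendsto_add tendsto_mult tendsto_power tendsto_sum tendsto_const lim g oI)
    show "(\<lambda>n. (L2_inner (K n) g (\<lambda>x. 1))\<^sup>2 + 2 * d ^ 4 * (\<Sum>i\<in>UNIV. L2_inner (K n) (G i) (G i))) \<longlonglongrightarrow>
      (L2_inner (interior T) g (\<lambda>x. 1))\<^sup>2 + 2 * d ^ 4 * (\<Sum>i\<in>UNIV. L2_inner (interior T) (G i) (G i))"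
      by (intro tendsto_add tendsto_mult tendsto_power tendsto_sum tendsto_const lim g oI)
    show "\<exists>N. \<forall>n\<ge>N. L2_inner (K n) (\<lambda>x. 1) (\<lambda>x. 1) * L2_inner (K n) g g \<le>
      (L2_inner (K n) g (\<lambda>x. 1))\<^sup>2 + 2 * d ^ 4 * (\<Sum>i\<in>UNIV. L2_inner (K n) (G i) (G i))"
      unfolding mK[symmetric] using le by blast
  qed
qed

section \<open>Edge means as volume integrals\<close>

definition mk2 :: "real \<Rightarrow> real \<Rightarrow> pt" where
  "mk2 s t = (\<chi> i. if i = 1 then s else t)"

lemma mk2_nth [simp]: "mk2 s t $ 1 = s" "mk2 s t $ 2 = t"
  by (simp_all add: mk2_def)

lemma continuous_on_mk2:
  assumes "continuous_on A f" "continuous_on A g"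
  shows "continuous_on A (\<lambda>x. mk2 (f x) (g x))"
  unfolding mk2_def
proof (rule continuous_on_vec_lambda)
  show "continuous_on A (\<lambda>x. if i = 1 then f x else g x)" for i :: 2
    using assms by (cases "i = 1") auto
qed

lemma mk2_measurable [measurable]: "(\<lambda>x. mk2 (fst x) (snd x)) \<in> borel_measurable (borel \<Otimes>\<^sub>M borel)"
proof -
  have "continuous_on UNIV (\<lambda>x::real \<times> real. mk2 (fst x) (snd x))"
    by (intro continuous_on_mk2 continuous_intros)
  then have "(\<lambda>x. mk2 (fst x) (snd x)) \<in> borel_measurable (borel :: (real \<times> real) measure)"
    by (rule borel_measurable_continuous_onI)
  then show ?thesis by (simp add: borel_prod)
qed

lemma prod_Basis_pt: "(\<Prod>b\<in>Basis. g (b :: pt)) = g (axis 1 1) * g (axis 2 1)"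
proof -
  have B: "Basis = {axis 1 1, axis 2 1 :: pt}"
    unfolding Basis_vec_def using exhaust_2 by (auto simp: UNIV_2)
  have "axis 1 1 \<notin> {axis 2 1 :: pt}" by (simp add: axis_eq_axis)
  then show ?thesis unfolding B by (subst prod.insert) auto
qed

text \<open>Boxes correspond to boxes of the same measure, which characterises
  \<open>lborel\<close>. The identity opens the way to Fubini's theorem in the two
  coordinates.\<close>

lemma lborel_pt: "distr (lborel \<Otimes>\<^sub>M lborel) borel (\<lambda>x. mk2 (fst x) (snd x)) = lborel"
proof (rule lborel_eqI[symmetric])
  fix l u :: pt assume lu: "\<And>b. b \<in> Basis \<Longrightarrow> l \<bullet> b \<le> u \<bullet> b"
  then have le: "l $ 1 \<le> u $ 1" "l $ 2 \<le> u $ 2"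
    using lu[of "axis 1 1"] lu[of "axis 2 1"] by (auto simp: inner_axis axis_in_Basis_iff)
  have m: "(\<lambda>x. mk2 (fst x) (snd x)) \<in> (lborel \<Otimes>\<^sub>M lborel) \<rightarrow>\<^sub>M borel"
    by measurable
  have "(\<lambda>x. mk2 (fst x) (snd x)) -` box l u \<inter> space (lborel \<Otimes>\<^sub>M lborel) = {l $ 1 <..< u $ 1} \<times> {l $ 2 <..< u $ 2}"
    by (auto simp: mem_box_cart space_pair_measure forall_2)
  then have "emeasure (distr (lborel \<Otimes>\<^sub>M lborel) borel (\<lambda>x. mk2 (fst x) (snd x))) (box l u) =
    emeasure (lborel \<Otimes>\<^sub>M lborel) ({l $ 1 <..< u $ 1} \<times> {l $ 2 <..< u $ 2})"
    using m by (subst emeasure_distr) auto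
  also have "\<dots> = emeasure lborel {l $ 1 <..< u $ 1} * emeasure lborel {l $ 2 <..< u $ 2}"
    by (rule lborel.emeasure_pair_measure_Times) auto
  also have "\<dots> = ennreal ((u $ 1 - l $ 1) * (u $ 2 - l $ 2))"
    using le by (simp add: ennreal_mult)
  finally show "emeasure (distr (lborel \<Otimes>\<^sub>M lborel) borel (\<lambda>x. mk2 (fst x) (snd x))) (box l u) = ennreal (\<Prod>b\<in>Basis. (u - l) \<bullet> b)"
    by (simp add: prod_Basis_pt inner_axis)
qed simp

lemma integral_pt_iterated:
  fixes F :: fn
  assumes F: "integrable lborel F"
  shows "(LINT z|lborel. F z) = (LINT s|lborel. LINT t|lborel. F (mk2 s t))"
    and "(LINT z|lborel. F z) = (LINT t|lborel. LINT s|lborel. F (mk2 s t))"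
proof -
  have [measurable]: "F \<in> borel_measurable borel" using F by auto
  have m: "(\<lambda>x. mk2 (fst x) (snd x)) \<in> (lborel \<Otimes>\<^sub>M lborel) \<rightarrow>\<^sub>M borel" by measurable
  have "integrable (distr (lborel \<Otimes>\<^sub>M lborel) borel (\<lambda>x. mk2 (fst x) (snd x))) F" unfolding lborel_pt by (rule F)
  then have i: "integrable (lborel \<Otimes>\<^sub>M lborel) (\<lambda>x. F (mk2 (fst x) (snd x)))"
    using m by (subst (asm) integrable_distr_eq) auto
  have e: "(LINT z|lborel. F z) = (LINT x|(lborel \<Otimes>\<^sub>M lborel). F (mk2 (fst x) (snd x)))"
    using m by (subst lborel_pt[symmetric], subst integral_distr) auto
  have i': "integrable (lborel \<Otimes>\<^sub>M lborel) (case_prod (\<lambda>s t. F (mk2 s t)))"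
    using i by (simp add: case_prod_unfold)
  show "(LINT z|lborel. F z) = (LINT s|lborel. LINT t|lborel. F (mk2 s t))"
    unfolding e using lborel_pair.integral_fst'[OF i] by simp
  show "(LINT z|lborel. F z) = (LINT t|lborel. LINT s|lborel. F (mk2 s t))"
    unfolding e using lborel_pair.integral_snd[OF i'] by (simp add: case_prod_unfold)
qed

definition aff2 :: "pt \<Rightarrow> pt \<Rightarrow> pt \<Rightarrow> pt \<Rightarrow> pt" where
  "aff2 c p q z = c + z $ 1 *\<^sub>R p + z $ 2 *\<^sub>R q"

lemma continuous_aff2: "continuous_on A (aff2 c p q)"
  unfolding aff2_def by (intro continuous_intros)

lemma linear_integral_scale:
  fixes g :: "pt \<Rightarrow> pt" and F :: fn
  assumes g: "linear g" and Q: "compact Q" and F: "continuous_on UNIV F"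
  shows "(LINT x:g ` Q|lebesgue. F x) = \<bar>det (matrix g)\<bar> * (LINT z:Q|lebesgue. F (g z))"
proof -
  have gc: "continuous_on A g" for A using g by (simp add: linear_continuous_on linear_conv_bounded_linear)
  have gQ: "compact (g ` Q)" by (rule compact_continuous_image[OF gc Q])
  have Fg: "continuous_on UNIV (\<lambda>z. F (g z))" by (rule continuous_on_compose2[OF F gc]) auto
  have ai: "h absolutely_integrable_on A" if "compact A" "continuous_on UNIV h" for h :: "pt \<Rightarrow> real^1" and A
  proof -
    have "integrable lborel (\<lambda>x. indicator A x *\<^sub>R h x)"
      using borel_integrable_compact[OF that(1) continuous_on_subset[OF that(2)]] by simp
    then show ?thesis unfolding set_integrable_def
      using that(1) by (subst integrable_completion) (auto dest: borel_measurable_integrable)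
  qed
  have ar: "h absolutely_integrable_on A" if "compact A" "continuous_on UNIV h" for h :: fn and A
  proof -
    have "integrable lborel (\<lambda>x. indicator A x *\<^sub>R h x)"
      using borel_integrable_compact[OF that(1) continuous_on_subset[OF that(2)]] by simp
    then show ?thesis unfolding set_integrable_def
      using that(1) by (subst integrable_completion) (auto dest: borel_measurable_integrable)
  qed
  have v: "continuous_on UNIV (\<lambda>x. vec (F x) :: real^1)"
    unfolding vec_def by (intro continuous_on_vec_lambda F)
  have vg: "continuous_on UNIV (\<lambda>x. vec (F (g x)) :: real^1)"
    unfolding vec_def by (intro continuous_on_vec_lambda Fg)
  \<comment> \<open>The rule for linear changes of variables concerns vector-valued integrands, so a
    scalar is read as a vector of \<open>real^1\<close>.\<close>
  have "integral (g ` Q) (\<lambda>x. vec (F x) :: real^1) = \<bar>det (matrix g)\<bar> *\<^sub>R integral Q ((\<lambda>x. vec (F x)) \<circ> g)"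
    using integral_change_of_variables_linear[OF g] ai[OF gQ v] by blast
  then have "integral (g ` Q) (\<lambda>x. vec (F x) :: real^1) $ 1 = \<bar>det (matrix g)\<bar> * (integral Q (\<lambda>x. vec (F (g x)) :: real^1) $ 1)"
    by (simp add: o_def)
  moreover have "integral (g ` Q) (\<lambda>x. vec (F x) :: real^1) $ 1 = integral (g ` Q) F"
    using integral_component_eq_cart[of "\<lambda>x. vec (F x) :: real^1" "g ` Q" 1] set_lebesgue_integral_eq_integral(1)[OF ai[OF gQ v]] by simp
  moreover have "integral Q (\<lambda>x. vec (F (g x)) :: real^1) $ 1 = integral Q (\<lambda>x. F (g x))"
    using integral_component_eq_cart[of "\<lambda>x. vec (F (g x)) :: real^1" Q 1] set_lebesgue_integral_eq_integral(1)[OF ai[OF Q vg]] by simp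
  ultimately show ?thesis
    using set_lebesgue_integral_eq_integral(2)[OF ar[OF gQ F]] set_lebesgue_integral_eq_integral(2)[OF ar[OF Q Fg]] by simp
qed

lemma aff2_integral:
  fixes F :: fn
  assumes Q: "compact Q" and F: "continuous_on UNIV F"
  shows "(LINT x:aff2 c p q ` Q|lebesgue. F x) = \<bar>det (matrix (aff2 0 p q))\<bar> * (LINT z:Q|lebesgue. F (aff2 c p q z))"
proof -
  have lin: "linear (aff2 0 p q)"
    by (rule linearI) (auto simp: aff2_def algebra_simps)
  have im: "aff2 c p q ` Q = (+) c ` (aff2 0 p q ` Q)"
    by (auto simp: aff2_def image_image add.assoc)
  have k: "compact (aff2 0 p q ` Q)" "compact (aff2 c p q ` Q)"
    by (intro compact_continuous_image continuous_aff2 Q)+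
  then have [measurable]: "aff2 0 p q ` Q \<in> sets borel" "aff2 c p q ` Q \<in> sets borel" by (auto simp: borel_compact)
  have [measurable]: "F \<in> borel_measurable borel" using F by (rule borel_measurable_continuous_onI)
  have "(LINT x:aff2 c p q ` Q|lebesgue. F x) = (LINT x|lborel. indicat_real (aff2 c p q ` Q) x * F x)"
    by (rule set_integral_lborel) auto
  also have "\<dots> = (LINT x|lborel. indicat_real (aff2 c p q ` Q) (x + c) * F (x + c))"
    by (rule lborel_integral_translate[symmetric]) auto
  also have "\<dots> = (LINT x|lborel. indicat_real (aff2 0 p q ` Q) x * F (x + c))"
  proof -
    have "x + c \<in> aff2 c p q ` Q \<longleftrightarrow> x \<in> aff2 0 p q ` Q" for x
      unfolding im by (auto simp: add.commute image_iff)
    then show ?thesis by (simp add: indicator_def)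
  qed
  also have "\<dots> = (LINT x:aff2 0 p q ` Q|lebesgue. F (x + c))"
    by (rule set_integral_lborel[symmetric]) auto
  also have "\<dots> = \<bar>det (matrix (aff2 0 p q))\<bar> * (LINT z:Q|lebesgue. F (aff2 0 p q z + c))"
    by (rule linear_integral_scale[OF lin Q]) (intro continuous_on_compose2[OF F] continuous_intros; simp)
  also have "(\<lambda>z. F (aff2 0 p q z + c)) = (\<lambda>z. F (aff2 c p q z))"
    by (simp add: aff2_def add_ac)
  finally show ?thesis .
qed

lemma aff2_derivative:
  assumes "smooth f"
  shows "((\<lambda>s. f (aff2 c p q (mk2 s t))) has_field_derivative grad f (aff2 c p q (mk2 s t)) \<bullet> p) (at s within A)"
    and "((\<lambda>t. f (aff2 c p q (mk2 s t))) has_field_derivative grad f (aff2 c p q (mk2 s t)) \<bullet> q) (at t within A)"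
proof -
  have 1: "((\<lambda>s. aff2 c p q (mk2 s t)) has_derivative (\<lambda>h. h *\<^sub>R p)) (at s within A)"
    and 2: "((\<lambda>t. aff2 c p q (mk2 s t)) has_derivative (\<lambda>h. h *\<^sub>R q)) (at t within A)"
    unfolding aff2_def by (auto intro!: derivative_eq_intros)
  show "((\<lambda>s. f (aff2 c p q (mk2 s t))) has_field_derivative grad f (aff2 c p q (mk2 s t)) \<bullet> p) (at s within A)"
    using has_derivative_compose[OF 1 smooth_has_derivative[OF assms]]
    by (simp add: has_field_derivative_def mult_commute_abs)
  show "((\<lambda>t. f (aff2 c p q (mk2 s t))) has_field_derivative grad f (aff2 c p q (mk2 s t)) \<bullet> q) (at t within A)"
    using has_derivative_compose[OF 2 smooth_has_derivative[OF assms]]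
    by (simp add: has_field_derivative_def mult_commute_abs)
qed

lemma continuous_mk2_1: "continuous_on A (\<lambda>s. mk2 s t)" and continuous_mk2_2: "continuous_on A (\<lambda>t. mk2 s t)"
  by (intro continuous_on_mk2 continuous_intros)+

lemma integral_FTC_indicator:
  fixes G :: "real \<Rightarrow> real"
  assumes "u \<le> v" "\<And>s. (G has_field_derivative g s) (at s)" "continuous_on UNIV g"
  shows "(LINT s|lborel. indicat_real {u..v} s * g s) = G v - G u"
proof -
  have "(LINT s|lborel. g s * indicat_real {u..v} s) = G v - G u"
    by (rule integral_FTC_Icc_real[OF assms(1,2)]) (use assms(3) in \<open>auto simp: continuous_on_eq_continuous_at\<close>)
  then show ?thesis by (simp add: mult.commute)
qed

lemma continuous_grad: "smooth f \<Longrightarrow> continuous_on A (grad f)"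
  unfolding grad_def by (intro continuous_on_vec_lambda smooth_continuous smooth_pd)

lemma integrable_indicator_compact:
  fixes F :: fn
  shows "compact Q \<Longrightarrow> continuous_on UNIV F \<Longrightarrow> integrable lborel (\<lambda>z. indicat_real Q z * F z)"
  using borel_integrable_compact[of Q F] continuous_on_subset[of UNIV F Q] by simp

lemma LINT_Icc_eq_integral:
  fixes h :: "real \<Rightarrow> real"
  assumes "continuous_on UNIV h"
  shows "(LINT t|lborel. indicat_real {0..1} t * h t) = integral {0..1} h"
proof -
  have "set_integrable lborel {0..1} h"
    using borel_integrable_compact[of "{0..1}" h] continuous_on_subset[OF assms] by (simp add: set_integrable_def)
  from set_borel_integral_eq_integral(2)[OF this] show ?thesis by (simp add: set_lebesgue_integral_def)
qed

section \<open>Edge integrals on the reference square and the reference simplex\<close>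

definition square2 :: "pt set" where
  "square2 = {z. 0 \<le> z $ 1 \<and> z $ 1 \<le> 1 \<and> 0 \<le> z $ 2 \<and> z $ 2 \<le> 1}"

definition simplex2 :: "pt set" where
  "simplex2 = {z. 0 \<le> z $ 1 \<and> 0 \<le> z $ 2 \<and> z $ 1 + z $ 2 \<le> 1}"

lemma compact_square2: "compact square2"
proof -
  have "square2 = cbox (mk2 0 0) (mk2 1 1)"
    by (auto simp: square2_def mem_box_cart forall_2)
  then show ?thesis using compact_cbox by metis
qed

lemma compact_simplex2: "compact simplex2"
proof -
  have "closed simplex2" unfolding simplex2_def
    by (intro closed_Collect_conj closed_Collect_le continuous_intros)
  moreover have "simplex2 = square2 \<inter> simplex2"
    by (auto simp: square2_def simplex2_def)
  ultimately show ?thesis using compact_square2 by (metis compact_Int_closed)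
qed

text \<open>The divergence of \<open>(s - r) f p\<close>, where \<open>s\<close> is the coordinate along \<open>p\<close>, is integrated
  over lines parallel to \<open>p\<close>.\<close>

lemma square_edge_integral:
  assumes f: "smooth f"
  shows "(LINT z:square2|lebesgue. (z $ 1 - r) * (grad f (aff2 c p q z) \<bullet> p) + f (aff2 c p q z)) =
    (1 - r) * integral {0..1} (\<lambda>t. f (c + p + t *\<^sub>R q)) + r * integral {0..1} (\<lambda>t. f (c + t *\<^sub>R q))"
proof -
  let ?F = "\<lambda>z. (z $ 1 - r) * (grad f (aff2 c p q z) \<bullet> p) + f (aff2 c p q z)"
  have Fc: "continuous_on UNIV ?F"
    by (intro continuous_intros continuous_on_compose2[OF continuous_grad[OF f] continuous_aff2]
        continuous_on_compose2[OF smooth_continuous[OF f] continuous_aff2]) auto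
  have [measurable]: "?F \<in> borel_measurable borel" "square2 \<in> sets borel"
    using Fc compact_square2 by (auto intro: borel_measurable_continuous_onI simp: borel_compact)
  have ind: "indicat_real square2 (mk2 s t) = indicat_real {0..1} t * indicat_real {0..1} s" for s t
    by (auto simp: square2_def indicator_def)
  have inner: "(LINT s|lborel. indicat_real {0..1} s * ?F (mk2 s t)) = (1 - r) * f (c + p + t *\<^sub>R q) + r * f (c + t *\<^sub>R q)" for t
  proof -
    have "(LINT s|lborel. indicat_real {0..1} s * ?F (mk2 s t)) =
       (1 - r) * f (aff2 c p q (mk2 1 t)) - (0 - r) * f (aff2 c p q (mk2 0 t))"
    proof (rule integral_FTC_indicator)
      show "((\<lambda>s. (s - r) * f (aff2 c p q (mk2 s t))) has_field_derivative ?F (mk2 s t)) (at s)" for s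
        by (rule derivative_eq_intros aff2_derivative(1)[OF f] refl | simp)+
      show "continuous_on UNIV (\<lambda>s. ?F (mk2 s t))"
        by (rule continuous_on_compose2[OF Fc continuous_mk2_1]) auto
    qed auto
    then show ?thesis by (simp add: aff2_def)
  qed
  have "(LINT z:square2|lebesgue. ?F z) = (LINT z|lborel. indicat_real square2 z * ?F z)"
    by (rule set_integral_lborel) auto
  also have "\<dots> = (LINT t|lborel. LINT s|lborel. indicat_real square2 (mk2 s t) * ?F (mk2 s t))"
    by (rule integral_pt_iterated(2)[OF integrable_indicator_compact[OF compact_square2 Fc]])
  also have "\<dots> = (LINT t|lborel. indicat_real {0..1} t * ((1 - r) * f (c + p + t *\<^sub>R q) + r * f (c + t *\<^sub>R q)))"
    unfolding ind mult.assoc integral_mult_right_zero inner ..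
  also have "\<dots> = integral {0..1} (\<lambda>t. (1 - r) * f (c + p + t *\<^sub>R q) + r * f (c + t *\<^sub>R q))"
    by (intro LINT_Icc_eq_integral continuous_intros continuous_on_compose2[OF smooth_continuous[OF f, of UNIV]]) auto
  also have "\<dots> = integral {0..1} (\<lambda>t. (1 - r) * f (c + p + t *\<^sub>R q)) + integral {0..1} (\<lambda>t. r * f (c + t *\<^sub>R q))"
    by (intro integral_add integrable_continuous_interval continuous_intros continuous_on_compose2[OF smooth_continuous[OF f, of UNIV]]) auto
  finally show ?thesis by simp
qed

text \<open>The position field relative to \<open>c\<close> has divergence 2 and is tangential on
  the two edges through \<open>c\<close>. Each of its two components is integrated along its own
  coordinate and leaves an integral over the opposite edge, with weights \<open>1 - t\<close> and
  \<open>t\<close>; the weights add up to 1.\<close>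

lemma simplex_edge_integral:
  assumes f: "smooth f"
  shows "(LINT z:simplex2|lebesgue. grad f (aff2 c p q z) \<bullet> (z $ 1 *\<^sub>R p + z $ 2 *\<^sub>R q) + 2 * f (aff2 c p q z)) =
    integral {0..1} (\<lambda>t. f (c + (1 - t) *\<^sub>R p + t *\<^sub>R q))"
proof -
  let ?F = "\<lambda>z. z $ 1 * (grad f (aff2 c p q z) \<bullet> p) + f (aff2 c p q z)"
  let ?G = "\<lambda>z. z $ 2 * (grad f (aff2 c p q z) \<bullet> q) + f (aff2 c p q z)"
  have Fc: "continuous_on UNIV ?F"
    by (intro continuous_intros continuous_on_compose2[OF continuous_grad[OF f] continuous_aff2]
        continuous_on_compose2[OF smooth_continuous[OF f] continuous_aff2]) auto
  have Gc: "continuous_on UNIV ?G"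
    by (intro continuous_intros continuous_on_compose2[OF continuous_grad[OF f] continuous_aff2]
        continuous_on_compose2[OF smooth_continuous[OF f] continuous_aff2]) auto
  have m: "?F \<in> borel_measurable borel" "?G \<in> borel_measurable borel" "simplex2 \<in> sets borel"
    using Fc Gc compact_simplex2 by (auto intro: borel_measurable_continuous_onI simp: borel_compact)
  let ?e = "\<lambda>t. f (c + (1 - t) *\<^sub>R p + t *\<^sub>R q)"
  have ec: "continuous_on UNIV ?e"
    by (intro continuous_intros continuous_on_compose2[OF smooth_continuous[OF f, of UNIV]]) auto
  have ind: "indicat_real simplex2 (mk2 s t) = indicat_real {0..1} t * indicat_real {0..1 - t} s"
    "indicat_real simplex2 (mk2 s t) = indicat_real {0..1} s * indicat_real {0..1 - s} t" for s t
    by (auto simp: simplex2_def indicator_def)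
  have innerF: "indicat_real {0..1} t * (LINT s|lborel. indicat_real {0..1 - t} s * ?F (mk2 s t)) = indicat_real {0..1} t * ((1 - t) * ?e t)" for t
  proof (cases "t \<in> {0..1}")
    case True
    have "(LINT s|lborel. indicat_real {0..1 - t} s * ?F (mk2 s t)) = (1 - t) * f (aff2 c p q (mk2 (1 - t) t)) - 0 * f (aff2 c p q (mk2 0 t))"
    proof (rule integral_FTC_indicator)
      show "((\<lambda>s. s * f (aff2 c p q (mk2 s t))) has_field_derivative ?F (mk2 s t)) (at s)" for s
        by (rule derivative_eq_intros aff2_derivative(1)[OF f] refl | simp)+
      show "continuous_on UNIV (\<lambda>s. ?F (mk2 s t))"
        by (rule continuous_on_compose2[OF Fc continuous_mk2_1]) auto
    qed (use True in auto)
    then show ?thesis by (simp add: aff2_def)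
  qed auto
  have innerG: "indicat_real {0..1} s * (LINT t|lborel. indicat_real {0..1 - s} t * ?G (mk2 s t)) = indicat_real {0..1} s * ((1 - s) * ?e (1 - s))" for s
  proof (cases "s \<in> {0..1}")
    case True
    have "(LINT t|lborel. indicat_real {0..1 - s} t * ?G (mk2 s t)) = (1 - s) * f (aff2 c p q (mk2 s (1 - s))) - 0 * f (aff2 c p q (mk2 s 0))"
    proof (rule integral_FTC_indicator)
      show "((\<lambda>t. t * f (aff2 c p q (mk2 s t))) has_field_derivative ?G (mk2 s t)) (at t)" for t
        by (rule derivative_eq_intros aff2_derivative(2)[OF f] refl | simp)+
      show "continuous_on UNIV (\<lambda>t. ?G (mk2 s t))"
        by (rule continuous_on_compose2[OF Gc continuous_mk2_2]) auto
    qed (use True in auto)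
    then show ?thesis by (simp add: aff2_def)
  qed auto
  have "(LINT z|lborel. indicat_real simplex2 z * ?F z) = (LINT t|lborel. LINT s|lborel. indicat_real simplex2 (mk2 s t) * ?F (mk2 s t))"
    by (rule integral_pt_iterated(2)[OF integrable_indicator_compact[OF compact_simplex2 Fc]])
  also have "\<dots> = (LINT t|lborel. indicat_real {0..1} t * ((1 - t) * ?e t))"
    unfolding ind(1) mult.assoc integral_mult_right_zero innerF ..
  also have "\<dots> = integral {0..1} (\<lambda>t. (1 - t) * ?e t)"
    by (intro LINT_Icc_eq_integral continuous_intros ec)
  finally have IF: "(LINT z|lborel. indicat_real simplex2 z * ?F z) = integral {0..1} (\<lambda>t. (1 - t) * ?e t)" .
  have "(LINT z|lborel. indicat_real simplex2 z * ?G z) = (LINT s|lborel. LINT t|lborel. indicat_real simplex2 (mk2 s t) * ?G (mk2 s t))"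
    by (rule integral_pt_iterated(1)[OF integrable_indicator_compact[OF compact_simplex2 Gc]])
  also have "\<dots> = (LINT s|lborel. indicat_real {0..1} s * ((1 - s) * ?e (1 - s)))"
    unfolding ind(2) mult.assoc integral_mult_right_zero innerG ..
  \<comment> \<open>Replacing \<open>s\<close> by \<open>1 - s\<close> makes both parts run along
    the opposite edge in the same direction.\<close>
  also have "\<dots> = (LINT s|lborel. indicat_real {0..1} (1 + (-1) * s) * ((1 - (1 + (-1) * s)) * ?e (1 - (1 + (-1) * s))))"
    using lborel_integral_real_affine[of "-1" "\<lambda>s. indicat_real {0..1} s * ((1 - s) * ?e (1 - s))" 1] by simp
  also have "\<dots> = (LINT s|lborel. indicat_real {0..1} s * (s * ?e s))"
    by (intro Bochner_Integration.integral_cong refl) (auto simp: indicator_def)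
  also have "\<dots> = integral {0..1} (\<lambda>t. t * ?e t)"
    by (intro LINT_Icc_eq_integral continuous_intros ec)
  finally have IG: "(LINT z|lborel. indicat_real simplex2 z * ?G z) = integral {0..1} (\<lambda>t. t * ?e t)" .
  have "(LINT z:simplex2|lebesgue. grad f (aff2 c p q z) \<bullet> (z $ 1 *\<^sub>R p + z $ 2 *\<^sub>R q) + 2 * f (aff2 c p q z))
      = (LINT z:simplex2|lebesgue. ?F z + ?G z)"
    by (simp add: inner_add_right algebra_simps)
  also have "\<dots> = (LINT z|lborel. indicat_real simplex2 z * (?F z + ?G z))"
    by (rule set_integral_lborel[OF borel_measurable_add[OF m(1,2)] m(3)])
  also have "\<dots> = (LINT z|lborel. indicat_real simplex2 z * ?F z) + (LINT z|lborel. indicat_real simplex2 z * ?G z)"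
    unfolding distrib_left[of "indicat_real simplex2 _" "?F _"]
    by (intro Bochner_Integration.integral_add integrable_indicator_compact[OF compact_simplex2 Fc] integrable_indicator_compact[OF compact_simplex2 Gc])
  also have "\<dots> = integral {0..1} (\<lambda>t. (1 - t) * ?e t + t * ?e t)"
    unfolding IF IG
    by (intro integral_add[symmetric] integrable_continuous_interval continuous_intros continuous_on_subset[OF ec]) auto
  also have "(\<lambda>t. (1 - t) * ?e t + t * ?e t) = ?e" by (simp add: algebra_simps)
  finally show ?thesis .
qed

section \<open>Triangles and rectangles\<close>

definition cross :: "pt \<Rightarrow> pt \<Rightarrow> real" where
  "cross u v = u $ 1 * v $ 2 - u $ 2 * v $ 1"

text \<open>Clockwise rotation by a right angle; it turns the edge vectors of a counterclockwise
  triangle outward.\<close>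

definition rot :: "pt \<Rightarrow> pt" where
  "rot u = mk2 (u $ 2) (- (u $ 1))"

lemma inner_pt: "(u::pt) \<bullet> v = u $ 1 * v $ 1 + u $ 2 * v $ 2"
  by (simp add: inner_vec_def sum_2)

lemma rot_inner: "rot u \<bullet> v = - cross u v"
  by (simp add: rot_def inner_pt cross_def)

lemma norm_rot [simp]: "norm (rot u) = norm u"
  by (simp add: norm_eq_sqrt_inner rot_def inner_pt algebra_simps)

lemma det_aff2: "det (matrix (aff2 0 p q)) = cross p q"
  by (simp add: det_2 matrix_def aff2_def cross_def axis_def)

lemma pt_eqI: "(u::pt) $ 1 = v $ 1 \<Longrightarrow> u $ 2 = v $ 2 \<Longrightarrow> u = v"
  by (simp add: vec_eq_iff forall_2)

text \<open>On the edge \<open>e\<close> of \<open>T\<close> with outward normal vector \<open>N\<close> (of length \<open>|e|\<close>), the field \<open>\<psi>\<close> has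
  divergence \<open>1 / |T|\<close> and turns the mean over \<open>e\<close> into a volume integral over \<open>T\<close>.\<close>

definition edge_field :: "pt set \<Rightarrow> pt set \<Rightarrow> pt \<Rightarrow> (pt \<Rightarrow> pt) \<Rightarrow> bool" where
  "edge_field T e N \<psi> \<longleftrightarrow>
     (\<exists>a b. a \<noteq> b \<and> e = closed_segment a b \<and> N \<bullet> (b - a) = 0 \<and> norm N = dist a b \<and>
        (\<forall>y\<in>T. N \<bullet> (y - a) \<le> 0) \<and>
        (\<forall>f. smooth f \<longrightarrow> (LINT x:T|lebesgue. grad f x \<bullet> \<psi> x + f x / measure lebesgue T) =
            integral {0..1} (\<lambda>t. f (linepath a b t)))) \<and>
     continuous_on UNIV \<psi> \<and> (\<forall>x\<in>T. norm (\<psi> x) \<le> diameter T / measure lebesgue T) \<and> e edge_of T"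

text \<open>A constant field \<open>v\<close> has flux \<open>N e \<bullet> v\<close> through
  \<open>e\<close>, and in the cases below \<open>\<psi> e\<close> has flux 1 through
  \<open>e\<close> and none through the other edges. The condition on the products of components
  says that the interpolant of \<open>v\<close> with these fluxes is \<open>v\<close>
  itself.\<close>

definition edge_fields :: "pt set \<Rightarrow> pt set set \<Rightarrow> (pt set \<Rightarrow> pt) \<Rightarrow> (pt set \<Rightarrow> pt \<Rightarrow> pt) \<Rightarrow> bool" where
  "edge_fields T E N \<psi> \<longleftrightarrow> finite E \<and> card E \<le> 4 \<and> frontier T \<subseteq> \<Union>E \<and> (\<forall>e\<in>E. edge_field T e (N e) (\<psi> e)) \<and>
     (\<forall>x i j. (\<Sum>e\<in>E. N e $ i * \<psi> e x $ j) = of_bool (i = j)) \<and> (\<Sum>e\<in>E. N e) = 0"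

subsection \<open>Triangles\<close>

lemma triangle_cross:
  assumes "\<not> collinear {a, b, c :: pt}"
  shows "cross (b - a) (c - a) \<noteq> 0"
proof
  assume 0: "cross (b - a) (c - a) = 0"
  have "a \<noteq> b" using assms by auto
  define r where "r = ((c - a) \<bullet> (b - a)) / ((b - a) \<bullet> (b - a))"
  have nz: "(b - a) \<bullet> (b - a) \<noteq> 0" using \<open>a \<noteq> b\<close> by simp
  have "((b - a) \<bullet> (b - a)) *\<^sub>R (c - a) = ((c - a) \<bullet> (b - a)) *\<^sub>R (b - a)"
    using 0 by (intro pt_eqI) (simp_all add: inner_pt cross_def, algebra+)
  then have "c - a = r *\<^sub>R (b - a)"
    using nz by (metis (no_types, lifting) divide_inverse_commute r_def scaleR_one scaleR_scaleR left_inverse)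
  then have "c = a + r *\<^sub>R (b - a)" by (simp add: algebra_simps)
  then have "collinear {a, b, c}"
    unfolding collinear_alt by (intro exI[of _ a] exI[of _ "b - a"]) 
      (auto intro: exI[of _ 0] exI[of _ 1] exI[of _ r])
  then show False using assms by simp
qed

lemma triangle_image: "convex hull {a, b, c} = aff2 c (a - c) (b - c) ` simplex2"
proof
  show "convex hull {a, b, c} \<subseteq> aff2 c (a - c) (b - c) ` simplex2"
  proof
    fix x assume "x \<in> convex hull {a, b, c}"
    then obtain u v w where uvw: "0 \<le> u" "0 \<le> v" "0 \<le> w" "u + v + w = 1" "x = u *\<^sub>R a + v *\<^sub>R b + w *\<^sub>R c"
      by (auto simp: convex_hull_3)
    have w: "w = 1 - u - v" using uvw by simp
    have "x = aff2 c (a - c) (b - c) (mk2 u v)" by (simp add: aff2_def uvw(5) w algebra_simps)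
    moreover have "mk2 u v \<in> simplex2" using uvw by (simp add: simplex2_def)
    ultimately show "x \<in> aff2 c (a - c) (b - c) ` simplex2" by blast
  qed
  show "aff2 c (a - c) (b - c) ` simplex2 \<subseteq> convex hull {a, b, c}"
  proof clarify
    fix z assume z: "z \<in> simplex2"
    have "aff2 c (a - c) (b - c) z = z $ 1 *\<^sub>R a + z $ 2 *\<^sub>R b + (1 - z $ 1 - z $ 2) *\<^sub>R c"
      by (simp add: aff2_def algebra_simps)
    then show "aff2 c (a - c) (b - c) z \<in> convex hull {a, b, c}"
      using z unfolding convex_hull_3 simplex2_def
      by (intro CollectI exI[of _ "z $ 1"] exI[of _ "z $ 2"] exI[of _ "1 - z $ 1 - z $ 2"]) auto
  qed
qed

text \<open>The affine image of \<open>simplex_edge_integral\<close>. The area formula is the same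
  identity for the constant function 1.\<close>

lemma triangle_edge_integral:
  assumes T: "T = convex hull {a, b, c}" and f: "smooth f"
  shows "(LINT x:T|lebesgue. grad f x \<bullet> (x - c) + 2 * f x) = \<bar>cross (a - c) (b - c)\<bar> * integral {0..1} (\<lambda>t. f (linepath a b t))"
    and "2 * measure lebesgue T = \<bar>cross (a - c) (b - c)\<bar>"
proof -
  have *: "(LINT x:T|lebesgue. grad f x \<bullet> (x - c) + 2 * f x) = \<bar>cross (a - c) (b - c)\<bar> * integral {0..1} (\<lambda>t. f (linepath a b t))"
    if f: "smooth f" for f
  proof -
    have "(LINT x:T|lebesgue. grad f x \<bullet> (x - c) + 2 * f x) = \<bar>cross (a - c) (b - c)\<bar> *
      (LINT z:simplex2|lebesgue. grad f (aff2 c (a - c) (b - c) z) \<bullet> (aff2 c (a - c) (b - c) z - c) + 2 * f (aff2 c (a - c) (b - c) z))"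
      unfolding T triangle_image det_aff2[symmetric]
      by (rule aff2_integral[OF compact_simplex2]) (intro continuous_intros continuous_grad smooth_continuous f)
    also have "(\<lambda>z. aff2 c (a - c) (b - c) z - c) = (\<lambda>z. z $ 1 *\<^sub>R (a - c) + z $ 2 *\<^sub>R (b - c))"
      by (simp add: aff2_def)
    then have "(LINT z:simplex2|lebesgue. grad f (aff2 c (a - c) (b - c) z) \<bullet> (aff2 c (a - c) (b - c) z - c) + 2 * f (aff2 c (a - c) (b - c) z)) = 
      integral {0..1} (\<lambda>t. f (c + (1 - t) *\<^sub>R (a - c) + t *\<^sub>R (b - c)))"
      unfolding simplex_edge_integral[OF f, symmetric] by metis
    also have "(\<lambda>t. f (c + (1 - t) *\<^sub>R (a - c) + t *\<^sub>R (b - c))) = (\<lambda>t. f (linepath a b t))"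
      by (simp add: linepath_def algebra_simps)
    finally show ?thesis .
  qed
  show "(LINT x:T|lebesgue. grad f x \<bullet> (x - c) + 2 * f x) = \<bar>cross (a - c) (b - c)\<bar> * integral {0..1} (\<lambda>t. f (linepath a b t))"
    by (rule *[OF f])
  have "compact T" unfolding T by (simp add: finite_imp_compact_convex_hull)
  then have "T \<in> lmeasurable" by (rule lmeasurable_compact)
  then have "(LINT x:T|lebesgue. 2) = 2 * measure lebesgue T"
    by (simp add: set_lebesgue_integral_def fmeasurable_def)
  moreover have "grad (\<lambda>x. 1) x = 0" for x by (simp add: grad_def vec_eq_iff)
  ultimately show "2 * measure lebesgue T = \<bar>cross (a - c) (b - c)\<bar>"
    using *[of "\<lambda>x. 1"] by simp
qed

text \<open>The field \<open>x - c\<close> issuing from the opposite vertex is tangential on the two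
  edges through \<open>c\<close>. The sign of \<open>D\<close> is the orientation of the vertices
  and makes the rotated edge vector point outward.\<close>

lemma triangle_edge_field:
  assumes T: "T = convex hull {a, b, c}" and nc: "\<not> collinear {a, b, c}"
  defines "D \<equiv> cross (b - a) (c - a)"
  shows "edge_field T (closed_segment a b) (sgn D *\<^sub>R rot (b - a)) (\<lambda>x. (x - c) /\<^sub>R \<bar>D\<bar>)"
proof -
  have D: "D \<noteq> 0" using triangle_cross[OF nc] by (simp add: D_def)
  have cD: "cross (a - c) (b - c) = D" by (simp add: cross_def D_def algebra_simps)
  have ab: "a \<noteq> b" using nc by auto
  have m: "2 * measure lebesgue T = \<bar>D\<bar>" using triangle_edge_integral(2)[OF T smooth_const[of 0]] by (simp add: cD)
  have Tc: "compact T" unfolding T by (simp add: finite_imp_compact_convex_hull)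
  have cT: "c \<in> T" unfolding T by (simp add: hull_inc)
  have 1: "(sgn D *\<^sub>R rot (b - a)) \<bullet> (b - a) = 0" by (simp add: rot_inner cross_def)
  have 2: "norm (sgn D *\<^sub>R rot (b - a)) = dist a b" using D by (simp add: dist_norm norm_minus_commute sgn_real_def)
  have 3: "(sgn D *\<^sub>R rot (b - a)) \<bullet> (y - a) \<le> 0" if "y \<in> T" for y
  proof -
    obtain u v w where uvw: "0 \<le> u" "0 \<le> v" "0 \<le> w" "u + v + w = 1" "y = u *\<^sub>R a + v *\<^sub>R b + w *\<^sub>R c"
      using \<open>y \<in> T\<close> unfolding T by (auto simp: convex_hull_3)
    have u: "u = 1 - v - w" using uvw by simp
    \<comment> \<open>Only the barycentric coordinate belonging to \<open>c\<close> contributes,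
      since the other two vertices lie on the edge.\<close>
    have "cross (b - a) (y - a) = w * D" unfolding uvw(5) u by (simp add: cross_def D_def algebra_simps)
    then have "(sgn D *\<^sub>R rot (b - a)) \<bullet> (y - a) = - (w * (sgn D * D))" by (simp add: rot_inner)
    also have "\<dots> = - (w * \<bar>D\<bar>)" by (simp add: abs_sgn mult.commute)
    finally show ?thesis using uvw by simp
  qed
  have 4: "(LINT x:T|lebesgue. grad f x \<bullet> ((x - c) /\<^sub>R \<bar>D\<bar>) + f x / measure lebesgue T) = integral {0..1} (\<lambda>t. f (linepath a b t))"
    if f: "smooth f" for f
  proof -
    have "1 / measure lebesgue T = 2 / \<bar>D\<bar>" using m D by (auto simp: field_simps)
    then have "grad f x \<bullet> ((x - c) /\<^sub>R \<bar>D\<bar>) + f x / measure lebesgue T = (1 / \<bar>D\<bar>) * (grad f x \<bullet> (x - c) + 2 * f x)" for x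
      by (simp add: divide_inverse algebra_simps)
    then show ?thesis
      using triangle_edge_integral(1)[OF T f] D by (simp add: cD)
  qed
  have 5: "norm ((x - c) /\<^sub>R \<bar>D\<bar>) \<le> diameter T / measure lebesgue T" if "x \<in> T" for x
  proof -
    have d: "norm (x - c) \<le> diameter T"
      using diameter_bounded_bound[OF compact_imp_bounded[OF Tc] that cT] by (simp add: dist_norm)
    then have "0 \<le> diameter T" using norm_ge_zero order_trans by blast
    then have "norm (x - c) \<le> 2 * diameter T" using d by linarith
    then have "norm (x - c) / \<bar>D\<bar> \<le> 2 * diameter T / \<bar>D\<bar>" by (rule divide_right_mono) simp
    moreover have "diameter T / measure lebesgue T = 2 * diameter T / \<bar>D\<bar>" using m D by (auto simp: field_simps)
    moreover have "norm ((x - c) /\<^sub>R \<bar>D\<bar>) = norm (x - c) / \<bar>D\<bar>" by (simp add: divide_inverse mult.commute)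
    ultimately show ?thesis by simp
  qed
  have 6: "closed_segment a b edge_of T"
  proof -
    have "\<not> affine_dependent {a, b, c}" using nc collinear_3_eq_affine_dependent by blast
    then have "convex hull {a, b} face_of convex hull {a, b, c}"
      by (subst face_of_convex_hull_affine_independent) (auto intro!: exI[of _ "{a, b}"])
    then show ?thesis using ab unfolding edge_of_def T by (simp add: segment_convex_hull aff_dim_convex_hull)
  qed
  have 7: "continuous_on UNIV (\<lambda>x. (x - c) /\<^sub>R \<bar>D\<bar>)" by (intro continuous_intros)
  show ?thesis unfolding edge_field_def using ab 1 2 3 4 5 6 7 by blast
qed

lemma triangle_edge_fields:
  assumes "triangle T"
  shows "\<exists>E N \<psi>. edge_fields T E N \<psi>"
proof -
  obtain a b c where nc: "\<not> collinear {a, b, c}" and T: "T = convex hull {a, b, c}"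
    using assms by (auto simp: triangle_def)
  define D where "D = cross (b - a) (c - a)"
  have D: "D \<noteq> 0" using triangle_cross[OF nc] by (simp add: D_def)
  have nc': "\<not> collinear {b, c, a}" "\<not> collinear {c, a, b}" using nc by (simp_all add: insert_commute)
  have T': "T = convex hull {b, c, a}" "T = convex hull {c, a, b}" using T by (simp_all add: insert_commute)
  \<comment> \<open>Cyclic permutation preserves the orientation, so one \<open>D\<close> serves all
    three edges.\<close>
  have D': "cross (c - b) (a - b) = D" "cross (a - c) (b - c) = D" by (simp_all add: cross_def D_def algebra_simps)
  let ?ab = "closed_segment a b" let ?bc = "closed_segment b c" let ?ca = "closed_segment c a"
  have col: "collinear {x, y, z}" if "z \<in> closed_segment x y" for x y z :: pt
    using that between_mem_segment between_imp_collinear collinear_3_eq_affine_dependent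
    by (metis collinear_between_cases insert_commute)
  \<comment> \<open>\<open>N\<close> and \<open>\<psi>\<close> are functions of the edge as a set,
    so the segments have to be distinct.\<close>
  have ne: "?ab \<noteq> ?bc" "?ab \<noteq> ?ca" "?bc \<noteq> ?ca"
  proof -
    have "c \<notin> ?ab" "a \<notin> ?bc" using col[of c a b] col[of a b c] nc nc' by (auto simp: insert_commute)
    moreover have "c \<in> ?bc" "c \<in> ?ca" "a \<in> ?ca" by auto
    ultimately show "?ab \<noteq> ?bc" "?ab \<noteq> ?ca" "?bc \<noteq> ?ca" by metis+
  qed
  define N where "N e = (if e = ?ab then sgn D *\<^sub>R rot (b - a) else if e = ?bc then sgn D *\<^sub>R rot (c - b) else sgn D *\<^sub>R rot (a - c))" for e
  define \<psi> where "\<psi> e = (if e = ?ab then (\<lambda>x. (x - c) /\<^sub>R \<bar>D\<bar>) else if e = ?bc then (\<lambda>x. (x - a) /\<^sub>R \<bar>D\<bar>) else (\<lambda>x. (x - b) /\<^sub>R \<bar>D\<bar>))" for e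
  have s: "(\<Sum>e\<in>{?ab, ?bc, ?ca}. h e) = h ?ab + (h ?bc + h ?ca)" for h :: "pt set \<Rightarrow> 'a::comm_monoid_add"
    using ne by simp
  have N: "N ?ab = sgn D *\<^sub>R rot (b - a)" "N ?bc = sgn D *\<^sub>R rot (c - b)" "N ?ca = sgn D *\<^sub>R rot (a - c)"
    using ne by (auto simp: N_def)
  have \<psi>: "\<psi> ?ab = (\<lambda>x. (x - c) /\<^sub>R \<bar>D\<bar>)" "\<psi> ?bc = (\<lambda>x. (x - a) /\<^sub>R \<bar>D\<bar>)" "\<psi> ?ca = (\<lambda>x. (x - b) /\<^sub>R \<bar>D\<bar>)"
    using ne by (auto simp: \<psi>_def)
  have "edge_fields T {?ab, ?bc, ?ca} N \<psi>"
    unfolding edge_fields_def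
  proof (intro conjI allI)
    show "card {?ab, ?bc, ?ca} \<le> 4" using ne by simp
    show "frontier T \<subseteq> \<Union> {?ab, ?bc, ?ca}"
      unfolding T by (subst frontier_of_triangle) auto
    show "\<forall>e\<in>{?ab, ?bc, ?ca}. edge_field T e (N e) (\<psi> e)"
      using triangle_edge_field[OF T nc] triangle_edge_field[OF T'(1) nc'(1)] triangle_edge_field[OF T'(2) nc'(2)]
      by (simp add: N \<psi> D' D_def[symmetric])
    show "(\<Sum>e\<in>{?ab, ?bc, ?ca}. N e) = 0"
      unfolding s N by (intro pt_eqI) (simp_all add: rot_def algebra_simps)
    fix x i j
    have sD: "sgn D * (w / \<bar>D\<bar>) = w / D" for w using D by (simp add: sgn_real_def)
    have "(\<Sum>e\<in>{?ab, ?bc, ?ca}. N e $ i * \<psi> e x $ j) =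
      (rot (b - a) $ i * (x - c) $ j + (rot (c - b) $ i * (x - a) $ j + rot (a - c) $ i * (x - b) $ j)) / D"
      unfolding s N \<psi> using D by (simp add: divide_inverse sgn_real_def algebra_simps)
    also have "\<dots> = of_bool (i = j)"
    proof -
      \<comment> \<open>The terms in \<open>x\<close> cancel because the edge vectors of a triangle
        sum to 0.\<close>
      have "rot (b - a) $ i * (x - c) $ j + (rot (c - b) $ i * (x - a) $ j + rot (a - c) $ i * (x - b) $ j) = of_bool (i = j) * D"
        using exhaust_2[of i] exhaust_2[of j] by (auto simp: rot_def D_def cross_def algebra_simps)
      then show ?thesis using D by simp
    qed
    finally show "(\<Sum>e\<in>{?ab, ?bc, ?ca}. N e $ i * \<psi> e x $ j) = of_bool (i = j)" .
  qed auto
  then show ?thesis by blast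
qed

subsection \<open>Rectangles\<close>

text \<open>By Lagrange's identity nonzero orthogonal vectors have nonzero cross product, so in the
  plane a vector orthogonal to both is 0.\<close>

lemma orthogonal_expansion:
  fixes p q y :: pt
  assumes "p \<noteq> 0" "q \<noteq> 0" "p \<bullet> q = 0"
  shows "y = ((y \<bullet> p) / (p \<bullet> p)) *\<^sub>R p + ((y \<bullet> q) / (q \<bullet> q)) *\<^sub>R q"
proof -
  define z where "z = y - (((y \<bullet> p) / (p \<bullet> p)) *\<^sub>R p + ((y \<bullet> q) / (q \<bullet> q)) *\<^sub>R q)"
  have z: "z \<bullet> p = 0" "z \<bullet> q = 0"
    using assms by (simp_all add: z_def inner_diff_left inner_add_left inner_commute[of q p])
  have "(cross p q)\<^sup>2 + (p \<bullet> q)\<^sup>2 = (p \<bullet> p) * (q \<bullet> q)"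
    by (simp add: cross_def inner_pt power2_eq_square algebra_simps)
  then have c: "cross p q \<noteq> 0" using assms by auto
  have "z $ 1 * cross p q = (z \<bullet> p) * q $ 2 - (z \<bullet> q) * p $ 2" "z $ 2 * cross p q = (z \<bullet> q) * p $ 1 - (z \<bullet> p) * q $ 1"
    by (simp_all add: cross_def inner_pt algebra_simps)
  then have "z = 0" using z c by (intro pt_eqI) auto
  then show ?thesis by (simp add: z_def)
qed

lemma rectangle_image: "convex hull {a, a + p, a + q, a + p + q} = aff2 a p q ` square2"
proof
  have sq: "mk2 s t \<in> square2" if "s \<in> {0, 1}" "t \<in> {0, 1}" for s t
    using that by (auto simp: square2_def)
  have lin: "linear (aff2 0 p q)"
    by (rule linearI) (auto simp: aff2_def algebra_simps)
  have "square2 = cbox (mk2 0 0) (mk2 1 1)"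
    by (auto simp: square2_def mem_box_cart forall_2)
  then have "convex (aff2 0 p q ` square2)" using convex_linear_image[OF lin convex_box(1)] by metis
  then have cv: "convex ((+) a ` (aff2 0 p q ` square2))" by (rule convex_translation)
  have im: "aff2 a p q ` square2 = (+) a ` (aff2 0 p q ` square2)"
    by (auto simp: aff2_def image_image add.assoc)
  show "convex hull {a, a + p, a + q, a + p + q} \<subseteq> aff2 a p q ` square2"
  proof (rule hull_minimal)
    show "{a, a + p, a + q, a + p + q} \<subseteq> aff2 a p q ` square2"
      using sq by (auto simp: aff2_def intro: image_eqI[of _ _ "mk2 0 0"] image_eqI[of _ _ "mk2 1 0"] image_eqI[of _ _ "mk2 0 1"] image_eqI[of _ _ "mk2 1 1"])
    show "convex (aff2 a p q ` square2)" unfolding im by (rule cv)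
  qed
  let ?T = "convex hull {a, a + p, a + q, a + p + q}"
  show "aff2 a p q ` square2 \<subseteq> ?T"
  proof clarify
    fix z assume z: "z \<in> square2"
    define s t where "s = z $ 1" and "t = z $ 2"
    have st: "0 \<le> s" "s \<le> 1" "0 \<le> t" "t \<le> 1" using z by (auto simp: square2_def s_def t_def)
    have v: "a \<in> ?T" "a + p \<in> ?T" "a + q \<in> ?T" "a + p + q \<in> ?T" by (auto intro: hull_inc)
    have u: "(1 - s) *\<^sub>R a + s *\<^sub>R (a + p) \<in> ?T" "(1 - s) *\<^sub>R (a + q) + s *\<^sub>R (a + p + q) \<in> ?T"
      using v st by (auto intro!: convexD_alt convex_convex_hull)
    have "(1 - t) *\<^sub>R ((1 - s) *\<^sub>R a + s *\<^sub>R (a + p)) + t *\<^sub>R ((1 - s) *\<^sub>R (a + q) + s *\<^sub>R (a + p + q)) \<in> ?T"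
      using u st by (auto intro!: convexD_alt convex_convex_hull)
    moreover have "aff2 a p q z = (1 - t) *\<^sub>R ((1 - s) *\<^sub>R a + s *\<^sub>R (a + p)) + t *\<^sub>R ((1 - s) *\<^sub>R (a + q) + s *\<^sub>R (a + p + q))"
      by (simp add: aff2_def s_def t_def algebra_simps)
    ultimately show "aff2 a p q z \<in> ?T" by simp
  qed
qed

lemma rectangle_coordinates:
  fixes a p q :: pt
  assumes T: "T = convex hull {a, a + p, a + q, a + p + q}" and pq: "p \<noteq> 0" "q \<noteq> 0" "p \<bullet> q = 0"
  shows "x \<in> T \<longleftrightarrow> 0 \<le> (x - a) \<bullet> p \<and> (x - a) \<bullet> p \<le> p \<bullet> p \<and> 0 \<le> (x - a) \<bullet> q \<and> (x - a) \<bullet> q \<le> q \<bullet> q"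
proof
  assume "x \<in> T"
  then obtain z where z: "z \<in> square2" "x = aff2 a p q z" unfolding T rectangle_image by blast
  have "(x - a) \<bullet> p = z $ 1 * (p \<bullet> p)" "(x - a) \<bullet> q = z $ 2 * (q \<bullet> q)"
    using pq by (simp_all add: z(2) aff2_def inner_add_left inner_commute[of q p])
  then show "0 \<le> (x - a) \<bullet> p \<and> (x - a) \<bullet> p \<le> p \<bullet> p \<and> 0 \<le> (x - a) \<bullet> q \<and> (x - a) \<bullet> q \<le> q \<bullet> q"
    using z(1) by (auto simp: square2_def mult_left_le_one_le)
next
  assume x: "0 \<le> (x - a) \<bullet> p \<and> (x - a) \<bullet> p \<le> p \<bullet> p \<and> 0 \<le> (x - a) \<bullet> q \<and> (x - a) \<bullet> q \<le> q \<bullet> q"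
  define z where "z = mk2 (((x - a) \<bullet> p) / (p \<bullet> p)) (((x - a) \<bullet> q) / (q \<bullet> q))"
  have pos: "0 < p \<bullet> p" "0 < q \<bullet> q" using pq by auto
  have "z \<in> square2" using x pos by (auto simp: square2_def z_def divide_le_eq)
  moreover have "x = aff2 a p q z"
    using orthogonal_expansion[OF pq, of "x - a"] by (simp add: aff2_def z_def algebra_simps)
  ultimately show "x \<in> T" unfolding T rectangle_image by blast
qed

text \<open>The edge through \<open>a\<close> is where the coordinate along \<open>p\<close> is 0.
  The other three edges arise by renaming the corner and the directions.\<close>

lemma rectangle_edge_eq:
  fixes a p q :: pt
  assumes T: "T = convex hull {a, a + p, a + q, a + p + q}" and pq: "p \<noteq> 0" "q \<noteq> 0" "p \<bullet> q = 0"
  shows "T \<inter> {x. (x - a) \<bullet> p = 0} = closed_segment a (a + q)"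
proof
  show "T \<inter> {x. (x - a) \<bullet> p = 0} \<subseteq> closed_segment a (a + q)"
  proof clarify
    fix x assume x: "x \<in> T" "(x - a) \<bullet> p = 0"
    define t where "t = ((x - a) \<bullet> q) / (q \<bullet> q)"
    have t: "0 \<le> t" "t \<le> 1" using rectangle_coordinates[OF T pq, of x] x pq by (auto simp: t_def divide_le_eq)
    have "x - a = t *\<^sub>R q" using orthogonal_expansion[OF pq, of "x - a"] x(2) by (simp add: t_def)
    then have "x = (1 - t) *\<^sub>R a + t *\<^sub>R (a + q)" by (simp add: algebra_simps)
    then show "x \<in> closed_segment a (a + q)" using t unfolding closed_segment_def by blast
  qed
  show "closed_segment a (a + q) \<subseteq> T \<inter> {x. (x - a) \<bullet> p = 0}"
  proof
    fix x assume "x \<in> closed_segment a (a + q)"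
    then obtain t where t: "0 \<le> t" "t \<le> 1" "x = (1 - t) *\<^sub>R a + t *\<^sub>R (a + q)" unfolding closed_segment_def by blast
    then have "x - a = t *\<^sub>R q" by (simp add: algebra_simps)
    then show "x \<in> T \<inter> {x. (x - a) \<bullet> p = 0}"
      using rectangle_coordinates[OF T pq, of x] t pq by (simp add: inner_commute[of q p] mult_left_le_one_le)
  qed
qed

lemma rectangle_edge_integral:
  fixes a p q :: pt
  assumes T: "T = convex hull {a, a + p, a + q, a + p + q}" and pq: "p \<noteq> 0" "q \<noteq> 0" "p \<bullet> q = 0" and f: "smooth f"
  shows "(LINT x:T|lebesgue. ((x - a) \<bullet> p / (p \<bullet> p) - 1) * (grad f x \<bullet> p) + f x) = \<bar>cross p q\<bar> * integral {0..1} (\<lambda>t. f (linepath a (a + q) t))"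
proof -
  have pos: "0 < p \<bullet> p" using pq by auto
  have "(LINT x:T|lebesgue. ((x - a) \<bullet> p / (p \<bullet> p) - 1) * (grad f x \<bullet> p) + f x) = \<bar>cross p q\<bar> *
    (LINT z:square2|lebesgue. ((aff2 a p q z - a) \<bullet> p / (p \<bullet> p) - 1) * (grad f (aff2 a p q z) \<bullet> p) + f (aff2 a p q z))"
    unfolding T rectangle_image det_aff2[symmetric]
    by (rule aff2_integral[OF compact_square2])
      (use pos in \<open>intro continuous_intros continuous_grad smooth_continuous f; simp\<close>)
  also have "(\<lambda>z. (aff2 a p q z - a) \<bullet> p / (p \<bullet> p)) = (\<lambda>z. z $ 1)"
    using pq by (simp add: aff2_def inner_add_left inner_commute[of q p])
  then have "(LINT z:square2|lebesgue. ((aff2 a p q z - a) \<bullet> p / (p \<bullet> p) - 1) * (grad f (aff2 a p q z) \<bullet> p) + f (aff2 a p q z)) =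
    (LINT z:square2|lebesgue. (z $ 1 - 1) * (grad f (aff2 a p q z) \<bullet> p) + f (aff2 a p q z))"
    by metis
  \<comment> \<open>With \<open>r = 1\<close> the field vanishes on the opposite edge, whose
    integral drops out.\<close>
  also have "\<dots> = integral {0..1} (\<lambda>t. f (a + t *\<^sub>R q))"
    using square_edge_integral[OF f, of 1 a p q] by simp
  also have "(\<lambda>t. f (a + t *\<^sub>R q)) = (\<lambda>t. f (linepath a (a + q) t))"
    by (simp add: linepath_def algebra_simps)
  finally show ?thesis .
qed

lemma rectangle_measure:
  fixes a p q :: pt
  assumes T: "T = convex hull {a, a + p, a + q, a + p + q}" and pq: "p \<noteq> 0" "q \<noteq> 0" "p \<bullet> q = 0"
  shows "measure lebesgue T = \<bar>cross p q\<bar>"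
proof -
  have "compact T" unfolding T by (simp add: finite_imp_compact_convex_hull)
  then have "T \<in> lmeasurable" by (rule lmeasurable_compact)
  then have "(LINT x:T|lebesgue. 1) = measure lebesgue T"
    by (simp add: set_lebesgue_integral_def fmeasurable_def)
  moreover have "grad (\<lambda>x. 1) x = 0" for x by (simp add: grad_def vec_eq_iff)
  ultimately show ?thesis using rectangle_edge_integral[OF assms, of "\<lambda>x. 1"] by simp
qed

text \<open>A multiple of \<open>p\<close> is tangential on the two sides parallel to
  \<open>p\<close>, and the scalar factor vanishes on the side opposite to the edge.\<close>

lemma rectangle_edge_field:
  fixes a p q :: pt
  assumes T: "T = convex hull {a, a + p, a + q, a + p + q}" and pq: "p \<noteq> 0" "q \<noteq> 0" "p \<bullet> q = 0"
  shows "edge_field T (closed_segment a (a + q)) (- (norm q / norm p) *\<^sub>R p)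
     (\<lambda>x. (((x - a) \<bullet> p / (p \<bullet> p) - 1) / measure lebesgue T) *\<^sub>R p)"
proof -
  have pos: "0 < p \<bullet> p" "0 < norm p" using pq by auto
  have co: "0 \<le> (x - a) \<bullet> p" "(x - a) \<bullet> p \<le> p \<bullet> p" if "x \<in> T" for x
    using rectangle_coordinates[OF T pq, of x] that by auto
  have Tc: "compact T" unfolding T by (simp add: finite_imp_compact_convex_hull)
  have Tx: "convex T" unfolding T by simp
  have aT: "a \<in> T" "a + p \<in> T" unfolding T by (auto intro: hull_inc)
  define m where "m = measure lebesgue T"
  define \<kappa> where "\<kappa> = \<bar>cross p q\<bar>"
  note I = rectangle_edge_integral[OF T pq, folded \<kappa>_def]
  have m: "m = \<kappa>" unfolding m_def \<kappa>_def by (rule rectangle_measure[OF T pq])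
  have "(cross p q)\<^sup>2 + (p \<bullet> q)\<^sup>2 = (p \<bullet> p) * (q \<bullet> q)"
    by (simp add: cross_def inner_pt power2_eq_square algebra_simps)
  then have m0: "0 < m" using pq by (auto simp: m \<kappa>_def)
  have 1: "(- (norm q / norm p) *\<^sub>R p) \<bullet> (a + q - a) = 0" using pq by simp
  have 2: "norm (- (norm q / norm p) *\<^sub>R p) = dist a (a + q)" using pos by (simp add: dist_norm)
  have 3: "(- (norm q / norm p) *\<^sub>R p) \<bullet> (y - a) \<le> 0" if "y \<in> T" for y
    using co(1)[OF that] by (simp add: inner_commute[of p])
  have 4: "(LINT x:T|lebesgue. grad f x \<bullet> ((((x - a) \<bullet> p / (p \<bullet> p) - 1) / m) *\<^sub>R p) + f x / m) = integral {0..1} (\<lambda>t. f (linepath a (a + q) t))"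
    if f: "smooth f" for f
  proof -
    have "grad f x \<bullet> ((((x - a) \<bullet> p / (p \<bullet> p) - 1) / m) *\<^sub>R p) + f x / m = (1 / m) * (((x - a) \<bullet> p / (p \<bullet> p) - 1) * (grad f x \<bullet> p) + f x)" for x
      by (simp add: divide_inverse algebra_simps)
    then show ?thesis using I[OF f] m0 by (simp add: m)
  qed
  have 5: "norm ((((x - a) \<bullet> p / (p \<bullet> p) - 1) / m) *\<^sub>R p) \<le> diameter T / m" if "x \<in> T" for x
  proof -
    have "dist a (a + p) \<le> diameter T" by (rule diameter_bounded_bound[OF compact_imp_bounded[OF Tc] aT])
    then have d: "norm p \<le> diameter T" by (simp add: dist_norm)
    have "\<bar>(x - a) \<bullet> p / (p \<bullet> p) - 1\<bar> \<le> 1" using co[OF that] pos by (auto simp: abs_le_iff divide_le_eq field_simps)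
    then have "\<bar>(x - a) \<bullet> p / (p \<bullet> p) - 1\<bar> * norm p \<le> 1 * diameter T" using d by (intro mult_mono) auto
    then have "\<bar>(x - a) \<bullet> p / (p \<bullet> p) - 1\<bar> * norm p / m \<le> diameter T / m" using m0 by (intro divide_right_mono) auto
    then show ?thesis using m0 by simp
  qed
  have 6: "closed_segment a (a + q) edge_of T"
  proof -
    have "T \<inter> {x. (x - a) \<bullet> p = 0} = T \<inter> {x. p \<bullet> x = p \<bullet> a}" by (auto simp: inner_diff_left inner_commute[of p])
    moreover have "(T \<inter> {x. p \<bullet> x = p \<bullet> a}) face_of T"
      by (rule face_of_Int_supporting_hyperplane_ge[OF Tx]) (use co(1) in \<open>auto simp: inner_diff_left inner_commute[of p]\<close>)
    moreover have "aff_dim (closed_segment a (a + q)) = 1" using pq by (simp add: segment_convex_hull aff_dim_convex_hull)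
    ultimately show ?thesis unfolding edge_of_def rectangle_edge_eq[OF T pq, symmetric] by simp
  qed
  have 7: "continuous_on UNIV (\<lambda>x. (((x - a) \<bullet> p / (p \<bullet> p) - 1) / m) *\<^sub>R p)"
    using pos m0 by (intro continuous_intros) auto
  have 8: "a \<noteq> a + q" using pq by simp
  show ?thesis unfolding edge_field_def m_def[symmetric] using 1 2 3 4 5 6 7 8 by blast
qed

lemma rectangle_edge_fields:
  assumes "rectangle T"
  shows "\<exists>E N \<psi>. edge_fields T E N \<psi>"
proof -
  obtain a p q where pq: "p \<noteq> 0" "q \<noteq> 0" "p \<bullet> q = 0" and T: "T = convex hull {a, a + p, a + q, a + p + q}"
    using assms by (auto simp: rectangle_def)
  \<comment> \<open>Read from the corners \<open>a\<close>, \<open>a + p\<close> and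
    \<open>a + q\<close> with suitable directions, the one edge treated above becomes each of the
    four.\<close>
  have pq2: "- p \<noteq> 0" "q \<noteq> 0" "- p \<bullet> q = 0" and pq3: "q \<noteq> 0" "p \<noteq> 0" "q \<bullet> p = 0" and pq4: "- q \<noteq> 0" "p \<noteq> 0" "- q \<bullet> p = 0"
    using pq by (auto simp: inner_commute)
  have T2: "T = convex hull {a + p, a + p + - p, a + p + q, a + p + - p + q}"
    and T3: "T = convex hull {a, a + q, a + p, a + q + p}"
    and T4: "T = convex hull {a + q, a + q + - q, a + q + p, a + q + - q + p}"
    unfolding T by (rule arg_cong[where f="\<lambda>A. convex hull A"]; auto simp: add_ac)+
  let ?e1 = "closed_segment a (a + q)" let ?e2 = "closed_segment (a + p) (a + p + q)"
  let ?e3 = "closed_segment a (a + p)" let ?e4 = "closed_segment (a + q) (a + q + p)"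
  define m where "m = measure lebesgue T"
  note F1 = rectangle_edge_field[OF T pq, folded m_def] and F2 = rectangle_edge_field[OF T2 pq2, folded m_def]
    and F3 = rectangle_edge_field[OF T3 pq3, folded m_def] and F4 = rectangle_edge_field[OF T4 pq4, folded m_def]
  note R1 = rectangle_edge_eq[OF T pq] and R2 = rectangle_edge_eq[OF T2 pq2]
    and R3 = rectangle_edge_eq[OF T3 pq3] and R4 = rectangle_edge_eq[OF T4 pq4]
  have pos: "0 < p \<bullet> p" "0 < q \<bullet> q" using pq by auto
  have mem: "x \<in> ?e1 \<longleftrightarrow> x \<in> T \<and> (x - a) \<bullet> p = 0" "x \<in> ?e2 \<longleftrightarrow> x \<in> T \<and> (x - a) \<bullet> p = p \<bullet> p"
    "x \<in> ?e3 \<longleftrightarrow> x \<in> T \<and> (x - a) \<bullet> q = 0" "x \<in> ?e4 \<longleftrightarrow> x \<in> T \<and> (x - a) \<bullet> q = q \<bullet> q" for x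
    unfolding R1[symmetric] R2[symmetric] R3[symmetric] R4[symmetric]
    by (auto simp: inner_diff_left inner_add_left algebra_simps)
  have V: "a \<in> T" "a + p \<in> T" "a + q \<in> T" "a + p + q \<in> T" unfolding T by (auto intro: hull_inc)
  have ne: "?e1 \<noteq> ?e2" "?e1 \<noteq> ?e3" "?e1 \<noteq> ?e4" "?e2 \<noteq> ?e3" "?e2 \<noteq> ?e4" "?e3 \<noteq> ?e4"
  proof -
    have "a \<in> ?e1" "a \<notin> ?e2" "a + q \<in> ?e1" "a + q \<notin> ?e3" "a \<notin> ?e4" "a \<in> ?e3"  "a + p \<in> ?e2" "a + p \<notin> ?e4"
      using mem V pos pq by (auto simp: inner_diff_left inner_add_left inner_commute)
    then show "?e1 \<noteq> ?e2" "?e1 \<noteq> ?e3" "?e1 \<noteq> ?e4" "?e2 \<noteq> ?e3" "?e2 \<noteq> ?e4" "?e3 \<noteq> ?e4" by metis+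
  qed
  define N where "N e = (if e = ?e1 then - (norm q / norm p) *\<^sub>R p else if e = ?e2 then - (norm q / norm (- p)) *\<^sub>R (- p)
    else if e = ?e3 then - (norm p / norm q) *\<^sub>R q else - (norm p / norm (- q)) *\<^sub>R (- q))" for e
  define \<psi> where "\<psi> e = (if e = ?e1 then (\<lambda>x. (((x - a) \<bullet> p / (p \<bullet> p) - 1) / m) *\<^sub>R p)
    else if e = ?e2 then (\<lambda>x. (((x - (a + p)) \<bullet> (- p) / ((- p) \<bullet> (- p)) - 1) / m) *\<^sub>R (- p))
    else if e = ?e3 then (\<lambda>x. (((x - a) \<bullet> q / (q \<bullet> q) - 1) / m) *\<^sub>R q)
    else (\<lambda>x. (((x - (a + q)) \<bullet> (- q) / ((- q) \<bullet> (- q)) - 1) / m) *\<^sub>R (- q)))" for e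
  have s: "(\<Sum>e\<in>{?e1, ?e2, ?e3, ?e4}. h e) = h ?e1 + (h ?e2 + (h ?e3 + h ?e4))" for h :: "pt set \<Rightarrow> 'a::comm_monoid_add"
    using ne by simp
  have N: "N ?e1 = - (norm q / norm p) *\<^sub>R p" "N ?e2 = - (norm q / norm (- p)) *\<^sub>R (- p)"
    "N ?e3 = - (norm p / norm q) *\<^sub>R q" "N ?e4 = - (norm p / norm (- q)) *\<^sub>R (- q)"
    using ne by (auto simp: N_def)
  have \<psi>: "\<psi> ?e1 = (\<lambda>x. (((x - a) \<bullet> p / (p \<bullet> p) - 1) / m) *\<^sub>R p)"
    "\<psi> ?e2 = (\<lambda>x. (((x - (a + p)) \<bullet> (- p) / ((- p) \<bullet> (- p)) - 1) / m) *\<^sub>R (- p))"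
    "\<psi> ?e3 = (\<lambda>x. (((x - a) \<bullet> q / (q \<bullet> q) - 1) / m) *\<^sub>R q)"
    "\<psi> ?e4 = (\<lambda>x. (((x - (a + q)) \<bullet> (- q) / ((- q) \<bullet> (- q)) - 1) / m) *\<^sub>R (- q))"
    using ne by (auto simp: \<psi>_def)
  have mm: "m = norm p * norm q"
  proof -
    have "m = \<bar>cross p q\<bar>"
      unfolding m_def T by (rule rectangle_measure[OF refl pq])
    moreover have "(cross p q)\<^sup>2 + (p \<bullet> q)\<^sup>2 = (norm p * norm q)\<^sup>2"
      by (simp add: cross_def inner_pt power_mult_distrib power2_norm_eq_inner) (simp add: power2_eq_square algebra_simps)
    then have "(cross p q)\<^sup>2 = (norm p * norm q)\<^sup>2" using pq(3) by simp
    then have "\<bar>cross p q\<bar> = \<bar>norm p * norm q\<bar>" by (metis real_sqrt_abs)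
    ultimately show ?thesis by simp
  qed
  have "edge_fields T {?e1, ?e2, ?e3, ?e4} N \<psi>"
    unfolding edge_fields_def
  proof (intro conjI allI)
    show "card {?e1, ?e2, ?e3, ?e4} \<le> 4" using ne by simp
    show "frontier T \<subseteq> \<Union> {?e1, ?e2, ?e3, ?e4}"
    proof
      fix x assume x: "x \<in> frontier T"
      have "compact T" unfolding T by (simp add: finite_imp_compact_convex_hull)
      then have xT: "x \<in> T" "x \<notin> interior T" using x by (auto simp: frontier_def compact_imp_closed)
      let ?U = "{x. 0 < (x - a) \<bullet> p} \<inter> {x. (x - a) \<bullet> p < p \<bullet> p} \<inter> {x. 0 < (x - a) \<bullet> q} \<inter> {x. (x - a) \<bullet> q < q \<bullet> q}"
      have "open ?U" by (intro open_Int open_Collect_less continuous_intros)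
      moreover have "?U \<subseteq> T" unfolding subset_iff rectangle_coordinates[OF T pq] by simp
      ultimately have "x \<notin> ?U" using xT interior_maximal by blast
      then show "x \<in> \<Union> {?e1, ?e2, ?e3, ?e4}"
        using iffD1[OF rectangle_coordinates[OF T pq, of x] xT(1)] xT(1)
        unfolding Union_insert Un_iff mem by auto
    qed
    show "\<forall>e\<in>{?e1, ?e2, ?e3, ?e4}. edge_field T e (N e) (\<psi> e)"
      using F1 F2 F3 F4 by (simp only: ball_simps N \<psi>)
    show "(\<Sum>e\<in>{?e1, ?e2, ?e3, ?e4}. N e) = 0"
      unfolding s N by simp
    fix x i j
    define y where "y = x - a"
    define \<alpha> \<beta> where "\<alpha> = (x - a) \<bullet> p / (p \<bullet> p)" and "\<beta> = (x - a) \<bullet> q / (q \<bullet> q)"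
    have t2: "(x - (a + p)) \<bullet> (- p) / ((- p) \<bullet> (- p)) = 1 - \<alpha>" "(x - (a + q)) \<bullet> (- q) / ((- q) \<bullet> (- q)) = 1 - \<beta>"
      using pos by (simp_all add: \<alpha>_def \<beta>_def inner_diff_left inner_add_left field_simps)
    have np: "0 < norm p" "0 < norm q" using pq by auto
    have "(\<Sum>e\<in>{?e1, ?e2, ?e3, ?e4}. N e $ i * \<psi> e x $ j) = 
      (norm q / norm p / m) * (p $ i * p $ j) + (norm p / norm q / m) * (q $ i * q $ j)"
      unfolding s N \<psi> t2 \<alpha>_def[symmetric] \<beta>_def[symmetric] by (simp add: divide_inverse algebra_simps)
    \<comment> \<open>The area \<open>norm p * norm q\<close> turns the weights into those of the
      orthogonal projections onto \<open>p\<close> and \<open>q\<close>, which sum to the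
      identity.\<close>
    also have "\<dots> = p $ i * p $ j / (p \<bullet> p) + q $ i * q $ j / (q \<bullet> q)"
      using np unfolding mm power2_norm_eq_inner[symmetric] by (simp add: field_simps power2_eq_square)
    also have "\<dots> = (axis j 1 :: pt) $ i"
      using arg_cong[OF orthogonal_expansion[OF pq, of "axis j 1"], of "\<lambda>v. v $ i"]
      by (simp add: inner_axis' mult.commute)
    also have "\<dots> = of_bool (i = j)" by (auto simp: axis_def)
    finally show "(\<Sum>e\<in>{?e1, ?e2, ?e3, ?e4}. N e $ i * \<psi> e x $ j) = of_bool (i = j)" .
  qed auto
  then show ?thesis by blast
qed

section \<open>Edges in a conforming mesh\<close>

text \<open>The end points of a segment are its extreme points, hence determined by the set up to
  order.\<close>

lemma closed_segment_eqD:
  fixes a b a' b' :: pt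
  assumes "closed_segment a b = closed_segment a' b'"
  shows "a' = a \<and> b' = b \<or> a' = b \<and> b' = a"
proof -
  have e: "x extreme_point_of closed_segment a b \<longleftrightarrow> x = a \<or> x = b"
    "x extreme_point_of closed_segment a' b' \<longleftrightarrow> x = a' \<or> x = b'" for x
    by (rule extreme_point_of_segment)+
  have "x = a \<or> x = b \<longleftrightarrow> x = a' \<or> x = b'" for x
    using e(1)[of x] e(2)[of x] unfolding assms by simp
  then show ?thesis by metis
qed

text \<open>\<open>edge_field\<close> hides the end points under an existential quantifier. Its
  properties do not depend on the orientation of the segment, so they hold for any way of writing
  the edge, and two elements can use one parametrisation of a common edge.\<close>

lemma edge_field_at:
  assumes "edge_field T (closed_segment a b) N \<psi>"
  shows "a \<noteq> b" "N \<bullet> (b - a) = 0" "norm N = dist a b" "y \<in> T \<Longrightarrow> N \<bullet> (y - a) \<le> 0"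
    "smooth f \<Longrightarrow> (LINT x:T|lebesgue. grad f x \<bullet> \<psi> x + f x / measure lebesgue T) =
            integral {0..1} (\<lambda>t. f (linepath a b t))"
proof -
  obtain a' b' where ab: "a' \<noteq> b'" "closed_segment a b = closed_segment a' b'" "N \<bullet> (b' - a') = 0" "norm N = dist a' b'"
    "\<And>y. y \<in> T \<Longrightarrow> N \<bullet> (y - a') \<le> 0"
    "\<And>f. smooth f \<Longrightarrow> (LINT x:T|lebesgue. grad f x \<bullet> \<psi> x + f x / measure lebesgue T) =
            integral {0..1} (\<lambda>t. f (linepath a' b' t))"
    using assms unfolding edge_field_def by blast
  have refl: "integral {0..1} (\<lambda>t. f (linepath b' a' t)) = integral {0..1} (\<lambda>t. f (linepath a' b' t))" if f: "smooth f" for f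
  proof -
    have c: "continuous_on UNIV (\<lambda>t. f (linepath x y t))" for x y
      unfolding linepath_def by (intro continuous_on_compose2[OF smooth_continuous[OF f, of UNIV]] continuous_intros) auto
    have "integral {0..1} (\<lambda>t. f (linepath a' b' t)) = (LINT t|lborel. indicat_real {0..1} t * f (linepath a' b' t))"
      by (rule LINT_Icc_eq_integral[OF c, symmetric])
    also have "\<dots> = (LINT t|lborel. indicat_real {0..1} (1 + (-1) * t) * f (linepath a' b' (1 + (-1) * t)))"
      using lborel_integral_real_affine[of "-1" "\<lambda>t. indicat_real {0..1} t * f (linepath a' b' t)" 1] by simp
    also have "\<dots> = (LINT t|lborel. indicat_real {0..1} t * f (linepath b' a' t))"
      by (intro Bochner_Integration.integral_cong refl) (auto simp: indicator_def linepath_def add.commute)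
    also have "\<dots> = integral {0..1} (\<lambda>t. f (linepath b' a' t))"
      by (rule LINT_Icc_eq_integral[OF c])
    finally show ?thesis ..
  qed
  consider "a = a'" "b = b'" | "a = b'" "b = a'" using closed_segment_eqD[OF ab(2)] by blast
  then have "a \<noteq> b \<and> N \<bullet> (b - a) = 0 \<and> norm N = dist a b \<and> (\<forall>y\<in>T. N \<bullet> (y - a) \<le> 0) \<and>
    (\<forall>f. smooth f \<longrightarrow> (LINT x:T|lebesgue. grad f x \<bullet> \<psi> x + f x / measure lebesgue T) =
            integral {0..1} (\<lambda>t. f (linepath a b t)))"
  proof cases
    case 1
    then show ?thesis using ab by blast
  next
    case 2
    have "N \<bullet> (y - b') = N \<bullet> (y - a') - N \<bullet> (b' - a')" for y by (simp add: inner_diff_right)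
    then have "\<forall>y\<in>T. N \<bullet> (y - a) \<le> 0" using ab(3,5) 2 by simp
    moreover have "N \<bullet> (b - a) = 0" using ab(3) 2 by (simp add: inner_diff_right)
    ultimately show ?thesis using ab refl 2 by (auto simp: dist_commute)
  qed
  then show "a \<noteq> b" "N \<bullet> (b - a) = 0" "norm N = dist a b" "y \<in> T \<Longrightarrow> N \<bullet> (y - a) \<le> 0"
    "smooth f \<Longrightarrow> (LINT x:T|lebesgue. grad f x \<bullet> \<psi> x + f x / measure lebesgue T) =
            integral {0..1} (\<lambda>t. f (linepath a b t))" by blast+
qed

lemma edge_field_segment:
  assumes "edge_field T e N \<psi>"
  obtains a b where "e = closed_segment a b" "edge_field T (closed_segment a b) N \<psi>"
proof -
  obtain a b where "e = closed_segment a b" using assms unfolding edge_field_def by blast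
  then show thesis using that[of a b] assms by simp
qed

text \<open>A face that meets the relative interior of an edge contains the edge. Being proper, it
  has dimension at most 1, while a proper face of it would have smaller dimension than the
  edge.\<close>

lemma face_eq_edge:
  fixes T :: "pt set"
  assumes T: "convex T" and F: "F face_of T" "F \<noteq> T" and e: "e edge_of T" "F \<inter> rel_interior e \<noteq> {}"
  shows "F = e"
proof -
  have eT: "e face_of T" "aff_dim e = 1" using e by (auto simp: edge_of_def)
  have sub: "e \<subseteq> F" using subset_of_face_of[OF F(1)] eT e(2) face_of_imp_subset by blast
  have "aff_dim F < aff_dim T" using face_of_aff_dim_lt[OF T F] .
  then have "aff_dim F \<le> 1" using aff_dim_le_DIM[of T] by simp
  moreover have eF: "e face_of F" using face_of_subset[OF eT(1) sub] F(1) face_of_imp_subset by blast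
  ultimately show ?thesis using face_of_aff_dim_lt[OF face_of_imp_convex[OF F(1) ] eF] eT(2) T by fastforce
qed

section \<open>The boundary of one element\<close>

locale mesh_element =
  fixes T :: "pt set" and E :: "pt set set" and N :: "pt set \<Rightarrow> pt" and \<psi> :: "pt set \<Rightarrow> pt \<Rightarrow> pt"
  assumes compact_T: "compact T" and convex_T: "convex T" and interior_T: "interior T \<noteq> {}"
    and fields: "edge_fields T E N \<psi>"
begin

lemma fieldD: "e \<in> E \<Longrightarrow> edge_field T e (N e) (\<psi> e)" and finite_E: "finite E" and frontier_subset: "frontier T \<subseteq> \<Union>E"
  using fields by (auto simp: edge_fields_def)

lemma edgeD: "e \<in> E \<Longrightarrow> e edge_of T"
  using fieldD edge_field_def by blast

lemma edge_face: "e edge_of T \<Longrightarrow> e face_of T" "e edge_of T \<Longrightarrow> e \<noteq> T" "e edge_of T \<Longrightarrow> e \<subseteq> T" "e edge_of T \<Longrightarrow> e \<inter> interior T = {}"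
  "e edge_of T \<Longrightarrow> rel_interior e \<noteq> {}" "e edge_of T \<Longrightarrow> convex e"
proof -
  assume e: "e edge_of T"
  then show f: "e face_of T" "e \<subseteq> T" by (auto simp: edge_of_def face_of_imp_subset)
  have "aff_dim T = 2" using aff_dim_nonempty_interior[OF interior_T] by simp
  then show "e \<noteq> T" using e by (auto simp: edge_of_def)
  then show "e \<inter> interior T = {}" using face_of_disjoint_interior f(1) by blast
  show "convex e" using f(1) convex_T face_of_imp_convex by blast
  moreover have "e \<noteq> {}" using e by (auto simp: edge_of_def)
  ultimately show "rel_interior e \<noteq> {}" using rel_interior_eq_empty by blast
qed

text \<open>The members of \<open>E\<close> come from an explicit construction, while adjacency is
  obtained in terms of \<open>edge_of\<close>. A relatively interior point of an edge lies on the
  frontier of \<open>T\<close>, hence in a member of \<open>E\<close>, which must be that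
  edge.\<close>

lemma all_edges: "e edge_of T \<Longrightarrow> e \<in> E"
proof -
  assume e: "e edge_of T"
  obtain x where x: "x \<in> rel_interior e" using edge_face(5)[OF e] by blast
  then have xe: "x \<in> e" using rel_interior_subset by blast
  then have "x \<in> T" "x \<notin> interior T" using edge_face[OF e] by auto
  then have "x \<in> frontier T" using compact_T by (simp add: frontier_def compact_imp_closed)
  then obtain e' where e': "e' \<in> E" "x \<in> e'" using frontier_subset by blast
  then have "e' = e" using face_eq_edge[OF convex_T edge_face(1,2)[OF edgeD[OF e'(1)]] e] x by blast
  then show ?thesis using e' by simp
qed

lemma outward:
  assumes "e \<in> E" "x \<in> e" "y \<in> T"
  shows "N e \<bullet> (y - x) \<le> 0" "y \<in> e \<Longrightarrow> N e \<bullet> (y - x) = 0" "N e \<noteq> 0"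
proof -
  obtain a b where ab: "e = closed_segment a b" "edge_field T (closed_segment a b) (N e) (\<psi> e)"
    using edge_field_segment[OF fieldD[OF assms(1)]] by blast
  note f = edge_field_at[OF ab(2)]
  have z: "N e \<bullet> (w - a) = 0" if w: "w \<in> e" for w
  proof -
    obtain t where "w = (1 - t) *\<^sub>R a + t *\<^sub>R b" using w unfolding ab(1) closed_segment_def by blast
    then have "w - a = t *\<^sub>R (b - a)" by (simp add: algebra_simps)
    then show ?thesis using f(2) by simp
  qed
  have d: "N e \<bullet> (y - x) = N e \<bullet> (y - a) - N e \<bullet> (x - a)" by (simp add: inner_diff_right)
  show "N e \<bullet> (y - x) \<le> 0" unfolding d using z[OF assms(2)] f(4)[OF assms(3)] by simp
  show "y \<in> e \<Longrightarrow> N e \<bullet> (y - x) = 0" unfolding d using z assms(2) by simp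
  show "N e \<noteq> 0" using f(1,3) by auto
qed

text \<open>Near \<open>x\<close> the frontier of \<open>T\<close> consists of points of
  \<open>e\<close> and so lies on one line. The open half disc on the inner side is connected,
  misses the frontier and meets \<open>T\<close>, hence lies in \<open>T\<close>.\<close>

lemma half_disc:
  assumes e: "e \<in> E" and x: "x \<in> rel_interior e"
  obtains r where "0 < r" "ball x r \<inter> {y. N e \<bullet> (y - x) < 0} \<subseteq> interior T"
proof -
  have xe: "x \<in> e" using x rel_interior_subset by blast
  have xT: "x \<in> T" using edge_face(3)[OF edgeD[OF e]] xe by blast
  have "x \<notin> e'" if "e' \<in> E - {e}" for e'
    using face_eq_edge[OF convex_T edge_face(1,2)[OF edgeD[of e']] edgeD[OF e]] x that by blast
  then have "x \<in> - \<Union>(E - {e})" by blast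
  moreover have "closed (\<Union>(E - {e}))"
  proof (rule closed_Union)
    show "\<forall>S\<in>E - {e}. closed S" using edge_field_segment[OF fieldD] by (metis DiffD1 closed_segment)
  qed (use finite_E in auto)
  ultimately obtain r where r: "0 < r" "ball x r \<subseteq> - \<Union>(E - {e})"
    using openE open_Compl by metis
  define Hd where "Hd = ball x r \<inter> {y. N e \<bullet> (y - x) < 0}"
  have hs: "{y. N e \<bullet> (y - x) < 0} = {y. N e \<bullet> y < N e \<bullet> x}" by (simp add: inner_diff_right)
  have Hc: "connected Hd" unfolding Hd_def hs
    by (intro convex_connected convex_Int convex_ball convex_halfspace_lt)
  have Ho: "open Hd" unfolding Hd_def hs by (intro open_Int open_ball open_halfspace_lt)
  have Hf: "Hd \<inter> frontier T = {}"
  proof (rule ccontr)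
    assume "Hd \<inter> frontier T \<noteq> {}"
    then obtain y where y: "y \<in> Hd" "y \<in> frontier T" by blast
    then obtain e' where e': "e' \<in> E" "y \<in> e'" using frontier_subset by blast
    have "e' = e" using y(1) r(2) e' unfolding Hd_def by blast
    moreover have "y \<in> T" using y(2) compact_T by (metis compact_imp_closed frontier_subset_closed subsetD)
    ultimately have "N e \<bullet> (y - x) = 0" using outward(2)[OF e xe] e' by blast
    then show False using y(1) by (simp add: Hd_def)
  qed
  have "Hd \<inter> T \<noteq> {}"
  proof -
    obtain c where c: "c \<in> interior T" using interior_T by blast
    \<comment> \<open>An interior point is strictly on the inner side, since it can be moved a
      little along \<open>N e\<close> without leaving \<open>T\<close>.\<close>
    have neg: "N e \<bullet> (c - x) < 0"
    proof -
      obtain s where s: "0 < s" "ball c s \<subseteq> T" using c by (auto simp: mem_interior)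
      define k where "k = s / (2 * norm (N e))"
      have n: "N e \<noteq> 0" using outward(3)[OF e xe xT] .
      have k: "0 < k" using s n by (simp add: k_def)
      have "c + k *\<^sub>R N e \<in> ball c s" using s n by (simp add: dist_norm k_def)
      then have "N e \<bullet> (c + k *\<^sub>R N e - x) \<le> 0" using outward(1)[OF e xe] s(2) by blast
      moreover have "N e \<bullet> (c + k *\<^sub>R N e - x) = N e \<bullet> (c - x) + k * (N e \<bullet> N e)" by (simp add: algebra_simps)
      moreover have "0 < k * (N e \<bullet> N e)" using k n by simp
      ultimately show ?thesis by linarith
    qed
    \<comment> \<open>A short step from \<open>x\<close> towards \<open>c\<close> stays in
      \<open>T\<close> and in the ball and goes to the inner side.\<close>
    define t where "t = min 1 (r / (2 * (norm (c - x) + 1)))"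
    have t: "0 < t" "t \<le> 1" using r by (auto simp: t_def add_nonneg_pos)
    define y where "y = x - t *\<^sub>R (x - c)"
    have "y \<in> T" using mem_interior_convex_shrink[OF convex_T c xT t] interior_subset unfolding y_def by blast
    moreover have "y \<in> ball x r"
    proof -
      have "t * norm (x - c) \<le> r / (2 * (norm (c - x) + 1)) * norm (x - c)" by (intro mult_right_mono) (auto simp: t_def)
      also have "\<dots> \<le> r / 2 * (norm (x - c) / (norm (x - c) + 1))" by (simp add: norm_minus_commute field_simps)
      also have "\<dots> \<le> r / 2 * 1" using r by (intro mult_left_mono) (auto simp: divide_le_eq add_nonneg_pos)
      also have "\<dots> < r" using r by simp
      finally show ?thesis using t by (simp add: y_def dist_norm)
    qed
    moreover have "N e \<bullet> (y - x) = t * (N e \<bullet> (c - x))" by (simp add: y_def algebra_simps)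
    then have "N e \<bullet> (y - x) < 0" using t neg by (simp add: mult_pos_neg)
    ultimately show ?thesis by (auto simp: Hd_def)
  qed
  then have "Hd \<subseteq> T" using connected_Int_frontier[OF Hc] Hf by blast
  then have "Hd \<subseteq> interior T" using Ho by (simp add: interior_maximal)
  then show thesis using that[OF r(1)] by (simp add: Hd_def)
qed

end

section \<open>Adjacent elements of a mesh\<close>

locale mesh =
  fixes \<Omega> :: "pt set" and \<T> :: "pt set set" and E :: "pt set \<Rightarrow> pt set set" and N :: "pt set \<Rightarrow> pt set \<Rightarrow> pt"
    and \<psi> :: "pt set \<Rightarrow> pt set \<Rightarrow> pt \<Rightarrow> pt"
  assumes domain: "polygonal_domain \<Omega>" and conforming: "conforming_mesh \<Omega> \<T>"
    and element: "\<And>T. T \<in> \<T> \<Longrightarrow> mesh_element T (E T) (N T) (\<psi> T)"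
begin

lemma omega: "open \<Omega>" "bounded \<Omega>" "interior (closure \<Omega>) = \<Omega>"
  using domain by (auto simp: polygonal_domain_def)

lemma mesh_facts: "finite \<T>" "\<Union>\<T> = closure \<Omega>" "T \<in> \<T> \<Longrightarrow> T' \<in> \<T> \<Longrightarrow> (T \<inter> T') face_of T"
  "T \<in> \<T> \<Longrightarrow> T' \<in> \<T> \<Longrightarrow> (T \<inter> T') face_of T'"
  using conforming by (auto simp: conforming_mesh_def)

text \<open>This rests on \<open>interior (closure \<Omega>) = \<Omega>\<close>, the absence of
  slits.\<close>

lemma interior_subset_omega: "T \<in> \<T> \<Longrightarrow> interior T \<subseteq> \<Omega>"
  using mesh_facts(2) omega(3) interior_mono by (metis Union_upper)

lemma face_meets_interior:
  assumes "T \<in> \<T>" "F face_of T" "F \<inter> interior T \<noteq> {}"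
  shows "F = T"
  using assms face_of_disjoint_interior by blast

lemma interiors_disjoint:
  assumes "T \<in> \<T>" "T' \<in> \<T>" "interior T \<inter> interior T' \<noteq> {}"
  shows "T = T'"
proof -
  have "(T \<inter> T') \<inter> interior T \<noteq> {}" "(T \<inter> T') \<inter> interior T' \<noteq> {}"
    using assms(3) interior_subset by blast+
  then have "T \<inter> T' = T" "T \<inter> T' = T'"
    using face_meets_interior assms(1,2) mesh_facts(3,4) by metis+
  then show ?thesis by simp
qed

text \<open>Both vectors are orthogonal to the edge and have its length, so they agree up to sign.
  If they were equal, both elements would contain a half disc on the same side of the edge and their
  interiors would meet.\<close>

lemma opposite_normals:
  assumes T: "T \<in> \<T>" "T' \<in> \<T>" "T \<noteq> T'" and e: "e \<in> E T" "e \<in> E T'"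
  shows "N T' e = - N T e"
proof -
  interpret A: mesh_element T "E T" "N T" "\<psi> T" using element[OF T(1)] .
  interpret B: mesh_element T' "E T'" "N T'" "\<psi> T'" using element[OF T(2)] .
  obtain a b where ab: "e = closed_segment a b" "edge_field T (closed_segment a b) (N T e) (\<psi> T e)"
    using edge_field_segment[OF A.fieldD[OF e(1)]] by blast
  have ab': "edge_field T' (closed_segment a b) (N T' e) (\<psi> T' e)" using B.fieldD[OF e(2)] ab(1) by simp
  note f = edge_field_at[OF ab(2)] and f' = edge_field_at[OF ab']
  have "b - a \<noteq> 0" using f(1) by simp
  \<comment> \<open>In the plane the vectors orthogonal to \<open>b - a\<close> are the multiples of
    \<open>rot (b - a)\<close>.\<close>
  have par: "n = rot (b - a) \<or> n = - rot (b - a)" if n: "n \<bullet> (b - a) = 0" "norm n = norm (b - a)" for n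
  proof -
    define u where "u = b - a"
    have u: "u \<noteq> 0" using f(1) by (simp add: u_def)
    have nn: "n \<bullet> n = u \<bullet> u" using n(2) by (simp add: u_def dot_square_norm)
    have nu: "n \<bullet> u = 0" using n(1) by (simp add: u_def)
    define r where "r = (n \<bullet> rot u) / (u \<bullet> u)"
    have ru: "rot u \<noteq> 0" "rot u \<bullet> u = 0" using u norm_rot[of u] by (auto simp: rot_inner cross_def simp del: norm_rot)
    have "n = ((n \<bullet> rot u) / (rot u \<bullet> rot u)) *\<^sub>R rot u + ((n \<bullet> u) / (u \<bullet> u)) *\<^sub>R u"
      by (rule orthogonal_expansion[OF ru(1) u ru(2)])
    moreover have ruu: "rot u \<bullet> rot u = u \<bullet> u" by (simp add: dot_square_norm)
    ultimately have nr: "n = r *\<^sub>R rot u" using nu by (simp add: r_def)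
    then have "r * r * (u \<bullet> u) = u \<bullet> u" using nn ruu by (metis inner_scaleR_left inner_scaleR_right mult.assoc)
    then have "r * r = 1" using u by simp
    then have "r = 1 \<or> r = -1" by (metis power2_eq_square power2_eq_1_iff)
    then show ?thesis using nr by (auto simp: u_def)
  qed
  have "N T' e = N T e \<or> N T' e = - N T e"
    using par[OF f(2)] par[OF f'(2)] f(3) f'(3) by (metis dist_norm minus_minus norm_minus_commute)
  moreover have "N T' e \<noteq> N T e"
  proof
    assume eq: "N T' e = N T e"
    obtain x where x: "x \<in> rel_interior e" using A.edge_face(5)[OF A.edgeD[OF e(1)]] by blast
    obtain r where r: "0 < r" "ball x r \<inter> {y. N T e \<bullet> (y - x) < 0} \<subseteq> interior T" using A.half_disc[OF e(1) x] by blast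
    obtain r' where r': "0 < r'" "ball x r' \<inter> {y. N T e \<bullet> (y - x) < 0} \<subseteq> interior T'" using B.half_disc[OF e(2) x] eq by metis
    \<comment> \<open>Half the smaller radius, measured in units of the normal, so that
      \<open>y\<close> lies in both half discs.\<close>
    define s where "s = min r r' / (2 * norm (N T e))"
    have xe: "x \<in> e" using x rel_interior_subset by blast
    have n: "N T e \<noteq> 0" using f(1,3) by auto
    have s: "0 < s" using r r' n by (simp add: s_def)
    define y where "y = x - s *\<^sub>R N T e"
    have "norm (s *\<^sub>R N T e) = min r r' / 2" using s n r r' by (simp add: s_def)
    then have "y \<in> ball x r" "y \<in> ball x r'" using r r' by (auto simp: y_def dist_norm)
    moreover have "N T e \<bullet> (y - x) < 0" using s n by (simp add: y_def)
    ultimately have "y \<in> interior T" "y \<in> interior T'" using r r' by blast+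
    then show False using interiors_disjoint[OF T(1,2)] T(3) by blast
  qed
  ultimately show ?thesis by blast
qed

text \<open>The relative interior of the edge has a point in \<Omega>. It is not interior to
  \<open>T\<close>, so a second element contains it, and the intersection of the two elements is a
  face of \<open>T\<close> through that point, hence the edge. That the whole relative interior lies
  in \<Omega>, and not only the point found first, is seen from the half discs on the two sides:
  they fill a disc up to a line, so the disc lies in the closure of \<Omega>.\<close>

lemma neighbour:
  assumes T: "T \<in> \<T>" and e: "e \<in> E T" and nb: "\<not> e \<subseteq> frontier \<Omega>"
  obtains T' where "T' \<in> \<T>" "T' \<noteq> T" "e \<in> E T'" "rel_interior e \<subseteq> \<Omega>"
proof -
  interpret A: mesh_element T "E T" "N T" "\<psi> T" using element[OF T] .
  have eT: "e edge_of T" using A.edgeD[OF e] .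
  obtain x1 where x1: "x1 \<in> e" "x1 \<notin> frontier \<Omega>" using nb by blast
  have "x1 \<in> closure \<Omega>" using x1(1) A.edge_face(3)[OF eT] T mesh_facts(2) by blast
  then have "x1 \<in> \<Omega>" using x1(2) omega(1) by (simp add: frontier_def interior_open)
  moreover have "x1 \<in> closure (rel_interior e)"
    using x1(1) convex_closure_rel_interior[OF A.edge_face(6)[OF eT]] closure_subset by blast
  ultimately have "\<Omega> \<inter> rel_interior e \<noteq> {}" using omega(1) open_Int_closure_eq_empty by blast
  then obtain x where x: "x \<in> \<Omega>" "x \<in> rel_interior e" by blast
  have xe: "x \<in> e" using x(2) rel_interior_subset by blast
  have cl: "closed T'" if "T' \<in> \<T>" for T' using mesh_element.compact_T[OF element[OF that]] by (rule compact_imp_closed)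
  have "\<exists>T'\<in>\<T>. T' \<noteq> T \<and> x \<in> T'"
  proof (rule ccontr)
    assume "\<not> (\<exists>T'\<in>\<T>. T' \<noteq> T \<and> x \<in> T')"
    then have "x \<in> \<Omega> \<inter> - \<Union>(\<T> - {T})" using x(1) by blast
    moreover have "open (\<Omega> \<inter> - \<Union>(\<T> - {T}))"
      using omega(1) mesh_facts(1) cl by (intro open_Int open_Compl closed_Union) auto
    moreover have "\<Omega> \<inter> - \<Union>(\<T> - {T}) \<subseteq> T" using mesh_facts(2) closure_subset[of \<Omega>] by blast
    ultimately have "x \<in> interior T" using interior_maximal by blast
    then show False using A.edge_face(4)[OF eT] xe by blast
  qed
  then obtain T' where T': "T' \<in> \<T>" "T' \<noteq> T" "x \<in> T'" by blast
  interpret B: mesh_element T' "E T'" "N T'" "\<psi> T'" using element[OF T'(1)] .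
  \<comment> \<open>Otherwise \<open>T\<close> would be a face of \<open>T'\<close> that meets the
    interior of \<open>T'\<close>, hence all of \<open>T'\<close>.\<close>
  have "T \<inter> T' \<noteq> T"
  proof
    assume "T \<inter> T' = T"
    then have "T face_of T'" "T \<subseteq> T'" using mesh_facts(4)[OF T T'(1)] by auto
    then have "T face_of T'" "interior T \<subseteq> interior T'" by (simp_all add: interior_mono)
    then have "T = T'" using A.interior_T interior_subset by (intro face_meets_interior[OF T'(1)]) blast+
    then show False using T'(2) by simp
  qed
  then have "T \<inter> T' = e"
    using face_eq_edge[OF A.convex_T mesh_facts(3)[OF T T'(1)] _ eT] x T' xe A.edge_face(3)[OF eT] by blast
  then have "e edge_of T'" using mesh_facts(4)[OF T T'(1)] eT by (simp add: edge_of_def)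
  then have e': "e \<in> E T'" by (rule B.all_edges)
  have op: "N T' e = - N T e" by (rule opposite_normals[OF T T'(1) _ e e']) (use T' in auto)
  have "rel_interior e \<subseteq> \<Omega>"
  proof
    fix y assume y: "y \<in> rel_interior e"
    have ye: "y \<in> e" using y rel_interior_subset by blast
    obtain r where r: "0 < r" "ball y r \<inter> {z. N T e \<bullet> (z - y) < 0} \<subseteq> interior T" using A.half_disc[OF e y] by blast
    obtain r' where r': "0 < r'" "ball y r' \<inter> {z. N T' e \<bullet> (z - y) < 0} \<subseteq> interior T'" using B.half_disc[OF e' y] by blast
    have lt: "z \<in> closure \<Omega>" if "z \<in> ball y (min r r')" "N T e \<bullet> (z - y) \<noteq> 0" for z
    proof (cases "N T e \<bullet> (z - y) < 0")
      case True
      then have "z \<in> interior T" using r that by auto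
      then show ?thesis using interior_subset T mesh_facts(2) by blast
    next
      case False
      then have "N T' e \<bullet> (z - y) < 0" using that(2) op by simp
      then have "z \<in> interior T'" using r' that by auto
      then show ?thesis using interior_subset T'(1) mesh_facts(2) by blast
    qed
    have n: "N T e \<noteq> 0" using A.outward(3)[OF e ye] A.edge_face(3)[OF eT] ye by blast
    have "ball y (min r r') \<subseteq> closure \<Omega>"
    proof
      fix z assume z: "z \<in> ball y (min r r')"
      show "z \<in> closure \<Omega>"
      proof (rule ccontr)
        \<comment> \<open>A ball around \<open>z\<close> would then avoid the closure and would have
          to lie on the line through the edge.\<close>
        assume "z \<notin> closure \<Omega>"
        then have "z \<in> ball y (min r r') \<inter> - closure \<Omega>" using z by blast
        moreover have "open (ball y (min r r') \<inter> - closure \<Omega>)" by (intro open_Int open_ball open_Compl closed_closure)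
        ultimately obtain s where s: "0 < s" "ball z s \<subseteq> ball y (min r r') \<inter> - closure \<Omega>"
          using open_contains_ball by meson
        define k where "k = s / (2 * norm (N T e))"
        have k: "0 < k" using s n by (simp add: k_def)
        have "z + k *\<^sub>R N T e \<in> ball z s" using s n by (simp add: dist_norm k_def)
        moreover have "z \<in> ball z s" using s by simp
        ultimately have "N T e \<bullet> (z - y) = 0" "N T e \<bullet> (z + k *\<^sub>R N T e - y) = 0" using lt s(2) by blast+
        then have "k * (N T e \<bullet> N T e) = 0" by (simp add: inner_diff_right inner_add_right)
        then show False using k n by simp
      qed
    qed
    then have "y \<in> interior (closure \<Omega>)"
      unfolding mem_interior using r(1) r'(1) by (intro exI[of _ "min r r'"]) simp
    then show "y \<in> \<Omega>" using omega(3) by simp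
  qed
  then show thesis using that[OF T'(1,2) e'] by blast
qed

text \<open>The sum is regrouped by edges. An edge not contained in the boundary belongs to exactly
  two elements: a third one would make three normals pairwise opposite, which forces them to be
  0.\<close>

lemma sum_over_sides_zero:
  fixes t :: "pt set \<Rightarrow> pt set \<Rightarrow> real"
  assumes bd: "\<And>T e. T \<in> \<T> \<Longrightarrow> e \<in> E T \<Longrightarrow> e \<subseteq> frontier \<Omega> \<Longrightarrow> t T e = 0"
    and opp: "\<And>T T' e. T \<in> \<T> \<Longrightarrow> T' \<in> \<T> \<Longrightarrow> T \<noteq> T' \<Longrightarrow> e \<in> E T \<Longrightarrow> e \<in> E T' \<Longrightarrow> \<not> e \<subseteq> frontier \<Omega> \<Longrightarrow> t T' e = - t T e"
  shows "(\<Sum>T\<in>\<T>. \<Sum>e\<in>E T. t T e) = 0"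
proof -
  have fE: "finite (E T)" if "T \<in> \<T>" for T using mesh_element.finite_E[OF element[OF that]] .
  define \<E> where "\<E> = \<Union>(E ` \<T>)"
  have f\<E>: "finite \<E>" using mesh_facts(1) fE by (auto simp: \<E>_def)
  have "(\<Sum>T\<in>\<T>. \<Sum>e\<in>E T. t T e) = (\<Sum>T\<in>\<T>. \<Sum>e\<in>\<E>. if e \<in> E T then t T e else 0)"
  proof (rule sum.cong[OF refl])
    fix T assume T: "T \<in> \<T>"
    then have "E T = \<E> \<inter> {e. e \<in> E T}" by (auto simp: \<E>_def)
    then show "(\<Sum>e\<in>E T. t T e) = (\<Sum>e\<in>\<E>. if e \<in> E T then t T e else 0)"
      using sum.inter_restrict[OF f\<E>, of "t T" "{e. e \<in> E T}"] by simp
  qed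
  also have "\<dots> = (\<Sum>e\<in>\<E>. \<Sum>T\<in>\<T>. if e \<in> E T then t T e else 0)" by (rule sum.swap)
  also have "\<dots> = (\<Sum>e\<in>\<E>. 0)"
  proof (rule sum.cong[OF refl])
    fix e assume "e \<in> \<E>"
    then obtain T where T: "T \<in> \<T>" "e \<in> E T" by (auto simp: \<E>_def)
    show "(\<Sum>T\<in>\<T>. if e \<in> E T then t T e else 0) = 0"
    proof (cases "e \<subseteq> frontier \<Omega>")
      case True
      then show ?thesis using bd by (intro sum.neutral) auto
    next
      case False
      obtain T' where T': "T' \<in> \<T>" "T' \<noteq> T" "e \<in> E T'" using neighbour[OF T False] by blast
      have only: "S = T \<or> S = T'" if S: "S \<in> \<T>" "e \<in> E S" for S
      proof (rule ccontr)
        assume "\<not> (S = T \<or> S = T')"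
        then have "N S e = - N T e" "N S e = - N T' e" "N T' e = - N T e"
          using opposite_normals[OF T(1) S(1) _ T(2) S(2)] opposite_normals[OF T'(1) S(1) _ T'(3) S(2)]
            opposite_normals[OF T(1) T'(1) _ T(2) T'(3)] T'(2) by blast+
        then have "N T e + N T e = 0" by simp
        then have "2 *\<^sub>R N T e = 0" by (simp only: scaleR_2)
        then have "N T e = 0" by simp
        moreover obtain x where "x \<in> rel_interior e"
          using mesh_element.edge_face(5)[OF element[OF T(1)]] mesh_element.edgeD[OF element[OF T(1)] T(2)] by blast
        moreover have "e \<subseteq> T" using mesh_element.edge_face(3)[OF element[OF T(1)]] mesh_element.edgeD[OF element[OF T(1)] T(2)] by blast
        ultimately show False
          using mesh_element.outward(3)[OF element[OF T(1)] T(2)] rel_interior_subset by blast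
      qed
      have "(\<Sum>S\<in>\<T>. if e \<in> E S then t S e else 0) = (\<Sum>S\<in>{T, T'}. if e \<in> E S then t S e else 0)"
        using mesh_facts(1) T T' only by (intro sum.mono_neutral_right) auto
      also have "\<dots> = t T e + t T' e" using T T' by simp
      also have "\<dots> = 0" using opp[OF T(1) T'(1) _ T(2) T'(3) False] T'(2) by auto
      finally show ?thesis .
    qed
  qed
  finally show ?thesis by simp
qed

end

text \<open>For smooth \<open>g\<close> with gradient \<open>G\<close> and an edge field \<psi> this
  is the mean of \<open>g\<close> over the edge. With a weak gradient it serves as the definition of
  that mean.\<close>

definition edge_mean :: "pt set \<Rightarrow> (pt \<Rightarrow> pt) \<Rightarrow> fn \<Rightarrow> (2 \<Rightarrow> fn) \<Rightarrow> real" where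
  "edge_mean T \<psi> g G = (LINT x:T|lebesgue. (\<Sum>i\<in>UNIV. G i x * \<psi> x $ i) + g x / measure lebesgue T)"

lemma shrink_aff2: "shrink c n x = aff2 ((1 / real (n + 2)) *\<^sub>R c) (axis 1 (1 - 1 / real (n + 2))) (axis 2 (1 - 1 / real (n + 2))) x"
  by (intro pt_eqI) (simp_all add: shrink_def aff2_def axis_def algebra_simps)

text \<open>Inverse of \<open>shrink\<close>; it carries the edge field of an element to the
  contracted copy.\<close>

definition unshrink :: "pt \<Rightarrow> nat \<Rightarrow> pt \<Rightarrow> pt" where
  "unshrink c n y = c + (1 / (1 - 1 / real (n + 2))) *\<^sub>R (y - c)"

lemma shrink_factor: "0 < 1 - 1 / real (n + 2)" "1 - 1 / real (n + 2) < 1"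
  by (simp_all add: field_simps)

lemma unshrink_shrink: "unshrink c n (shrink c n x) = x"
  using shrink_factor(1)[of n] unfolding unshrink_def shrink_def by simp

lemma continuous_shrink: "continuous_on A (shrink c n)" and continuous_unshrink: "continuous_on A (unshrink c n)"
  unfolding shrink_def unshrink_def by (intro continuous_intros)+

lemma unshrink_tendsto: "(\<lambda>n. unshrink c n y) \<longlonglongrightarrow> y"
proof -
  have "(\<lambda>n. 1 / real (n + 2)) \<longlonglongrightarrow> 0"
    using LIMSEQ_ignore_initial_segment[OF lim_1_over_n, of 2] .
  then have r: "(\<lambda>n. 1 - 1 / real (n + 2)) \<longlonglongrightarrow> 1 - 0" by (rule tendsto_diff[OF tendsto_const])
  have "(\<lambda>n. c + (1 / (1 - 1 / real (n + 2))) *\<^sub>R (y - c)) \<longlonglongrightarrow> c + (1 / (1 - 0)) *\<^sub>R (y - c)"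
    by (intro tendsto_intros r) auto
  then show ?thesis by (simp add: unshrink_def)
qed

context mesh_element
begin

lemma psi_continuous: "e \<in> E \<Longrightarrow> continuous_on UNIV (\<psi> e)"
  and psi_bound: "e \<in> E \<Longrightarrow> x \<in> T \<Longrightarrow> norm (\<psi> e x) \<le> diameter T / measure lebesgue T"
  using fieldD unfolding edge_field_def by blast+

lemma measure_pos: "0 < measure lebesgue T"
proof -
  have "\<not> negligible T" using interior_T open_not_negligible[OF open_interior] negligible_subset interior_subset by metis
  then show ?thesis using lmeasurable_compact[OF compact_T] by (simp add: negligible_iff_measure zero_less_measure_iff)
qed

lemma negligible_frontier: "negligible (frontier T)"
  using convex_T by (rule negligible_convex_frontier)

lemma aeq_interior_integral: "(LINT x:T|lebesgue. f x) = (LINT x:interior T|lebesgue. f x)" for f :: fn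
proof -
  have "frontier T \<in> null_sets lebesgue" using negligible_frontier by (simp add: negligible_iff_null_sets)
  then have ae: "AE x in lebesgue. x \<notin> frontier T" by (rule AE_not_in)
  have "aeq UNIV (\<lambda>x. indicat_real T x * f x) (\<lambda>x. indicat_real (interior T) x * f x)"
    unfolding aeq_def using ae
  proof (rule AE_mp, intro AE_I2 impI)
    fix x assume "x \<notin> frontier T"
    then show "indicat_real T x * f x = indicat_real (interior T) x * f x"
      using interior_subset closure_subset by (auto simp: frontier_def indicator_def)
  qed
  from aeq_set_integral[OF this] show ?thesis by (simp add: set_lebesgue_integral_def)
qed

text \<open>\<open>c\<close> may lie on the frontier of \<open>T\<close>, as it does when it is a
  point of the edge, and the contracted copies then touch the frontier too.\<close>

lemma shrunk_edge_mean_tendsto: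
  assumes e: "e \<in> E" and c: "c \<in> T" and S: "interior T \<subseteq> \<Omega>" and g: "g \<in> L2 \<Omega>" "\<And>i. G i \<in> L2 \<Omega>"
  shows "(\<lambda>n. LINT y:shrink c n ` T|lebesgue. (\<Sum>i\<in>UNIV. (1 - 1 / real (n + 2)) * G i y * \<psi> e (unshrink c n y) $ i) + g y / measure lebesgue T)
     \<longlonglongrightarrow> edge_mean T (\<psi> e) g G"
proof -
  \<comment> \<open>Cutting with the interior removes only a null set and puts the sets where
    \<open>g\<close> and \<open>G\<close> are square integrable.\<close>
  let ?A = "\<lambda>n. interior T \<inter> shrink c n ` T"
  define b where "b = diameter T / measure lebesgue T"
  have iT: "open (interior T)" "bounded (interior T)" "interior T \<in> lmeasurable"
    using compact_T bounded_subset[OF compact_imp_bounded interior_subset] by (auto intro: lmeasurable_open)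
  have gT: "g \<in> L2 (interior T)" "G i \<in> L2 (interior T)" for i using L2_subset[OF _ S] g by auto
  have int: "set_integrable lebesgue (interior T) f" if "f \<in> L2 (interior T)" for f
    using L2_mult_integrable[OF that L2_const[OF iT(3), of 1]] by simp
  \<comment> \<open>The dominating function: the ratio of the contraction is below 1 and the
    components of the field are bounded by \<open>b\<close>.\<close>
  define w where "w x = (\<Sum>i\<in>UNIV. \<bar>G i x\<bar> * b) + \<bar>g x\<bar> / measure lebesgue T" for x
  have Kc: "compact (shrink c n ` T)" for n
    by (intro compact_continuous_image continuous_shrink compact_T)
  have shrinkT: "shrink c n ` T \<subseteq> T" for n
  proof clarify
    fix x assume "x \<in> T"
    then have "(1 - (1 - 1 / real (n + 2))) *\<^sub>R c + (1 - 1 / real (n + 2)) *\<^sub>R x \<in> T"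
      using convex_T c shrink_factor[of n] by (intro convexD_alt) auto
    then show "shrink c n x \<in> T" by (simp add: shrink_def algebra_simps)
  qed
  have psib: "\<bar>\<psi> e (unshrink c n y) $ i\<bar> \<le> b" if "y \<in> shrink c n ` T" for n y i
  proof -
    have "unshrink c n y \<in> T" using that unshrink_shrink by auto
    then show ?thesis using component_le_norm_cart[of "\<psi> e (unshrink c n y)" i] psi_bound[OF e] unfolding b_def by (meson order_trans)
  qed
  have b: "0 \<le> b" using psib[of "shrink c 0 c" 0 1] c by (meson abs_ge_zero imageI order_trans)
  have cont: "continuous_on UNIV (\<lambda>y. \<psi> e (unshrink c n y) $ i)" for n i
    by (intro continuous_intros continuous_on_compose2[OF psi_continuous[OF e] continuous_unshrink]) auto
  have L: "(\<lambda>n. LINT y:?A n|lebesgue. (\<Sum>i\<in>UNIV. (1 - 1 / real (n + 2)) * G i y * \<psi> e (unshrink c n y) $ i) + g y / measure lebesgue T)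
     \<longlonglongrightarrow> (LINT x:interior T|lebesgue. (\<Sum>i\<in>UNIV. G i x * \<psi> e x $ i) + g x / measure lebesgue T)"
  proof (rule shrink_integral_tendsto[where w=w])
    show "negligible (frontier (interior T))" using convex_T by (intro negligible_convex_frontier convex_interior)
    show "set_integrable lebesgue (interior T) w"
      unfolding w_def sum_2
      by (intro set_integral_add set_integrable_mult_left set_integrable_divide set_integrable_abs int gT impI)
    have cont': "continuous_on UNIV (\<lambda>y. \<psi> e y $ i)" for i
      by (intro continuous_intros psi_continuous[OF e])
    have p: "(\<lambda>y. \<psi> e y $ i) \<in> L2 (interior T)" "(\<lambda>y. \<psi> e (unshrink c n y) $ i) \<in> L2 (interior T)" for i n
      using iT by (auto intro!: L2_continuous cont cont')
    have "set_integrable lebesgue (interior T) (\<lambda>x. (\<Sum>i\<in>UNIV. G i x * \<psi> e x $ i) + g x / measure lebesgue T)"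
      unfolding sum_2 by (intro set_integral_add set_integrable_divide int gT L2_mult_integrable p impI)
    then show "set_borel_measurable lebesgue (interior T) (\<lambda>x. (\<Sum>i\<in>UNIV. G i x * \<psi> e x $ i) + g x / measure lebesgue T)"
      by (auto simp: set_integrable_def set_borel_measurable_def)
    show "set_borel_measurable lebesgue (?A n) (\<lambda>y. (\<Sum>i\<in>UNIV. (1 - 1 / real (n + 2)) * G i y * \<psi> e (unshrink c n y) $ i) + g y / measure lebesgue T)" for n
    proof -
      have "set_integrable lebesgue (interior T) (\<lambda>y. (\<Sum>i\<in>UNIV. (1 - 1 / real (n + 2)) * (G i y * \<psi> e (unshrink c n y) $ i)) + g y / measure lebesgue T)"
        unfolding sum_2 by (intro set_integral_add set_integrable_divide set_integrable_mult_right int gT L2_mult_integrable p impI)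
      then have "set_integrable lebesgue (?A n) (\<lambda>y. (\<Sum>i\<in>UNIV. (1 - 1 / real (n + 2)) * (G i y * \<psi> e (unshrink c n y) $ i)) + g y / measure lebesgue T)"
        by (rule set_integrable_subset) (use Kc iT in \<open>auto simp: borel_compact\<close>)
      then show ?thesis by (auto simp: set_integrable_def set_borel_measurable_def mult.assoc)
    qed
    show "\<bar>(\<Sum>i\<in>UNIV. (1 - 1 / real (n + 2)) * G i y * \<psi> e (unshrink c n y) $ i) + g y / measure lebesgue T\<bar> \<le> w y" if "y \<in> ?A n" for n y
    proof -
      have "\<bar>(1 - 1 / real (n + 2)) * G i y * \<psi> e (unshrink c n y) $ i\<bar> \<le> 1 * \<bar>G i y\<bar> * b" for i
        unfolding abs_mult using that shrink_factor[of n] by (intro mult_mono psib) auto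
      then have "\<bar>\<Sum>i\<in>UNIV. (1 - 1 / real (n + 2)) * G i y * \<psi> e (unshrink c n y) $ i\<bar> \<le> (\<Sum>i\<in>UNIV. \<bar>G i y\<bar> * b)"
        by (intro order_trans[OF sum_abs sum_mono]) simp
      then show ?thesis unfolding w_def by (intro order_trans[OF abs_triangle_ineq add_mono]) (auto simp: abs_divide)
    qed
    show "(\<lambda>n. (\<Sum>i\<in>UNIV. (1 - 1 / real (n + 2)) * G i x * \<psi> e (unshrink c n x) $ i) + g x / measure lebesgue T)
       \<longlonglongrightarrow> (\<Sum>i\<in>UNIV. G i x * \<psi> e x $ i) + g x / measure lebesgue T" for x
    proof -
      have "(\<lambda>n. 1 / real (n + 2)) \<longlonglongrightarrow> 0" using LIMSEQ_ignore_initial_segment[OF lim_1_over_n, of 2] .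
      then have r: "(\<lambda>n. 1 - 1 / real (n + 2)) \<longlonglongrightarrow> 1 - 0" by (rule tendsto_diff[OF tendsto_const])
      have p: "(\<lambda>n. \<psi> e (unshrink c n x)) \<longlonglongrightarrow> \<psi> e x"
        using psi_continuous[OF e] unshrink_tendsto by (rule continuous_on_tendsto_compose) auto
      have "(\<lambda>n. (\<Sum>i\<in>UNIV. (1 - 1 / real (n + 2)) * G i x * \<psi> e (unshrink c n x) $ i) + g x / measure lebesgue T)
       \<longlonglongrightarrow> (\<Sum>i\<in>UNIV. (1 - 0) * G i x * \<psi> e x $ i) + g x / measure lebesgue T"
        by (intro tendsto_add tendsto_sum tendsto_mult tendsto_const r tendsto_vec_nth p)
      then show ?thesis by simp
    qed
    show "\<forall>\<^sub>F n in sequentially. x \<in> ?A n" if "x \<in> interior (interior T)" for x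
      by (rule eventually_mono[OF shrink_image_eventually[of x T c]]) (use that in auto)
  qed auto
  have cut: "(LINT y:?A n|lebesgue. f y) = (LINT y:shrink c n ` T|lebesgue. f y)" for n and f :: fn
  proof -
    have "frontier T \<in> null_sets lebesgue" using negligible_frontier by (simp add: negligible_iff_null_sets)
    then have ae: "AE x in lebesgue. x \<notin> frontier T" by (rule AE_not_in)
    have "aeq UNIV (\<lambda>x. indicat_real (?A n) x * f x) (\<lambda>x. indicat_real (shrink c n ` T) x * f x)"
      unfolding aeq_def using ae
    proof (rule AE_mp, intro AE_I2 impI)
      fix x assume "x \<notin> frontier T"
      then have "x \<in> T \<Longrightarrow> x \<in> interior T" using closure_subset by (auto simp: frontier_def)
      then show "indicat_real (?A n) x * f x = indicat_real (shrink c n ` T) x * f x"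
        using shrinkT[of n] by (auto simp: indicator_def)
    qed
    from aeq_set_integral[OF this] show ?thesis by (simp add: set_lebesgue_integral_def)
  qed
  show ?thesis using L unfolding cut edge_mean_def aeq_interior_integral .
qed

text \<open>Change of variables by \<open>shrink\<close>: the chain rule accounts for the factor at
  the gradient, the determinant for the square in front. The result depends on the edge, on
  \<open>c\<close> and on \<open>n\<close> but no longer on \<open>T\<close>, which is why two
  neighbours are contracted towards the same point.\<close>

lemma shrunk_edge_mean_smooth:
  assumes e: "edge_field T (closed_segment a b) (N e) (\<psi> e)" "e \<in> E" and \<phi>: "smooth \<phi>"
  shows "(LINT y:shrink c n ` T|lebesgue. (\<Sum>i\<in>UNIV. (1 - 1 / real (n + 2)) * pd i \<phi> y * \<psi> e (unshrink c n y) $ i) + \<phi> y / measure lebesgue T)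
     = (1 - 1 / real (n + 2))\<^sup>2 * integral {0..1} (\<lambda>t. \<phi> (shrink c n (linepath a b t)))"
proof -
  let ?r = "1 - 1 / real (n + 2)"
  let ?F = "\<lambda>y. (\<Sum>i\<in>UNIV. ?r * pd i \<phi> y * \<psi> e (unshrink c n y) $ i) + \<phi> y / measure lebesgue T"
  let ?f = "\<lambda>x. \<phi> (shrink c n x)"
  have eq: "shrink c n x = (1 / real (n + 2)) *\<^sub>R c + ?r *\<^sub>R x" for x by (simp add: shrink_def algebra_simps)
  have f: "smooth ?f" unfolding eq by (rule smooth_affine[OF \<phi>])
  have gr: "pd i ?f x = ?r * pd i \<phi> (shrink c n x)" for i x
    unfolding eq by (rule pd_affine(1)[OF smooth_differentiable[OF \<phi>]])
  have Fc: "continuous_on UNIV ?F"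
    by (intro continuous_intros smooth_continuous smooth_pd \<phi> continuous_on_compose2[OF psi_continuous[OF e(2)] continuous_unshrink]) (use measure_pos in auto)
  have "(LINT y:shrink c n ` T|lebesgue. ?F y) = \<bar>cross (axis 1 ?r) (axis 2 ?r)\<bar> * (LINT x:T|lebesgue. ?F (shrink c n x))"
    unfolding shrink_aff2 det_aff2[symmetric] by (rule aff2_integral[OF compact_T]) (use Fc in simp)
  also have "\<bar>cross (axis 1 ?r) (axis 2 ?r)\<bar> = ?r\<^sup>2"
    by (simp add: cross_def axis_def power2_eq_square)
  also have "(LINT x:T|lebesgue. ?F (shrink c n x)) = (LINT x:T|lebesgue. grad ?f x \<bullet> \<psi> e x + ?f x / measure lebesgue T)"
    unfolding unshrink_shrink inner_vec_def grad_def by (simp add: gr)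
  also have "\<dots> = integral {0..1} (\<lambda>t. ?f (linepath a b t))"
    by (rule edge_field_at(5)[OF e(1) f])
  finally show ?thesis .
qed

end

context mesh
begin

text \<open>The critical points are those that stay on the frontier of \<open>T\<close>. Such a
  point other than \<open>c\<close> lies strictly between \<open>c\<close> and some \<open>x\<close>
  in \<open>T\<close>; by the face property both lie in one edge, which is \<open>e\<close> because
  it contains \<open>c\<close>. The contracted point is then in the relative interior of
  \<open>e\<close>.\<close>

lemma shrink_subset:
  assumes T: "T \<in> \<T>" and e: "e \<in> E T" and c: "c \<in> rel_interior e" "rel_interior e \<subseteq> \<Omega>"
  shows "shrink c n ` T \<subseteq> \<Omega>"
proof
  interpret A: mesh_element T "E T" "N T" "\<psi> T" using element[OF T] .
  note eT = A.edgeD[OF e]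
  have ce: "c \<in> e" using c(1) rel_interior_subset by blast
  have cT: "c \<in> T" using ce A.edge_face(3)[OF eT] by blast
  fix y assume "y \<in> shrink c n ` T"
  then obtain x where x: "x \<in> T" "y = shrink c n x" by blast
  have y: "y = (1 - (1 - 1 / real (n + 2))) *\<^sub>R c + (1 - 1 / real (n + 2)) *\<^sub>R x" by (simp add: x(2) shrink_def algebra_simps)
  have yT: "y \<in> T" unfolding y using A.convex_T cT x(1) shrink_factor[of n] by (intro convexD_alt) auto
  show "y \<in> \<Omega>"
  proof (cases "y \<in> interior T")
    case True
    then show ?thesis using interior_subset_omega[OF T] by blast
  next
    case False
    have xe: "x \<in> e"
    proof (cases "x = c")
      case True
      then show ?thesis using ce by simp
    next
      case ne: False
      have "y \<in> frontier T" using False yT closure_subset by (auto simp: frontier_def)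
      then obtain e' where e': "e' \<in> E T" "y \<in> e'" using A.frontier_subset by blast
      have "y \<in> open_segment c x"
        unfolding in_segment using ne y shrink_factor[of n] by blast
      then have "c \<in> e'" "x \<in> e'"
        using face_ofD[OF A.edge_face(1)[OF A.edgeD[OF e'(1)]] _ cT x(1) e'(2)] by blast+
      moreover have "e' = e"
        using face_eq_edge[OF A.convex_T A.edge_face(1,2)[OF A.edgeD[OF e'(1)]] eT] c(1) \<open>c \<in> e'\<close> by blast
      ultimately show ?thesis by simp
    qed
    have "x - (1 / real (n + 2)) *\<^sub>R (x - c) \<in> rel_interior e"
      using rel_interior_convex_shrink[OF A.edge_face(6)[OF eT] c(1) xe, of "1 / real (n + 2)"] by simp
    moreover have "y = x - (1 / real (n + 2)) *\<^sub>R (x - c)" by (simp add: x(2) shrink_def algebra_simps)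
    ultimately show ?thesis using c(2) by auto
  qed
qed

text \<open>Contracting both elements towards a point in the relative interior of \<open>e\<close> moves them into \<open>\<Omega>\<close>,
  where \<open>g\<close> is a limit of smooth functions, while they keep the contracted edge in common.\<close>

lemma edge_mean_single_valued:
  assumes T: "T \<in> \<T>" "T' \<in> \<T>" and e: "e \<in> E T" "e \<in> E T'" "rel_interior e \<subseteq> \<Omega>"
    and g: "g \<in> L2 \<Omega>" "\<And>i. G i \<in> L2 \<Omega>" "\<And>i. is_weak_deriv \<Omega> (idx1 i) g (G i)"
  shows "edge_mean T (\<psi> T e) g G = edge_mean T' (\<psi> T' e) g G"
proof -
  interpret A: mesh_element T "E T" "N T" "\<psi> T" using element[OF T(1)] .
  interpret B: mesh_element T' "E T'" "N T'" "\<psi> T'" using element[OF T(2)] .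
  obtain a b where ab: "e = closed_segment a b" "edge_field T (closed_segment a b) (N T e) (\<psi> T e)"
    using edge_field_segment[OF A.fieldD[OF e(1)]] by blast
  have ab': "edge_field T' (closed_segment a b) (N T' e) (\<psi> T' e)" using B.fieldD[OF e(2)] ab(1) by simp
  obtain c where c: "c \<in> rel_interior e" using A.edge_face(5)[OF A.edgeD[OF e(1)]] by blast
  have cT: "c \<in> T" "c \<in> T'"
    using c rel_interior_subset A.edge_face(3)[OF A.edgeD[OF e(1)]] B.edge_face(3)[OF B.edgeD[OF e(2)]] by blast+
  define I where "I n S h F = (LINT y:shrink c n ` S|lebesgue. (\<Sum>i\<in>UNIV. (1 - 1 / real (n + 2)) * F i y * \<psi> S e (unshrink c n y) $ i) + h y / measure lebesgue S)"
    for n S h and F :: "2 \<Rightarrow> fn"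
  have "I n T g G = I n T' g G" for n
  proof -
    \<comment> \<open>One compact subset of \<Omega> for both copies, so that a single smooth
      sequence approximates \<open>g\<close> on both.\<close>
    define K where "K = shrink c n ` T \<union> shrink c n ` T'"
    have comp: "compact (shrink c n ` T)" "compact (shrink c n ` T')"
      by (intro compact_continuous_image continuous_shrink A.compact_T B.compact_T)+
    have K: "compact K" "K \<subseteq> \<Omega>"
      using comp shrink_subset[OF T(1) e(1) c e(3)] shrink_subset[OF T(2) e(2) c e(3)] by (auto simp: K_def)
    obtain \<phi> where p: "\<And>k. smooth (\<phi> k)" "(\<lambda>k. L2_norm K (\<lambda>x. g x - \<phi> k x)) \<longlonglongrightarrow> 0"
      "\<And>i. (\<lambda>k. L2_norm K (\<lambda>x. G i x - pd i (\<phi> k) x)) \<longlonglongrightarrow> 0"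
      using weak_gradient_approx_seq[OF omega(1,2) K g] by blast
    have lim: "(\<lambda>k. I n S (\<phi> k) (\<lambda>i. pd i (\<phi> k))) \<longlonglongrightarrow> I n S g G"
      if S: "compact (shrink c n ` S)" "shrink c n ` S \<subseteq> K" "continuous_on UNIV (\<psi> S e)" for S
    proof -
      let ?C = "shrink c n ` S"
      have Cl: "?C \<in> sets lebesgue" "bounded ?C" using S(1) by (auto simp: borel_compact compact_imp_bounded)
      have sm: "f \<in> L2 ?C" "f \<in> L2 K" if "smooth f" for f
        using Cl K by (auto intro!: L2_continuous smooth_continuous that simp: borel_compact compact_imp_bounded)
      have gK: "g \<in> L2 K" "G i \<in> L2 K" for i using L2_subset[OF _ K(2)] g K(1) by (auto simp: borel_compact)
      have gC: "g \<in> L2 ?C" "G i \<in> L2 ?C" for i using L2_subset[OF _ S(2) Cl(1)] gK by auto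
      have ps: "(\<lambda>y. \<psi> S e (unshrink c n y) $ i) \<in> L2 ?C" for i
        using Cl by (intro L2_continuous continuous_intros continuous_on_compose2[OF S(3) continuous_unshrink]) auto
      have one: "(\<lambda>y. 1) \<in> L2 ?C" by (rule sm) simp
      have Ieq: "I n S h F = (\<Sum>i\<in>UNIV. (1 - 1 / real (n + 2)) * L2_inner ?C (F i) (\<lambda>y. \<psi> S e (unshrink c n y) $ i)) + L2_inner ?C h (\<lambda>y. 1) / measure lebesgue S"
        if h: "h \<in> L2 ?C" "\<And>i. F i \<in> L2 ?C" for h and F :: "2 \<Rightarrow> fn"
      proof -
        have i1: "set_integrable lebesgue ?C (\<lambda>y. (1 - 1 / real (n + 2)) * (F i y * \<psi> S e (unshrink c n y) $ i))" for i
          using h ps by (intro set_integrable_mult_right L2_mult_integrable)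
        have i2: "set_integrable lebesgue ?C (\<lambda>y. h y * 1 / measure lebesgue S)"
          using h one by (intro set_integrable_divide L2_mult_integrable)
        have "I n S h F = (LINT y:?C|lebesgue. ((1 - 1 / real (n + 2)) * (F 1 y * \<psi> S e (unshrink c n y) $ 1) + (1 - 1 / real (n + 2)) * (F 2 y * \<psi> S e (unshrink c n y) $ 2)) + h y * 1 / measure lebesgue S)"
          by (simp add: I_def sum_2 mult.assoc)
        also have "\<dots> = (\<Sum>i\<in>UNIV. (1 - 1 / real (n + 2)) * L2_inner ?C (F i) (\<lambda>y. \<psi> S e (unshrink c n y) $ i)) + L2_inner ?C h (\<lambda>y. 1) / measure lebesgue S"
          unfolding set_integral_add(2)[OF set_integral_add(1)[OF i1 i1] i2] set_integral_add(2)[OF i1 i1]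
          by (simp add: sum_2 L2_inner_def)
        finally show ?thesis .
      qed
      have small: "(\<lambda>k. L2_norm ?C (f k)) \<longlonglongrightarrow> 0" if "(\<lambda>k. L2_norm K (f k)) \<longlonglongrightarrow> 0" "\<And>k. f k \<in> L2 K" for f :: "nat \<Rightarrow> fn"
        by (rule real_tendsto_sandwich[OF _ _ tendsto_const that(1)]) (use L2_norm_mono_set[OF that(2) S(2) Cl(1)] in auto)
      have l1: "(\<lambda>k. L2_norm ?C (\<lambda>x. g x - \<phi> k x)) \<longlonglongrightarrow> 0"
        by (rule small[OF p(2)]) (intro L2_diff gK sm p)
      have l2: "(\<lambda>k. L2_norm ?C (\<lambda>x. G i x - pd i (\<phi> k) x)) \<longlonglongrightarrow> 0" for i
        by (rule small[OF p(3)]) (intro L2_diff gK sm smooth_pd p)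
      have I1: "I n S (\<phi> k) (\<lambda>i. pd i (\<phi> k)) = (\<Sum>i\<in>UNIV. (1 - 1 / real (n + 2)) * L2_inner ?C (pd i (\<phi> k)) (\<lambda>y. \<psi> S e (unshrink c n y) $ i)) + L2_inner ?C (\<phi> k) (\<lambda>y. 1) / measure lebesgue S" for k
        by (rule Ieq) (intro sm smooth_pd p)+
      show ?thesis
        unfolding I1 Ieq[OF gC] divide_inverse
        by (intro tendsto_add tendsto_sum tendsto_mult tendsto_const L2_inner_tendsto gC ps one sm smooth_pd p(1) l1 l2)
    qed
    \<comment> \<open>For smooth functions both sides are the same integral over the contracted
      edge.\<close>
    have eq: "I n T (\<phi> k) (\<lambda>i. pd i (\<phi> k)) = I n T' (\<phi> k) (\<lambda>i. pd i (\<phi> k))" for k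
      unfolding I_def A.shrunk_edge_mean_smooth[OF ab(2) e(1) p(1)] B.shrunk_edge_mean_smooth[OF ab' e(2) p(1)] ..
    have "(\<lambda>k. I n T (\<phi> k) (\<lambda>i. pd i (\<phi> k))) \<longlonglongrightarrow> I n T g G"
      by (rule lim[OF comp(1) _ A.psi_continuous[OF e(1)]]) (simp add: K_def)
    moreover have "(\<lambda>k. I n T (\<phi> k) (\<lambda>i. pd i (\<phi> k))) \<longlonglongrightarrow> I n T' g G"
      unfolding eq by (rule lim[OF comp(2) _ B.psi_continuous[OF e(2)]]) (simp add: K_def)
    ultimately show ?thesis by (rule LIMSEQ_unique)
  qed
  moreover have "(\<lambda>n. I n T g G) \<longlonglongrightarrow> edge_mean T (\<psi> T e) g G"
    unfolding I_def by (rule A.shrunk_edge_mean_tendsto[OF e(1) cT(1) interior_subset_omega[OF T(1)] g(1,2)])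
  moreover have "(\<lambda>n. I n T' g G) \<longlonglongrightarrow> edge_mean T' (\<psi> T' e) g G"
    unfolding I_def by (rule B.shrunk_edge_mean_tendsto[OF e(2) cT(2) interior_subset_omega[OF T(2)] g(1,2)])
  ultimately show ?thesis using LIMSEQ_unique by simp
qed

end

section \<open>The estimate on one element\<close>

definition gnorm :: "pt set \<Rightarrow> (2 \<Rightarrow> fn) \<Rightarrow> real" where
  "gnorm S G = sqrt (\<Sum>i\<in>UNIV. (L2_norm S (G i))\<^sup>2)"

lemma gnorm_nonneg [simp]: "0 \<le> gnorm S G"
  by (simp add: gnorm_def sum_nonneg)

lemma gnorm_sq: "(gnorm S G)\<^sup>2 = (\<Sum>i\<in>UNIV. (L2_norm S (G i))\<^sup>2)"
  by (simp add: gnorm_def sum_nonneg)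

lemma L2_norm_le_gnorm: "L2_norm S (G i) \<le> gnorm S G"
proof -
  have "(L2_norm S (G i))\<^sup>2 \<le> (\<Sum>i\<in>UNIV. (L2_norm S (G i))\<^sup>2)" by (intro member_le_sum) auto
  then show ?thesis unfolding gnorm_def by (rule real_le_rsqrt)
qed

text \<open>The disc contains the concentric square of side \<open>r\<close>.\<close>

lemma measure_lower_bound:
  assumes T: "compact T" "cball x r \<subseteq> T" "0 < r"
  shows "r\<^sup>2 \<le> measure lebesgue (T :: pt set)"
proof -
  let ?Q = "cbox (\<chi> i. x $ i - r / 2) (\<chi> i. x $ i + r / 2) :: pt set"
  have "?Q \<subseteq> cball x r"
  proof
    fix y assume "y \<in> ?Q"
    then have y: "\<And>i. x $ i - r / 2 \<le> y $ i \<and> y $ i \<le> x $ i + r / 2" by (simp add: mem_box_cart)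
    have "\<bar>(y - x) $ i\<bar> \<le> r / 2" for i using y[of i] unfolding vector_minus_component by arith
    from this[of 1] this[of 2] have "norm (y - x) \<le> r" using norm_le_l1_cart[of "y - x"] by (simp add: sum_2)
    then show "y \<in> cball x r" by (simp add: dist_norm norm_minus_commute)
  qed
  then have "?Q \<subseteq> T" using T(2) by blast
  then have "measure lebesgue ?Q \<le> measure lebesgue T"
    using T(1) by (intro measure_mono_fmeasurable lmeasurable_compact) auto
  moreover have "measure lebesgue ?Q = r\<^sup>2"
  proof -
    have "x \<in> ?Q" using T(3) by (simp add: mem_box_cart)
    then have "?Q \<noteq> {}" by blast
    then have "measure lborel ?Q = r\<^sup>2" by (subst content_cbox_cart) (auto simp: UNIV_2 power2_eq_square)
    then show ?thesis by simp
  qed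
  ultimately show ?thesis by simp
qed

text \<open>The estimates see the shape of the element only through the quotient of the squared
  diameter and the area; this form fits triangles and rectangles alike.\<close>

locale regular_element = mesh_element +
  fixes \<sigma> :: real
  assumes sigma: "0 \<le> \<sigma>" and regular: "(diameter T)\<^sup>2 \<le> \<sigma>\<^sup>2 * measure lebesgue T"
begin

abbreviation (input) "S \<equiv> interior T"
abbreviation (input) "A \<equiv> measure lebesgue T"
abbreviation (input) "d \<equiv> diameter T"

lemma S_facts: "open S" "bounded S" "S \<in> lmeasurable" "S \<subseteq> T" "measure lebesgue S = A"
proof -
  show o: "open S" "bounded S" "S \<in> lmeasurable" "S \<subseteq> T"
    using compact_T bounded_subset[OF compact_imp_bounded interior_subset] interior_subset by (auto intro: lmeasurable_open)
  have "measure lebesgue B = (LINT x:B|lebesgue. 1)" if "B \<in> lmeasurable" for B :: "pt set"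
    using that by (simp add: set_lebesgue_integral_def fmeasurable_def)
  then show "measure lebesgue S = A"
    using aeq_interior_integral[of "\<lambda>x. 1"] o(3) lmeasurable_compact[OF compact_T] by metis
qed

lemma d_nonneg: "0 \<le> d"
  using diameter_ge_0[OF compact_imp_bounded[OF compact_T]] .

lemma dist_le_d: "x \<in> T \<Longrightarrow> y \<in> T \<Longrightarrow> norm (x - y) \<le> d"
  using diameter_bounded_bound[OF compact_imp_bounded[OF compact_T]] by (simp add: dist_norm)

lemma smooth_L2: "smooth f \<Longrightarrow> f \<in> L2 S"
  using S_facts by (intro L2_continuous smooth_continuous) auto

lemma cont_L2: "continuous_on UNIV f \<Longrightarrow> f \<in> L2 S"
  using S_facts by (intro L2_continuous) auto

lemma const_L2: "(\<lambda>x. c) \<in> L2 S"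
  by (rule cont_L2) simp

lemma inner_one: "L2_inner S (\<lambda>x. 1) (\<lambda>x. 1) = A"
  using S_facts(3) by (simp add: L2_inner_def set_lebesgue_integral_def fmeasurable_def S_facts(5))

text \<open>\<open>c\<close> is the mean of \<open>g\<close>, for which the squared distance is the
  defect in \<open>poincare_convex\<close> divided by the area. The factor 2 rounds up
  \<open>sqrt 2\<close>.\<close>

lemma poincare_element:
  assumes g: "g \<in> L2 S" "\<And>i. G i \<in> L2 S" "\<And>i. is_weak_deriv S (idx1 i) g (G i)"
  obtains c where "L2_norm S (\<lambda>x. g x - c) \<le> 2 * \<sigma> * d * gnorm S G"
proof -
  define I where "I = L2_inner S g (\<lambda>x. 1)"
  define c where "c = I / A"
  have P: "A * L2_inner S g g \<le> I\<^sup>2 + 2 * d ^ 4 * (gnorm S G)\<^sup>2"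
    using poincare_convex[OF compact_T convex_T interior_T dist_le_d d_nonneg g]
    unfolding I_def gnorm_sq L2_norm_sq S_facts(5) .
  have A: "0 < A" by (rule measure_pos)
  have cc: "(\<lambda>x. c) \<in> L2 S" "(\<lambda>x. c * 1) \<in> L2 S" by (rule const_L2)+
  have "(L2_norm S (\<lambda>x. g x - c))\<^sup>2 = L2_inner S (\<lambda>x. g x - c * 1) (\<lambda>x. g x - c * 1)" by (simp add: L2_norm_sq)
  also have "\<dots> = L2_inner S g g - 2 * c * I + c\<^sup>2 * A"
    using g(1) cc(2) const_L2[of 1] L2_diff[OF g(1) cc(2)] unfolding I_def
    by (simp only: L2_inner_diff L2_inner_diff_right L2_inner_cmult L2_inner_cmult_right inner_one L2_inner_commute[of S "\<lambda>x. 1" g])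
      (simp add: power2_eq_square algebra_simps)
  also have "\<dots> = (A * L2_inner S g g - I\<^sup>2) / A" using A by (simp add: c_def power2_eq_square field_simps)
  also have "\<dots> \<le> (2 * d ^ 4 * (gnorm S G)\<^sup>2) / A" using P A by (intro divide_right_mono) auto
  also have "\<dots> = 2 * d\<^sup>2 * (gnorm S G)\<^sup>2 * (d\<^sup>2 / A)" by (simp add: eval_nat_numeral)
  also have "\<dots> \<le> 2 * d\<^sup>2 * (gnorm S G)\<^sup>2 * \<sigma>\<^sup>2"
    using regular A by (intro mult_left_mono) (auto simp: divide_le_eq)
  also have "\<dots> \<le> (2 * \<sigma> * d * gnorm S G)\<^sup>2" by (simp add: power_mult_distrib mult_ac)
  finally have "L2_norm S (\<lambda>x. g x - c) \<le> 2 * \<sigma> * d * gnorm S G"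
    by (rule power2_le_imp_le) (use sigma d_nonneg in auto)
  then show thesis by (rule that)
qed

text \<open>If \<open>F\<close> and \<open>W\<close> are the gradients of \<open>h\<close> and \<open>w\<close>, then this is the mean of \<open>h w\<close> over \<open>e\<close>, by
  the product rule.\<close>

definition bform :: "pt set \<Rightarrow> fn \<Rightarrow> (2 \<Rightarrow> fn) \<Rightarrow> fn \<Rightarrow> (2 \<Rightarrow> fn) \<Rightarrow> real" where
  "bform e h F w W = (\<Sum>i\<in>UNIV. L2_inner S (F i) (\<lambda>x. \<psi> e x $ i * w x) + L2_inner S h (\<lambda>x. \<psi> e x $ i * W i x)) + L2_inner S h w / A"

lemma psi_L2:
  assumes "e \<in> E" "continuous_on UNIV w"
  shows "(\<lambda>x. \<psi> e x $ i * w x) \<in> L2 S"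
  by (intro cont_L2 continuous_intros psi_continuous assms)

lemma bform_one:
  assumes e: "e \<in> E" and g: "g \<in> L2 S" "\<And>i. G i \<in> L2 S"
  shows "bform e g G (\<lambda>x. 1) (\<lambda>i x. 0) = edge_mean T (\<psi> e) g G"
proof -
  have p: "(\<lambda>x. \<psi> e x $ i) \<in> L2 S" for i using psi_L2[OF e, of "\<lambda>x. 1"] by simp
  have i1: "set_integrable lebesgue S (\<lambda>x. G i x * \<psi> e x $ i)" for i by (intro L2_mult_integrable g p)
  have i2: "set_integrable lebesgue S (\<lambda>x. g x * 1 / A)" by (intro set_integrable_divide L2_mult_integrable g const_L2)
  have "edge_mean T (\<psi> e) g G = (LINT x:S|lebesgue. (G 1 x * \<psi> e x $ 1 + G 2 x * \<psi> e x $ 2) + g x * 1 / A)"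
    unfolding edge_mean_def aeq_interior_integral by (simp add: sum_2)
  also have "\<dots> = L2_inner S (G 1) (\<lambda>x. \<psi> e x $ 1) + L2_inner S (G 2) (\<lambda>x. \<psi> e x $ 2) + L2_inner S g (\<lambda>x. 1) / A"
    unfolding set_integral_add(2)[OF set_integral_add(1)[OF i1 i1] i2] set_integral_add(2)[OF i1 i1]
    by (simp add: L2_inner_def)
  also have "\<dots> = bform e g G (\<lambda>x. 1) (\<lambda>i x. 0)"
    by (simp add: bform_def sum_2 L2_inner_def set_lebesgue_integral_def)
  finally show ?thesis ..
qed

text \<open>\<open>bform\<close> is symmetric in its two functions with their gradients, so the
  factor 1 can be moved to the place where \<open>bform_one\<close> applies.\<close>

lemma bform_smooth:
  assumes e: "e \<in> E" "e = closed_segment a b" and v: "smooth v"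
  shows "bform e (\<lambda>x. 1) (\<lambda>i x. 0) v (\<lambda>i. pd i v) = integral {0..1} (\<lambda>t. v (linepath a b t))"
proof -
  have "bform e (\<lambda>x. 1) (\<lambda>i x. 0) v (\<lambda>i. pd i v) = bform e v (\<lambda>i. pd i v) (\<lambda>x. 1) (\<lambda>i x. 0)"
    by (simp add: bform_def L2_inner_def set_lebesgue_integral_def mult.commute)
  also have "\<dots> = edge_mean T (\<psi> e) v (\<lambda>i. pd i v)"
    by (intro bform_one e smooth_L2 smooth_pd v)
  also have "\<dots> = (LINT x:T|lebesgue. grad v x \<bullet> \<psi> e x + v x / A)"
    by (simp add: edge_mean_def inner_vec_def grad_def)
  also have "\<dots> = integral {0..1} (\<lambda>t. v (linepath a b t))"
    by (rule edge_field_at(5)[OF _ v]) (use fieldD[OF e(1)] e(2) in simp)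
  finally show ?thesis .
qed

lemma bform_bound:
  assumes e: "e \<in> E" and h: "h \<in> L2 S" "\<And>i. F i \<in> L2 S" and w: "continuous_on UNIV w" "\<And>i. continuous_on UNIV (W i)"
  shows "\<bar>bform e h F w W\<bar> \<le> d / A * (\<Sum>i\<in>UNIV. L2_norm S (F i) * L2_norm S w + L2_norm S h * L2_norm S (W i)) + L2_norm S h * L2_norm S w / A"
proof -
  have A: "0 < A" by (rule measure_pos)
  have b: "\<bar>L2_inner S f (\<lambda>x. \<psi> e x $ i * u x)\<bar> \<le> d / A * (L2_norm S f * L2_norm S u)"
    if "f \<in> L2 S" "continuous_on UNIV u" for f u i
  proof -
    have "\<bar>L2_inner S f (\<lambda>x. \<psi> e x $ i * u x)\<bar> \<le> L2_norm S f * L2_norm S (\<lambda>x. \<psi> e x $ i * u x)"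
      by (intro L2_Cauchy_Schwarz that psi_L2 e)
    also have "\<dots> \<le> L2_norm S f * (d / A * L2_norm S u)"
    proof (intro mult_left_mono L2_norm_bounded_mult cont_L2 that)
      show "(\<lambda>x. \<psi> e x $ i) \<in> borel_measurable lebesgue"
        by (intro measurable_completion) (simp, intro borel_measurable_continuous_onI continuous_intros psi_continuous e)
      show "\<bar>\<psi> e x $ i\<bar> \<le> d / A" if "x \<in> S" for x
        using component_le_norm_cart[of "\<psi> e x" i] psi_bound[OF e, of x] that S_facts(4) by (meson order_trans subsetD)
    qed (use A d_nonneg in auto)
    finally show ?thesis by (simp add: mult_ac)
  qed
  have c: "\<bar>L2_inner S h w / A\<bar> \<le> L2_norm S h * L2_norm S w / A"
    using A L2_Cauchy_Schwarz[OF h(1) cont_L2[OF w(1)]] by (simp add: divide_right_mono)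
  have "\<bar>\<Sum>i\<in>UNIV. L2_inner S (F i) (\<lambda>x. \<psi> e x $ i * w x) + L2_inner S h (\<lambda>x. \<psi> e x $ i * W i x)\<bar>
     \<le> (\<Sum>i\<in>UNIV. d / A * (L2_norm S (F i) * L2_norm S w) + d / A * (L2_norm S h * L2_norm S (W i)))"
    by (intro order_trans[OF sum_abs sum_mono] order_trans[OF abs_triangle_ineq add_mono] b h w)
  also have "\<dots> = d / A * (\<Sum>i\<in>UNIV. L2_norm S (F i) * L2_norm S w + L2_norm S h * L2_norm S (W i))"
    by (simp add: sum_distrib_left distrib_left)
  finally show ?thesis unfolding bform_def using c by (intro order_trans[OF abs_triangle_ineq add_mono])
qed

text \<open>Bilinear expansion of the edge mean of \<open>(g - c) * (v - m)\<close>. The terms with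
  \<open>c\<close> cancel because \<open>m\<close> is the edge mean of \<open>v\<close>, so
  \<open>c\<close> is free and can be the same for all edges of the element.\<close>

lemma bform_split:
  assumes e: "e \<in> E" and g: "g \<in> L2 S" "\<And>i. G i \<in> L2 S" and v: "smooth v"
    and m: "m = bform e (\<lambda>x. 1) (\<lambda>i x. 0) v (\<lambda>i. pd i v)"
  shows "bform e g G v (\<lambda>i. pd i v) = bform e (\<lambda>x. g x - c) G (\<lambda>x. v x - m) (\<lambda>i. pd i v) + m * edge_mean T (\<psi> e) g G"
proof -
  have vc: "continuous_on UNIV v" "continuous_on UNIV (pd i v)" for i by (intro smooth_continuous smooth_pd v)+
  have P: "(\<lambda>x. \<psi> e x $ i) \<in> L2 S" "(\<lambda>x. \<psi> e x $ i * v x) \<in> L2 S" "(\<lambda>x. \<psi> e x $ i * pd j v x) \<in> L2 S" for i j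
    using psi_L2[OF e, of "\<lambda>x. 1"] psi_L2[OF e] vc by auto
  have one: "(\<lambda>x. 1) \<in> L2 S" "v \<in> L2 S" by (auto intro: const_L2 cont_L2 vc)
  have A: "A \<noteq> 0" using measure_pos by simp
  have mP: "(\<lambda>x. m * \<psi> e x $ i) \<in> L2 S" "(\<lambda>x. m * 1) \<in> L2 S" "(\<lambda>x. c * 1) \<in> L2 S" for i
    by (intro L2_cmult P one)+
  have s: "bform e (\<lambda>x. g x - c) G (\<lambda>x. v x - m) (\<lambda>i. pd i v) =
    (\<Sum>i\<in>UNIV. L2_inner S (G i) (\<lambda>x. \<psi> e x $ i * v x - m * \<psi> e x $ i) + L2_inner S (\<lambda>x. g x - c * 1) (\<lambda>x. \<psi> e x $ i * pd i v x))
     + L2_inner S (\<lambda>x. g x - c * 1) (\<lambda>x. v x - m * 1) / A"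
    by (simp add: bform_def algebra_simps)
  have s': "\<dots> = (\<Sum>i\<in>UNIV. L2_inner S (G i) (\<lambda>x. \<psi> e x $ i * v x) - m * L2_inner S (G i) (\<lambda>x. \<psi> e x $ i)
       + (L2_inner S g (\<lambda>x. \<psi> e x $ i * pd i v x) - c * L2_inner S (\<lambda>x. 1) (\<lambda>x. \<psi> e x $ i * pd i v x)))
     + (L2_inner S g v - c * L2_inner S (\<lambda>x. 1) v - m * (L2_inner S g (\<lambda>x. 1) - c * A)) / A"
    using P mP one g L2_diff[OF g(1) mP(3)]
    by (simp only: L2_inner_diff L2_inner_diff_right L2_inner_cmult L2_inner_cmult_right inner_one)
  have m': "m = (\<Sum>i\<in>UNIV. L2_inner S (\<lambda>x. 1) (\<lambda>x. \<psi> e x $ i * pd i v x)) + L2_inner S (\<lambda>x. 1) v / A"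
    unfolding m by (simp add: bform_def L2_inner_def set_lebesgue_integral_def)
  have em: "edge_mean T (\<psi> e) g G = (\<Sum>i\<in>UNIV. L2_inner S (G i) (\<lambda>x. \<psi> e x $ i)) + L2_inner S g (\<lambda>x. 1) / A"
    unfolding bform_one[OF e g, symmetric] by (simp add: bform_def L2_inner_def set_lebesgue_integral_def)
  have "bform e g G v (\<lambda>i. pd i v) - bform e (\<lambda>x. g x - c) G (\<lambda>x. v x - m) (\<lambda>i. pd i v) - m * edge_mean T (\<psi> e) g G
     = c * ((\<Sum>i\<in>UNIV. L2_inner S (\<lambda>x. 1) (\<lambda>x. \<psi> e x $ i * pd i v x)) + L2_inner S (\<lambda>x. 1) v / A - m)"
    unfolding s s' em using A by (simp add: bform_def sum_2 algebra_simps diff_divide_distrib add_divide_distrib)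
  then show ?thesis using m' by simp
qed

lemma L2_inner_sum_right:
  "finite I \<Longrightarrow> h \<in> L2 B \<Longrightarrow> (\<And>i. i \<in> I \<Longrightarrow> f i \<in> L2 B) \<Longrightarrow> L2_inner B h (\<lambda>x. \<Sum>i\<in>I. f i x) = (\<Sum>i\<in>I. L2_inner B h (f i))"
  by (induction I rule: finite_induct) (auto simp: L2_inner_add_right L2_sum, simp add: L2_inner_def set_lebesgue_integral_def)

text \<open>Since the matrices \<open>N e \<psi> e\<close> sum to the identity and the vectors \<open>N e\<close> to zero, this is a
  pointwise identity of the integrands; no integration by parts is involved.\<close>

lemma divergence_as_edge_sum:
  assumes g: "g \<in> L2 S" "\<And>i. G i \<in> L2 S" and v: "smooth v"
  shows "L2_inner S (G j) v + L2_inner S g (pd j v) = (\<Sum>e\<in>E. N e $ j * bform e g G v (\<lambda>i. pd i v))"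
proof -
  have vc: "continuous_on UNIV v" "continuous_on UNIV (pd i v)" for i by (intro smooth_continuous smooth_pd v)+
  have dual: "(\<Sum>e\<in>E. N e $ j * \<psi> e x $ i) = of_bool (j = i)" for x i
    using fields by (auto simp: edge_fields_def)
  have zero: "(\<Sum>e\<in>E. N e $ j) = 0"
  proof -
    have "(\<Sum>e\<in>E. N e) $ j = 0" using fields by (simp add: edge_fields_def)
    then show ?thesis by (simp add: sum_component)
  qed
  have D: "(\<Sum>e\<in>E. N e $ j * L2_inner S h (\<lambda>x. \<psi> e x $ i * w x)) = of_bool (j = i) * L2_inner S h w"
    if h: "h \<in> L2 S" and w: "continuous_on UNIV w" for h w i
  proof -
    have "(\<Sum>e\<in>E. N e $ j * L2_inner S h (\<lambda>x. \<psi> e x $ i * w x)) = L2_inner S h (\<lambda>x. \<Sum>e\<in>E. N e $ j * (\<psi> e x $ i * w x))"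
      by (subst L2_inner_sum_right) (auto simp: L2_inner_cmult_right finite_E h intro!: L2_cmult psi_L2 w)
    also have "(\<lambda>x. \<Sum>e\<in>E. N e $ j * (\<psi> e x $ i * w x)) = (\<lambda>x. of_bool (j = i) * w x)"
      unfolding mult.assoc[symmetric] sum_distrib_right[symmetric] dual ..
    finally show ?thesis by (simp add: L2_inner_cmult_right)
  qed
  have "(\<Sum>e\<in>E. N e $ j * bform e g G v (\<lambda>i. pd i v)) =
    (\<Sum>i\<in>UNIV. (\<Sum>e\<in>E. N e $ j * L2_inner S (G i) (\<lambda>x. \<psi> e x $ i * v x)) + (\<Sum>e\<in>E. N e $ j * L2_inner S g (\<lambda>x. \<psi> e x $ i * pd i v x)))
    + (\<Sum>e\<in>E. N e $ j) * (L2_inner S g v / A)"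
    by (simp add: bform_def sum_2 sum.distrib distrib_left sum_distrib_right sum_divide_distrib)
  also have "\<dots> = (\<Sum>i\<in>UNIV. of_bool (j = i) * L2_inner S (G i) v + of_bool (j = i) * L2_inner S g (pd i v))"
    unfolding zero D[OF g(2) vc(1)] D[OF g(1) vc(2)] by simp
  also have "\<dots> = L2_inner S (G j) v + L2_inner S g (pd j v)"
    using exhaust_2[of j] by (auto simp: sum_2)
  finally show ?thesis ..
qed

text \<open>After the products of means are removed, each edge carries a product of fluctuations, of
  \<open>g\<close> about a constant for the element and of \<open>v\<close> about its edge mean,
  both of order \<open>d\<close> by the Poincare inequality. A normal has length at most
  \<open>d\<close>, and \<open>d\<^sup>2 / A\<close> is at most \<open>\<sigma>\<^sup>2\<close>, so
  one power of \<open>d\<close> remains. The leading 4 bounds the number of edges.\<close>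

lemma element_consistency:
  assumes g: "g \<in> L2 S" "\<And>i. G i \<in> L2 S" "\<And>i. is_weak_deriv S (idx1 i) g (G i)" and v: "smooth v"
    and m: "\<And>e. e \<in> E \<Longrightarrow> m e = bform e (\<lambda>x. 1) (\<lambda>i x. 0) v (\<lambda>i. pd i v)"
  shows "\<bar>L2_inner S (G j) v + L2_inner S g (pd j v) - (\<Sum>e\<in>E. N e $ j * (m e * edge_mean T (\<psi> e) g G))\<bar>
    \<le> 4 * \<sigma>\<^sup>2 * (8 * \<sigma>\<^sup>2 + 16 * \<sigma> + 4) * d * gnorm S G * gnorm S (\<lambda>i. pd i v)"
proof -
  have vc: "continuous_on UNIV v" "continuous_on UNIV (pd i v)" for i by (intro smooth_continuous smooth_pd v)+
  have A: "0 < A" by (rule measure_pos)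
  have wv: "is_weak_deriv S (idx1 i) v (pd i v)" for i
    using smooth_weak_deriv[OF v, of S "idx1 i"] by (simp add: mpd_idx1[OF v])
  obtain c where c: "L2_norm S (\<lambda>x. g x - c) \<le> 2 * \<sigma> * d * gnorm S G" using poincare_element[OF g] by blast
  obtain b where b: "L2_norm S (\<lambda>x. v x - b) \<le> 2 * \<sigma> * d * gnorm S (\<lambda>i. pd i v)"
    using poincare_element[OF smooth_L2[OF v] smooth_L2[OF smooth_pd[OF v]] wv] by blast
  define \<Gamma> where "\<Gamma> = gnorm S G"
  define \<Delta> where "\<Delta> = gnorm S (\<lambda>i. pd i v)"
  have nn: "0 \<le> \<Gamma>" "0 \<le> \<Delta>" by (simp_all add: \<Gamma>_def \<Delta>_def)
  have lG: "L2_norm S (G i) \<le> \<Gamma>" "L2_norm S (pd i v) \<le> \<Delta>" for i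
    unfolding \<Gamma>_def \<Delta>_def by (rule L2_norm_le_gnorm, rule L2_norm_le_gnorm[of S "\<lambda>i. pd i v"])
  have each: "\<bar>bform e (\<lambda>x. g x - c) G (\<lambda>x. v x - m e) (\<lambda>i. pd i v)\<bar> \<le> d\<^sup>2 / A * ((8 * \<sigma>\<^sup>2 + 16 * \<sigma> + 4) * \<Gamma> * \<Delta>)" if e: "e \<in> E" for e
  proof -
    \<comment> \<open>\<open>m e\<close> is a mean over the edge, while the Poincare inequality
      gives a constant \<open>b\<close> for the element. The difference is the edge mean of
      \<open>v - b\<close> and costs \<open>2 + 2 * \<sigma>\<close>; another
      \<open>2 * \<sigma>\<close> comes from \<open>v - b\<close> itself.\<close>
    have wm: "L2_norm S (\<lambda>x. v x - m e) \<le> (4 * \<sigma> + 2) * d * \<Delta>"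
    proof -
      have sb: "smooth (\<lambda>x. v x - b)" by (intro smooth_diff v smooth_const)
      have pb: "pd i (\<lambda>x. v x - b) = pd i v" for i by (simp add: pd_smooth_diff[OF v smooth_const])
      obtain a a' where aa: "e = closed_segment a a'" using edge_field_segment[OF fieldD[OF e]] by blast
      have ci: "h integrable_on {0..1}" if "continuous_on UNIV h" for h :: "real \<Rightarrow> real"
        using that by (intro integrable_continuous_interval) (auto intro: continuous_on_subset)
      have vi: "continuous_on UNIV (\<lambda>t. v (linepath a a' t))"
        unfolding linepath_def by (intro continuous_on_compose2[OF vc(1)] continuous_intros) auto
      have "m e - b = integral {0..1} (\<lambda>t. v (linepath a a' t) - b)"
        unfolding m[OF e] bform_smooth[OF e aa v]
        using integral_diff[OF ci[OF vi] ci[of "\<lambda>t. b"]] by simp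
      also have "\<dots> = bform e (\<lambda>x. 1) (\<lambda>i x. 0) (\<lambda>x. v x - b) (\<lambda>i. pd i v)"
        using bform_smooth[OF e aa sb] by (simp add: pb)
      finally have "\<bar>m e - b\<bar> \<le> d / A * (\<Sum>i\<in>UNIV. L2_norm S (\<lambda>x. 0) * L2_norm S (\<lambda>x. v x - b) + L2_norm S (\<lambda>x. 1) * L2_norm S (pd i v))
          + L2_norm S (\<lambda>x. 1) * L2_norm S (\<lambda>x. v x - b) / A"
        using bform_bound[OF e const_L2[of 1] const_L2[of 0], of "\<lambda>x. v x - b" "\<lambda>i. pd i v"] vc smooth_continuous[OF sb] by simp
      also have "\<dots> \<le> d / A * (\<Sum>i\<in>(UNIV :: 2 set). L2_norm S (\<lambda>x. 1) * \<Delta>) + L2_norm S (\<lambda>x. 1) * (2 * \<sigma> * d * \<Delta>) / A"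
      proof -
        have zn: "L2_norm S (\<lambda>x. 0) = 0" by (simp add: L2_norm_def L2_inner_def set_lebesgue_integral_def)
        have "L2_norm S (\<lambda>x. 0) * L2_norm S (\<lambda>x. v x - b) + L2_norm S (\<lambda>x. 1) * L2_norm S (pd i v) \<le> L2_norm S (\<lambda>x. 1) * \<Delta>" for i
          unfolding zn using lG(2) by (simp add: mult_left_mono)
        moreover have "L2_norm S (\<lambda>x. 1) * L2_norm S (\<lambda>x. v x - b) / A \<le> L2_norm S (\<lambda>x. 1) * (2 * \<sigma> * d * \<Delta>) / A"
          using A b unfolding \<Delta>_def by (intro divide_right_mono mult_left_mono) auto
        moreover have "0 \<le> d / A" using A d_nonneg by simp
        ultimately show ?thesis by (intro add_mono mult_left_mono sum_mono)
      qed
      also have "\<dots> = L2_norm S (\<lambda>x. 1) / A * ((2 + 2 * \<sigma>) * d * \<Delta>)" by (simp add: algebra_simps add_divide_distrib)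
      finally have mb: "\<bar>m e - b\<bar> \<le> L2_norm S (\<lambda>x. 1) / A * ((2 + 2 * \<sigma>) * d * \<Delta>)" .
      have n1: "L2_norm S (\<lambda>x. 1) * L2_norm S (\<lambda>x. 1) = A"
        using L2_norm_sq[of S "\<lambda>x. 1"] inner_one by (simp add: power2_eq_square)
      have "L2_norm S (\<lambda>x. v x - m e) = L2_norm S (\<lambda>x. (v x - b) + (b - m e) * 1)" by simp
      also have "\<dots> \<le> L2_norm S (\<lambda>x. v x - b) + L2_norm S (\<lambda>x. (b - m e) * 1)"
        by (intro L2_norm_triangle smooth_L2 sb const_L2)
      also have "L2_norm S (\<lambda>x. (b - m e) * 1) = \<bar>m e - b\<bar> * L2_norm S (\<lambda>x. 1)"
        unfolding L2_norm_cmult by (simp add: abs_minus_commute)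
      also have "\<dots> \<le> L2_norm S (\<lambda>x. 1) / A * ((2 + 2 * \<sigma>) * d * \<Delta>) * L2_norm S (\<lambda>x. 1)"
        using mb by (rule mult_right_mono) simp
      also have "\<dots> = (L2_norm S (\<lambda>x. 1) * L2_norm S (\<lambda>x. 1)) / A * ((2 + 2 * \<sigma>) * d * \<Delta>)" by simp
      also have "\<dots> = (2 + 2 * \<sigma>) * d * \<Delta>" unfolding n1 using A by simp
      finally show ?thesis using b by (simp add: \<Delta>_def algebra_simps)
    qed
    have hc: "(\<lambda>x. g x - c) \<in> L2 S" by (intro L2_diff g const_L2)
    have "\<bar>bform e (\<lambda>x. g x - c) G (\<lambda>x. v x - m e) (\<lambda>i. pd i v)\<bar> \<le>
      d / A * (\<Sum>i\<in>UNIV. L2_norm S (G i) * L2_norm S (\<lambda>x. v x - m e) + L2_norm S (\<lambda>x. g x - c) * L2_norm S (pd i v))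
      + L2_norm S (\<lambda>x. g x - c) * L2_norm S (\<lambda>x. v x - m e) / A"
      by (intro bform_bound e hc g continuous_intros vc)
    also have "\<dots> \<le> d / A * (\<Sum>i\<in>(UNIV :: 2 set). \<Gamma> * ((4 * \<sigma> + 2) * d * \<Delta>) + (2 * \<sigma> * d * \<Gamma>) * \<Delta>) + (2 * \<sigma> * d * \<Gamma>) * ((4 * \<sigma> + 2) * d * \<Delta>) / A"
      using A d_nonneg sigma nn lG wm c
      by (intro add_mono mult_left_mono sum_mono divide_right_mono mult_mono) (auto simp: \<Gamma>_def)
    \<comment> \<open>The sum over both components gives \<open>12 * \<sigma> + 4\<close>, the last
      term \<open>8 * \<sigma>\<^sup>2 + 4 * \<sigma>\<close>.\<close>
    also have "\<dots> = d\<^sup>2 / A * ((8 * \<sigma>\<^sup>2 + 16 * \<sigma> + 4) * \<Gamma> * \<Delta>)"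
      using A by (simp add: sum_2 field_simps power2_eq_square)
    finally show ?thesis .
  qed
  have N: "\<bar>N e $ j\<bar> \<le> d" if e: "e \<in> E" for e
  proof -
    obtain a a' where aa: "e = closed_segment a a'" "edge_field T (closed_segment a a') (N e) (\<psi> e)"
      using edge_field_segment[OF fieldD[OF e]] by blast
    have "a \<in> T" "a' \<in> T" using edge_face(3)[OF edgeD[OF e]] aa(1) by auto
    then show ?thesis
      using edge_field_at(3)[OF aa(2)] component_le_norm_cart[of "N e" j] dist_le_d[of a a'] by (simp add: dist_norm)
  qed
  have sp: "N e $ j * bform e g G v (\<lambda>i. pd i v) - N e $ j * (m e * edge_mean T (\<psi> e) g G)
     = N e $ j * bform e (\<lambda>x. g x - c) G (\<lambda>x. v x - m e) (\<lambda>i. pd i v)" if "e \<in> E" for e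
    using bform_split[OF that g(1,2) v m[OF that], where c=c] by (simp add: algebra_simps)
  have "L2_inner S (G j) v + L2_inner S g (pd j v) - (\<Sum>e\<in>E. N e $ j * (m e * edge_mean T (\<psi> e) g G))
    = (\<Sum>e\<in>E. N e $ j * bform e g G v (\<lambda>i. pd i v) - N e $ j * (m e * edge_mean T (\<psi> e) g G))"
    using divergence_as_edge_sum[where G=G and j=j, OF g(1,2) v] by (simp add: sum_subtractf)
  also have "\<dots> = (\<Sum>e\<in>E. N e $ j * bform e (\<lambda>x. g x - c) G (\<lambda>x. v x - m e) (\<lambda>i. pd i v))"
    by (rule sum.cong[OF refl sp])
  finally have eq: "L2_inner S (G j) v + L2_inner S g (pd j v) - (\<Sum>e\<in>E. N e $ j * (m e * edge_mean T (\<psi> e) g G)) =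
     (\<Sum>e\<in>E. N e $ j * bform e (\<lambda>x. g x - c) G (\<lambda>x. v x - m e) (\<lambda>i. pd i v))" .
  have "\<bar>\<Sum>e\<in>E. N e $ j * bform e (\<lambda>x. g x - c) G (\<lambda>x. v x - m e) (\<lambda>i. pd i v)\<bar> \<le> (\<Sum>e\<in>E. d * (d\<^sup>2 / A * ((8 * \<sigma>\<^sup>2 + 16 * \<sigma> + 4) * \<Gamma> * \<Delta>)))"
    by (intro order_trans[OF sum_abs sum_mono], unfold abs_mult, intro mult_mono N each) (use d_nonneg in auto)
  also have "\<dots> = real (card E) * (d * (d\<^sup>2 / A * ((8 * \<sigma>\<^sup>2 + 16 * \<sigma> + 4) * \<Gamma> * \<Delta>)))" by (rule sum_constant)
  also have "\<dots> \<le> 4 * (d * (\<sigma>\<^sup>2 * ((8 * \<sigma>\<^sup>2 + 16 * \<sigma> + 4) * \<Gamma> * \<Delta>)))"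
  proof (rule mult_mono)
    show "real (card E) \<le> 4" using fields by (simp add: edge_fields_def)
    have "d\<^sup>2 / A \<le> \<sigma>\<^sup>2" using regular A by (simp add: divide_le_eq)
    then show "d * (d\<^sup>2 / A * ((8 * \<sigma>\<^sup>2 + 16 * \<sigma> + 4) * \<Gamma> * \<Delta>)) \<le> d * (\<sigma>\<^sup>2 * ((8 * \<sigma>\<^sup>2 + 16 * \<sigma> + 4) * \<Gamma> * \<Delta>))"
      by (rule mult_left_mono[OF mult_right_mono]) (use d_nonneg sigma nn in auto)
  qed (use d_nonneg A sigma nn in auto)
  finally show ?thesis unfolding eq by (simp add: \<Gamma>_def \<Delta>_def mult_ac)
qed

end

section \<open>Discrete functions on the mesh\<close>

text \<open>Ensures that the limit in \<open>trace_from\<close> is taken along a nontrivial filter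
  and is therefore unique.\<close>

lemma islimpt_interior_convex:
  fixes T :: "pt set"
  assumes T: "convex T" "interior T \<noteq> {}" and x: "x \<in> T"
  shows "x islimpt interior T"
proof (cases "x \<in> interior T")
  case True
  then show ?thesis using open_imp_islimpt[OF open_interior] by blast
next
  case False
  have "x \<in> closure (interior T)" using convex_closure_interior[OF T] x closure_subset by blast
  then show ?thesis using False by (simp add: closure_def)
qed

lemma trace_from_eq:
  fixes T :: "pt set"
  assumes T: "convex T" "interior T \<noteq> {}" and x: "x \<in> T"
    and k: "continuous_on UNIV k" "\<And>y. y \<in> interior T \<Longrightarrow> w y = k y"
  shows "trace_from T w x = k x"
proof -
  have "(k \<longlongrightarrow> k x) (at x within interior T)"
    using k(1) by (metis UNIV_I continuous_on_def subset_UNIV tendsto_within_subset)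
  then have "(w \<longlongrightarrow> k x) (at x within interior T)"
    by (rule Lim_transform_eventually) (auto simp: eventually_at_filter k(2))
  moreover have "\<not> trivial_limit (at x within interior T)"
    using islimpt_interior_convex[OF T x] by (simp add: trivial_limit_within)
  ultimately show ?thesis unfolding trace_from_def by (intro tendsto_Lim)
qed

text \<open>The derivative is formed inside the element, where \<open>w\<close> agrees with
  \<open>p\<close>, and only then extended to the boundary; \<open>w\<close> itself need not be
  differentiable there.\<close>

lemma normal_deriv_from_eq:
  fixes T :: "pt set"
  assumes T: "convex T" "interior T \<noteq> {}" and x: "x \<in> T"
    and p: "smooth p" "\<And>y. y \<in> interior T \<Longrightarrow> w y = p y"
  shows "normal_deriv_from T n w x = grad p x \<bullet> n"
  unfolding normal_deriv_from_def
proof (rule trace_from_eq[OF T x])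
  show "continuous_on UNIV (\<lambda>x. grad p x \<bullet> n)" by (intro continuous_intros continuous_grad p)
  fix y assume y: "y \<in> interior T"
  have "(w has_derivative (\<lambda>h. grad p y \<bullet> h)) (at y)"
    by (rule has_derivative_transform_within_open[OF smooth_has_derivative[OF p(1)] open_interior y]) (simp add: p(2))
  then have "frechet_derivative w (at y) = (\<lambda>h. grad p y \<bullet> h)" using frechet_derivative_at by metis
  then show "frechet_derivative w (at y) n = grad p y \<bullet> n" by simp
qed

definition seg_mean :: "pt \<Rightarrow> pt \<Rightarrow> fn \<Rightarrow> pt \<Rightarrow> real" where
  "seg_mean a b p u = integral {0..1} (\<lambda>t. grad p (linepath a b t) \<bullet> u)"

lemma seg_mean_integrable:
  assumes "smooth p"
  shows "(\<lambda>t. grad p (linepath a b t) \<bullet> u) integrable_on {0..1}"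
  unfolding linepath_def
  by (intro integrable_continuous_interval continuous_intros continuous_on_compose2[OF continuous_grad[OF assms, of UNIV]]) auto

lemma seg_mean_linear:
  assumes "smooth p"
  shows "seg_mean a b p (r *\<^sub>R u + s *\<^sub>R v) = r * seg_mean a b p u + s * seg_mean a b p v"
proof -
  have "seg_mean a b p (r *\<^sub>R u + s *\<^sub>R v) = integral {0..1} (\<lambda>t. r * (grad p (linepath a b t) \<bullet> u) + s * (grad p (linepath a b t) \<bullet> v))"
    by (simp add: seg_mean_def inner_add_right)
  also have "\<dots> = integral {0..1} (\<lambda>t. r * (grad p (linepath a b t) \<bullet> u)) + integral {0..1} (\<lambda>t. s * (grad p (linepath a b t) \<bullet> v))"
    by (intro integral_add integrable_on_mult_right seg_mean_integrable assms)
  finally show ?thesis by (simp add: seg_mean_def)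
qed

lemma seg_mean_tangential:
  assumes "smooth p"
  shows "seg_mean a b p (b - a) = p b - p a"
proof -
  have "((\<lambda>t. p (linepath a b t)) has_vector_derivative grad p (linepath a b t) \<bullet> (b - a)) (at t within {0..1})" for t
  proof -
    have "(linepath a b has_derivative (\<lambda>s. s *\<^sub>R (b - a))) (at t within {0..1})"
      unfolding linepath_def by (auto intro!: derivative_eq_intros simp: algebra_simps)
    from has_derivative_compose[OF this smooth_has_derivative[OF assms]]
    show ?thesis by (simp add: has_vector_derivative_def)
  qed
  from fundamental_theorem_of_calculus[OF _ this]
  have "((\<lambda>t. grad p (linepath a b t) \<bullet> (b - a)) has_integral p (linepath a b 1) - p (linepath a b 0)) {0..1}" by simp
  then show ?thesis by (simp add: seg_mean_def integral_unique linepath_1' linepath_0')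
qed

lemma seg_mean_axis: "seg_mean a b p (axis i 1) = integral {0..1} (\<lambda>t. pd i p (linepath a b t))"
  by (simp add: seg_mean_def inner_axis grad_def)

lemma edge_integral_normal:
  fixes T :: "pt set"
  assumes T: "convex T" "interior T \<noteq> {}" and ab: "closed_segment a b \<subseteq> T"
    and p: "smooth p" "\<And>y. y \<in> interior T \<Longrightarrow> w y = p y"
  shows "edge_integral a b (normal_deriv_from T n w) = dist a b * seg_mean a b p n"
proof -
  have "integral {0..1} (\<lambda>t. normal_deriv_from T n w (linepath a b t)) = integral {0..1} (\<lambda>t. grad p (linepath a b t) \<bullet> n)"
  proof (rule integral_cong)
    fix t :: real assume "t \<in> {0..1}"
    then have "linepath a b t \<in> closed_segment a b" by (simp add: linepath_in_path)
    then show "normal_deriv_from T n w (linepath a b t) = grad p (linepath a b t) \<bullet> n"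
      using ab by (intro normal_deriv_from_eq[OF T _ p]) auto
  qed
  then show ?thesis by (simp add: edge_integral_def seg_mean_def)
qed

lemma unit_normal_exists:
  assumes "a \<noteq> b"
  shows "unit_normal a b (inverse (dist a b) *\<^sub>R rot (b - a))"
  using assms by (simp add: unit_normal_def rot_inner cross_def dist_norm norm_minus_commute)

text \<open>The mean is linear in the direction, so its tangential and normal values determine it.
  The factor \<open>c\<close> is 1 for the comparison of two elements and 0 on the boundary.\<close>

lemma seg_mean_determined:
  assumes ab: "a \<noteq> b" and n: "unit_normal a b n" and p: "smooth p" "smooth q"
    and eq: "seg_mean a b p n = c * seg_mean a b q n" "seg_mean a b p (b - a) = c * seg_mean a b q (b - a)"
  shows "seg_mean a b p u = c * seg_mean a b q u"
proof -
  have "n \<noteq> 0" "b - a \<noteq> 0" "n \<bullet> (b - a) = 0" using n ab by (auto simp: unit_normal_def)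
  from orthogonal_expansion[OF this, of u]
  obtain r s where u: "u = r *\<^sub>R n + s *\<^sub>R (b - a)" by blast
  show ?thesis unfolding u seg_mean_linear[OF p(1)] seg_mean_linear[OF p(2)] eq by (simp add: algebra_simps)
qed

context mesh
begin

text \<open>The tangential part of a gradient mean is a difference of vertex values and is governed
  by (H2); the normal part is governed by (H3).\<close>

lemma gradient_means:
  assumes T: "T \<in> \<T>" and e: "e \<in> E T" "e = closed_segment a b"
    and p: "smooth p" "\<And>y. y \<in> interior T \<Longrightarrow> w y = p y"
    and w: "continuous_at_vertices \<Omega> \<T> w" "continuous_normal_means \<Omega> \<T> w"
  shows "T' \<in> \<T> \<Longrightarrow> e \<in> E T' \<Longrightarrow> smooth p' \<Longrightarrow> (\<And>y. y \<in> interior T' \<Longrightarrow> w y = p' y) \<Longrightarrow>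
      seg_mean a b p u = seg_mean a b p' u"
    and "e \<subseteq> frontier \<Omega> \<Longrightarrow> seg_mean a b p u = 0"
proof -
  interpret A: mesh_element T "E T" "N T" "\<psi> T" using element[OF T] .
  have f: "edge_field T (closed_segment a b) (N T e) (\<psi> T e)" using A.fieldD[OF e(1)] e(2) by simp
  have ab: "a \<noteq> b" "dist a b \<noteq> 0" using edge_field_at(1)[OF f] by auto
  have eT: "closed_segment a b edge_of T" using A.edgeD[OF e(1)] e(2) by simp
  obtain n where n: "unit_normal a b n" using unit_normal_exists[OF ab(1)] by blast
  have ext: "x extreme_point_of S" if "closed_segment a b edge_of S" "x \<in> {a, b}" for x S
    using that extreme_point_of_face[of "closed_segment a b" S x] by (auto simp: edge_of_def extreme_point_of_segment)
  have tr: "trace_from T w x = p x" if "x \<in> {a, b}" for x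
  proof (rule trace_from_eq[OF A.convex_T A.interior_T _ smooth_continuous[OF p(1)] p(2)])
    show "x \<in> T" using that A.edge_face(3)[OF eT] by auto
  qed
  have nI: "edge_integral a b (normal_deriv_from T n w) = dist a b * seg_mean a b p n"
    by (rule edge_integral_normal[OF A.convex_T A.interior_T A.edge_face(3)[OF eT] p])
  show "seg_mean a b p u = seg_mean a b p' u"
    if T': "T' \<in> \<T>" "e \<in> E T'" and p': "smooth p'" "\<And>y. y \<in> interior T' \<Longrightarrow> w y = p' y"
  proof -
    interpret B: mesh_element T' "E T'" "N T'" "\<psi> T'" using element[OF T'(1)] .
    have eT': "closed_segment a b edge_of T'" using B.edgeD[OF T'(2)] e(2) by simp
    have tr': "trace_from T' w x = p' x" if "x \<in> {a, b}" for x
    proof (rule trace_from_eq[OF B.convex_T B.interior_T _ smooth_continuous[OF p'(1)] p'(2)])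
      show "x \<in> T'" using that B.edge_face(3)[OF eT'] by auto
    qed
    have nI': "edge_integral a b (normal_deriv_from T' n w) = dist a b * seg_mean a b p' n"
      by (rule edge_integral_normal[OF B.convex_T B.interior_T B.edge_face(3)[OF eT'] p'])
    have "dist a b * seg_mean a b p n = dist a b * seg_mean a b p' n"
      unfolding nI[symmetric] nI'[symmetric] using w(2) T T'(1) eT eT' n unfolding continuous_normal_means_def by blast
    then have 1: "seg_mean a b p n = 1 * seg_mean a b p' n" using ab by simp
    have "trace_from T w x = trace_from T' w x" if "x \<in> {a, b}" for x
      using w(1) T T'(1) ext[OF eT that] ext[OF eT' that] unfolding continuous_at_vertices_def by blast
    then have "p x = p' x" if "x \<in> {a, b}" for x using tr tr' that by metis
    then have 2: "seg_mean a b p (b - a) = 1 * seg_mean a b p' (b - a)"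
      by (simp add: seg_mean_tangential p(1) p'(1))
    show ?thesis using seg_mean_determined[OF ab(1) n p(1) p'(1) 1 2] by simp
  qed
  show "seg_mean a b p u = 0" if fr: "e \<subseteq> frontier \<Omega>"
  proof -
    have "dist a b * seg_mean a b p n = 0"
      unfolding nI[symmetric] using w(2) T eT n fr e(2) unfolding continuous_normal_means_def by blast
    then have 1: "seg_mean a b p n = 0 * seg_mean a b p n" using ab by simp
    have "trace_from T w x = 0" if "x \<in> {a, b}" for x
    proof -
      have "x \<in> frontier \<Omega>" using fr that e(2) by auto
      then show ?thesis using w(1) T ext[OF eT that] unfolding continuous_at_vertices_def by blast
    qed
    then have "p x = 0" if "x \<in> {a, b}" for x using tr that by metis
    then have 2: "seg_mean a b p (b - a) = 0 * seg_mean a b p (b - a)"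
      by (simp add: seg_mean_tangential p(1))
    show ?thesis using seg_mean_determined[OF ab(1) n p(1) p(1) 1 2] by simp
  qed
qed

section \<open>Integrals and norms as sums over the elements\<close>

lemma interior_facts:
  assumes "T \<in> \<T>"
  shows "open (interior T)" "bounded (interior T)" "interior T \<subseteq> \<Omega>" "interior T \<in> sets lebesgue" "interior T \<in> lmeasurable"
  using interior_subset_omega[OF assms] omega(2) by (auto intro: bounded_subset lmeasurable_open)

text \<open>Frontiers of convex sets are null, and a point of \<Omega> off these frontiers lies in
  the interior of exactly one element.\<close>

lemma indicator_mesh:
  "AE x in lebesgue. indicat_real \<Omega> x = (\<Sum>T\<in>\<T>. indicat_real (interior T) x)"
proof -
  have "negligible (\<Union>T\<in>\<T>. frontier T)"
    using mesh_facts(1) mesh_element.negligible_frontier[OF element] by (intro negligible_Union) auto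
  then have "AE x in lebesgue. x \<notin> (\<Union>T\<in>\<T>. frontier T)"
    by (intro AE_not_in) (simp add: negligible_iff_null_sets)
  then show ?thesis
  proof (rule AE_mp, intro AE_I2 impI)
    fix x assume x: "x \<notin> (\<Union>T\<in>\<T>. frontier T)"
    show "indicat_real \<Omega> x = (\<Sum>T\<in>\<T>. indicat_real (interior T) x)"
    proof (cases "x \<in> \<Omega>")
      case True
      then obtain T where T: "T \<in> \<T>" "x \<in> T" using mesh_facts(2) closure_subset[of \<Omega>] by blast
      then have xi: "x \<in> interior T" using x closure_subset[of T] by (auto simp: frontier_def)
      have "(\<Sum>T'\<in>\<T>. indicat_real (interior T') x) = (\<Sum>T'\<in>{T}. indicat_real (interior T') x)"
        using mesh_facts(1) T(1) xi interiors_disjoint[OF T(1)] by (intro sum.mono_neutral_right) (auto simp: indicator_def)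
      then show ?thesis using True xi by simp
    next
      case False
      then have "x \<notin> interior T" if "T \<in> \<T>" for T using interior_subset_omega[OF that] by blast
      then show ?thesis using False by simp
    qed
  qed
qed

lemma mesh_set_integral:
  fixes f :: fn
  assumes "\<And>T. T \<in> \<T> \<Longrightarrow> set_integrable lebesgue (interior T) f"
  shows "set_integrable lebesgue \<Omega> f" "(LINT x:\<Omega>|lebesgue. f x) = (\<Sum>T\<in>\<T>. LINT x:interior T|lebesgue. f x)"
proof -
  have ae: "aeq UNIV (\<lambda>x. \<Sum>T\<in>\<T>. indicat_real (interior T) x * f x) (\<lambda>x. indicat_real \<Omega> x * f x)"
    unfolding aeq_def sum_distrib_right[symmetric] using indicator_mesh by (elim AE_mp) auto
  have i: "integrable lebesgue (\<lambda>x. indicat_real (interior T) x * f x)" if "T \<in> \<T>" for T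
    using assms[OF that] by (simp add: set_integrable_def)
  then have s: "integrable lebesgue (\<lambda>x. \<Sum>T\<in>\<T>. indicat_real (interior T) x * f x)" by (rule Bochner_Integration.integrable_sum)
  then show "set_integrable lebesgue \<Omega> f"
    using aeq_set_integrable[OF ae] by (simp add: set_integrable_def)
  have "(LINT x:\<Omega>|lebesgue. f x) = (LINT x|lebesgue. (\<Sum>T\<in>\<T>. indicat_real (interior T) x * f x))"
    using aeq_set_integral[OF ae] by (simp add: set_lebesgue_integral_def)
  also have "\<dots> = (\<Sum>T\<in>\<T>. LINT x:interior T|lebesgue. f x)"
    using i by (subst Bochner_Integration.integral_sum) (auto simp: set_lebesgue_integral_def)
  finally show "(LINT x:\<Omega>|lebesgue. f x) = (\<Sum>T\<in>\<T>. LINT x:interior T|lebesgue. f x)" .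
qed

lemma mesh_L2_inner:
  assumes "\<And>T. T \<in> \<T> \<Longrightarrow> f \<in> L2 (interior T)" "\<And>T. T \<in> \<T> \<Longrightarrow> g \<in> L2 (interior T)"
  shows "L2_inner \<Omega> f g = (\<Sum>T\<in>\<T>. L2_inner (interior T) f g)"
  unfolding L2_inner_def by (rule mesh_set_integral(2)) (intro L2_mult_integrable assms)

lemma omega_L2_interior: "f \<in> L2 \<Omega> \<Longrightarrow> T \<in> \<T> \<Longrightarrow> f \<in> L2 (interior T)"
  using L2_subset interior_facts by blast

lemma mesh_L2_norm_sq: "f \<in> L2 \<Omega> \<Longrightarrow> (\<Sum>T\<in>\<T>. (L2_norm (interior T) f)\<^sup>2) = (L2_norm \<Omega> f)\<^sup>2"
  unfolding L2_norm_sq by (rule mesh_L2_inner[symmetric]) (auto intro: omega_L2_interior)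

lemma mesh_gnorm_sq: "(\<And>k. G k \<in> L2 \<Omega>) \<Longrightarrow> (\<Sum>T\<in>\<T>. (gnorm (interior T) G)\<^sup>2) = (gnorm \<Omega> G)\<^sup>2"
  unfolding gnorm_sq by (subst sum.swap) (simp add: mesh_L2_norm_sq)

lemma diameter_le_mesh_size: "T \<in> \<T> \<Longrightarrow> diameter T \<le> mesh_size \<T>"
  unfolding mesh_size_def using mesh_facts(1) by (intro Max_ge) auto

lemma mesh_size_nonneg: "0 \<le> mesh_size \<T>"
proof -
  have "\<T> \<noteq> {}" using mesh_facts(2) domain by (auto simp: polygonal_domain_def)
  then obtain T where T: "T \<in> \<T>" by blast
  have "0 \<le> diameter T" using mesh_element.compact_T[OF element[OF T]] by (intro diameter_ge_0 compact_imp_bounded)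
  then show ?thesis using diameter_le_mesh_size[OF T] by linarith
qed

end

lemma sum_mult_le_sqrt:
  fixes a b :: "'a \<Rightarrow> real"
  shows "(\<Sum>i\<in>I. a i * b i) \<le> sqrt (\<Sum>i\<in>I. (a i)\<^sup>2) * sqrt (\<Sum>i\<in>I. (b i)\<^sup>2)"
proof -
  have "(\<Sum>i\<in>I. a i * b i) \<le> (\<Sum>i\<in>I. \<bar>a i\<bar> * \<bar>b i\<bar>)" by (intro sum_mono) (metis abs_ge_self abs_mult)
  also have "\<dots> \<le> sqrt (\<Sum>i\<in>I. (a i)\<^sup>2) * sqrt (\<Sum>i\<in>I. (b i)\<^sup>2)"
    using L2_set_mult_ineq[of a b I] by (simp add: L2_set_def)
  finally show ?thesis .
qed

definition piecewise :: "mesh \<Rightarrow> (pt set \<Rightarrow> fn) \<Rightarrow> fn \<Rightarrow> bool" where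
  "piecewise \<T> p w \<longleftrightarrow> (\<forall>T\<in>\<T>. smooth (p T) \<and> (\<forall>x\<in>interior T. w x = p T x))"

text \<open>One derivative in direction \<open>i\<close> and two in direction \<open>j\<close>; the
  sum over \<open>j\<close> belongs to the \<open>i\<close>-th derivative of the Laplacian, which
  integration by parts of the Hessian term produces.\<close>

definition idx3 :: "2 \<Rightarrow> 2 \<Rightarrow> 2 \<Rightarrow> nat" where
  "idx3 i j = (\<lambda>k. idx2 i j k + idx1 j k)"

lemma mdeg_idx3 [simp]: "mdeg (idx3 i j) = 3"
  by (simp add: idx3_def mdeg_add)

locale regular_mesh = mesh +
  fixes \<sigma> :: real
  assumes sigma: "0 \<le> \<sigma>" and regular: "\<And>T. T \<in> \<T> \<Longrightarrow> (diameter T)\<^sup>2 \<le> \<sigma>\<^sup>2 * measure lebesgue T"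
begin

lemma regular_elt: "T \<in> \<T> \<Longrightarrow> regular_element T (E T) (N T) (\<psi> T) \<sigma>"
  using element sigma regular by (simp add: regular_element_def regular_element_axioms_def)

lemma piecewise_wd:
  assumes "piecewise \<T> p w" "T \<in> \<T>"
  shows "w \<in> H m (interior T)" "aeq (interior T) (wd (interior T) \<alpha> w) (mpd \<alpha> (p T))"
proof -
  have w: "aeq (interior T) w (p T)" "smooth (p T)" using assms by (auto simp: piecewise_def intro: aeq_pointwise)
  note S = interior_facts(1,2)[OF assms(2)]
  show "w \<in> H m (interior T)" using aeq_H[OF w(1)] H_smooth(1)[OF S w(2)] by blast
  show "aeq (interior T) (wd (interior T) \<alpha> w) (mpd \<alpha> (p T))" using aeq_wd[OF w(1)] H_smooth(2)[OF S w(2)] by metis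
qed

text \<open>The products of edge means cancel in the sum over the mesh and may be subtracted at no
  cost. The remainders are estimated element by element and summed with the Cauchy-Schwarz
  inequality.\<close>

lemma component_consistency:
  assumes g: "g \<in> L2 \<Omega>" "\<And>k. G k \<in> L2 \<Omega>" "\<And>k. is_weak_deriv \<Omega> (idx1 k) g (G k)"
    and w: "piecewise \<T> p w" "continuous_at_vertices \<Omega> \<T> w" "continuous_normal_means \<Omega> \<T> w"
  shows "\<bar>\<Sum>T\<in>\<T>. L2_inner (interior T) (G j) (pd i (p T)) + L2_inner (interior T) g (pd j (pd i (p T)))\<bar>
     \<le> 4 * \<sigma>\<^sup>2 * (8 * \<sigma>\<^sup>2 + 16 * \<sigma> + 4) * mesh_size \<T> * gnorm \<Omega> G * sqrt (\<Sum>T\<in>\<T>. (gnorm (interior T) (\<lambda>k. pd k (pd i (p T))))\<^sup>2)"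
proof -
  have p: "smooth (p T)" "\<And>x. x \<in> interior T \<Longrightarrow> w x = p T x" if "T \<in> \<T>" for T
    using w(1) that by (auto simp: piecewise_def)
  define m where "m T e = regular_element.bform T (\<psi> T) e (\<lambda>x. 1) (\<lambda>i x. 0) (pd i (p T)) (\<lambda>k. pd k (pd i (p T)))" for T e
  have m: "m T e = seg_mean a b (p T) (axis i 1)" if "T \<in> \<T>" "e \<in> E T" "e = closed_segment a b" for T e a b
    unfolding m_def seg_mean_axis by (rule regular_element.bform_smooth[OF regular_elt[OF that(1)] that(2,3) smooth_pd[OF p(1)[OF that(1)]]])
  have seg: "\<exists>a b. e = closed_segment a b" if "T \<in> \<T>" "e \<in> E T" for T e
    using edge_field_segment[OF mesh_element.fieldD[OF element[OF that(1)] that(2)]] by blast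
  \<comment> \<open>Both means are single valued across an edge while the normals are opposite; on
    the boundary \<open>m T e\<close> is 0.\<close>
  define t where "t T e = N T e $ j * (m T e * edge_mean T (\<psi> T e) g G)" for T e
  have zero: "(\<Sum>T\<in>\<T>. \<Sum>e\<in>E T. t T e) = 0"
  proof (rule sum_over_sides_zero)
    fix T e assume T: "T \<in> \<T>" "e \<in> E T" "e \<subseteq> frontier \<Omega>"
    obtain a b where ab: "e = closed_segment a b" using seg[OF T(1,2)] by blast
    have "m T e = 0" unfolding m[OF T(1,2) ab]
      by (rule gradient_means(2)[OF T(1,2) ab p[OF T(1)] w(2,3) T(3)])
    then show "t T e = 0" by (simp add: t_def)
  next
    fix T T' e assume T: "T \<in> \<T>" "T' \<in> \<T>" "T \<noteq> T'" and e: "e \<in> E T" "e \<in> E T'" "\<not> e \<subseteq> frontier \<Omega>"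
    obtain a b where ab: "e = closed_segment a b" using seg[OF T(1) e(1)] by blast
    have "m T e = m T' e" unfolding m[OF T(1) e(1) ab] m[OF T(2) e(2) ab]
      by (rule gradient_means(1)[OF T(1) e(1) ab p[OF T(1)] w(2,3) T(2) e(2) p[OF T(2)]])
    moreover have "rel_interior e \<subseteq> \<Omega>" using neighbour[OF T(1) e(1,3)] by metis
    then have "edge_mean T (\<psi> T e) g G = edge_mean T' (\<psi> T' e) g G"
      by (rule edge_mean_single_valued[OF T(1,2) e(1,2) _ g])
    moreover have "N T' e = - N T e" by (rule opposite_normals[OF T e(1,2)])
    ultimately show "t T' e = - t T e" by (simp add: t_def)
  qed
  define K where "K = 4 * \<sigma>\<^sup>2 * (8 * \<sigma>\<^sup>2 + 16 * \<sigma> + 4)"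
  have K: "0 \<le> K" using sigma by (simp add: K_def)
  define \<Delta> where "\<Delta> T = gnorm (interior T) (\<lambda>k. pd k (pd i (p T)))" for T
  have each: "\<bar>L2_inner (interior T) (G j) (pd i (p T)) + L2_inner (interior T) g (pd j (pd i (p T))) - (\<Sum>e\<in>E T. t T e)\<bar>
     \<le> K * mesh_size \<T> * (gnorm (interior T) G * \<Delta> T)" if T: "T \<in> \<T>" for T
  proof -
    have wk: "is_weak_deriv (interior T) (idx1 k) g (G k)" for k
      using is_weak_deriv_subset[OF g(3) interior_facts(3)[OF T]] .
    have "\<bar>L2_inner (interior T) (G j) (pd i (p T)) + L2_inner (interior T) g (pd j (pd i (p T))) - (\<Sum>e\<in>E T. t T e)\<bar>
      \<le> K * diameter T * gnorm (interior T) G * \<Delta> T"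
      unfolding t_def K_def \<Delta>_def
      by (rule regular_element.element_consistency[OF regular_elt[OF T] omega_L2_interior[OF g(1) T] omega_L2_interior[OF g(2) T] wk smooth_pd[OF p(1)[OF T]]])
        (simp add: m_def)
    also have "\<dots> \<le> K * mesh_size \<T> * gnorm (interior T) G * \<Delta> T"
      using diameter_le_mesh_size[OF T] K by (intro mult_right_mono mult_left_mono) (auto simp: \<Delta>_def)
    finally show ?thesis by (simp add: mult.assoc)
  qed
  have "(\<Sum>T\<in>\<T>. L2_inner (interior T) (G j) (pd i (p T)) + L2_inner (interior T) g (pd j (pd i (p T)))) =
    (\<Sum>T\<in>\<T>. L2_inner (interior T) (G j) (pd i (p T)) + L2_inner (interior T) g (pd j (pd i (p T))) - (\<Sum>e\<in>E T. t T e))"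
    using zero by (simp add: sum_subtractf)
  moreover have "\<bar>\<Sum>T\<in>\<T>. L2_inner (interior T) (G j) (pd i (p T)) + L2_inner (interior T) g (pd j (pd i (p T))) - (\<Sum>e\<in>E T. t T e)\<bar>
    \<le> (\<Sum>T\<in>\<T>. K * mesh_size \<T> * (gnorm (interior T) G * \<Delta> T))"
    by (intro order_trans[OF sum_abs sum_mono] each)
  moreover have "(\<Sum>T\<in>\<T>. K * mesh_size \<T> * (gnorm (interior T) G * \<Delta> T)) = K * mesh_size \<T> * (\<Sum>T\<in>\<T>. gnorm (interior T) G * \<Delta> T)"
    by (simp add: sum_distrib_left)
  moreover have "K * mesh_size \<T> * (\<Sum>T\<in>\<T>. gnorm (interior T) G * \<Delta> T) \<le> K * mesh_size \<T> * (sqrt (\<Sum>T\<in>\<T>. (gnorm (interior T) G)\<^sup>2) * sqrt (\<Sum>T\<in>\<T>. (\<Delta> T)\<^sup>2))"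
    using K mesh_size_nonneg by (intro mult_left_mono sum_mult_le_sqrt) auto
  moreover have "sqrt (\<Sum>T\<in>\<T>. (gnorm (interior T) G)\<^sup>2) = gnorm \<Omega> G"
    using mesh_gnorm_sq[OF g(2)] by simp
  ultimately show ?thesis by (simp add: K_def \<Delta>_def mult.assoc)
qed

text \<open>Each second derivative of \<open>u\<close>, with its gradient \<open>G i j\<close>, is
  paired with the first derivative of \<open>w\<close> in direction \<open>i\<close>. The constant
  32 is the 4 of the element estimate times 4 pairs of indices times 2, the last factor rounding up
  the \<open>sqrt 2\<close> in the bound of the norm of \<open>G i j\<close>.\<close>

lemma consistency:
  assumes u: "u \<in> H 3 \<Omega>"
    and w: "piecewise \<T> p w" "continuous_at_vertices \<Omega> \<T> w" "continuous_normal_means \<Omega> \<T> w"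
  shows "\<bar>\<Sum>T\<in>\<T>. \<Sum>i\<in>UNIV. \<Sum>j\<in>UNIV. L2_inner (interior T) (wd \<Omega> (idx2 i j) u) (wd (interior T) (idx2 i j) w)
       + L2_inner (interior T) (wd \<Omega> (idx3 i j) u) (wd (interior T) (idx1 i) w)\<bar>
     \<le> 32 * \<sigma>\<^sup>2 * (8 * \<sigma>\<^sup>2 + 16 * \<sigma> + 4) * mesh_size \<T> * H_semi 3 \<Omega> u * sqrt (a_h \<T> w w)"
proof -
  define G where "G i j k = wd \<Omega> (\<lambda>l. idx2 i j l + idx1 k l) u" for i j k
  have deg: "mdeg (\<lambda>l. idx2 i j l + idx1 k l) = 3" for i j k by (simp add: mdeg_add)
  have GL: "G i j k \<in> L2 \<Omega>" for i j k unfolding G_def by (rule wd_L2[OF u]) (simp add: deg)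
  have gL: "wd \<Omega> (idx2 i j) u \<in> L2 \<Omega>" for i j by (rule wd_L2[OF u]) simp
  have wk: "is_weak_deriv \<Omega> (idx1 k) (wd \<Omega> (idx2 i j) u) (G i j k)" for i j k
    unfolding G_def by (rule wd_weak_deriv_pd[OF omega(1,2) u]) simp
  have p: "smooth (p T)" if "T \<in> \<T>" for T using w(1) that by (auto simp: piecewise_def)
  have eq: "L2_inner (interior T) (wd \<Omega> (idx2 i j) u) (wd (interior T) (idx2 i j) w)
       + L2_inner (interior T) (wd \<Omega> (idx3 i j) u) (wd (interior T) (idx1 i) w)
     = L2_inner (interior T) (G i j j) (pd i (p T)) + L2_inner (interior T) (wd \<Omega> (idx2 i j) u) (pd j (pd i (p T)))" if T: "T \<in> \<T>" for T i j
  proof -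
    have 1: "aeq (interior T) (wd (interior T) (idx2 i j) w) (pd j (pd i (p T)))"
      using piecewise_wd(2)[OF w(1) T, of "idx2 i j"] mpd_idx2[OF p[OF T]] pd_commute[OF p[OF T], of i j] by simp
    have 2: "aeq (interior T) (wd (interior T) (idx1 i) w) (pd i (p T))"
      using piecewise_wd(2)[OF w(1) T, of "idx1 i"] mpd_idx1[OF p[OF T]] by simp
    show ?thesis using aeq_L2_inner[OF aeq_refl 1] aeq_L2_inner[OF aeq_refl 2] by (simp add: G_def idx3_def)
  qed
  have a: "(gnorm (interior T) (\<lambda>k. pd k (pd i (p T))))\<^sup>2 \<le> a_form (interior T) w w" if T: "T \<in> \<T>" for T i
  proof -
    have "L2_norm (interior T) (pd k (pd i (p T))) = L2_norm (interior T) (wd (interior T) (idx2 i k) w)" for k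
      using aeq_L2_norm[OF piecewise_wd(2)[OF w(1) T, of "idx2 i k"]] mpd_idx2[OF p[OF T]] pd_commute[OF p[OF T], of i k] by simp
    then have "(gnorm (interior T) (\<lambda>k. pd k (pd i (p T))))\<^sup>2 = (\<Sum>k\<in>UNIV. (L2_norm (interior T) (wd (interior T) (idx2 i k) w))\<^sup>2)"
      by (simp add: gnorm_sq)
    also have "\<dots> \<le> (\<Sum>i\<in>UNIV. \<Sum>k\<in>UNIV. (L2_norm (interior T) (wd (interior T) (idx2 i k) w))\<^sup>2)"
      by (rule member_le_sum) (auto intro: sum_nonneg)
    finally show ?thesis using a_form_sq[OF piecewise_wd(1)[OF w(1) T]] by simp
  qed
  define K where "K = 4 * \<sigma>\<^sup>2 * (8 * \<sigma>\<^sup>2 + 16 * \<sigma> + 4)"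
  have K: "0 \<le> K" using sigma by (simp add: K_def)
  have comp: "\<bar>\<Sum>T\<in>\<T>. L2_inner (interior T) (G i j j) (pd i (p T)) + L2_inner (interior T) (wd \<Omega> (idx2 i j) u) (pd j (pd i (p T)))\<bar>
    \<le> K * mesh_size \<T> * (2 * H_semi 3 \<Omega> u) * sqrt (a_h \<T> w w)" for i j
  proof -
    have "gnorm \<Omega> (G i j) \<le> 2 * H_semi 3 \<Omega> u"
    proof -
      have "L2_norm \<Omega> (G i j k) \<le> H_semi 3 \<Omega> u" for k
        using wd_le_H_semi[of \<Omega> "\<lambda>l. idx2 i j l + idx1 k l" u] unfolding deg G_def .
      then have "(gnorm \<Omega> (G i j))\<^sup>2 \<le> (\<Sum>k\<in>(UNIV::2 set). (H_semi 3 \<Omega> u)\<^sup>2)"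
        unfolding gnorm_sq by (intro sum_mono power_mono) auto
      also have "\<dots> \<le> (2 * H_semi 3 \<Omega> u)\<^sup>2" by (simp add: power_mult_distrib)
      finally show ?thesis by (rule power2_le_imp_le) simp
    qed
    moreover have "sqrt (\<Sum>T\<in>\<T>. (gnorm (interior T) (\<lambda>k. pd k (pd i (p T))))\<^sup>2) \<le> sqrt (a_h \<T> w w)"
      unfolding a_h_def by (intro real_sqrt_le_mono sum_mono a)
    moreover have "\<bar>\<Sum>T\<in>\<T>. L2_inner (interior T) (G i j j) (pd i (p T)) + L2_inner (interior T) (wd \<Omega> (idx2 i j) u) (pd j (pd i (p T)))\<bar>
      \<le> K * mesh_size \<T> * gnorm \<Omega> (G i j) * sqrt (\<Sum>T\<in>\<T>. (gnorm (interior T) (\<lambda>k. pd k (pd i (p T))))\<^sup>2)"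
      unfolding K_def by (rule component_consistency[OF gL GL wk w])
    ultimately show ?thesis using K mesh_size_nonneg
      by (elim order_trans) (intro mult_mono mult_left_mono mult_nonneg_nonneg, auto simp: sum_nonneg)
  qed
  have "(\<Sum>T\<in>\<T>. \<Sum>i\<in>UNIV. \<Sum>j\<in>UNIV. L2_inner (interior T) (wd \<Omega> (idx2 i j) u) (wd (interior T) (idx2 i j) w)
       + L2_inner (interior T) (wd \<Omega> (idx3 i j) u) (wd (interior T) (idx1 i) w))
    = (\<Sum>T\<in>\<T>. \<Sum>i\<in>UNIV. \<Sum>j\<in>UNIV. L2_inner (interior T) (G i j j) (pd i (p T)) + L2_inner (interior T) (wd \<Omega> (idx2 i j) u) (pd j (pd i (p T))))"
    by (intro sum.cong refl eq)
  also have "\<dots> = (\<Sum>i\<in>UNIV. \<Sum>j\<in>UNIV. \<Sum>T\<in>\<T>. L2_inner (interior T) (G i j j) (pd i (p T)) + L2_inner (interior T) (wd \<Omega> (idx2 i j) u) (pd j (pd i (p T))))"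
    by (subst sum.swap) (intro sum.cong refl sum.swap)
  finally have e: "(\<Sum>T\<in>\<T>. \<Sum>i\<in>UNIV. \<Sum>j\<in>UNIV. L2_inner (interior T) (wd \<Omega> (idx2 i j) u) (wd (interior T) (idx2 i j) w)
       + L2_inner (interior T) (wd \<Omega> (idx3 i j) u) (wd (interior T) (idx1 i) w)) = \<dots>" .
  have "\<bar>\<Sum>i\<in>UNIV. \<Sum>j\<in>UNIV. \<Sum>T\<in>\<T>. L2_inner (interior T) (G i j j) (pd i (p T)) + L2_inner (interior T) (wd \<Omega> (idx2 i j) u) (pd j (pd i (p T)))\<bar>
    \<le> (\<Sum>i\<in>(UNIV::2 set). \<Sum>j\<in>(UNIV::2 set). K * mesh_size \<T> * (2 * H_semi 3 \<Omega> u) * sqrt (a_h \<T> w w))"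
    by (intro order_trans[OF sum_abs sum_mono] comp)
  also have "\<dots> = 8 * K * mesh_size \<T> * H_semi 3 \<Omega> u * sqrt (a_h \<T> w w)" by simp
  finally show ?thesis unfolding e by (simp add: K_def)
qed

end

section \<open>The consistency error\<close>

lemma L2_norm_zero [simp]: "L2_norm S (\<lambda>x. 0) = 0"
  by (simp add: L2_norm_def L2_inner_def set_lebesgue_integral_def)

lemma mpd_zero_fun: "mpd \<alpha> (\<lambda>x. 0) = (\<lambda>x. 0)"
proof -
  have "(pd i ^^ n) (\<lambda>x. 0) = (\<lambda>x. 0)" for i n by (induction n) auto
  then show ?thesis by (simp add: mpd_def)
qed

lemma wd_zero_fun: "open S \<Longrightarrow> bounded S \<Longrightarrow> L2_norm S (wd S \<alpha> (\<lambda>x. 0)) = 0"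
  using aeq_L2_norm[OF H_smooth(2)[of S "\<lambda>x. 0" \<alpha>]] by (simp add: mpd_zero_fun)

lemma test_functions_H0:
  assumes "\<phi> \<in> test_functions S" "open S" "bounded S"
  shows "\<phi> \<in> H0 m S"
  using H_smooth(1)[OF assms(2,3) test_functionsD(1)[OF assms(1)]] assms(1) wd_zero_fun[OF assms(2,3)]
  by (auto simp: H0_def H_norm_def intro!: bexI[of _ \<phi>])

lemma H0_subset_H: "u \<in> H0 m S \<Longrightarrow> u \<in> H m S"
  by (simp add: H0_def)

text \<open>For a test function one integration by parts moves a derivative over to
  \<open>u\<close>. After that only first derivatives of the test function occur, so both sides are
  continuous in the H1 norm and the identity extends by density.\<close>

lemma weak_equation_H01:
  assumes S: "open S" "bounded S" and u: "u \<in> H 3 S" and f: "f \<in> L2 S" and z: "z \<in> H0 1 S"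
    and eq: "\<And>v. v \<in> H0 2 S \<Longrightarrow> c * a_form S u v + b_form S u v = L2_inner S f v"
  shows "L2_inner S f z = - c * (\<Sum>i\<in>UNIV. \<Sum>j\<in>UNIV. L2_inner S (wd S (idx3 i j) u) (wd S (idx1 i) z))
     + (\<Sum>i\<in>UNIV. L2_inner S (wd S (idx1 i) u) (wd S (idx1 i) z))"
proof -
  have zH: "z \<in> H 1 S" using z by (rule H0_subset_H)
  have u2: "u \<in> H 2 S" "u \<in> H 1 S" using H_mono[OF u] by auto
  have g3: "wd S (idx3 i j) u \<in> L2 S" for i j by (rule wd_L2[OF u]) simp
  have g2: "wd S (idx2 i j) u \<in> L2 S" for i j by (rule wd_L2[OF u]) simp
  have g1: "wd S (idx1 i) u \<in> L2 S" for i by (rule wd_L2[OF u]) simp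
  \<comment> \<open>The residual of the claimed identity as a functional of
    \<open>v\<close>.\<close>
  define \<Lambda> where "\<Lambda> v = L2_inner S f v + c * (\<Sum>i\<in>UNIV. \<Sum>j\<in>UNIV. L2_inner S (wd S (idx3 i j) u) (wd S (idx1 i) v))
     - (\<Sum>i\<in>UNIV. L2_inner S (wd S (idx1 i) u) (wd S (idx1 i) v))" for v
  have test: "\<Lambda> \<phi> = 0" if \<phi>: "\<phi> \<in> test_functions S" for \<phi>
  proof -
    have sm: "smooth \<phi>" using test_functionsD(1)[OF \<phi>] .
    have H2: "\<phi> \<in> H0 2 S" by (rule test_functions_H0[OF \<phi> S])
    have H2': "\<phi> \<in> H 2 S" "\<phi> \<in> H 1 S" using H0_subset_H[OF H2] H_mono by auto
    have e1: "L2_inner S h (wd S (idx1 i) \<phi>) = L2_inner S h (pd i \<phi>)" for h i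
      using aeq_L2_inner[OF aeq_refl H_smooth(2)[OF S sm, of "idx1 i"]] mpd_idx1[OF sm] by simp
    have e2: "L2_inner S (wd S (idx2 i j) u) (wd S (idx2 i j) \<phi>) = - L2_inner S (wd S (idx3 i j) u) (pd i \<phi>)" for i j
    proof -
      have "L2_inner S (wd S (idx2 i j) u) (wd S (idx2 i j) \<phi>) = L2_inner S (wd S (idx2 i j) u) (pd j (pd i \<phi>))"
        using aeq_L2_inner[OF aeq_refl H_smooth(2)[OF S sm, of "idx2 i j"]] mpd_idx2[OF sm] pd_commute[OF sm, of i j] by simp
      also have "\<dots> = - L2_inner S (wd S (idx3 i j) u) (pd i \<phi>)"
      proof -
        have "is_weak_deriv S (idx1 j) (wd S (idx2 i j) u) (wd S (idx3 i j) u)"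
          using wd_weak_deriv_pd[OF S u, of "idx2 i j" j] by (simp add: idx3_def)
        then have "L2_inner S (wd S (idx2 i j) u) (mpd (idx1 j) (pd i \<phi>)) = (-1) ^ mdeg (idx1 j) * L2_inner S (wd S (idx3 i j) u) (pd i \<phi>)"
          unfolding is_weak_deriv_def using test_functions_pd[OF \<phi>, of i] by blast
        then show ?thesis by (simp add: mpd_idx1[OF smooth_pd[OF sm]])
      qed
      finally show ?thesis .
    qed
    have "a_form S u \<phi> = - (\<Sum>i\<in>UNIV. \<Sum>j\<in>UNIV. L2_inner S (wd S (idx3 i j) u) (pd i \<phi>))"
      unfolding a_form_eq[OF u2(1) H2'(1)] e2 by (simp add: sum_negf)
    moreover have "b_form S u \<phi> = (\<Sum>i\<in>UNIV. L2_inner S (wd S (idx1 i) u) (pd i \<phi>))"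
      unfolding b_form_eq[OF u2(2) H2'(2)] e1 ..
    ultimately show ?thesis using eq[OF H2] unfolding \<Lambda>_def e1 by simp
  qed
  \<comment> \<open>A bound for this functional in the H1 norm; it may be 0, hence
    \<open>M + 1\<close> in the choice of \<open>e'\<close>.\<close>
  define M where "M = L2_norm S f + \<bar>c\<bar> * (\<Sum>i\<in>UNIV. \<Sum>j\<in>UNIV. L2_norm S (wd S (idx3 i j) u)) + (\<Sum>i\<in>UNIV. L2_norm S (wd S (idx1 i) u))"
  have M: "0 \<le> M" unfolding M_def by (intro add_nonneg_nonneg mult_nonneg_nonneg sum_nonneg) auto
  have bound: "\<bar>\<Lambda> z\<bar> \<le> 0 + e" if "0 < e" for e
  proof -
    define e' where "e' = e / (M + 1)"
    have e': "0 < e'" "M * e' \<le> e" using that M by (auto simp: e'_def field_simps)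
    obtain \<phi> where \<phi>: "\<phi> \<in> test_functions S" "H_norm 1 S (\<lambda>x. z x - \<phi> x) < e'"
      using z e'(1) by (auto simp: H0_def)
    have \<phi>H: "\<phi> \<in> H 1 S" using test_functions_H0[OF \<phi>(1) S] H0_subset_H by blast
    define r where "r x = z x - \<phi> x" for x
    have rH: "r \<in> H 1 S" unfolding r_def by (rule H_diff(1)[OF S zH \<phi>H])
    have small: "L2_norm S (wd S \<alpha> r) \<le> e'" if "mdeg \<alpha> \<le> 1" for \<alpha>
      using wd_le_H_norm[OF that, of S r] \<phi>(2) unfolding r_def by linarith
    have r0: "L2_norm S r \<le> e'"
      using small[of "\<lambda>_. 0"] aeq_L2_norm[OF wd_zero[OF S H_imp_L2[OF rH]]] by (simp add: mdeg_eq)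
    have r1: "L2_norm S (wd S (idx1 i) r) \<le> e'" for i by (rule small) simp
    have d0: "L2_inner S f z - L2_inner S f \<phi> = L2_inner S f r"
      unfolding r_def using L2_inner_diff_right[OF H_imp_L2[OF zH] H_imp_L2[OF \<phi>H] f] by simp
    have d1: "L2_inner S h (wd S (idx1 i) z) - L2_inner S h (wd S (idx1 i) \<phi>) = L2_inner S h (wd S (idx1 i) r)" if h: "h \<in> L2 S" for h i
    proof -
      have "aeq S (wd S (idx1 i) r) (\<lambda>x. wd S (idx1 i) z x - wd S (idx1 i) \<phi> x)"
        unfolding r_def by (rule H_diff(2)[OF S zH \<phi>H]) simp
      from aeq_L2_inner[OF aeq_refl this]
      have "L2_inner S h (wd S (idx1 i) r) = L2_inner S h (\<lambda>x. wd S (idx1 i) z x - wd S (idx1 i) \<phi> x)" .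
      also have "\<dots> = L2_inner S h (wd S (idx1 i) z) - L2_inner S h (wd S (idx1 i) \<phi>)"
        by (intro L2_inner_diff_right wd_L2[OF zH] wd_L2[OF \<phi>H] h) auto
      finally show ?thesis ..
    qed
    have "\<Lambda> z = \<Lambda> z - \<Lambda> \<phi>" using test[OF \<phi>(1)] by simp
    also have "\<dots> = L2_inner S f r + c * (\<Sum>i\<in>UNIV. \<Sum>j\<in>UNIV. L2_inner S (wd S (idx3 i j) u) (wd S (idx1 i) r))
       - (\<Sum>i\<in>UNIV. L2_inner S (wd S (idx1 i) u) (wd S (idx1 i) r))"
      unfolding \<Lambda>_def d0[symmetric] d1[OF g3, symmetric] d1[OF g1, symmetric]
      by (simp add: sum_subtractf algebra_simps)
    finally have L: "\<Lambda> z = \<dots>" .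
    have cs: "\<bar>L2_inner S h q\<bar> \<le> L2_norm S h * e'" if "h \<in> L2 S" "q \<in> L2 S" "L2_norm S q \<le> e'" for h q
      using L2_Cauchy_Schwarz[OF that(1,2)] mult_left_mono[OF that(3) L2_norm_nonneg[of S h]] by linarith
    have rL: "wd S (idx1 i) r \<in> L2 S" for i by (rule wd_L2[OF rH]) simp
    have t1: "\<bar>L2_inner S f r\<bar> \<le> L2_norm S f * e'" by (rule cs[OF f H_imp_L2[OF rH] r0])
    have t2: "\<bar>\<Sum>i\<in>UNIV. \<Sum>j\<in>UNIV. L2_inner S (wd S (idx3 i j) u) (wd S (idx1 i) r)\<bar> \<le> (\<Sum>i\<in>UNIV. \<Sum>j\<in>UNIV. L2_norm S (wd S (idx3 i j) u) * e')"
      by (intro order_trans[OF sum_abs sum_mono] cs g3 rL r1)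
    have t3: "\<bar>\<Sum>i\<in>UNIV. L2_inner S (wd S (idx1 i) u) (wd S (idx1 i) r)\<bar> \<le> (\<Sum>i\<in>UNIV. L2_norm S (wd S (idx1 i) u) * e')"
      by (intro order_trans[OF sum_abs sum_mono] cs g1 rL r1)
    have "\<bar>\<Lambda> z\<bar> \<le> \<bar>L2_inner S f r\<bar> + \<bar>c\<bar> * \<bar>\<Sum>i\<in>UNIV. \<Sum>j\<in>UNIV. L2_inner S (wd S (idx3 i j) u) (wd S (idx1 i) r)\<bar>
       + \<bar>\<Sum>i\<in>UNIV. L2_inner S (wd S (idx1 i) u) (wd S (idx1 i) r)\<bar>"
      unfolding L abs_mult[symmetric] by linarith
    also have "\<dots> \<le> L2_norm S f * e' + \<bar>c\<bar> * (\<Sum>i\<in>UNIV. \<Sum>j\<in>UNIV. L2_norm S (wd S (idx3 i j) u) * e') + (\<Sum>i\<in>UNIV. L2_norm S (wd S (idx1 i) u) * e')"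
      by (intro add_mono mult_left_mono t1 t2 t3) auto
    also have "\<dots> = M * e'" by (simp add: M_def sum_distrib_right algebra_simps sum_distrib_left)
    finally show ?thesis using e'(2) by simp
  qed
  have "\<bar>\<Lambda> z\<bar> \<le> 0" by (rule field_le_epsilon[OF bound])
  then show ?thesis by (simp add: \<Lambda>_def)
qed

section \<open>The energy form, the Strang argument and the residual\<close>

context regular_mesh
begin

definition eform :: "real \<Rightarrow> fn \<Rightarrow> fn \<Rightarrow> real" where
  "eform \<epsilon> v w = \<epsilon>\<^sup>2 * a_h \<T> v w + b_h \<T> v w"

lemma energy_norm_eform: "energy_norm \<epsilon> \<T> v = sqrt (eform \<epsilon> v v)"
  by (simp add: energy_norm_def eform_def)

text \<open>A common space for \<open>u\<close> and the discrete functions, on which the energy form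
  is bilinear and nonnegative.\<close>

definition broken :: "fn set" where
  "broken = {v. \<forall>T\<in>\<T>. v \<in> H 2 (interior T)}"

lemma eform_commute: "eform \<epsilon> v w = eform \<epsilon> w v"
  by (simp add: eform_def a_h_def b_h_def a_form_def b_form_def mult.commute)

lemma form_lincomb:
  assumes S: "open S" "bounded S" and v: "v \<in> H 2 S" "w \<in> H 2 S" "z \<in> H 2 S"
  shows "a_form S (\<lambda>x. v x + c * w x) z = a_form S v z + c * a_form S w z"
    and "b_form S (\<lambda>x. v x + c * w x) z = b_form S v z + c * b_form S w z"
proof -
  have l: "(\<lambda>x. v x + c * w x) \<in> H 2 S" by (rule H_lincomb(1)[OF S v(1,2)])
  have *: "L2_inner S (wd S \<alpha> (\<lambda>x. v x + c * w x)) (wd S \<alpha> z) = L2_inner S (wd S \<alpha> v) (wd S \<alpha> z) + c * L2_inner S (wd S \<alpha> w) (wd S \<alpha> z)"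
    if "mdeg \<alpha> \<le> 2" for \<alpha>
    using aeq_L2_inner[OF H_lincomb(2)[OF S v(1,2) that, of c] aeq_refl, of "wd S \<alpha> z"] wd_L2[OF v(1) that] wd_L2[OF v(2) that] wd_L2[OF v(3) that]
    by (simp add: L2_inner_add L2_inner_cmult L2_cmult)
  show "a_form S (\<lambda>x. v x + c * w x) z = a_form S v z + c * a_form S w z"
    unfolding a_form_eq[OF l v(3)] a_form_eq[OF v(1,3)] a_form_eq[OF v(2,3)]
    using * by (simp add: sum.distrib sum_distrib_left)
  have 1: "x \<in> H 1 S" if "x \<in> H 2 S" for x using H_mono[OF that] by simp
  show "b_form S (\<lambda>x. v x + c * w x) z = b_form S v z + c * b_form S w z"
    unfolding b_form_eq[OF 1[OF l] 1[OF v(3)]] b_form_eq[OF 1[OF v(1)] 1[OF v(3)]] b_form_eq[OF 1[OF v(2)] 1[OF v(3)]]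
    using * by (simp add: sum.distrib sum_distrib_left)
qed

lemma broken_lincomb: "v \<in> broken \<Longrightarrow> w \<in> broken \<Longrightarrow> (\<lambda>x. v x + c * w x) \<in> broken"
  using H_lincomb(1)[OF interior_facts(1,2)] by (auto simp: broken_def)

lemma eform_lincomb:
  assumes "v \<in> broken" "w \<in> broken" "z \<in> broken"
  shows "eform \<epsilon> (\<lambda>x. v x + c * w x) z = eform \<epsilon> v z + c * eform \<epsilon> w z"
proof -
  have "a_h \<T> (\<lambda>x. v x + c * w x) z = a_h \<T> v z + c * a_h \<T> w z"
    "b_h \<T> (\<lambda>x. v x + c * w x) z = b_h \<T> v z + c * b_h \<T> w z"
    using assms form_lincomb[OF interior_facts(1,2)]
    by (simp_all add: a_h_def b_h_def broken_def sum_distrib_left sum.distrib[symmetric])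
  then show ?thesis by (simp add: eform_def algebra_simps)
qed

lemma broken_nonneg:
  assumes "v \<in> broken"
  shows "0 \<le> a_h \<T> v v" "0 \<le> b_h \<T> v v" "0 \<le> eform \<epsilon> v v"
proof -
  show a: "0 \<le> a_h \<T> v v" "0 \<le> b_h \<T> v v"
    unfolding a_h_def b_h_def using assms H_mono[of v 2 _ 1]
    by (auto intro!: sum_nonneg a_form_nonneg b_form_nonneg simp: broken_def)
  then show "0 \<le> eform \<epsilon> v v" by (simp add: eform_def)
qed

lemma eform_sum_sq:
  assumes "v \<in> broken" "w \<in> broken"
  shows "eform \<epsilon> (\<lambda>x. v x + c * w x) (\<lambda>x. v x + c * w x) = eform \<epsilon> v v + 2 * c * eform \<epsilon> v w + c\<^sup>2 * eform \<epsilon> w w"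
proof -
  note l = broken_lincomb[OF assms, of c]
  have "eform \<epsilon> (\<lambda>x. v x + c * w x) (\<lambda>x. v x + c * w x) = eform \<epsilon> (\<lambda>x. v x + c * w x) v + c * eform \<epsilon> (\<lambda>x. v x + c * w x) w"
    using eform_lincomb[OF assms l, of \<epsilon> c] eform_commute by metis
  also have "\<dots> = eform \<epsilon> v v + 2 * c * eform \<epsilon> v w + c\<^sup>2 * eform \<epsilon> w w"
    using eform_commute[of \<epsilon> w v]
    by (simp add: eform_lincomb[OF assms assms(1)] eform_lincomb[OF assms assms(2)] power2_eq_square algebra_simps)
  finally show ?thesis .
qed

lemma eform_Cauchy_Schwarz:
  assumes "v \<in> broken" "w \<in> broken"
  shows "\<bar>eform \<epsilon> v w\<bar> \<le> energy_norm \<epsilon> \<T> v * energy_norm \<epsilon> \<T> w"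
  unfolding energy_norm_eform
proof (rule quadratic_nonneg_discriminant)
  fix t show "0 \<le> eform \<epsilon> v v + 2 * t * eform \<epsilon> v w + t\<^sup>2 * eform \<epsilon> w w"
    using broken_nonneg(3)[OF broken_lincomb[OF assms], of \<epsilon> t] unfolding eform_sum_sq[OF assms] .
qed (intro broken_nonneg assms)+

lemma energy_norm_triangle:
  assumes "v \<in> broken" "w \<in> broken"
  shows "energy_norm \<epsilon> \<T> (\<lambda>x. v x + w x) \<le> energy_norm \<epsilon> \<T> v + energy_norm \<epsilon> \<T> w"
proof (rule power2_le_imp_le)
  note nn = broken_nonneg(3)[OF assms(1), of \<epsilon>] broken_nonneg(3)[OF assms(2), of \<epsilon>] broken_nonneg(3)[OF broken_lincomb[OF assms, of 1], of \<epsilon>]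
  have "(energy_norm \<epsilon> \<T> (\<lambda>x. v x + w x))\<^sup>2 = eform \<epsilon> v v + 2 * eform \<epsilon> v w + eform \<epsilon> w w"
    using eform_sum_sq[OF assms, of \<epsilon> 1] nn by (simp add: energy_norm_eform)
  also have "\<dots> \<le> eform \<epsilon> v v + 2 * (energy_norm \<epsilon> \<T> v * energy_norm \<epsilon> \<T> w) + eform \<epsilon> w w"
    using eform_Cauchy_Schwarz[OF assms, of \<epsilon>] by linarith
  also have "\<dots> = (energy_norm \<epsilon> \<T> v + energy_norm \<epsilon> \<T> w)\<^sup>2"
    using nn by (simp add: energy_norm_eform power2_sum)
  finally show "(energy_norm \<epsilon> \<T> (\<lambda>x. v x + w x))\<^sup>2 \<le> (energy_norm \<epsilon> \<T> v + energy_norm \<epsilon> \<T> w)\<^sup>2" .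
  show "0 \<le> energy_norm \<epsilon> \<T> v + energy_norm \<epsilon> \<T> w" using nn by (simp add: energy_norm_eform)
qed

text \<open>The energy of \<open>w = q - u\<^sub>h\<close> equals the residual at \<open>w\<close>
  minus the form applied to \<open>u - q\<close> and \<open>w\<close>. Dividing by the norm of
  \<open>w\<close> bounds it by \<open>R\<close> plus the norm of \<open>u - q\<close>; the triangle
  inequality adds that norm once more.\<close>

lemma strang:
  assumes X: "u \<in> broken" "q \<in> broken" "u\<^sub>h \<in> broken"
    and res: "\<bar>eform \<epsilon> u (\<lambda>x. q x - u\<^sub>h x) - eform \<epsilon> u\<^sub>h (\<lambda>x. q x - u\<^sub>h x)\<bar> \<le> R * energy_norm \<epsilon> \<T> (\<lambda>x. q x - u\<^sub>h x)" and R: "0 \<le> R"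
  shows "energy_norm \<epsilon> \<T> (\<lambda>x. u x - u\<^sub>h x) \<le> 2 * energy_norm \<epsilon> \<T> (\<lambda>x. u x - q x) + R"
proof -
  define w where "w x = q x - u\<^sub>h x" for x
  define e where "e x = u x - q x" for x
  have weq: "w = (\<lambda>x. q x + (-1) * u\<^sub>h x)" "e = (\<lambda>x. u x + (-1) * q x)" by (auto simp: w_def e_def)
  have wX: "w \<in> broken" "e \<in> broken" unfolding weq by (intro broken_lincomb X)+
  have "eform \<epsilon> w w = eform \<epsilon> q w - eform \<epsilon> u\<^sub>h w"
    using eform_lincomb[OF X(2,3) wX(1), of \<epsilon> "-1"] unfolding weq(1)[symmetric] by simp
  moreover have "eform \<epsilon> e w = eform \<epsilon> u w - eform \<epsilon> q w"
    using eform_lincomb[OF X(1,2) wX(1), of \<epsilon> "-1"] unfolding weq(2)[symmetric] by simp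
  ultimately have "eform \<epsilon> w w = (eform \<epsilon> u w - eform \<epsilon> u\<^sub>h w) - eform \<epsilon> e w" by simp
  also have "\<dots> \<le> R * energy_norm \<epsilon> \<T> w + energy_norm \<epsilon> \<T> e * energy_norm \<epsilon> \<T> w"
    using eform_Cauchy_Schwarz[OF wX(2,1), of \<epsilon>] res unfolding w_def[symmetric] by linarith
  finally have le: "energy_norm \<epsilon> \<T> w * energy_norm \<epsilon> \<T> w \<le> (R + energy_norm \<epsilon> \<T> e) * energy_norm \<epsilon> \<T> w"
    using broken_nonneg(3)[OF wX(1), of \<epsilon>] by (simp add: energy_norm_eform algebra_simps)
  have nn: "0 \<le> energy_norm \<epsilon> \<T> w" "0 \<le> energy_norm \<epsilon> \<T> e" using broken_nonneg(3)[OF wX(1)] broken_nonneg(3)[OF wX(2)] by (simp_all add: energy_norm_eform)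
  have "energy_norm \<epsilon> \<T> w \<le> R + energy_norm \<epsilon> \<T> e"
  proof (cases "energy_norm \<epsilon> \<T> w = 0")
    case False
    then show ?thesis using le nn by simp
  qed (use R nn in simp)
  moreover have "energy_norm \<epsilon> \<T> (\<lambda>x. u x - u\<^sub>h x) \<le> energy_norm \<epsilon> \<T> e + energy_norm \<epsilon> \<T> w"
    using energy_norm_triangle[OF wX(2,1), of \<epsilon>] by (simp add: e_def w_def)
  ultimately show ?thesis unfolding e_def[symmetric] by simp
qed

text \<open>The constants are crude: the forms have four and two terms, each at most the square of
  the full norm.\<close>

lemma interpolation_energy:
  assumes e: "e \<in> broken" and \<epsilon>: "0 \<le> \<epsilon>"
  shows "energy_norm \<epsilon> \<T> e \<le> 2 * \<epsilon> * sqrt (\<Sum>T\<in>\<T>. (H_norm 2 (interior T) e)\<^sup>2) + 2 * sqrt (\<Sum>T\<in>\<T>. (H_norm 1 (interior T) e)\<^sup>2)"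
proof -
  have e2: "e \<in> H 2 (interior T)" "e \<in> H 1 (interior T)" if "T \<in> \<T>" for T using e that H_mono[of e 2 _ 1] by (auto simp: broken_def)
  have a: "a_form (interior T) e e \<le> 4 * (H_norm 2 (interior T) e)\<^sup>2" if T: "T \<in> \<T>" for T
  proof -
    have "a_form (interior T) e e \<le> (\<Sum>i\<in>(UNIV::2 set). \<Sum>j\<in>(UNIV::2 set). (H_norm 2 (interior T) e)\<^sup>2)"
      unfolding a_form_sq[OF e2(1)[OF T]] by (intro sum_mono power_mono wd_le_H_norm) auto
    then show ?thesis by simp
  qed
  have b: "b_form (interior T) e e \<le> 4 * (H_norm 1 (interior T) e)\<^sup>2" if T: "T \<in> \<T>" for T
  proof -
    have "b_form (interior T) e e \<le> (\<Sum>i\<in>(UNIV::2 set). (H_norm 1 (interior T) e)\<^sup>2)"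
      unfolding b_form_sq[OF e2(2)[OF T]] by (intro sum_mono power_mono wd_le_H_norm) auto
    also have "\<dots> = 2 * (H_norm 1 (interior T) e)\<^sup>2" by simp
    also have "\<dots> \<le> 4 * (H_norm 1 (interior T) e)\<^sup>2" by (rule mult_right_mono) auto
    finally show ?thesis .
  qed
  have A: "a_h \<T> e e \<le> 4 * (\<Sum>T\<in>\<T>. (H_norm 2 (interior T) e)\<^sup>2)" "b_h \<T> e e \<le> 4 * (\<Sum>T\<in>\<T>. (H_norm 1 (interior T) e)\<^sup>2)"
    unfolding a_h_def b_h_def sum_distrib_left by (intro sum_mono a b; assumption)+
  have "energy_norm \<epsilon> \<T> e \<le> sqrt (\<epsilon>\<^sup>2 * a_h \<T> e e) + sqrt (b_h \<T> e e)"
    unfolding energy_norm_def using broken_nonneg[OF e] by (intro sqrt_add_le_add_sqrt) auto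
  also have "\<dots> \<le> sqrt (\<epsilon>\<^sup>2 * (4 * (\<Sum>T\<in>\<T>. (H_norm 2 (interior T) e)\<^sup>2))) + sqrt (4 * (\<Sum>T\<in>\<T>. (H_norm 1 (interior T) e)\<^sup>2))"
    by (intro add_mono real_sqrt_le_mono mult_left_mono A) auto
  also have "\<dots> = 2 * \<epsilon> * sqrt (\<Sum>T\<in>\<T>. (H_norm 2 (interior T) e)\<^sup>2) + 2 * sqrt (\<Sum>T\<in>\<T>. (H_norm 1 (interior T) e)\<^sup>2)"
    using \<epsilon> by (simp add: real_sqrt_mult)
  finally show ?thesis .
qed

text \<open>Stated for an arbitrary companion \<open>z\<close> with its own constant
  \<open>C\<close>, so that \<open>z = w\<close> and \<open>C = 0\<close> are admissible and give
  the conforming case.\<close>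

lemma consistency_error:
  assumes u: "u \<in> H 3 \<Omega>" and f: "f \<in> L2 \<Omega>" and \<epsilon>: "0 < \<epsilon>" and z: "z \<in> H0 1 \<Omega>"
    and eq: "\<And>v. v \<in> H0 2 \<Omega> \<Longrightarrow> \<epsilon>\<^sup>2 * a_form \<Omega> u v + b_form \<Omega> u v = L2_inner \<Omega> f v"
    and w: "piecewise \<T> p w" "continuous_at_vertices \<Omega> \<T> w" "continuous_normal_means \<Omega> \<T> w"
    and mean: "\<And>T i. T \<in> \<T> \<Longrightarrow> (LINT x:interior T|lebesgue. wd (interior T) (idx1 i) (\<lambda>y. w y - z y) x) = 0"
    and C: "0 \<le> C"
      "\<And>T. T \<in> \<T> \<Longrightarrow> H_semi 0 (interior T) (\<lambda>y. w y - z y) \<le> C * mesh_size \<T> * H_semi 1 (interior T) w"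
      "\<And>T. T \<in> \<T> \<Longrightarrow> H_semi 1 (interior T) (\<lambda>y. w y - z y) \<le> C * H_semi 1 (interior T) w"
      "\<And>T. T \<in> \<T> \<Longrightarrow> H_semi 1 (interior T) (\<lambda>y. w y - z y) \<le> C * mesh_size \<T> * H_semi 2 (interior T) w"
  shows "\<bar>eform \<epsilon> u w - L2_inner \<Omega> f w\<bar> \<le> mesh_size \<T> *
    ((32 * \<sigma>\<^sup>2 * (8 * \<sigma>\<^sup>2 + 16 * \<sigma> + 4) + 4 * C) * (\<epsilon> * H_semi 3 \<Omega> u) + 8 * \<sigma> * C * H_semi 2 \<Omega> u + C * L2_norm \<Omega> f)
    * energy_norm \<epsilon> \<T> w"
proof -
  let ?S = "\<lambda>T. interior T"
  define h where "h = mesh_size \<T>"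
  have h: "0 \<le> h" unfolding h_def by (rule mesh_size_nonneg)
  have zH: "z \<in> H 1 \<Omega>" using z by (rule H0_subset_H)
  note SF = interior_facts
  have zT: "z \<in> H 1 (?S T)" "aeq (?S T) (wd (?S T) (idx1 i) z) (wd \<Omega> (idx1 i) z)" if "T \<in> \<T>" for T i
    using H_subset(1)[OF zH SF(1-3)[OF that]] H_subset(2)[OF zH SF(1-3)[OF that], of "idx1 i"] by auto
  have uT: "u \<in> H 3 (?S T)" "mdeg \<alpha> \<le> 3 \<Longrightarrow> aeq (?S T) (wd (?S T) \<alpha> u) (wd \<Omega> \<alpha> u)" if "T \<in> \<T>" for T \<alpha>
    using H_subset(1)[OF u SF(1-3)[OF that]] H_subset(2)[OF u SF(1-3)[OF that], of \<alpha>] by auto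
  have wT: "w \<in> H m (?S T)" if "T \<in> \<T>" for T m using piecewise_wd(1)[OF w(1) that] .
  have wX: "w \<in> broken" using wT by (simp add: broken_def)
  define r where "r y = w y - z y" for y
  have rH: "r \<in> H 1 (?S T)" if T: "T \<in> \<T>" for T
    unfolding r_def by (rule H_diff(1)[OF SF(1,2)[OF T] wT[OF T] zT(1)[OF T]])
  have rwd: "aeq (?S T) (wd (?S T) (idx1 i) r) (\<lambda>x. wd (?S T) (idx1 i) w x - wd (?S T) (idx1 i) z x)" if T: "T \<in> \<T>" for T i
    unfolding r_def by (rule H_diff(2)[OF SF(1,2)[OF T] wT[OF T] zT(1)[OF T]]) simp
  have uL: "wd \<Omega> \<alpha> u \<in> L2 \<Omega>" if "mdeg \<alpha> \<le> 3" for \<alpha> using wd_L2[OF u that] .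
  have uLT: "wd \<Omega> \<alpha> u \<in> L2 (?S T)" if "mdeg \<alpha> \<le> 3" "T \<in> \<T>" for \<alpha> T using omega_L2_interior[OF uL] that by blast
  have split: "L2_inner (?S T) g (wd (?S T) (idx1 i) w) - L2_inner (?S T) g (wd \<Omega> (idx1 i) z) = L2_inner (?S T) g (wd (?S T) (idx1 i) r)"
    if T: "T \<in> \<T>" and g: "g \<in> L2 (?S T)" for T i g
  proof -
    have "L2_inner (?S T) g (wd (?S T) (idx1 i) r) = L2_inner (?S T) g (wd (?S T) (idx1 i) w) - L2_inner (?S T) g (wd (?S T) (idx1 i) z)"
      unfolding aeq_L2_inner[OF aeq_refl rwd[OF T]]
      by (intro L2_inner_diff_right wd_L2[OF wT[OF T]] wd_L2[OF zT(1)[OF T]] g) auto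
    then show ?thesis using aeq_L2_inner[OF aeq_refl zT(2)[OF T]] by simp
  qed
  have zL: "wd \<Omega> (idx1 i) z \<in> L2 \<Omega>" for i by (rule wd_L2[OF zH]) simp
  have meshz: "L2_inner \<Omega> (wd \<Omega> \<alpha> u) (wd \<Omega> (idx1 i) z) = (\<Sum>T\<in>\<T>. L2_inner (?S T) (wd \<Omega> \<alpha> u) (wd \<Omega> (idx1 i) z))" if "mdeg \<alpha> \<le> 3" for \<alpha> i
    by (rule mesh_L2_inner) (auto intro: uLT that omega_L2_interior zL)
  \<comment> \<open>\<open>Q\<close> is the expression bounded in \<open>consistency\<close>. The
    three remainders collect what is left when \<open>w\<close> is replaced by \<open>z\<close>, in
    the third-order terms, in the gradient terms and in the load.\<close>
  define Q where "Q = (\<Sum>T\<in>\<T>. \<Sum>i\<in>UNIV. \<Sum>j\<in>UNIV. L2_inner (?S T) (wd \<Omega> (idx2 i j) u) (wd (?S T) (idx2 i j) w)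
       + L2_inner (?S T) (wd \<Omega> (idx3 i j) u) (wd (?S T) (idx1 i) w))"
  define R1 where "R1 = (\<Sum>i\<in>UNIV. \<Sum>j\<in>UNIV. \<Sum>T\<in>\<T>. L2_inner (?S T) (wd \<Omega> (idx3 i j) u) (wd (?S T) (idx1 i) r))"
  define R2 where "R2 = (\<Sum>i\<in>UNIV. \<Sum>T\<in>\<T>. L2_inner (?S T) (wd \<Omega> (idx1 i) u) (wd (?S T) (idx1 i) r))"
  define R0 where "R0 = (\<Sum>T\<in>\<T>. L2_inner (?S T) f r)"
  have ah: "a_h \<T> u w = (\<Sum>T\<in>\<T>. \<Sum>i\<in>UNIV. \<Sum>j\<in>UNIV. L2_inner (?S T) (wd \<Omega> (idx2 i j) u) (wd (?S T) (idx2 i j) w))"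
    unfolding a_h_def
  proof (rule sum.cong[OF refl])
    fix T assume T: "T \<in> \<T>"
    have "u \<in> H 2 (?S T)" using H_mono[OF uT(1)[OF T]] by simp
    then show "a_form (?S T) u w = (\<Sum>i\<in>UNIV. \<Sum>j\<in>UNIV. L2_inner (?S T) (wd \<Omega> (idx2 i j) u) (wd (?S T) (idx2 i j) w))"
      using aeq_L2_inner[OF uT(2)[OF T] aeq_refl] by (simp add: a_form_eq wT[OF T])
  qed
  have bh: "b_h \<T> u w = (\<Sum>T\<in>\<T>. \<Sum>i\<in>UNIV. L2_inner (?S T) (wd \<Omega> (idx1 i) u) (wd (?S T) (idx1 i) w))"
    unfolding b_h_def
  proof (rule sum.cong[OF refl])
    fix T assume T: "T \<in> \<T>"
    have "u \<in> H 1 (?S T)" using H_mono[OF uT(1)[OF T]] by simp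
    then show "b_form (?S T) u w = (\<Sum>i\<in>UNIV. L2_inner (?S T) (wd \<Omega> (idx1 i) u) (wd (?S T) (idx1 i) w))"
      using aeq_L2_inner[OF uT(2)[OF T] aeq_refl] by (simp add: b_form_eq wT[OF T])
  qed
  have R1': "(\<Sum>T\<in>\<T>. \<Sum>i\<in>UNIV. \<Sum>j\<in>UNIV. L2_inner (?S T) (wd \<Omega> (idx3 i j) u) (wd (?S T) (idx1 i) w))
     - (\<Sum>i\<in>UNIV. \<Sum>j\<in>UNIV. L2_inner \<Omega> (wd \<Omega> (idx3 i j) u) (wd \<Omega> (idx1 i) z)) = R1"
  proof -
    have "(\<Sum>T\<in>\<T>. \<Sum>i\<in>UNIV. \<Sum>j\<in>UNIV. L2_inner (?S T) (wd \<Omega> (idx3 i j) u) (wd (?S T) (idx1 i) w))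
      = (\<Sum>i\<in>UNIV. \<Sum>j\<in>UNIV. \<Sum>T\<in>\<T>. L2_inner (?S T) (wd \<Omega> (idx3 i j) u) (wd (?S T) (idx1 i) w))"
      by (subst sum.swap) (intro sum.cong refl sum.swap)
    then show ?thesis
      unfolding R1_def by (simp add: meshz sum_subtractf[symmetric] split uLT)
  qed
  have R2': "(\<Sum>T\<in>\<T>. \<Sum>i\<in>UNIV. L2_inner (?S T) (wd \<Omega> (idx1 i) u) (wd (?S T) (idx1 i) w))
     - (\<Sum>i\<in>UNIV. L2_inner \<Omega> (wd \<Omega> (idx1 i) u) (wd \<Omega> (idx1 i) z)) = R2"
  proof -
    have "(\<Sum>T\<in>\<T>. \<Sum>i\<in>UNIV. L2_inner (?S T) (wd \<Omega> (idx1 i) u) (wd (?S T) (idx1 i) w))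
      = (\<Sum>i\<in>UNIV. \<Sum>T\<in>\<T>. L2_inner (?S T) (wd \<Omega> (idx1 i) u) (wd (?S T) (idx1 i) w))"
      by (rule sum.swap)
    then show ?thesis
      unfolding R2_def by (simp add: meshz sum_subtractf[symmetric] split uLT)
  qed
  have zLT: "z \<in> L2 (?S T)" and wLT: "w \<in> L2 (?S T)" if "T \<in> \<T>" for T
    using H_imp_L2[OF zT(1)[OF that]] H_imp_L2[OF wT[OF that, of 0]] by auto
  have R0': "L2_inner \<Omega> f w - L2_inner \<Omega> f z = R0"
  proof -
    have "L2_inner (?S T) f r = L2_inner (?S T) f w - L2_inner (?S T) f z" if T: "T \<in> \<T>" for T
      unfolding r_def[abs_def] by (intro L2_inner_diff_right omega_L2_interior[OF f T] wLT[OF T] zLT[OF T])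
    then show ?thesis
      using mesh_L2_inner[OF omega_L2_interior[OF f] wLT] mesh_L2_inner[OF omega_L2_interior[OF f] zLT]
      by (simp add: R0_def sum_subtractf)
  qed
  have Q': "Q = a_h \<T> u w + (\<Sum>T\<in>\<T>. \<Sum>i\<in>UNIV. \<Sum>j\<in>UNIV. L2_inner (?S T) (wd \<Omega> (idx3 i j) u) (wd (?S T) (idx1 i) w))"
    unfolding Q_def ah by (simp add: sum.distrib)
  have main: "eform \<epsilon> u w - L2_inner \<Omega> f w = \<epsilon>\<^sup>2 * Q - \<epsilon>\<^sup>2 * R1 + R2 - R0"
    using weak_equation_H01[OF omega(1,2) u f z eq] R0'
    unfolding eform_def Q' R1'[symmetric] R2'[symmetric] bh by (simp add: algebra_simps)
  have s2: "sqrt (a_form (?S T) w w) \<ge> H_semi 2 (?S T) w" "sqrt (b_form (?S T) w w) \<ge> H_semi 1 (?S T) w" if T: "T \<in> \<T>" for T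
    using H_semi_2_le[OF wT[OF T]] H_semi_1_le[OF wT[OF T]] by (auto intro: real_le_rsqrt)
  have nnf: "0 \<le> a_form (?S T) w w" "0 \<le> b_form (?S T) w w" if T: "T \<in> \<T>" for T
    using a_form_nonneg[OF wT[OF T]] b_form_nonneg[OF wT[OF T]] by auto
  have sums: "sqrt (\<Sum>T\<in>\<T>. (sqrt (a_form (?S T) w w))\<^sup>2) = sqrt (a_h \<T> w w)" "sqrt (\<Sum>T\<in>\<T>. (sqrt (b_form (?S T) w w))\<^sup>2) = sqrt (b_h \<T> w w)"
    by (simp_all add: a_h_def b_h_def nnf)
  have rL: "wd (?S T) (idx1 i) r \<in> L2 (?S T)" if T: "T \<in> \<T>" for T i by (rule wd_L2[OF rH[OF T]]) simp
  have r1: "L2_norm (?S T) (wd (?S T) (idx1 i) r) \<le> H_semi 1 (?S T) r" for T i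
    using wd_le_H_semi[of "?S T" "idx1 i" r] by simp
  have r0: "L2_norm (?S T) r \<le> H_semi 0 (?S T) r" if T: "T \<in> \<T>" for T
    using wd_le_H_semi[of "?S T" "\<lambda>_. 0" r] aeq_L2_norm[OF wd_zero[OF SF(1,2)[OF T] H_imp_L2[OF rH[OF T]]]] by (simp add: mdeg_eq)
  have CS_sum: "\<bar>\<Sum>T\<in>\<T>. t T\<bar> \<le> c * (sqrt (\<Sum>T\<in>\<T>. (a T)\<^sup>2) * sqrt (\<Sum>T\<in>\<T>. (b T)\<^sup>2))"
    if "\<And>T. T \<in> \<T> \<Longrightarrow> \<bar>t T\<bar> \<le> c * (a T * b T)" "0 \<le> c" for t a b :: "pt set \<Rightarrow> real" and c
  proof -
    have "\<bar>\<Sum>T\<in>\<T>. t T\<bar> \<le> (\<Sum>T\<in>\<T>. c * (a T * b T))" by (intro order_trans[OF sum_abs sum_mono] that)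
    also have "\<dots> = c * (\<Sum>T\<in>\<T>. a T * b T)" by (simp add: sum_distrib_left)
    also have "\<dots> \<le> c * (sqrt (\<Sum>T\<in>\<T>. (a T)\<^sup>2) * sqrt (\<Sum>T\<in>\<T>. (b T)\<^sup>2))"
      by (intro mult_left_mono sum_mult_le_sqrt that(2))
    finally show ?thesis .
  qed
  have bR0: "\<bar>R0\<bar> \<le> C * h * (L2_norm \<Omega> f * sqrt (b_h \<T> w w))"
  proof -
    have "\<bar>R0\<bar> \<le> C * h * (sqrt (\<Sum>T\<in>\<T>. (L2_norm (?S T) f)\<^sup>2) * sqrt (\<Sum>T\<in>\<T>. (sqrt (b_form (?S T) w w))\<^sup>2))"
      unfolding R0_def
    proof (rule CS_sum)
      fix T assume T: "T \<in> \<T>"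
      have "\<bar>L2_inner (?S T) f r\<bar> \<le> L2_norm (?S T) f * L2_norm (?S T) r"
        by (rule L2_Cauchy_Schwarz[OF omega_L2_interior[OF f T] H_imp_L2[OF rH[OF T]]])
      also have "\<dots> \<le> L2_norm (?S T) f * (C * h * sqrt (b_form (?S T) w w))"
      proof (rule mult_left_mono)
        have "H_semi 0 (?S T) r \<le> C * h * H_semi 1 (?S T) w" unfolding r_def h_def by (rule C(2)[OF T])
        also have "\<dots> \<le> C * h * sqrt (b_form (?S T) w w)" using C(1) h s2(2)[OF T] by (intro mult_left_mono) auto
        finally show "L2_norm (?S T) r \<le> C * h * sqrt (b_form (?S T) w w)" using r0[OF T] by linarith
      qed simp
      finally show "\<bar>L2_inner (?S T) f r\<bar> \<le> C * h * (L2_norm (?S T) f * sqrt (b_form (?S T) w w))" by (simp add: mult_ac)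
    qed (use C(1) h in simp)
    then show ?thesis unfolding sums mesh_L2_norm_sq[OF f] by simp
  qed
  \<comment> \<open>The power of \<open>h\<close> comes from bounding \<open>r\<close> by second
    derivatives of \<open>w\<close>. The energy norm controls these with a factor \<epsilon>, which
    this term can afford because it carries \<open>\<epsilon>\<^sup>2\<close>.\<close>
  have bR1: "\<bar>R1\<bar> \<le> 4 * (C * h * (H_semi 3 \<Omega> u * sqrt (a_h \<T> w w)))"
  proof -
    have "\<bar>\<Sum>T\<in>\<T>. L2_inner (?S T) (wd \<Omega> (idx3 i j) u) (wd (?S T) (idx1 i) r)\<bar> \<le> C * h * (H_semi 3 \<Omega> u * sqrt (a_h \<T> w w))" for i j
    proof -
      have "\<bar>\<Sum>T\<in>\<T>. L2_inner (?S T) (wd \<Omega> (idx3 i j) u) (wd (?S T) (idx1 i) r)\<bar>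
         \<le> C * h * (sqrt (\<Sum>T\<in>\<T>. (L2_norm (?S T) (wd \<Omega> (idx3 i j) u))\<^sup>2) * sqrt (\<Sum>T\<in>\<T>. (sqrt (a_form (?S T) w w))\<^sup>2))"
      proof (rule CS_sum)
        fix T assume T: "T \<in> \<T>"
        have "\<bar>L2_inner (?S T) (wd \<Omega> (idx3 i j) u) (wd (?S T) (idx1 i) r)\<bar> \<le> L2_norm (?S T) (wd \<Omega> (idx3 i j) u) * L2_norm (?S T) (wd (?S T) (idx1 i) r)"
          by (intro L2_Cauchy_Schwarz uLT T rL) simp
        also have "\<dots> \<le> L2_norm (?S T) (wd \<Omega> (idx3 i j) u) * (C * h * sqrt (a_form (?S T) w w))"
        proof (rule mult_left_mono)
          have "H_semi 1 (?S T) r \<le> C * h * H_semi 2 (?S T) w" unfolding r_def h_def by (rule C(4)[OF T])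
          also have "\<dots> \<le> C * h * sqrt (a_form (?S T) w w)" using C(1) h s2(1)[OF T] by (intro mult_left_mono) auto
          finally show "L2_norm (?S T) (wd (?S T) (idx1 i) r) \<le> C * h * sqrt (a_form (?S T) w w)" using r1[of T i] by linarith
        qed simp
        finally show "\<bar>L2_inner (?S T) (wd \<Omega> (idx3 i j) u) (wd (?S T) (idx1 i) r)\<bar> \<le> C * h * (L2_norm (?S T) (wd \<Omega> (idx3 i j) u) * sqrt (a_form (?S T) w w))"
          by (simp add: mult_ac)
      qed (use C(1) h in simp)
      also have "\<dots> = C * h * (L2_norm \<Omega> (wd \<Omega> (idx3 i j) u) * sqrt (a_h \<T> w w))"
        unfolding sums by (subst mesh_L2_norm_sq) (auto intro: uL)
      also have "\<dots> \<le> C * h * (H_semi 3 \<Omega> u * sqrt (a_h \<T> w w))"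
        using wd_le_H_semi[of \<Omega> "idx3 i j" u] C(1) h broken_nonneg(1)[OF wX] by (intro mult_left_mono mult_right_mono) auto
      finally show ?thesis .
    qed
    then have "\<bar>R1\<bar> \<le> (\<Sum>i\<in>(UNIV::2 set). \<Sum>j\<in>(UNIV::2 set). C * h * (H_semi 3 \<Omega> u * sqrt (a_h \<T> w w)))"
      unfolding R1_def by (intro order_trans[OF sum_abs sum_mono])
    then show ?thesis by simp
  qed
  \<comment> \<open>No factor \<epsilon> is available here, so only first derivatives of
    \<open>w\<close> may enter, and bounding the gradient of \<open>r\<close> by them yields no
    power of \<open>h\<close>. The power is gained on the other factor: the gradient of
    \<open>r\<close> has mean 0, hence a constant can be subtracted from the derivative of
    \<open>u\<close>.\<close>
  have bR2: "\<bar>R2\<bar> \<le> 2 * (2 * \<sigma> * C * h * (2 * H_semi 2 \<Omega> u * sqrt (b_h \<T> w w)))"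
  proof -
    have "\<bar>\<Sum>T\<in>\<T>. L2_inner (?S T) (wd \<Omega> (idx1 i) u) (wd (?S T) (idx1 i) r)\<bar> \<le> 2 * \<sigma> * C * h * (2 * H_semi 2 \<Omega> u * sqrt (b_h \<T> w w))" for i
    proof -
      define G where "G k = wd \<Omega> (\<lambda>l. idx1 i l + idx1 k l) u" for k
      have deg: "mdeg (\<lambda>l. idx1 i l + idx1 k l) = 2" for k by (simp add: mdeg_add)
      have GL: "G k \<in> L2 \<Omega>" for k unfolding G_def by (rule uL) (simp add: deg)
      have wk: "is_weak_deriv \<Omega> (idx1 k) (wd \<Omega> (idx1 i) u) (G k)" for k
        unfolding G_def by (rule wd_weak_deriv_pd[OF omega(1,2) u]) simp
      have "\<bar>\<Sum>T\<in>\<T>. L2_inner (?S T) (wd \<Omega> (idx1 i) u) (wd (?S T) (idx1 i) r)\<bar>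
         \<le> 2 * \<sigma> * C * h * (sqrt (\<Sum>T\<in>\<T>. (gnorm (?S T) G)\<^sup>2) * sqrt (\<Sum>T\<in>\<T>. (sqrt (b_form (?S T) w w))\<^sup>2))"
      proof (rule CS_sum)
        fix T assume T: "T \<in> \<T>"
        interpret A: regular_element T "E T" "N T" "\<psi> T" \<sigma> using regular_elt[OF T] .
        let ?q = "wd (?S T) (idx1 i) r"
        have u1: "wd \<Omega> (idx1 i) u \<in> L2 (?S T)" by (rule uLT[OF _ T]) simp
        obtain c where c: "L2_norm (?S T) (\<lambda>x. wd \<Omega> (idx1 i) u x - c) \<le> 2 * \<sigma> * diameter T * gnorm (?S T) G"
          using A.poincare_element[OF u1 omega_L2_interior[OF GL T] is_weak_deriv_subset[OF wk SF(3)[OF T]]] by blast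
        have "L2_inner (?S T) (\<lambda>x. c * 1) ?q = c * (LINT x:?S T|lebesgue. ?q x)"
          unfolding L2_inner_cmult by (simp add: L2_inner_def)
        also have "\<dots> = 0" using mean[OF T, of i] by (simp add: r_def[abs_def])
        finally have c0: "L2_inner (?S T) (\<lambda>x. c * 1) ?q = 0" .
        have "L2_inner (?S T) (wd \<Omega> (idx1 i) u) ?q = L2_inner (?S T) (\<lambda>x. wd \<Omega> (idx1 i) u x - c * 1) ?q"
          using L2_inner_diff[OF u1 A.const_L2[of "c * 1"] rL[OF T, of i]] c0 by simp
        also have "\<bar>L2_inner (?S T) (\<lambda>x. wd \<Omega> (idx1 i) u x - c * 1) ?q\<bar> \<le> L2_norm (?S T) (\<lambda>x. wd \<Omega> (idx1 i) u x - c * 1) * L2_norm (?S T) ?q"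
          by (intro L2_Cauchy_Schwarz L2_diff u1 A.const_L2 rL T)
        also have "\<dots> \<le> (2 * \<sigma> * h * gnorm (?S T) G) * (C * sqrt (b_form (?S T) w w))"
        proof (rule mult_mono)
          have "2 * \<sigma> * diameter T * gnorm (?S T) G \<le> 2 * \<sigma> * h * gnorm (?S T) G"
            using diameter_le_mesh_size[OF T] sigma unfolding h_def by (intro mult_right_mono mult_left_mono) auto
          then show "L2_norm (?S T) (\<lambda>x. wd \<Omega> (idx1 i) u x - c * 1) \<le> 2 * \<sigma> * h * gnorm (?S T) G" using c by simp
          have "H_semi 1 (?S T) r \<le> C * H_semi 1 (?S T) w" unfolding r_def by (rule C(3)[OF T])
          also have "\<dots> \<le> C * sqrt (b_form (?S T) w w)" using C(1) s2(2)[OF T] by (intro mult_left_mono) auto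
          finally show "L2_norm (?S T) ?q \<le> C * sqrt (b_form (?S T) w w)" using r1[of T i] by linarith
        qed (use sigma h in auto)
        finally show "\<bar>L2_inner (?S T) (wd \<Omega> (idx1 i) u) ?q\<bar> \<le> 2 * \<sigma> * C * h * (gnorm (?S T) G * sqrt (b_form (?S T) w w))"
          by (simp add: mult_ac)
      qed (use C(1) h sigma in simp)
      also have "\<dots> = 2 * \<sigma> * C * h * (gnorm \<Omega> G * sqrt (b_h \<T> w w))"
        unfolding sums mesh_gnorm_sq[OF GL] by simp
      also have "\<dots> \<le> 2 * \<sigma> * C * h * (2 * H_semi 2 \<Omega> u * sqrt (b_h \<T> w w))"
      proof (intro mult_left_mono mult_right_mono)
        have "L2_norm \<Omega> (G k) \<le> H_semi 2 \<Omega> u" for k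
          using wd_le_H_semi[of \<Omega> "\<lambda>l. idx1 i l + idx1 k l" u] unfolding deg G_def .
        then have "(gnorm \<Omega> G)\<^sup>2 \<le> (\<Sum>k\<in>(UNIV::2 set). (H_semi 2 \<Omega> u)\<^sup>2)"
          unfolding gnorm_sq by (intro sum_mono power_mono) auto
        also have "\<dots> \<le> (2 * H_semi 2 \<Omega> u)\<^sup>2" by (simp add: power_mult_distrib)
        finally show "gnorm \<Omega> G \<le> 2 * H_semi 2 \<Omega> u" by (rule power2_le_imp_le) simp
      qed (use C(1) h sigma broken_nonneg(2)[OF wX] in auto)
      finally show ?thesis .
    qed
    then have "\<bar>R2\<bar> \<le> (\<Sum>i\<in>(UNIV::2 set). 2 * \<sigma> * C * h * (2 * H_semi 2 \<Omega> u * sqrt (b_h \<T> w w)))"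
      unfolding R2_def by (intro order_trans[OF sum_abs sum_mono])
    then show ?thesis by simp
  qed
  define K where "K = 32 * \<sigma>\<^sup>2 * (8 * \<sigma>\<^sup>2 + 16 * \<sigma> + 4)"
  have K: "0 \<le> K" using sigma by (simp add: K_def)
  have bQ: "\<bar>Q\<bar> \<le> K * h * H_semi 3 \<Omega> u * sqrt (a_h \<T> w w)"
    unfolding Q_def K_def h_def by (rule consistency[OF u w])
  define W where "W = energy_norm \<epsilon> \<T> w"
  have W: "\<epsilon> * sqrt (a_h \<T> w w) \<le> W" "sqrt (b_h \<T> w w) \<le> W"
  proof -
    have "\<epsilon> * sqrt (a_h \<T> w w) = sqrt (\<epsilon>\<^sup>2 * a_h \<T> w w)" using \<epsilon> by (simp add: real_sqrt_mult)
    also have "\<dots> \<le> W" unfolding W_def energy_norm_def using broken_nonneg(2)[OF wX] by (intro real_sqrt_le_mono) simp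
    finally show "\<epsilon> * sqrt (a_h \<T> w w) \<le> W" .
    show "sqrt (b_h \<T> w w) \<le> W" unfolding W_def energy_norm_def using broken_nonneg(1)[OF wX] by (intro real_sqrt_le_mono) simp
  qed
  have "\<bar>\<epsilon>\<^sup>2 * Q - \<epsilon>\<^sup>2 * R1 + R2 - R0\<bar> \<le> \<epsilon>\<^sup>2 * \<bar>Q\<bar> + \<epsilon>\<^sup>2 * \<bar>R1\<bar> + \<bar>R2\<bar> + \<bar>R0\<bar>"
  proof -
    have "\<epsilon>\<^sup>2 * \<bar>Q\<bar> = \<bar>\<epsilon>\<^sup>2 * Q\<bar>" "\<epsilon>\<^sup>2 * \<bar>R1\<bar> = \<bar>\<epsilon>\<^sup>2 * R1\<bar>" by (simp_all add: abs_mult)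
    then show ?thesis by linarith
  qed
  also have "\<dots> \<le> \<epsilon>\<^sup>2 * (K * h * H_semi 3 \<Omega> u * sqrt (a_h \<T> w w)) + \<epsilon>\<^sup>2 * (4 * (C * h * (H_semi 3 \<Omega> u * sqrt (a_h \<T> w w))))
     + 2 * (2 * \<sigma> * C * h * (2 * H_semi 2 \<Omega> u * sqrt (b_h \<T> w w))) + C * h * (L2_norm \<Omega> f * sqrt (b_h \<T> w w))"
    by (intro add_mono mult_left_mono bQ bR0 bR1 bR2) auto
  \<comment> \<open>One \<epsilon> goes to the third derivatives of \<open>u\<close>, the other to
    \<open>sqrt (a_h \<T> w w)\<close>, so that the energy norm bounds both second factors.\<close>
  also have "\<dots> = (h * (K + 4 * C) * (\<epsilon> * H_semi 3 \<Omega> u)) * (\<epsilon> * sqrt (a_h \<T> w w))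
     + (h * (8 * \<sigma> * C * H_semi 2 \<Omega> u + C * L2_norm \<Omega> f)) * sqrt (b_h \<T> w w)"
    by (simp add: power2_eq_square algebra_simps)
  also have "\<dots> \<le> (h * (K + 4 * C) * (\<epsilon> * H_semi 3 \<Omega> u)) * W + (h * (8 * \<sigma> * C * H_semi 2 \<Omega> u + C * L2_norm \<Omega> f)) * W"
    using h K C(1) \<epsilon> sigma by (intro add_mono mult_left_mono W) auto
  also have "\<dots> = h * ((K + 4 * C) * (\<epsilon> * H_semi 3 \<Omega> u) + 8 * \<sigma> * C * H_semi 2 \<Omega> u + C * L2_norm \<Omega> f) * W"
    by (simp add: algebra_simps)
  finally show ?thesis unfolding main h_def K_def W_def .
qed

section \<open>The error estimate\<close>

lemma fe_error:
  assumes fe: "fe_space \<Omega> P J \<T> V I"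
    and H2: "\<And>v. v \<in> V \<Longrightarrow> continuous_at_vertices \<Omega> \<T> v"
    and H3: "\<And>v. v \<in> V \<Longrightarrow> continuous_normal_means \<Omega> \<T> v"
    and Pi: "conforming_operator \<Omega> \<T> V Pi_h"
    and H4: "\<not> V \<subseteq> H0 1 \<Omega> \<Longrightarrow> preserves_mean_gradients \<T> V Pi_h"
    and I_bound: "interpolation_bound \<Omega> \<T> I D" and Pi_bound: "conforming_bound \<T> V Pi_h C" and C: "0 \<le> C"
    and \<epsilon>: "0 < \<epsilon>" and f: "f \<in> L2 \<Omega>" and u0: "u \<in> H0 2 \<Omega>" and u: "u \<in> H 3 \<Omega>"
    and eq: "\<And>v. v \<in> H0 2 \<Omega> \<Longrightarrow> \<epsilon>\<^sup>2 * a_form \<Omega> u v + b_form \<Omega> u v = L2_inner \<Omega> f v"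
    and uh: "u\<^sub>h \<in> V" "\<And>v. v \<in> V \<Longrightarrow> eform \<epsilon> u\<^sub>h v = L2_inner \<Omega> f v"
  defines "K \<equiv> 32 * \<sigma>\<^sup>2 * (8 * \<sigma>\<^sup>2 + 16 * \<sigma> + 4)"
  shows "energy_norm \<epsilon> \<T> (\<lambda>x. u x - u\<^sub>h x)
      \<le> 4 * D * mesh_size \<T> * (\<epsilon> * H_semi 3 \<Omega> u + H_semi 2 \<Omega> u)
        + mesh_size \<T> * ((K + 4 * C) * (\<epsilon> * H_semi 3 \<Omega> u) + 8 * \<sigma> * C * H_semi 2 \<Omega> u + C * L2_norm \<Omega> f)"
    and "V \<subseteq> H0 1 \<Omega> \<Longrightarrow> energy_norm \<epsilon> \<T> (\<lambda>x. u x - u\<^sub>h x)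
      \<le> 4 * D * mesh_size \<T> * (\<epsilon> + mesh_size \<T>) * H_semi 3 \<Omega> u + mesh_size \<T> * K * (\<epsilon> * H_semi 3 \<Omega> u)"
proof -
  define h where "h = mesh_size \<T>"
  define q where "q = I u"
  define w where "w x = q x - u\<^sub>h x" for x
  have h: "0 \<le> h" unfolding h_def by (rule mesh_size_nonneg)
  have K: "0 \<le> K" using sigma by (simp add: K_def)
  have qV: "q \<in> V" using fe u0 by (auto simp: fe_space_def q_def)
  \<comment> \<open>\<open>finite_dim_space\<close> describes \<open>V\<close> as a span, which
    gives closure under differences.\<close>
  have diff: "(\<lambda>x. v x - v' x) \<in> V" if vV: "v \<in> V" "v' \<in> V" for v v'
  proof -
    obtain n :: nat and b where Vb: "V = {w. \<exists>c. \<forall>x. w x = (\<Sum>i<n. c i * b i x)}"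
      using fe by (auto simp: fe_space_def finite_dim_space_def)
    obtain c c' where "\<forall>x. v x = (\<Sum>i<n. c i * b i x)" "\<forall>x. v' x = (\<Sum>i<n. c' i * b i x)" using vV unfolding Vb mem_Collect_eq by blast
    then have "\<forall>x. v x - v' x = (\<Sum>i<n. (c i - c' i) * b i x)" by (simp add: sum_subtractf left_diff_distrib)
    then show ?thesis unfolding Vb mem_Collect_eq by (rule exI[of _ "\<lambda>i. c i - c' i"])
  qed
  have wV: "w \<in> V" unfolding w_def[abs_def] by (rule diff[OF qV uh(1)])
  have pw: "\<exists>p. piecewise \<T> p v" if "v \<in> V" for v
  proof -
    have "\<forall>T\<in>\<T>. \<exists>p. smooth p \<and> (\<forall>x\<in>interior T. v x = p x)"
      using fe that unfolding fe_space_def finite_element_def by meson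
    then obtain p where "\<forall>T\<in>\<T>. smooth (p T) \<and> (\<forall>x\<in>interior T. v x = p T x)" by metis
    then show ?thesis unfolding piecewise_def by blast
  qed
  obtain p where p: "piecewise \<T> p w" using pw[OF wV] by blast
  have VX: "v \<in> broken" if "v \<in> V" for v using pw[OF that] piecewise_wd(1) by (auto simp: broken_def)
  have "u \<in> H 3 (interior T)" if "T \<in> \<T>" for T using H_subset(1)[OF u interior_facts(1-3)[OF that]] .
  then have uX: "u \<in> broken" using H_mono[of u 3 _ 2] by (simp add: broken_def)
  have W: "0 \<le> energy_norm \<epsilon> \<T> w" using broken_nonneg(3)[OF VX[OF wV]] by (simp add: energy_norm_eform)
  have error: "energy_norm \<epsilon> \<T> (\<lambda>x. u x - u\<^sub>h x) \<le> 2 * energy_norm \<epsilon> \<T> (\<lambda>x. u x - q x) + R"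
    if "\<bar>eform \<epsilon> u w - L2_inner \<Omega> f w\<bar> \<le> R * energy_norm \<epsilon> \<T> w" "0 \<le> R" for R
    using strang[OF uX VX[OF qV] VX[OF uh(1)], of \<epsilon> R] that uh(2)[OF wV] unfolding w_def[abs_def] by simp
  \<comment> \<open>The companion of \<open>w\<close> is \<open>w\<close> itself, with constant
    0.\<close>
  have conf: "\<bar>eform \<epsilon> u w - L2_inner \<Omega> f w\<bar> \<le> h * (K * (\<epsilon> * H_semi 3 \<Omega> u)) * energy_norm \<epsilon> \<T> w" if V: "V \<subseteq> H0 1 \<Omega>"
  proof -
    have zero: "H_semi m (interior T) (\<lambda>y. 0) = 0" if T: "T \<in> \<T>" for T m
      by (simp add: H_semi_def wd_zero_fun[OF interior_facts(1,2)[OF T]])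
    have mean: "(LINT x:interior T|lebesgue. wd (interior T) (idx1 i) (\<lambda>y. w y - w y) x) = 0" if T: "T \<in> \<T>" for T i
    proof -
      have "aeq (interior T) (wd (interior T) (idx1 i) (\<lambda>x. 0)) (mpd (idx1 i) (\<lambda>x. 0))"
        by (rule H_smooth(2)[OF interior_facts(1,2)[OF T]]) simp
      from aeq_L2_inner[OF aeq_refl[of _ "\<lambda>x. 1"] this] show ?thesis by (simp add: L2_inner_def mpd_zero_fun)
    qed
    have "w \<in> H0 1 \<Omega>" using V wV by blast
    from consistency_error[OF u f \<epsilon> this eq p H2[OF wV] H3[OF wV] mean, of 0] show ?thesis
      unfolding h_def K_def by (simp add: zero)
  qed
  have "\<bar>eform \<epsilon> u w - L2_inner \<Omega> f w\<bar> \<le> h * ((K + 4 * C) * (\<epsilon> * H_semi 3 \<Omega> u) + 8 * \<sigma> * C * H_semi 2 \<Omega> u + C * L2_norm \<Omega> f) * energy_norm \<epsilon> \<T> w"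
  proof (cases "V \<subseteq> H0 1 \<Omega>")
    \<comment> \<open>(H4) is at hand only in the other case; here the sharper conforming bound is
      weakened.\<close>
    case True
    have "h * (K * (\<epsilon> * H_semi 3 \<Omega> u)) * energy_norm \<epsilon> \<T> w
       \<le> h * ((K + 4 * C) * (\<epsilon> * H_semi 3 \<Omega> u) + 8 * \<sigma> * C * H_semi 2 \<Omega> u + C * L2_norm \<Omega> f) * energy_norm \<epsilon> \<T> w"
      using h K C \<epsilon> sigma W by (intro mult_right_mono mult_left_mono) (auto simp: distrib_right)
    then show ?thesis using conf[OF True] by linarith
  next
    case False
    have bd: "H_semi j (interior T) (\<lambda>x. w x - Pi_h w x) \<le> C * h ^ (m - j) * H_semi m (interior T) w"
      if "T \<in> \<T>" "j \<in> {0, 1}" "m \<in> {1, 2}" "j \<le> m" for T j m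
      using Pi_bound wV that unfolding conforming_bound_def h_def by blast
    show ?thesis
      unfolding h_def K_def
    proof (rule consistency_error[OF u f \<epsilon> _ eq p H2[OF wV] H3[OF wV] _ C])
      show "Pi_h w \<in> H0 1 \<Omega>" using Pi wV by (auto simp: conforming_operator_def)
      show "(LINT x:interior T|lebesgue. wd (interior T) (idx1 i) (\<lambda>y. w y - Pi_h w y) x) = 0" if "T \<in> \<T>" for T i
        using H4[OF False] wV that unfolding preserves_mean_gradients_def by blast
    qed (use bd[of _ 0 1] bd[of _ 1 1] bd[of _ 1 2] in \<open>simp_all add: h_def\<close>)
  qed
  note general = error[OF this]
  have interp: "sqrt (\<Sum>T\<in>\<T>. (H_norm j (interior T) (\<lambda>x. u x - q x))\<^sup>2) \<le> D * h ^ (k - j) * H_semi k \<Omega> u"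
    if "k \<in> {2, 3}" "j \<in> {0, 1, 2}" for j k
  proof -
    have "u \<in> H0 2 \<Omega> \<inter> H k \<Omega>" using u0 H_mono[OF u, of k] that(1) by auto
    then show ?thesis using I_bound that unfolding interpolation_bound_def h_def q_def by blast
  qed
  have eX: "(\<lambda>x. u x - q x) \<in> broken" using broken_lincomb[OF uX VX[OF qV], of "-1"] by simp
  note ie = interpolation_energy[OF eX, of \<epsilon>]
  have i32: "2 * \<epsilon> * sqrt (\<Sum>T\<in>\<T>. (H_norm 2 (interior T) (\<lambda>x. u x - q x))\<^sup>2) \<le> 2 * \<epsilon> * (D * h * H_semi 3 \<Omega> u)"
    using interp[of 3 2] \<epsilon> by (intro mult_left_mono) auto
  \<comment> \<open>The first-order part of the interpolation error is measured by second
    derivatives for the general estimate and by third derivatives for the conforming one, where this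
    yields the term in \<open>h\<^sup>2\<close>.\<close>
  have i21: "sqrt (\<Sum>T\<in>\<T>. (H_norm 1 (interior T) (\<lambda>x. u x - q x))\<^sup>2) \<le> D * h * H_semi 2 \<Omega> u"
    using interp[of 2 1] by simp
  have i31: "sqrt (\<Sum>T\<in>\<T>. (H_norm 1 (interior T) (\<lambda>x. u x - q x))\<^sup>2) \<le> D * h\<^sup>2 * H_semi 3 \<Omega> u"
    using interp[of 3 1] by simp
  have e1: "energy_norm \<epsilon> \<T> (\<lambda>x. u x - q x) \<le> 2 * \<epsilon> * (D * h * H_semi 3 \<Omega> u) + 2 * (D * h * H_semi 2 \<Omega> u)"
    using ie i32 i21 \<epsilon> by linarith
  have e2: "energy_norm \<epsilon> \<T> (\<lambda>x. u x - q x) \<le> 2 * \<epsilon> * (D * h * H_semi 3 \<Omega> u) + 2 * (D * h\<^sup>2 * H_semi 3 \<Omega> u)"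
    using ie i32 i31 \<epsilon> by linarith
  have nn: "0 \<le> h * ((K + 4 * C) * (\<epsilon> * H_semi 3 \<Omega> u) + 8 * \<sigma> * C * H_semi 2 \<Omega> u + C * L2_norm \<Omega> f)" "0 \<le> h * (K * (\<epsilon> * H_semi 3 \<Omega> u))"
    using h K C \<epsilon> sigma by (auto intro!: mult_nonneg_nonneg add_nonneg_nonneg)
  show "energy_norm \<epsilon> \<T> (\<lambda>x. u x - u\<^sub>h x)
      \<le> 4 * D * mesh_size \<T> * (\<epsilon> * H_semi 3 \<Omega> u + H_semi 2 \<Omega> u)
        + mesh_size \<T> * ((K + 4 * C) * (\<epsilon> * H_semi 3 \<Omega> u) + 8 * \<sigma> * C * H_semi 2 \<Omega> u + C * L2_norm \<Omega> f)"
    using general[OF nn(1)] e1 unfolding h_def[symmetric] by (simp add: algebra_simps)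
  show "energy_norm \<epsilon> \<T> (\<lambda>x. u x - u\<^sub>h x)
      \<le> 4 * D * mesh_size \<T> * (\<epsilon> + mesh_size \<T>) * H_semi 3 \<Omega> u + mesh_size \<T> * K * (\<epsilon> * H_semi 3 \<Omega> u)" if "V \<subseteq> H0 1 \<Omega>"
    using error[OF conf[OF that] nn(2)] e2 unfolding h_def[symmetric] by (simp add: algebra_simps power2_eq_square)
qed

end

text \<open>The inscribed discs give area at least the squared radius, which turns shape regularity
  into the bound of the squared diameter by the area. The edge fields are chosen separately for each
  element.\<close>

lemma regular_mesh_exists:
  assumes domain: "polygonal_domain \<Omega>" and conf: "conforming_mesh \<Omega> \<T>" and \<sigma>: "0 < \<sigma>"
    and reg: "\<And>T. T \<in> \<T> \<Longrightarrow> \<exists>x r. 0 < r \<and> cball x r \<subseteq> T \<and> diameter T \<le> \<sigma> * r"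
  shows "\<exists>E N \<psi>. regular_mesh \<Omega> \<T> E N \<psi> \<sigma>"
proof -
  have shape: "triangle T \<or> rectangle T" if "T \<in> \<T>" for T using conf that by (auto simp: conforming_mesh_def)
  have cc: "compact T" "convex T" if T: "T \<in> \<T>" for T
    using shape[OF T] by (auto simp: triangle_def rectangle_def intro!: finite_imp_compact_convex_hull)
  have elt: "\<forall>T\<in>\<T>. \<exists>E N \<psi>. mesh_element T E N \<psi>"
  proof
    fix T assume T: "T \<in> \<T>"
    obtain x r where r: "0 < r" "cball x r \<subseteq> T" using reg[OF T] by blast
    have "x \<in> interior T" using interior_mono[OF r(2)] r(1) by (auto simp: interior_cball)
    then show "\<exists>E N \<psi>. mesh_element T E N \<psi>"
      using cc[OF T] shape[OF T] triangle_edge_fields[of T] rectangle_edge_fields[of T] unfolding mesh_element_def by blast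
  qed
  then obtain E N \<psi> where el: "\<And>T. T \<in> \<T> \<Longrightarrow> mesh_element T (E T) (N T) (\<psi> T)" by metis
  have "(diameter T)\<^sup>2 \<le> \<sigma>\<^sup>2 * measure lebesgue T" if T: "T \<in> \<T>" for T
  proof -
    obtain x r where r: "0 < r" "cball x r \<subseteq> T" "diameter T \<le> \<sigma> * r" using reg[OF T] by blast
    have "(diameter T)\<^sup>2 \<le> (\<sigma> * r)\<^sup>2" using r(3) diameter_ge_0[OF compact_imp_bounded[OF cc(1)[OF T]]] by (rule power_mono)
    also have "\<dots> \<le> \<sigma>\<^sup>2 * measure lebesgue T"
      unfolding power_mult_distrib by (intro mult_left_mono measure_lower_bound[OF cc(1)[OF T] r(2,1)]) simp
    finally show ?thesis .
  qed
  then have "regular_mesh \<Omega> \<T> E N \<psi> \<sigma>"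
    using domain conf el \<sigma> unfolding regular_mesh_def regular_mesh_axioms_def mesh_def by auto
  then show ?thesis by blast
qed

section \<open>Uniform constants and the final estimate\<close>

lemma interpolation_bound_mono:
  assumes "interpolation_bound \<Omega> \<T> I C" "C \<le> D" "0 \<le> mesh_size \<T>"
  shows "interpolation_bound \<Omega> \<T> I D"
  unfolding interpolation_bound_def
proof (intro ballI)
  fix k j :: nat and v assume a: "k \<in> {2, 3}" "j \<in> {0, 1, 2}" "v \<in> H0 2 \<Omega> \<inter> H k \<Omega>"
  have "sqrt (\<Sum>T\<in>\<T>. (H_norm j (interior T) (\<lambda>x. v x - I v x))\<^sup>2) \<le> C * mesh_size \<T> ^ (k - j) * H_semi k \<Omega> v"
    using assms(1) a unfolding interpolation_bound_def by blast
  also have "\<dots> \<le> D * mesh_size \<T> ^ (k - j) * H_semi k \<Omega> v" using assms(2,3) by (intro mult_right_mono) auto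
  finally show "sqrt (\<Sum>T\<in>\<T>. (H_norm j (interior T) (\<lambda>x. v x - I v x))\<^sup>2) \<le> D * mesh_size \<T> ^ (k - j) * H_semi k \<Omega> v" .
qed

lemma conforming_bound_mono:
  assumes "conforming_bound \<T> V Pi_h C" "C \<le> D" "0 \<le> mesh_size \<T>"
  shows "conforming_bound \<T> V Pi_h D"
  unfolding conforming_bound_def
proof (intro ballI impI)
  fix v T and j m :: nat assume a: "v \<in> V" "T \<in> \<T>" "j \<in> {0, 1}" "m \<in> {1, 2}" "j \<le> m"
  have "H_semi j (interior T) (\<lambda>x. v x - Pi_h v x) \<le> C * mesh_size \<T> ^ (m - j) * H_semi m (interior T) v"
    using assms(1) a unfolding conforming_bound_def by blast
  also have "\<dots> \<le> D * mesh_size \<T> ^ (m - j) * H_semi m (interior T) v" using assms(2,3) by (intro mult_right_mono) auto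
  finally show "H_semi j (interior T) (\<lambda>x. v x - Pi_h v x) \<le> D * mesh_size \<T> ^ (m - j) * H_semi m (interior T) v" .
qed

theorem theorem3p1:
  fixes \<Omega> :: "(real^2) set"
    and \<MM> :: "mesh set"
    and P :: "(real^2) set \<Rightarrow> fn set"
    and J :: "(real^2) set \<Rightarrow> fn \<Rightarrow> fn"
    and V :: "mesh \<Rightarrow> fn set"
    and I :: "mesh \<Rightarrow> fn \<Rightarrow> fn"
    and Pi_h :: "mesh \<Rightarrow> fn \<Rightarrow> fn"
  assumes domain: "polygonal_domain \<Omega>"
    and meshes: "\<forall>\<T>\<in>\<MM>. conforming_mesh \<Omega> \<T>"
    and regular: "shape_regular \<MM>"
    and fe: "\<forall>\<T>\<in>\<MM>. fe_space \<Omega> P J \<T> (V \<T>) (I \<T>)"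
    and nonconforming: "\<forall>\<T>\<in>\<MM>. \<not> V \<T> \<subseteq> H0 2 \<Omega>"
    and H1: "\<forall>\<T>\<in>\<MM>. reproduces_P2 P J \<T>"
    and H2: "\<forall>\<T>\<in>\<MM>. \<forall>v\<in>V \<T>. continuous_at_vertices \<Omega> \<T> v"
    and H3: "\<forall>\<T>\<in>\<MM>. \<forall>v\<in>V \<T>. continuous_normal_means \<Omega> \<T> v"
    and Pi: "\<forall>\<T>\<in>\<MM>. conforming_operator \<Omega> \<T> (V \<T>) (Pi_h \<T>)"
    and H4: "\<forall>\<T>\<in>\<MM>. \<not> V \<T> \<subseteq> H0 1 \<Omega> \<longrightarrow> preserves_mean_gradients \<T> (V \<T>) (Pi_h \<T>)"
    and I_bound: "\<exists>C. \<forall>\<T>\<in>\<MM>. interpolation_bound \<Omega> \<T> (I \<T>) C"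
    and Pi_bound: "\<exists>C. \<forall>\<T>\<in>\<MM>. conforming_bound \<T> (V \<T>) (Pi_h \<T>) C"
  shows "\<exists>C. \<forall>\<T>\<in>\<MM>. \<forall>\<epsilon> f u u\<^sub>h.
           0 < \<epsilon> \<and> \<epsilon> \<le> 1 \<and> f \<in> L2 \<Omega> \<and>
           u \<in> H0 2 \<Omega> \<and> u \<in> H 3 \<Omega> \<and>
           (\<forall>v\<in>H0 2 \<Omega>. \<epsilon>\<^sup>2 * a_form \<Omega> u v + b_form \<Omega> u v = L2_inner \<Omega> f v) \<and>
           u\<^sub>h \<in> V \<T> \<and>
           (\<forall>v\<^sub>h\<in>V \<T>. \<epsilon>\<^sup>2 * a_h \<T> u\<^sub>h v\<^sub>h + b_h \<T> u\<^sub>h v\<^sub>h = L2_inner \<Omega> f v\<^sub>h) \<longrightarrow>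
           energy_norm \<epsilon> \<T> (\<lambda>x. u x - u\<^sub>h x)
             \<le> C * mesh_size \<T> * (H_semi 2 \<Omega> u + \<epsilon> * H_semi 3 \<Omega> u + L2_norm \<Omega> f) \<and>
           (V \<T> \<subseteq> H0 1 \<Omega> \<longrightarrow>
             energy_norm \<epsilon> \<T> (\<lambda>x. u x - u\<^sub>h x)
               \<le> C * mesh_size \<T> * (mesh_size \<T> + \<epsilon>) * H_semi 3 \<Omega> u)"
proof -
  obtain D0 C0 where D0: "\<forall>\<T>\<in>\<MM>. interpolation_bound \<Omega> \<T> (I \<T>) D0" and C0: "\<forall>\<T>\<in>\<MM>. conforming_bound \<T> (V \<T>) (Pi_h \<T>) C0"
    using I_bound Pi_bound by blast
  obtain \<sigma> where \<sigma>: "0 < \<sigma>" "\<forall>\<T>\<in>\<MM>. \<forall>T\<in>\<T>. \<exists>x r. 0 < r \<and> cball x r \<subseteq> T \<and> diameter T \<le> \<sigma> * r"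
    using regular by (auto simp: shape_regular_def)
  \<comment> \<open>The constants in the hypotheses come without a sign; absolute values preserve
    the bounds and make every coefficient nonnegative.\<close>
  define D where "D = \<bar>D0\<bar>"
  define C where "C = \<bar>C0\<bar>"
  define K where "K = 32 * \<sigma>\<^sup>2 * (8 * \<sigma>\<^sup>2 + 16 * \<sigma> + 4)"
  \<comment> \<open>Dominates every coefficient that occurs: \<open>4 * D + K + 4 * C\<close> at the
    third derivatives of \<open>u\<close>, \<open>4 * D + 8 * \<sigma> * C\<close> at the second
    derivatives, \<open>C\<close> at \<open>f\<close>, and \<open>4 * D\<close> and
    \<open>4 * D + K\<close> in the conforming case.\<close>
  define c where "c = 4 * D + K + 5 * C + 8 * \<sigma> * C"
  have nn: "0 \<le> D" "0 \<le> C" "0 \<le> K" using \<sigma>(1) by (simp_all add: D_def C_def K_def)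
  have sC: "0 \<le> \<sigma> * C" using \<sigma>(1) nn(2) by simp
  show ?thesis
  proof (rule exI[of _ c], intro ballI allI impI, elim conjE)
    fix \<T> \<epsilon> f u u\<^sub>h
    assume \<T>: "\<T> \<in> \<MM>" and \<epsilon>: "0 < \<epsilon>" and f: "f \<in> L2 \<Omega>" and u: "u \<in> H0 2 \<Omega>" "u \<in> H 3 \<Omega>"
      and eq: "\<forall>v\<in>H0 2 \<Omega>. \<epsilon>\<^sup>2 * a_form \<Omega> u v + b_form \<Omega> u v = L2_inner \<Omega> f v"
      and uh: "u\<^sub>h \<in> V \<T>" "\<forall>v\<^sub>h\<in>V \<T>. \<epsilon>\<^sup>2 * a_h \<T> u\<^sub>h v\<^sub>h + b_h \<T> u\<^sub>h v\<^sub>h = L2_inner \<Omega> f v\<^sub>h"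
    obtain E N \<psi> where "regular_mesh \<Omega> \<T> E N \<psi> \<sigma>"
      using regular_mesh_exists[OF domain _ \<sigma>(1)] meshes \<sigma>(2) \<T> by meson
    then interpret regular_mesh \<Omega> \<T> E N \<psi> \<sigma> .
    let ?h = "mesh_size \<T>"
    have h: "0 \<le> ?h" by (rule mesh_size_nonneg)
    have IB: "interpolation_bound \<Omega> \<T> (I \<T>) D"
      using interpolation_bound_mono[OF bspec[OF D0 \<T>] _ h, of D] by (simp add: D_def)
    have CB: "conforming_bound \<T> (V \<T>) (Pi_h \<T>) C"
      using conforming_bound_mono[OF bspec[OF C0 \<T>] _ h, of C] by (simp add: C_def)
    have Heq: "eform \<epsilon> u\<^sub>h v = L2_inner \<Omega> f v" if "v \<in> V \<T>" for v using uh(2) that by (simp add: eform_def)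
    note est = fe_error[OF bspec[OF fe \<T>] bspec[OF bspec[OF H2 \<T>]] bspec[OF bspec[OF H3 \<T>]] bspec[OF Pi \<T>]
        mp[OF bspec[OF H4 \<T>]] IB CB nn(2) \<epsilon> f u bspec[OF eq] uh(1) Heq, folded K_def]
    let ?A = "H_semi 2 \<Omega> u" and ?B = "\<epsilon> * H_semi 3 \<Omega> u" and ?F = "L2_norm \<Omega> f"
    have pos: "0 \<le> ?A" "0 \<le> ?B" "0 \<le> ?F" using \<epsilon> by auto
    have "energy_norm \<epsilon> \<T> (\<lambda>x. u x - u\<^sub>h x) \<le> ?h * ((4 * D + K + 4 * C) * ?B + (4 * D + 8 * \<sigma> * C) * ?A + C * ?F)"
      by (rule order_trans[OF est(1)]) (assumption | simp add: algebra_simps)+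
    also have "\<dots> \<le> ?h * (c * ?B + c * ?A + c * ?F)"
      using nn sC by (intro mult_left_mono add_mono mult_right_mono pos h) (auto simp: c_def)
    finally have 1: "energy_norm \<epsilon> \<T> (\<lambda>x. u x - u\<^sub>h x) \<le> c * ?h * (?A + ?B + ?F)" by (simp add: algebra_simps)
    have 2: "energy_norm \<epsilon> \<T> (\<lambda>x. u x - u\<^sub>h x) \<le> c * ?h * (?h + \<epsilon>) * H_semi 3 \<Omega> u" if "V \<T> \<subseteq> H0 1 \<Omega>"
    proof -
      have "energy_norm \<epsilon> \<T> (\<lambda>x. u x - u\<^sub>h x) \<le> ?h * H_semi 3 \<Omega> u * (4 * D * ?h + (4 * D + K) * \<epsilon>)"
        by (rule order_trans[OF est(2)[OF _ _ _ _ _ that]]) (assumption | simp add: algebra_simps)+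
      also have "\<dots> \<le> ?h * H_semi 3 \<Omega> u * (c * ?h + c * \<epsilon>)"
        using nn sC \<epsilon> h by (intro mult_left_mono add_mono mult_right_mono) (auto simp: c_def)
      finally show ?thesis by (simp add: algebra_simps)
    qed
    show "energy_norm \<epsilon> \<T> (\<lambda>x. u x - u\<^sub>h x)
             \<le> c * mesh_size \<T> * (H_semi 2 \<Omega> u + \<epsilon> * H_semi 3 \<Omega> u + L2_norm \<Omega> f) \<and>
           (V \<T> \<subseteq> H0 1 \<Omega> \<longrightarrow>
             energy_norm \<epsilon> \<T> (\<lambda>x. u x - u\<^sub>h x)
               \<le> c * mesh_size \<T> * (mesh_size \<T> + \<epsilon>) * H_semi 3 \<Omega> u)"
      using 1 2 by blast
  qed
qed

end
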